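(* Let $(\mathcal F,\mathcal D,U,\Omega)$ be an involutive Möbius-covariant Wightman CFT on $S^1$, and for each interval $I$ let $\mathcal P(I)\subset\operatorname{End}_*(\mathcal D)$ be the unital algebra generated by the operators $\varphi(f)$ with $\varphi\in\mathcal F$ and $\operatorname{supp}f\subset I$. Let $\mathcal Q(I)$ be the Möbius-covariant net of algebras $\mathcal Q(I):=\mathcal P(I)''$. Then $\mathcal Q$ satisfies Haag duality: $\mathcal Q(I)'=\mathcal Q(I')$ for all intervals $I$, where commutants are taken in $\operatorname{End}_*(\mathcal D)$. Moreover, $\mathcal Q(I)=\mathcal P(I')'$ for all intervals $I$.
   Context: **Wightman CFTs.** $S^1\subset\mathbb C$ is the unit circle and $C^\infty(S^1)$ is the space of complex-valued smooth functions, with the Fréchet topology of the norms $\|f\|_{C^N}=\sum_{j=0}^N\|\frac{d^j}{d\theta^j}f\|_\infty$. An interval is an open, connected, nonempty, non-dense subset of $S^1$; $I'$ denotes the interior of the complement of $I$. $\mathrm{Mob}=\mathrm{PSU}(1,1)$ is the group of holomorphic automorphisms of the unit disk (acting on $S^1$), and $r_\theta\in\mathrm{Mob}$ is rotation by $\theta$. For $\gamma\in\mathrm{Mob}$ put $X_\gamma(e^{i\theta})=-i\frac{d}{d\theta}\log\gamma(e^{i\theta})$, and for $d\in\mathbb Z_{\ge0}$ put $(\beta_d(\gamma)f)(z)=X_\gamma(\gamma^{-1}(z))^{d-1}f(\gamma^{-1}(z))$. Let $\mathcal D$ be a complex vector space. An operator-valued distribution with domain $\mathcal D$ is a linear map $\varphi$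 from $C^\infty(S^1)$ to the linear operators on $\mathcal D$. Let $\mathcal F$ be a set of these. A linear functional $\lambda:\mathcal D\to\mathbb C$ is compatible with $\mathcal F$ if $(f_1,\dots,f_k)\mapsto\lambda(\varphi_1(f_1)\cdots\varphi_k(f_k)\Phi)$ is jointly continuous on $C^\infty(S^1)^k$ for all $k$, $\varphi_j\in\mathcal F$, $\Phi\in\mathcal D$; $\mathcal D_{\mathcal F}^*$ is the space of such functionals. $\mathcal F$ acts regularly if $\mathcal D_{\mathcal F}^*$ separates points of $\mathcal D$. The $\mathcal F$-strong topology on $\mathcal D$ is the finest locally convex topology for which all maps $(f_1,\dots,f_k)\mapsto\varphi_1(f_1)\cdots\varphi_k(f_k)\Phi$ are jointly continuous. $\mathcal D$ carries this topology, and $\operatorname{End}(\mathcal D)$ denotes the continuous linear operators on $\mathcal D$. A Möbius-covariant Wightman CFT on $S^1$ is $(\mathcal F,\mathcal D,U,\Omega)$ with $\mathcal F$ acting regularly on $\mathcal D$, $U:\mathrm{Mob}\to\operatorname{End}(\mathcal D)$ a representation, $0\ne\Omega\in\mathcal D$, such that: (W1) each $\varphi\in\mathcal F$ has a conformal dimension $d_\varphi\in\mathbb Z_{\ge0}$ with $U(\gamma)\varphi(f)U(\gamma)^{-1}=\varphi(\beta_{d_\varphi}(\gamma)f)$ for all $\gamma,f$; (W2) $\varphi_1(f),\varphi_2(g)$ commute if $f,g$ have disjoint supports, $\varphi_1,\varphi_2\in\mathcal F$; (W3) if $d\in\mathbb Z$, $d<0$ and $U(r_\theta)\Phi=e^{id\theta}\Phi$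 for all $\theta$, then $\Phi=0$; (W4) $\Omega$ is $U$-invariant and $\mathcal D$ is algebraically spanned by the vectors $\varphi_1(f_1)\cdots\varphi_k(f_k)\Omega$. **Involutive theories.** The CFT is involutive if it is equipped with a nondegenerate, jointly $\mathcal F$-strongly continuous Hermitian form $\langle\cdot,\cdot\rangle$ on $\mathcal D$ (linear in the first variable) and a PCT operator $\theta$, i.e. an antiunitary involution $\theta:\mathcal D\to\mathcal D$ (antilinear, $\theta^2=1$, $\langle\theta\Phi,\theta\Psi\rangle=\overline{\langle\Phi,\Psi\rangle}$) with $\theta\Omega=\Omega$, such that the form is invariant: $\langle\varphi(f)\Phi,\Psi\rangle=\langle\Phi,\varphi^\dagger(\overline f)\Psi\rangle$ for all $\Phi,\Psi\in\mathcal D$, $\varphi\in\mathcal F$, $f\in C^\infty(S^1)$, where $\varphi^\dagger(f):=(-1)^{d_\varphi}\theta\varphi(\overline f\circ z^{-1})\theta$ (with $f\circ z^{-1}$ the function $z\mapsto f(z^{-1})$) and $(-1)^{d_\varphi}\varphi^\dagger\in\mathcal F$; and $\langle U(\gamma)\Phi,U(\gamma)\Psi\rangle=\langle\Phi,\Psi\rangle$ for all $\gamma\in\mathrm{Mob}$. $\operatorname{End}_*(\mathcal D)$ is the $*$-algebra of $x\in\operatorname{End}(\mathcal D)$ having an adjoint $x^*\in\operatorname{End}(\mathcal D)$, $\langle x\Phi,\Psi\rangle=\langle\Phi,x^*\Psi\rangle$. Each $\mathcal P(I)$ is a $*$-subalgebra of $\operatorname{End}_*(\mathcal D)$. For $S\subset\operatorname{End}_*(\mathcal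 D)$, $S'$ denotes the commutant of $S$ in $\operatorname{End}_*(\mathcal D)$. **Nets.** A Möbius-covariant net of algebras (with respect to $\mathcal D,U,\Omega$) is a family of unital $*$-subalgebras $\mathcal Q(I)\subset\operatorname{End}_*(\mathcal D)$, $I$ ranging over intervals, with: isotony ($I_1\subseteq I_2\Rightarrow\mathcal Q(I_1)\subseteq\mathcal Q(I_2)$); Möbius covariance ($U(\gamma)\mathcal Q(I)U(\gamma)^{-1}=\mathcal Q(\gamma(I))$); locality ($\mathcal Q(I)$ and $\mathcal Q(I')$ commute); vacuum ($\Omega$ is fixed by $\mathrm{Mob}$ and $\mathcal Q(I)\Omega$ is dense in $\mathcal D$ for each $I$). *)

theory Defs
  imports "HOL-Analysis.Analysis"
begin

section \<open>The circle, test functions and the Moebius group\<close>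

abbreviation unit_circle :: "complex set" ("S\<^sup>1")
  where "S\<^sup>1 \<equiv> sphere 0 1"

text \<open>A function on the circle is a function on the complex plane vanishing off the circle, so that
  equality of functions is equality on the circle.  Derivatives are derivatives in the angle.\<close>

definition angle_deriv :: "nat \<Rightarrow> (complex \<Rightarrow> complex) \<Rightarrow> real \<Rightarrow> complex" where
  "angle_deriv j f = ((\<lambda>g t. vector_derivative g (at t)) ^^ j) (\<lambda>t. f (cis t))"

definition smooth_fns :: "(complex \<Rightarrow> complex) set" ("C\<^sup>\<infinity>") where
  "C\<^sup>\<infinity> = {f. (\<forall>z. z \<notin> S\<^sup>1 \<longrightarrow> f z = 0) \<and> (\<forall>j t. angle_deriv j f differentiable (at t))}"

definition CN_norm :: "nat \<Rightarrow> (complex \<Rightarrow> complex) \<Rightarrow> real" where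
  "CN_norm N f = (\<Sum>j\<le>N. SUP t. cmod (angle_deriv j f t))"

definition smooth_topology :: "(complex \<Rightarrow> complex) topology" where
  "smooth_topology = topology_generated_by
     {{g \<in> C\<^sup>\<infinity>. CN_norm N (\<lambda>z. g z - f z) < e} | f N e. f \<in> C\<^sup>\<infinity> \<and> 0 < e}"

definition supp :: "(complex \<Rightarrow> complex) \<Rightarrow> complex set" where
  "supp f = closure {z. f z \<noteq> 0}"

definition circle_interval :: "complex set \<Rightarrow> bool" where
  "circle_interval I \<longleftrightarrow>
     openin (top_of_set S\<^sup>1) I \<and> connected I \<and> I \<noteq> {} \<and> \<not> S\<^sup>1 \<subseteq> closure I"

definition opposite :: "complex set \<Rightarrow> complex set" where
  "opposite I = (top_of_set S\<^sup>1) interior_of (S\<^sup>1 - I)"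

text \<open>An element of PSU(1,1) is represented by its action on the closed unit disk, extended by the
  identity.  The elements are then bijections of the plane, the group law is composition and
  the group inverse is the inverse function.\<close>

definition su11_action :: "complex \<Rightarrow> complex \<Rightarrow> complex \<Rightarrow> complex" where
  "su11_action a b z = (if cmod z \<le> 1 then (a * z + b) / (cnj b * z + cnj a) else z)"

definition Mob :: "(complex \<Rightarrow> complex) set" where
  "Mob = {su11_action a b | a b. (cmod a)\<^sup>2 - (cmod b)\<^sup>2 = 1}"

definition rotation :: "real \<Rightarrow> complex \<Rightarrow> complex" where
  "rotation t z = (if cmod z \<le> 1 then cis t * z else z)"

text \<open>The derivative of the logarithm is taken as a logarithmic derivative, since no branch of the
  logarithm is continuous on the whole circle.\<close>

definition angular_speed :: "(complex \<Rightarrow> complex) \<Rightarrow> complex \<Rightarrow> complex" ("X\<^bsub>_\<^esub>") where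
  "X\<^bsub>\<gamma>\<^esub> z = - \<i> * (vector_derivative (\<lambda>t. \<gamma> (cis t)) (at (Arg z)) / \<gamma> z)"

definition beta :: "nat \<Rightarrow> (complex \<Rightarrow> complex) \<Rightarrow> (complex \<Rightarrow> complex) \<Rightarrow> complex \<Rightarrow> complex" where
  "beta d \<gamma> f z = X\<^bsub>\<gamma>\<^esub> (inv \<gamma> z) powi (int d - 1) * f (inv \<gamma> z)"


section \<open>Operator-valued distributions and the strong topology\<close>

text \<open>The complex vector space is a type 'd with a scalar multiplication sc.
  A distribution is only meaningful on smooth functions; elsewhere it takes the value 0.\<close>

type_synonym 'd distr = "(complex \<Rightarrow> complex) \<Rightarrow> 'd \<Rightarrow> 'd"

definition op_distribution :: "(complex \<Rightarrow> 'd \<Rightarrow> 'd::ab_group_add) \<Rightarrow> 'd distr \<Rightarrow> bool" where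
  "op_distribution sc \<phi> \<longleftrightarrow>
     (\<forall>f\<in>C\<^sup>\<infinity>. Vector_Spaces.linear sc sc (\<phi> f)) \<and>
     (\<forall>f\<in>C\<^sup>\<infinity>. \<forall>g\<in>C\<^sup>\<infinity>. \<forall>v. \<phi> (\<lambda>z. f z + g z) v = \<phi> f v + \<phi> g v) \<and>
     (\<forall>f\<in>C\<^sup>\<infinity>. \<forall>c v. \<phi> (\<lambda>z. c * f z) v = sc c (\<phi> f v)) \<and>
     (\<forall>f. f \<notin> C\<^sup>\<infinity> \<longrightarrow> \<phi> f = (\<lambda>v. 0))"

text \<open>\<open>word [\<phi>\<^sub>0, \<dots>, \<phi>\<^sub>k] f v\<close> is \<open>\<phi>\<^sub>0(f 0) \<cdots> \<phi>\<^sub>k(f k) v\<close>; the k-tuples of test functions form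
  the k-fold product topology of the Frechet topology.\<close>

definition word :: "'d distr list \<Rightarrow> (nat \<Rightarrow> complex \<Rightarrow> complex) \<Rightarrow> 'd \<Rightarrow> 'd" where
  "word \<phi>s f v = foldr (\<lambda>j. (\<phi>s ! j) (f j)) [0..<length \<phi>s] v"

abbreviation tuple_topology :: "nat \<Rightarrow> (nat \<Rightarrow> complex \<Rightarrow> complex) topology" where
  "tuple_topology k \<equiv> product_topology (\<lambda>_. smooth_topology) {..<k}"

definition compatible_functional ::
  "(complex \<Rightarrow> 'd \<Rightarrow> 'd::ab_group_add) \<Rightarrow> 'd distr set \<Rightarrow> ('d \<Rightarrow> complex) \<Rightarrow> bool" where
  "compatible_functional sc F l \<longleftrightarrow> Vector_Spaces.linear sc (*) l \<and>
     (\<forall>\<phi>s v. set \<phi>s \<subseteq> F \<longrightarrow>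
        continuous_map (tuple_topology (length \<phi>s)) euclidean (\<lambda>f. l (word \<phi>s f v)))"

definition acts_regularly :: "(complex \<Rightarrow> 'd \<Rightarrow> 'd::ab_group_add) \<Rightarrow> 'd distr set \<Rightarrow> bool" where
  "acts_regularly sc F \<longleftrightarrow>
     (\<forall>v w. v \<noteq> w \<longrightarrow> (\<exists>l. compatible_functional sc F l \<and> l v \<noteq> l w))"

definition locally_convex_topology ::
  "(complex \<Rightarrow> 'd \<Rightarrow> 'd::ab_group_add) \<Rightarrow> 'd topology \<Rightarrow> bool" where
  "locally_convex_topology sc T \<longleftrightarrow> topspace T = UNIV \<and>
     continuous_map (prod_topology T T) T (\<lambda>(v, w). v + w) \<and>
     continuous_map (prod_topology euclidean T) T (\<lambda>(c, v). sc c v) \<and>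
     (\<forall>W. openin T W \<and> 0 \<in> W \<longrightarrow>
        (\<exists>V. openin T V \<and> 0 \<in> V \<and> V \<subseteq> W \<and>
           (\<forall>v\<in>V. \<forall>w\<in>V. \<forall>t\<in>{0..1}. sc (of_real t) v + sc (of_real (1 - t)) w \<in> V)))"

definition words_continuous :: "'d distr set \<Rightarrow> 'd topology \<Rightarrow> bool" where
  "words_continuous F T \<longleftrightarrow>
     (\<forall>\<phi>s v. set \<phi>s \<subseteq> F \<longrightarrow>
        continuous_map (tuple_topology (length \<phi>s)) T (\<lambda>f. word \<phi>s f v))"

text \<open>The supremum of all locally convex topologies making the words continuous; the lemmas below
  show that it is the finest one.\<close>

definition strong_topology ::
  "(complex \<Rightarrow> 'd \<Rightarrow> 'd::ab_group_add) \<Rightarrow> 'd distr set \<Rightarrow> 'd topology" where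
  "strong_topology sc F = topology_generated_by
     {W. \<exists>T. locally_convex_topology sc T \<and> words_continuous F T \<and> openin T W}"

lemma strong_topology_finest:
  assumes "locally_convex_topology sc T" "words_continuous F T" "openin T W"
  shows "openin (strong_topology sc F) W"
  unfolding strong_topology_def by (rule topology_generated_by_Basis) (use assms in blast)

lemma indiscrete_words_continuous:
  "locally_convex_topology sc (topology_generated_by {UNIV})"
  "words_continuous F (topology_generated_by {UNIV})"
proof -
  have op: "W = {} \<or> W = UNIV" if "openin (topology_generated_by {UNIV}) W" for W :: "'a set"
  proof -
    have "generate_topology_on {UNIV} W"
      using that by (rule openin_topology_generated_by)
    then show ?thesis by induction auto
  qed
  have cont: "continuous_map X (topology_generated_by {UNIV}) h" for X :: "'c topology" and h :: "'c \<Rightarrow> 'b"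
    by (rule continuous_on_generated_topo) auto
  have cont2: "continuous_map X (topology_generated_by {UNIV}) h" for X :: "'c topology" and h :: "'c \<Rightarrow> 'a"
    by (rule continuous_on_generated_topo) auto
  have opU: "openin (topology_generated_by {UNIV}) (UNIV :: 'a set)"
    by (simp add: topology_generated_by_Basis)
  have "\<exists>V. openin (topology_generated_by {UNIV}) V \<and> 0 \<in> V \<and> V \<subseteq> W \<and>
      (\<forall>v\<in>V. \<forall>w\<in>V. \<forall>t\<in>{0..1}. sc (of_real t) v + sc (of_real (1 - t)) w \<in> V)"
    if W: "openin (topology_generated_by {UNIV}) W \<and> 0 \<in> W" for W
  proof -
    from W op[of W] have "W = UNIV" by blast
    with opU show ?thesis by (intro exI[of _ UNIV]) simp
  qed
  then show "locally_convex_topology sc (topology_generated_by {UNIV})"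
    unfolding locally_convex_topology_def by (intro conjI allI impI cont2) simp_all
  show "words_continuous F (topology_generated_by {UNIV})"
    unfolding words_continuous_def by (intro allI impI cont)
qed

lemma topspace_strong_topology: "topspace (strong_topology sc F) = UNIV"
proof -
  have "openin (topology_generated_by {UNIV}) (UNIV :: 'a set)"
    by (simp add: topology_generated_by_Basis)
  then have "openin (strong_topology sc F) UNIV"
    by (rule strong_topology_finest[OF indiscrete_words_continuous])
  then show ?thesis by (simp add: openin_subset top.extremum_uniqueI)
qed

lemma continuous_map_into_strong_topology:
  assumes "\<And>T. locally_convex_topology sc T \<Longrightarrow> words_continuous F T \<Longrightarrow> continuous_map X T h"
  shows "continuous_map X (strong_topology sc F) h"
  unfolding strong_topology_def
proof (rule continuous_on_generated_topo)
  fix W assume "W \<in> {W. \<exists>T. locally_convex_topology sc T \<and> words_continuous F T \<and> openin T W}"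
  then obtain T where "locally_convex_topology sc T" "words_continuous F T" "openin T W" by blast
  then show "openin X (h -` W \<inter> topspace X)"
    using assms by (metis continuous_map_alt)
next
  show "h ` topspace X \<subseteq>
    \<Union> {W. \<exists>T. locally_convex_topology sc T \<and> words_continuous F T \<and> openin T W}"
    using topspace_strong_topology[of sc F]
    unfolding strong_topology_def topology_generated_by_topspace by simp
qed

lemma continuous_map_id_strong_topology:
  assumes "locally_convex_topology sc T" "words_continuous F T"
  shows "continuous_map (strong_topology sc F) T id"
  using assms strong_topology_finest[OF assms]
  by (simp add: continuous_map_alt topspace_strong_topology locally_convex_topology_def)

lemma strong_topology_words_continuous: "words_continuous F (strong_topology sc F)"
  unfolding words_continuous_def
  by (auto intro!: continuous_map_into_strong_topology simp: words_continuous_def)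

lemma strong_topology_locally_convex: "locally_convex_topology sc (strong_topology sc F)"
  unfolding locally_convex_topology_def
proof (intro conjI allI impI)
  let ?S = "strong_topology sc F"
  show "topspace ?S = UNIV" by (rule topspace_strong_topology)
  show "continuous_map (prod_topology ?S ?S) ?S (\<lambda>(v, w). v + w)"
  proof (rule continuous_map_into_strong_topology)
    fix T assume T: "locally_convex_topology sc T" "words_continuous F T"
    have "continuous_map (prod_topology ?S ?S) (prod_topology T T) (\<lambda>(v, w). (id v, id w))"
      unfolding continuous_map_prod_top
      by (intro disjI2 conjI continuous_map_id_strong_topology T)
    moreover have "continuous_map (prod_topology T T) T (\<lambda>(v, w). v + w)"
      using T(1) unfolding locally_convex_topology_def by blast
    ultimately have "continuous_map (prod_topology ?S ?S) T ((\<lambda>(v, w). v + w) \<circ> (\<lambda>(v, w). (id v, id w)))"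
      by (rule continuous_map_compose)
    then
    show "continuous_map (prod_topology ?S ?S) T (\<lambda>(v, w). v + w)"
      by (simp only: o_def case_prod_unfold id_apply fst_conv snd_conv)
  qed
  show "continuous_map (prod_topology euclidean ?S) ?S (\<lambda>(c, v). sc c v)"
  proof (rule continuous_map_into_strong_topology)
    fix T assume T: "locally_convex_topology sc T" "words_continuous F T"
    have "continuous_map (prod_topology euclidean ?S) (prod_topology euclidean T)
            (\<lambda>(c, v). (id c :: complex, id v))"
      unfolding continuous_map_prod_top
      by (intro disjI2 conjI continuous_map_id continuous_map_id_strong_topology T)
    moreover have "continuous_map (prod_topology euclidean T) T (\<lambda>(c, v). sc c v)"
      using T(1) unfolding locally_convex_topology_def by blast
    ultimately have "continuous_map (prod_topology euclidean ?S) T ((\<lambda>(c, v). sc c v) \<circ> (\<lambda>(c, v). (id c, id v)))"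
      by (rule continuous_map_compose)
    then
    show "continuous_map (prod_topology euclidean ?S) T (\<lambda>(c, v). sc c v)"
      by (simp only: o_def case_prod_unfold id_apply fst_conv snd_conv)
  qed
  define cvx where "cvx V \<longleftrightarrow>
    (\<forall>v\<in>V. \<forall>w\<in>V. \<forall>t\<in>{0..1}. sc (of_real t) v + sc (of_real (1 - t)) w \<in> V)" for V
  have cvx_Int: "cvx (V1 \<inter> V2)" if "cvx V1" "cvx V2" for V1 V2
    using that unfolding cvx_def by blast
  fix W assume W: "openin ?S W \<and> 0 \<in> W"
  then have "generate_topology_on
      {W. \<exists>T. locally_convex_topology sc T \<and> words_continuous F T \<and> openin T W} W"
    unfolding strong_topology_def by (simp only: openin_topology_generated_by)
  then have "0 \<in> W \<longrightarrow> (\<exists>V. openin ?S V \<and> 0 \<in> V \<and> V \<subseteq> W \<and> cvx V)"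
  proof induction
    case (Int a b)
    show ?case
    proof
      assume "0 \<in> a \<inter> b"
      with Int.IH obtain V1 V2 where
        V: "openin ?S V1" "0 \<in> V1" "V1 \<subseteq> a" "cvx V1" "openin ?S V2" "0 \<in> V2" "V2 \<subseteq> b" "cvx V2"
        by (elim IntE) (simp only: simp_thms, elim exE conjE, rule that)
      show "\<exists>V. openin ?S V \<and> 0 \<in> V \<and> V \<subseteq> a \<inter> b \<and> cvx V"
        by (rule exI[of _ "V1 \<inter> V2"]) (use V in \<open>simp add: openin_Int cvx_Int le_infI1 le_infI2\<close>)
    qed
  next
    case (Basis s)
    then obtain T where T: "locally_convex_topology sc T" "words_continuous F T" "openin T s"
      by (elim CollectE exE conjE) (rule that)
    have "0 \<in> s \<longrightarrow> (\<exists>V. openin T V \<and> 0 \<in> V \<and> V \<subseteq> s \<and> cvx V)"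
      using T(1,3) unfolding locally_convex_topology_def cvx_def by (elim conjE) blast
    with strong_topology_finest[OF T(1,2)] show ?case by blast
  next
    case (UN K)
    show ?case
    proof
      assume "0 \<in> \<Union>K"
      then obtain k where k: "k \<in> K" "0 \<in> k" by (rule UnionE)
      with UN.IH[OF k(1)] obtain V where "openin ?S V \<and> 0 \<in> V \<and> V \<subseteq> k \<and> cvx V"
        by (elim impE exE) (assumption, rule that)
      with k show "\<exists>V. openin ?S V \<and> 0 \<in> V \<and> V \<subseteq> \<Union>K \<and> cvx V"
        by (intro exI[of _ V]) (simp, blast)
    qed
  qed simp
  with W show "\<exists>V. openin ?S V \<and> 0 \<in> V \<and> V \<subseteq> W \<and>
      (\<forall>v\<in>V. \<forall>w\<in>V. \<forall>t\<in>{0..1}. sc (of_real t) v + sc (of_real (1 - t)) w \<in> V)"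
    unfolding cvx_def by (elim conjE mp)
qed

definition cont_ops ::
  "(complex \<Rightarrow> 'd \<Rightarrow> 'd::ab_group_add) \<Rightarrow> 'd distr set \<Rightarrow> ('d \<Rightarrow> 'd) set" where
  "cont_ops sc F = {x. Vector_Spaces.linear sc sc x \<and>
     continuous_map (strong_topology sc F) (strong_topology sc F) x}"


section \<open>Wightman theories\<close>

locale wightman_cft = vector_space sc
  for sc :: "complex \<Rightarrow> 'd \<Rightarrow> 'd::ab_group_add" +
  fixes F :: "'d distr set"
    and d :: "'d distr \<Rightarrow> nat"
    and U :: "(complex \<Rightarrow> complex) \<Rightarrow> 'd \<Rightarrow> 'd"
    and \<Omega> :: 'd
  assumes distributions: "\<phi> \<in> F \<Longrightarrow> op_distribution sc \<phi>"
    and regular: "acts_regularly sc F"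
    and U_cont: "\<gamma> \<in> Mob \<Longrightarrow> U \<gamma> \<in> cont_ops sc F"
    and U_id: "U id = id"
    and U_comp: "\<gamma>1 \<in> Mob \<Longrightarrow> \<gamma>2 \<in> Mob \<Longrightarrow> U (\<gamma>1 \<circ> \<gamma>2) = U \<gamma>1 \<circ> U \<gamma>2"
    and vacuum_nonzero: "\<Omega> \<noteq> 0"
    and covariance: "\<phi> \<in> F \<Longrightarrow> \<gamma> \<in> Mob \<Longrightarrow> f \<in> C\<^sup>\<infinity> \<Longrightarrow>
      U \<gamma> \<circ> \<phi> f \<circ> inv (U \<gamma>) = \<phi> (beta (d \<phi>) \<gamma> f)"
    and locality: "\<phi>1 \<in> F \<Longrightarrow> \<phi>2 \<in> F \<Longrightarrow> f \<in> C\<^sup>\<infinity> \<Longrightarrow> g \<in> C\<^sup>\<infinity> \<Longrightarrow> supp f \<inter> supp g = {} \<Longrightarrow>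
      \<phi>1 f \<circ> \<phi>2 g = \<phi>2 g \<circ> \<phi>1 f"
    and spectrum: "\<And>(n::int) v. n < 0 \<Longrightarrow>
      (\<forall>t. U (rotation t) v = sc (cis (of_int n * t)) v) \<Longrightarrow> v = 0"
    and vacuum_invariant: "\<gamma> \<in> Mob \<Longrightarrow> U \<gamma> \<Omega> = \<Omega>"
    and vacuum_cyclic:
      "span {word \<phi>s f \<Omega> | \<phi>s f. set \<phi>s \<subseteq> F \<and> (\<forall>j<length \<phi>s. f j \<in> C\<^sup>\<infinity>)} = UNIV"

definition dagger ::
  "(complex \<Rightarrow> 'd \<Rightarrow> 'd::ab_group_add) \<Rightarrow> ('d \<Rightarrow> 'd) \<Rightarrow> nat \<Rightarrow> 'd distr \<Rightarrow> 'd distr" where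
  "dagger sc \<theta> n \<phi> f v = sc ((- 1) ^ n) (\<theta> (\<phi> (\<lambda>z. cnj (f (inverse z))) (\<theta> v)))"

locale involutive_wightman_cft = wightman_cft sc F d U \<Omega>
  for sc :: "complex \<Rightarrow> 'd \<Rightarrow> 'd::ab_group_add" and F d U \<Omega> +
  fixes form :: "'d \<Rightarrow> 'd \<Rightarrow> complex"
    and \<theta> :: "'d \<Rightarrow> 'd"
  assumes form_add: "form (v + w) u = form v u + form w u"
    and form_scale: "form (sc c v) u = c * form v u"
    and form_hermitian: "form u v = cnj (form v u)"
    and form_nondegenerate: "(\<forall>u. form v u = 0) \<Longrightarrow> v = 0"
    and form_continuous: "continuous_map
      (prod_topology (strong_topology sc F) (strong_topology sc F)) euclidean (\<lambda>(v, u). form v u)"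
    and pct_add: "\<theta> (v + w) = \<theta> v + \<theta> w"
    and pct_scale: "\<theta> (sc c v) = sc (cnj c) (\<theta> v)"
    and pct_involution: "\<theta> (\<theta> v) = v"
    and pct_antiunitary: "form (\<theta> v) (\<theta> u) = cnj (form v u)"
    and pct_vacuum: "\<theta> \<Omega> = \<Omega>"
    and form_invariant: "\<phi> \<in> F \<Longrightarrow> f \<in> C\<^sup>\<infinity> \<Longrightarrow>
      form (\<phi> f v) u = form v (dagger sc \<theta> (d \<phi>) \<phi> (\<lambda>z. cnj (f z)) u)"
    and dagger_field: "\<phi> \<in> F \<Longrightarrow>
      (\<lambda>f v. sc ((- 1) ^ d \<phi>) (dagger sc \<theta> (d \<phi>) \<phi> f v)) \<in> F"
    and U_unitary: "\<gamma> \<in> Mob \<Longrightarrow> form (U \<gamma> v) (U \<gamma> u) = form v u"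


section \<open>Operator algebras and nets\<close>

definition is_adjoint :: "('d \<Rightarrow> 'd \<Rightarrow> complex) \<Rightarrow> ('d \<Rightarrow> 'd) \<Rightarrow> ('d \<Rightarrow> 'd) \<Rightarrow> bool" where
  "is_adjoint form x y \<longleftrightarrow> (\<forall>v u. form (x v) u = form v (y u))"

definition star_ops ::
  "(complex \<Rightarrow> 'd \<Rightarrow> 'd::ab_group_add) \<Rightarrow> 'd distr set \<Rightarrow> ('d \<Rightarrow> 'd \<Rightarrow> complex) \<Rightarrow> ('d \<Rightarrow> 'd) set" where
  "star_ops sc F form = {x \<in> cont_ops sc F. \<exists>y \<in> cont_ops sc F. is_adjoint form x y}"

definition commutant ::
  "(complex \<Rightarrow> 'd \<Rightarrow> 'd::ab_group_add) \<Rightarrow> 'd distr set \<Rightarrow> ('d \<Rightarrow> 'd \<Rightarrow> complex) \<Rightarrow>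
   ('d \<Rightarrow> 'd) set \<Rightarrow> ('d \<Rightarrow> 'd) set" where
  "commutant sc F form A = {x \<in> star_ops sc F form. \<forall>y\<in>A. x \<circ> y = y \<circ> x}"

definition unital_algebra ::
  "(complex \<Rightarrow> 'd \<Rightarrow> 'd::ab_group_add) \<Rightarrow> ('d \<Rightarrow> 'd) set \<Rightarrow> bool" where
  "unital_algebra sc A \<longleftrightarrow> id \<in> A \<and> (\<forall>x\<in>A. \<forall>y\<in>A. (\<lambda>v. x v + y v) \<in> A) \<and>
     (\<forall>c. \<forall>x\<in>A. (\<lambda>v. sc c (x v)) \<in> A) \<and> (\<forall>x\<in>A. \<forall>y\<in>A. x \<circ> y \<in> A)"

definition unital_star_algebra ::
  "(complex \<Rightarrow> 'd \<Rightarrow> 'd::ab_group_add) \<Rightarrow> 'd distr set \<Rightarrow> ('d \<Rightarrow> 'd \<Rightarrow> complex) \<Rightarrow>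
   ('d \<Rightarrow> 'd) set \<Rightarrow> bool" where
  "unital_star_algebra sc F form A \<longleftrightarrow> unital_algebra sc A \<and> A \<subseteq> star_ops sc F form \<and>
     (\<forall>x\<in>A. \<exists>y\<in>A. is_adjoint form x y)"

definition local_alg ::
  "(complex \<Rightarrow> 'd \<Rightarrow> 'd::ab_group_add) \<Rightarrow> 'd distr set \<Rightarrow> complex set \<Rightarrow> ('d \<Rightarrow> 'd) set" where
  "local_alg sc F I =
     unital_algebra sc hull {\<phi> f | \<phi> f. \<phi> \<in> F \<and> f \<in> C\<^sup>\<infinity> \<and> supp f \<subseteq> I}"

definition bicommutant_alg ::
  "(complex \<Rightarrow> 'd \<Rightarrow> 'd::ab_group_add) \<Rightarrow> 'd distr set \<Rightarrow> ('d \<Rightarrow> 'd \<Rightarrow> complex) \<Rightarrow>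
   complex set \<Rightarrow> ('d \<Rightarrow> 'd) set" where
  "bicommutant_alg sc F form I = commutant sc F form (commutant sc F form (local_alg sc F I))"

definition moebius_net ::
  "(complex \<Rightarrow> 'd \<Rightarrow> 'd::ab_group_add) \<Rightarrow> 'd distr set \<Rightarrow> ('d \<Rightarrow> 'd \<Rightarrow> complex) \<Rightarrow>
   ((complex \<Rightarrow> complex) \<Rightarrow> 'd \<Rightarrow> 'd) \<Rightarrow> 'd \<Rightarrow> (complex set \<Rightarrow> ('d \<Rightarrow> 'd) set) \<Rightarrow> bool" where
  "moebius_net sc F form U \<Omega> Q \<longleftrightarrow>
     (\<forall>I. circle_interval I \<longrightarrow> unital_star_algebra sc F form (Q I)) \<and>
     (\<forall>I J. circle_interval I \<and> circle_interval J \<and> I \<subseteq> J \<longrightarrow> Q I \<subseteq> Q J) \<and>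
     (\<forall>\<gamma>\<in>Mob. \<forall>I. circle_interval I \<longrightarrow> (\<lambda>x. U \<gamma> \<circ> x \<circ> inv (U \<gamma>)) ` Q I = Q (\<gamma> ` I)) \<and>
     (\<forall>I. circle_interval I \<longrightarrow> (\<forall>x\<in>Q I. \<forall>y\<in>Q (opposite I). x \<circ> y = y \<circ> x)) \<and>
     (\<forall>\<gamma>\<in>Mob. U \<gamma> \<Omega> = \<Omega>) \<and>
     (\<forall>I. circle_interval I \<longrightarrow> strong_topology sc F closure_of {x \<Omega> | x. x \<in> Q I} = UNIV)"

end

theory Submission
  imports Defs "HOL-Complex_Analysis.Complex_Analysis"
begin

text \<open>
  Let \<open>\<delta>\<^sub>t\<close> be the dilations preserving a half circle I.  Since \<open>\<phi>(z\<^sup>m)\<Omega> = 0\<close> for \<open>m > - d\<close>, the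
  functions \<open>t \<mapsto> \<lambda>(U(\<delta>\<^sub>t) w \<Omega>)\<close>, with w a word of fields smeared in I, integrated against Gaussians
  admit a shift of the contour by \<open>\<i>\<pi>\<close>, which replaces \<open>w \<Omega>\<close> by \<open>\<theta> w\<^sup>* \<Omega>\<close>: a Bisognano-Wichmann
  property that needs neither positivity nor a Hilbert space.  By the Reeh-Schlieder property the
  resulting relation between \<open>\<langle>U(\<delta>\<^sub>t) \<Phi>, x\<^sup>* \<Omega>\<rangle>\<close> and \<open>\<langle>U(\<delta>\<^sub>t) \<Phi>, \<theta> x \<Omega>\<rangle>\<close> holds for all \<open>\<Phi>\<close> and all x
  commuting with the fields in I.  Combining it for \<open>x \<in> P(I')'\<close> and \<open>y \<in> P(I)'\<close> gives
  \<open>\<langle>x y \<Omega>, \<Omega>\<rangle> = \<langle>y x \<Omega>, \<Omega>\<rangle>\<close>, and with \<open>q\<^sup>* x p\<close> in place of x, for words p and q in I, \<open>x y = y x\<close>.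
  So \<open>P(I')' \<subseteq> P(I)''\<close>, and the reverse inclusion is locality.
\<close>

section \<open>Smooth functions on the circle and Fourier series\<close>

text \<open>The obstacle is that f is only smooth: the orbit t \<mapsto> U(\<open>dil t\<close>)
  \<phi>(f)\<Omega> need not extend to a strip. What is analytic are the kernels that compute
  Fourier coefficients on a half circle. A substitution moves t from f into such a kernel, and the
  contour is then shifted mode by mode. Integrals against Gaussians are used because orbits are
  controlled only up to e^{M|t|}; narrowing Gaussians recover values at points.

  The amount i\<pi> comes from the coordinate w on the upper half circle in which dilations are
  translations: w + i\<pi> corresponds to z^{-1}, the reflection in the PCT operator. The kernel of
  the mode -n is bounded on this strip for n \<ge> d, and this is why the modes of \<phi> on the
  vacuum must vanish already for m > -d.

  Reeh-Schlieder is proved for functionals bounded by seminorms on each type of word. This class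
  contains the compatible functionals and is stable under Gaussian averages over dilations, so that
  relations between averaged orbits, checked on words in one half circle, extend to all
  vectors.\<close>

lemma cis_Arg_circle: "z \<in> S\<^sup>1 \<Longrightarrow> cis (Arg z) = z"
  using cis_Arg[of z] by (cases "z = 0") (auto simp: sgn_div_norm)

section \<open>Test functions and their angular derivatives\<close>

lemma angle_deriv_0: "angle_deriv 0 f t = f (cis t)"
  by (simp add: angle_deriv_def)

lemma angle_deriv_Suc: "angle_deriv (Suc j) f t = vector_derivative (angle_deriv j f) (at t)"
  by (simp add: angle_deriv_def)

lemma smooth_has_vector_derivative:
  "f \<in> C\<^sup>\<infinity> \<Longrightarrow> (angle_deriv j f has_vector_derivative angle_deriv (Suc j) f t) (at t)"
  by (simp add: smooth_fns_def angle_deriv_Suc vector_derivative_works)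

text \<open>\<open>angle_deriv\<close> iterates a total derivative operator, so its values mean
  something only once differentiability is known at every order. Exhibiting the whole sequence of
  derivatives settles both questions; \<open>smoothI\<close> and the later smoothness proofs work
  this way.\<close>

lemma angle_deriv_eqI:
  assumes "\<And>t. h 0 t = f (cis t)" "\<And>j t. (h j has_vector_derivative h (Suc j) t) (at t)"
  shows "angle_deriv j f = h j"
proof (induction j)
  case 0
  show ?case using assms(1) by (auto simp: angle_deriv_0)
next
  case (Suc j)
  show ?case
    using vector_derivative_at[OF assms(2)] by (auto simp: angle_deriv_Suc Suc)
qed

lemma smoothI:
  assumes "\<And>z. z \<notin> S\<^sup>1 \<Longrightarrow> f z = 0"
    and h: "\<And>t. h 0 t = f (cis t)" "\<And>j t. (h j has_vector_derivative h (Suc j) t) (at t)"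
  shows "f \<in> C\<^sup>\<infinity>"
proof -
  have "angle_deriv j f = h j" for j by (rule angle_deriv_eqI[of h, OF h])
  then show ?thesis using assms(1) h(2) unfolding smooth_fns_def
    by (simp, metis differentiableI_vector)
qed

lemma smooth_off_circle: "f \<in> C\<^sup>\<infinity> \<Longrightarrow> z \<notin> S\<^sup>1 \<Longrightarrow> f z = 0"
  by (simp add: smooth_fns_def)

lemma smooth_add:
  assumes "f \<in> C\<^sup>\<infinity>" "g \<in> C\<^sup>\<infinity>"
  shows "(\<lambda>z. f z + g z) \<in> C\<^sup>\<infinity>"
    and "angle_deriv j (\<lambda>z. f z + g z) = (\<lambda>t. angle_deriv j f t + angle_deriv j g t)"
proof -
  let ?h = "\<lambda>j t. angle_deriv j f t + angle_deriv j g t"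
  have h: "?h 0 t = f (cis t) + g (cis t)" "(?h j has_vector_derivative ?h (Suc j) t) (at t)" for j t
    by (auto simp: angle_deriv_0 intro!: has_vector_derivative_add smooth_has_vector_derivative assms)
  show "(\<lambda>z. f z + g z) \<in> C\<^sup>\<infinity>"
    by (rule smoothI[of _ ?h, OF _ h]) (simp add: smooth_off_circle[OF assms(1)] smooth_off_circle[OF assms(2)])
  show "angle_deriv j (\<lambda>z. f z + g z) = (\<lambda>t. angle_deriv j f t + angle_deriv j g t)"
    by (rule angle_deriv_eqI[of ?h, OF h])
qed

lemma smooth_cmult:
  assumes "f \<in> C\<^sup>\<infinity>"
  shows "(\<lambda>z. c * f z) \<in> C\<^sup>\<infinity>" and "angle_deriv j (\<lambda>z. c * f z) = (\<lambda>t. c * angle_deriv j f t)"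
proof -
  let ?h = "\<lambda>j t. c * angle_deriv j f t"
  have h: "?h 0 t = c * f (cis t)" "(?h j has_vector_derivative ?h (Suc j) t) (at t)" for j t
    by (auto simp: angle_deriv_0 intro!: has_vector_derivative_mult_right smooth_has_vector_derivative assms)
  show "(\<lambda>z. c * f z) \<in> C\<^sup>\<infinity>"
    by (rule smoothI[of _ ?h, OF _ h]) (simp add: smooth_off_circle[OF assms(1)])
  show "angle_deriv j (\<lambda>z. c * f z) = (\<lambda>t. c * angle_deriv j f t)"
    by (rule angle_deriv_eqI[of ?h, OF h])
qed

lemma smooth_zero: "(\<lambda>z. 0) \<in> C\<^sup>\<infinity>"
  by (rule smoothI[of _ "\<lambda>j t. 0"]) auto

lemma smooth_diff:
  assumes "f \<in> C\<^sup>\<infinity>" "g \<in> C\<^sup>\<infinity>"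
  shows "(\<lambda>z. f z - g z) \<in> C\<^sup>\<infinity>"
    and "angle_deriv j (\<lambda>z. f z - g z) = (\<lambda>t. angle_deriv j f t - angle_deriv j g t)"
  using smooth_add(1)[OF assms(1) smooth_cmult(1)[OF assms(2), of "-1"]]
    smooth_add(2)[OF assms(1) smooth_cmult(1)[OF assms(2), of "-1"], of j]
    smooth_cmult(2)[OF assms(2), of j "-1"] by simp_all

lemma smooth_sum:
  assumes "finite A" "\<And>n. n \<in> A \<Longrightarrow> f n \<in> C\<^sup>\<infinity>"
  shows "(\<lambda>z. \<Sum>n\<in>A. f n z) \<in> C\<^sup>\<infinity>
    \<and> angle_deriv j (\<lambda>z. \<Sum>n\<in>A. f n z) = (\<lambda>t. \<Sum>n\<in>A. angle_deriv j (f n) t)"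
  using assms
proof (induction A rule: finite_induct)
  case empty
  have "angle_deriv j (\<lambda>z. 0) = (\<lambda>t. 0)" by (rule angle_deriv_eqI[of "\<lambda>j t. 0"]) auto
  then show ?case using smooth_zero by simp
next
  case (insert x A)
  then have 1: "f x \<in> C\<^sup>\<infinity>" "(\<lambda>z. \<Sum>n\<in>A. f n z) \<in> C\<^sup>\<infinity>" by auto
  from smooth_add[OF 1] insert show ?case by auto
qed

lemma smooth_cnj:
  assumes "f \<in> C\<^sup>\<infinity>"
  shows "(\<lambda>z. cnj (f z)) \<in> C\<^sup>\<infinity>"
proof -
  let ?h = "\<lambda>j t. cnj (angle_deriv j f t)"
  have h: "?h 0 t = cnj (f (cis t))" "(?h j has_vector_derivative ?h (Suc j) t) (at t)" for j t
    by (auto simp: angle_deriv_0 intro!: has_vector_derivative_cnj smooth_has_vector_derivative assms)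
  show ?thesis
    by (rule smoothI[of _ ?h, OF _ h]) (simp add: smooth_off_circle[OF assms(1)])
qed

lemma smooth_inverse_arg:
  assumes "f \<in> C\<^sup>\<infinity>"
  shows "(\<lambda>z. f (inverse z)) \<in> C\<^sup>\<infinity>"
proof -
  let ?h = "\<lambda>j t. (-1) ^ j * angle_deriv j f (- t)"
  have d: "((\<lambda>t. angle_deriv j f (- t)) has_vector_derivative - angle_deriv (Suc j) f (- t)) (at t)" for j t
    using vector_diff_chain_at[OF has_vector_derivative_minus[OF has_vector_derivative_id]
       smooth_has_vector_derivative[OF assms], of j "t"]
    by (simp add: o_def)
  have h: "?h 0 t = f (inverse (cis t))" "(?h j has_vector_derivative ?h (Suc j) t) (at t)" for j t
    using has_vector_derivative_mult_right[OF d, of "(-1)^j" j t]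
    by (auto simp: angle_deriv_0 cis_inverse)
  have "f (inverse z) = 0" if "z \<notin> S\<^sup>1" for z
    using that by (intro smooth_off_circle[OF assms]) (auto simp: norm_inverse)
  then show ?thesis
    by (rule smoothI[of _ ?h, OF _ h])
qed

lemma angle_deriv_periodic:
  "f \<in> C\<^sup>\<infinity> \<Longrightarrow> angle_deriv j f (t + 2 * pi) = angle_deriv j f t"
proof (induction j arbitrary: t)
  case 0
  then show ?case by (simp add: angle_deriv_0 cis.ctr)
next
  case (Suc j)
  have "((\<lambda>t. angle_deriv j f (t + 2 * pi)) has_vector_derivative angle_deriv (Suc j) f (t + 2 * pi)) (at t)"
  proof -
    have "((\<lambda>t. t + 2 * pi) has_vector_derivative 1) (at t)"
      by (auto intro!: derivative_eq_intros)
    from vector_diff_chain_at[OF this smooth_has_vector_derivative[OF Suc.prems, of j]]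
    show ?thesis by (simp add: o_def)
  qed
  then have "(angle_deriv j f has_vector_derivative angle_deriv (Suc j) f (t + 2 * pi)) (at t)"
    using Suc by simp
  with smooth_has_vector_derivative[OF Suc.prems] show ?case
    by (metis vector_derivative_at)
qed

lemma periodic_int:
  fixes g :: "real \<Rightarrow> 'a"
  assumes "\<And>t. g (t + 2 * pi) = g t"
  shows "g (t + 2 * pi * of_int n) = g t"
proof -
  have nat: "g (t + 2 * pi * of_nat k) = g t" for k t
  proof (induction k arbitrary: t)
    case (Suc k)
    have "g (t + 2 * pi * of_nat (Suc k)) = g ((t + 2 * pi * of_nat k) + 2 * pi)"
      by (simp add: algebra_simps)
    then show ?case using Suc assms by simp
  qed simp
  show ?thesis
  proof (cases "n \<ge> 0")
    case True
    then show ?thesis using nat[of t "nat n"] by simp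
  next
    case False
    then show ?thesis using nat[of "t + 2 * pi * of_int n" "nat (- n)"] by simp
  qed
qed

lemma cis_eq_imp: "cis a = cis b \<Longrightarrow> \<exists>n::int. a = b + 2 * pi * n"
  using sin_cos_eq_iff[of a b] by (auto simp: complex_eq_iff)

text \<open>Turns estimates on a compact period into estimates on the line; g and \<open>cis\<close>
  are reduced by the same shift.\<close>

lemma periodic_reduce:
  assumes "\<And>t. g (t + 2 * pi) = g t"
  shows "\<exists>s\<in>{0..2 * pi}. g t = g s \<and> cis t = cis s"
proof -
  define n where "n = \<lfloor>t / (2 * pi)\<rfloor>"
  define s where "s = t + 2 * pi * of_int (- n)"
  have "of_int n \<le> t / (2 * pi)" "t / (2 * pi) < of_int n + 1"
    unfolding n_def by linarith+
  then have "of_int n * (2 * pi) \<le> t" "t < (of_int n + 1) * (2 * pi)"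
    by (simp_all add: field_simps)
  then have "s \<in> {0..2 * pi}" unfolding s_def by (auto simp: algebra_simps)
  moreover have "g s = g t" "cis s = cis t"
    unfolding s_def
    using periodic_int[of g t "- n", OF assms] periodic_int[of cis t "- n"] by (simp_all add: cis.ctr)
  ultimately show ?thesis by metis
qed

section \<open>Seminorms on test functions\<close>

lemma smooth_continuous: "f \<in> C\<^sup>\<infinity> \<Longrightarrow> continuous_on A (angle_deriv j f)"
  by (meson continuous_at_imp_continuous_on has_vector_derivative_continuous smooth_has_vector_derivative)

lemma smooth_bdd: "f \<in> C\<^sup>\<infinity> \<Longrightarrow> bdd_above (range (\<lambda>t. cmod (angle_deriv j f t)))"
proof -
  assume f: "f \<in> C\<^sup>\<infinity>"
  have "compact ((\<lambda>t. cmod (angle_deriv j f t)) ` {0..2*pi})"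
    by (intro compact_continuous_image continuous_intros smooth_continuous f) auto
  then obtain B where B: "cmod (angle_deriv j f t) \<le> B" if "t \<in> {0..2*pi}" for t
    by (metis bounded_imp_bdd_above compact_imp_bounded bdd_above.unfold image_eqI)
  have "cmod (angle_deriv j f t) \<le> B" for t
    using periodic_reduce[of "angle_deriv j f" t] angle_deriv_periodic[OF f] B by metis
  then show ?thesis unfolding bdd_above_def by blast
qed

lemma angle_deriv_le_CN: "f \<in> C\<^sup>\<infinity> \<Longrightarrow> j \<le> N \<Longrightarrow> cmod (angle_deriv j f t) \<le> CN_norm N f"
proof -
  assume f: "f \<in> C\<^sup>\<infinity>" "j \<le> N"
  have nn: "0 \<le> (SUP t. cmod (angle_deriv i f t))" for i
    by (rule cSUP_upper2[OF smooth_bdd[OF f(1)], of 0]) auto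
  have "cmod (angle_deriv j f t) \<le> (SUP t. cmod (angle_deriv j f t))"
    by (rule cSUP_upper[OF _ smooth_bdd[OF f(1)]]) simp
  also have "\<dots> \<le> CN_norm N f"
    unfolding CN_norm_def by (rule member_le_sum) (use f nn in auto)
  finally show ?thesis .
qed

lemma CN_norm_nonneg: "f \<in> C\<^sup>\<infinity> \<Longrightarrow> 0 \<le> CN_norm N f"
  using angle_deriv_le_CN[of f 0 N 0] by (meson norm_ge_zero order_trans zero_le)

lemma CN_norm_leI:
  assumes "\<And>j t. j \<le> N \<Longrightarrow> cmod (angle_deriv j f t) \<le> B j"
  shows "CN_norm N f \<le> (\<Sum>j\<le>N. B j)"
  unfolding CN_norm_def by (rule sum_mono, rule cSUP_least) (use assms in auto)

lemma CN_norm_mono: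
  assumes f: "f \<in> C\<^sup>\<infinity>" and "M \<le> N" shows "CN_norm M f \<le> CN_norm N f"
  unfolding CN_norm_def
  by (rule sum_mono2) (use assms in \<open>auto intro: cSUP_upper2[OF smooth_bdd[OF f], of 0]\<close>)

lemma CN_norm_cmult:
  assumes "f \<in> C\<^sup>\<infinity>"
  shows "CN_norm N (\<lambda>z. c * f z) \<le> cmod c * CN_norm N f"
proof -
  have "CN_norm N (\<lambda>z. c * f z) \<le> (\<Sum>j\<le>N. cmod c * (SUP t. cmod (angle_deriv j f t)))"
    by (rule CN_norm_leI)
      (auto simp: smooth_cmult(2)[OF assms] norm_mult intro!: mult_left_mono cSUP_upper[OF _ smooth_bdd[OF assms]])
  then show ?thesis by (simp add: CN_norm_def sum_distrib_left)
qed

lemma CN_norm_triangle: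
  assumes "f \<in> C\<^sup>\<infinity>" "g \<in> C\<^sup>\<infinity>"
  shows "CN_norm N (\<lambda>z. f z + g z) \<le> CN_norm N f + CN_norm N g"
proof -
  have "CN_norm N (\<lambda>z. f z + g z)
      \<le> (\<Sum>j\<le>N. (SUP t. cmod (angle_deriv j f t)) + (SUP t. cmod (angle_deriv j g t)))"
    by (rule CN_norm_leI)
      (auto simp: smooth_add(2)[OF assms] intro!: norm_triangle_mono
         cSUP_upper[OF _ smooth_bdd[OF assms(1)]] cSUP_upper[OF _ smooth_bdd[OF assms(2)]])
  then show ?thesis by (simp add: CN_norm_def sum.distrib)
qed

section \<open>Fourier coefficients: decay, uniqueness and uniform convergence\<close>

definition trig :: "int \<Rightarrow> complex \<Rightarrow> complex" where
  "trig n z = (if z \<in> S\<^sup>1 then z powi n else 0)"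

lemma trig_cis: "trig n (cis t) = cis (of_int n * t)"
  by (simp add: trig_def cis_power_int)

lemma cis_has_vector_derivative:
  "((\<lambda>t. cis (c * t)) has_vector_derivative (\<i> * of_real c * cis (c * t))) (at t within S)"
  unfolding has_vector_derivative_complex_iff
  by (auto intro!: derivative_eq_intros simp: algebra_simps)

lemma trig_smooth:
  shows "trig n \<in> C\<^sup>\<infinity>" and "angle_deriv j (trig n) = (\<lambda>t. (\<i> * of_int n) ^ j * cis (of_int n * t))"
proof -
  let ?h = "\<lambda>j t. (\<i> * of_int n) ^ j * cis (of_int n * t)"
  have h: "?h 0 t = trig n (cis t)" "(?h j has_vector_derivative ?h (Suc j) t) (at t)" for j t
    using has_vector_derivative_mult_right[OF cis_has_vector_derivative[of "of_int n" t UNIV], of "(\<i> * of_int n)^j"]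
    by (auto simp: trig_cis algebra_simps)
  show "trig n \<in> C\<^sup>\<infinity>" by (rule smoothI[of _ ?h, OF _ h]) (simp add: trig_def)
  show "angle_deriv j (trig n) = ?h j" by (rule angle_deriv_eqI[of ?h, OF h])
qed

lemma CN_norm_trig: "CN_norm N (trig n) \<le> (1 + real N) * (1 + \<bar>of_int n\<bar>) ^ N"
proof -
  have "CN_norm N (trig n) \<le> (\<Sum>j\<le>N. (1 + \<bar>of_int n\<bar>) ^ N)"
  proof (rule CN_norm_leI)
    fix j t assume j: "j \<le> N"
    have "cmod (angle_deriv j (trig n) t) = \<bar>of_int n\<bar> ^ j"
      by (simp add: trig_smooth norm_mult norm_power)
    also have "\<dots> \<le> (1 + \<bar>of_int n\<bar>) ^ j" by (rule power_mono) auto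
    also have "\<dots> \<le> (1 + \<bar>of_int n\<bar>) ^ N" by (rule power_increasing) (use j in auto)
    finally show "cmod (angle_deriv j (trig n) t) \<le> (1 + \<bar>of_int n\<bar>) ^ N" .
  qed
  then show ?thesis by simp
qed

text \<open>Defined for functions of the angle rather than of the point on the circle, so that it
  applies directly to \<open>angle_deriv j f\<close>; \<open>fhat\<close> is the version for test
  functions.\<close>

definition fourier :: "(real \<Rightarrow> complex) \<Rightarrow> int \<Rightarrow> complex" where
  "fourier g n = of_real (1 / (2 * pi)) * integral {0..2 * pi} (\<lambda>t. g t * cis (- (of_int n * t)))"

lemma fourier_le:
  assumes "continuous_on {0..2*pi} g" "\<And>t. t \<in> {0..2*pi} \<Longrightarrow> cmod (g t) \<le> B"
  shows "cmod (fourier g n) \<le> B"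
proof -
  have "cmod (integral {0..2 * pi} (\<lambda>t. g t * cis (- (of_int n * t)))) \<le> B * (2 * pi - 0)"
    by (rule integral_bound) (use assms in \<open>auto intro!: continuous_intros simp: norm_mult\<close>)
  then show ?thesis by (simp add: fourier_def norm_mult field_simps norm_divide)
qed

lemma fourier_lin:
  assumes "continuous_on {0..2*pi} g" "continuous_on {0..2*pi} h"
  shows "fourier (\<lambda>t. a * g t + b * h t) n = a * fourier g n + b * fourier h n"
proof -
  have 1: "(\<lambda>t. g t * cis (- (of_int n * t))) integrable_on {0..2*pi}"
    "(\<lambda>t. h t * cis (- (of_int n * t))) integrable_on {0..2*pi}"
    by (intro integrable_continuous_real continuous_intros assms)+
  have "integral {0..2 * pi} (\<lambda>t. (a * g t + b * h t) * cis (- (of_int n * t)))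
    = integral {0..2 * pi} (\<lambda>t. a * (g t * cis (- (of_int n * t))) + b * (h t * cis (- (of_int n * t))))"
    by (simp add: algebra_simps)
  also have "\<dots> = a * integral {0..2 * pi} (\<lambda>t. g t * cis (- (of_int n * t)))
     + b * integral {0..2 * pi} (\<lambda>t. h t * cis (- (of_int n * t)))"
    using 1 by (subst Henstock_Kurzweil_Integration.integral_add) (auto intro!: integrable_on_mult_right)
  finally show ?thesis by (simp add: fourier_def algebra_simps)
qed

lemma fourier_lin_UNIV:
  assumes "continuous_on UNIV g" "continuous_on UNIV h"
  shows "fourier (\<lambda>t. a * g t + b * h t) n = a * fourier g n + b * fourier h n"
  by (intro fourier_lin continuous_on_subset[OF assms(1)] continuous_on_subset[OF assms(2)]) auto

lemma fourier_mult_cis: "fourier (\<lambda>t. g t * cis (of_int k * t)) n = fourier g (n - k)"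
  by (simp add: fourier_def mult.assoc cis_mult algebra_simps)

lemma fourier_deriv:
  assumes "\<And>t. (g has_vector_derivative g' t) (at t)" "continuous_on UNIV g'" "g (2 * pi) = g 0"
  shows "fourier g' n = \<i> * of_int n * fourier g n"
proof -
  have contg: "continuous_on UNIV g"
    by (meson assms(1) continuous_at_imp_continuous_on has_vector_derivative_continuous)
  have d: "((\<lambda>t. cis (- (of_int n * t))) has_vector_derivative - (\<i> * of_int n * cis (- (of_int n * t)))) (at t within S)" for t S
    using cis_has_vector_derivative[of "- of_int n" t S] by simp
  have "((\<lambda>t. g t * - (\<i> * of_int n * cis (- (of_int n * t))) + g' t * cis (- (of_int n * t)))
    has_integral g (2 * pi) * cis (- (of_int n * (2 * pi))) - g 0 * cis (- (of_int n * 0))) {0..2 * pi}"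
    by (rule fundamental_theorem_of_calculus)
      (simp, rule has_vector_derivative_mult[OF has_vector_derivative_at_within[OF assms(1)] d])
  moreover have "cis (- (of_int n * (2 * pi))) = 1"
    using cis_multiple_2pi[of "- of_int n"] by (simp add: mult.commute mult.left_commute)
  ultimately have z: "((\<lambda>t. g t * - (\<i> * of_int n * cis (- (of_int n * t))) + g' t * cis (- (of_int n * t)))
    has_integral 0) {0..2 * pi}" using assms(3) by simp
  have "fourier (\<lambda>t. (- \<i> * of_int n) * g t + 1 * g' t) n = 0"
    unfolding fourier_def using integral_unique[OF z] by (simp add: algebra_simps)
  moreover have "fourier (\<lambda>t. (- \<i> * of_int n) * g t + 1 * g' t) n = (- \<i> * of_int n) * fourier g n + 1 * fourier g' n"
    by (rule fourier_lin) (auto intro: continuous_on_subset[OF contg] continuous_on_subset[OF assms(2)])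
  ultimately show ?thesis by (simp add: algebra_simps add_eq_0_iff2)
qed

lemma fourier_cis: "fourier (\<lambda>t. cis (of_int k * t)) n = (if n = k then 1 else 0)"
proof (cases "n = k")
  case True
  then show ?thesis by (simp add: fourier_def cis_mult scaleR_conv_of_real)
next
  case False
  have "fourier (\<lambda>t. 1 * cis (of_int k * t)) n = fourier (\<lambda>t. 1) (n - k)"
    by (rule fourier_mult_cis)
  moreover have "fourier (\<lambda>t. 0) (n - k) = \<i> * of_int (n - k) * fourier (\<lambda>t. 1) (n - k)"
    by (rule fourier_deriv) auto
  moreover have "fourier (\<lambda>t. 0) (n - k) = 0" by (simp add: fourier_def)
  ultimately show ?thesis using False by simp
qed

text \<open>Multiplication by e^{it} or e^{-it} only shifts the coefficients, and the coordinates on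
  the circle are combinations of these two. So the vanishing of all coefficients survives
  multiplication by any polynomial in the coordinates. The function u stays arbitrary because the
  product case multiplies by the factors in succession.\<close>

lemma fourier_poly_zero:
  assumes "real_polynomial_function p"
    and "continuous_on UNIV u" "\<And>n. fourier u n = 0"
  shows "continuous_on UNIV (\<lambda>t. u t * of_real (p (cis t)))
    \<and> (\<forall>n. fourier (\<lambda>t. u t * of_real (p (cis t))) n = 0)"
  using assms
proof (induction p arbitrary: u rule: real_polynomial_function.induct)
  case (linear f)
  \<comment> \<open>The coefficients of e^{it} and e^{-it} in the real-linear functional f
    restricted to the circle.\<close>
  define \<alpha> where "\<alpha> = (of_real (f 1) - \<i> * of_real (f \<i>)) / 2"
  define \<beta> where "\<beta> = (of_real (f 1) + \<i> * of_real (f \<i>)) / 2"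
  interpret f: bounded_linear f by fact
  have fz: "f z = Re z * f 1 + Im z * f \<i>" for z
  proof -
    have "z = Re z *\<^sub>R 1 + Im z *\<^sub>R \<i>" by (simp add: complex_eq_iff)
    then have "f z = f (Re z *\<^sub>R 1 + Im z *\<^sub>R \<i>)" by simp
    also have "\<dots> = Re z * f 1 + Im z * f \<i>" by (simp only: f.add f.scaleR real_scaleR_def)
    finally show ?thesis .
  qed
  have "of_real (f (cis t)) = \<alpha> * cis t + \<beta> * cis (- t)" for t
    unfolding fz[of "cis t"]
    by (auto simp: \<alpha>_def \<beta>_def complex_eq_iff mult.commute add_divide_distrib diff_divide_distrib)
  then have eq: "(\<lambda>t. u t * of_real (f (cis t))) =
      (\<lambda>t. \<alpha> * (u t * cis (of_int 1 * t)) + \<beta> * (u t * cis (of_int (-1) * t)))"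
    by (auto simp: algebra_simps)
  have c: "continuous_on UNIV (\<lambda>t. u t * cis (of_int k * t))" for k
    by (intro continuous_intros linear)
  have "continuous_on UNIV (\<lambda>t. \<alpha> * (u t * cis (of_int 1 * t)) + \<beta> * (u t * cis (of_int (-1) * t)))"
    by (intro continuous_intros linear)
  moreover have "fourier (\<lambda>t. \<alpha> * (u t * cis (of_int 1 * t)) + \<beta> * (u t * cis (of_int (-1) * t))) n = 0" for n
    by (subst fourier_lin_UNIV[OF c c]) (simp only: fourier_mult_cis linear(3) mult_zero_right add_0)
  ultimately show ?case unfolding eq by blast
next
  case (const c)
  have "fourier (\<lambda>t. of_real c * u t + 0 * u t) n = 0" for n
    by (subst fourier_lin_UNIV[OF const(1) const(1)]) (simp add: const)
  then show ?case using const by (auto simp: mult.commute intro!: continuous_intros)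
next
  case (add f g)
  from add.IH(1)[OF add.prems] add.IH(2)[OF add.prems]
  have c: "continuous_on UNIV (\<lambda>t. u t * of_real (f (cis t)))" "continuous_on UNIV (\<lambda>t. u t * of_real (g (cis t)))"
    and z: "\<And>n. fourier (\<lambda>t. u t * of_real (f (cis t))) n = 0" "\<And>n. fourier (\<lambda>t. u t * of_real (g (cis t))) n = 0"
    by auto
  have "fourier (\<lambda>t. 1 * (u t * of_real (f (cis t))) + 1 * (u t * of_real (g (cis t)))) n = 0" for n
    by (subst fourier_lin_UNIV[OF c]) (simp add: z)
  then show ?case using continuous_on_add[OF c] by (simp add: algebra_simps)
next
  case (mult f g)
  from mult.IH(2)[of "\<lambda>t. u t * of_real (f (cis t))"] mult.IH(1)[OF mult.prems]
  show ?case by (simp add: algebra_simps)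
qed

lemma periodic_Arg_cis:
  fixes g :: "real \<Rightarrow> 'a"
  assumes "\<And>t. g (t + 2 * pi) = g t"
  shows "g (Arg (cis t)) = g t"
proof -
  have "cis (Arg (cis t)) = cis t" by (simp add: cis_Arg_circle)
  then obtain n :: int where "Arg (cis t) = t + 2 * pi * n" using cis_eq_imp by blast
  then show ?thesis using periodic_int[of g t n] assms by simp
qed

text \<open>\<open>Arg\<close> jumps at the negative axis, so continuity at z is checked with the
  local angle \<open>Arg (w / z) + Arg z\<close>, which is continuous at w = z and agrees with
  \<open>Arg w\<close> up to a multiple of 2\<pi>.\<close>

lemma continuous_on_Arg_periodic:
  fixes g :: "real \<Rightarrow> 'a::metric_space"
  assumes g: "continuous_on UNIV g" and per: "\<And>t. g (t + 2 * pi) = g t"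
  shows "continuous_on S\<^sup>1 (\<lambda>z. g (Arg z))"
  unfolding continuous_on_eq_continuous_within
proof
  fix z :: complex assume z: "z \<in> S\<^sup>1"
  have "continuous (at z within S\<^sup>1) (\<lambda>w. g (Arg (w / z) + Arg z))"
  proof (rule continuous_within_compose3[where g=g])
    show "isCont g (Arg (z / z) + Arg z)" using g by (simp add: continuous_on_eq_continuous_at)
    have "isCont Arg (z / z)" using z by (intro continuous_at_Arg) auto
    moreover have "continuous (at z within S\<^sup>1) (\<lambda>w. w / z)"
      using z by (intro continuous_intros) auto
    ultimately have "continuous (at z within S\<^sup>1) (\<lambda>w. Arg (w / z))"
      by (rule continuous_within_compose3[where g=Arg])
    then show "continuous (at z within S\<^sup>1) (\<lambda>w. Arg (w / z) + Arg z)"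
      by (intro continuous_add continuous_const)
  qed
  moreover have "g (Arg w) = g (Arg (w / z) + Arg z)" if "w \<in> S\<^sup>1" for w
  proof -
    have "cis (Arg (w / z)) = w / z" "cis (Arg z) = z"
      using that z by (intro cis_Arg_circle; simp add: norm_divide)+
    then have "cis (Arg (w / z) + Arg z) = w"
      using z by (auto simp: cis_mult[symmetric])
    then show ?thesis using periodic_Arg_cis[of g, OF per] by metis
  qed
  ultimately show "continuous (at z within S\<^sup>1) (\<lambda>z. g (Arg z))"
    using z by (auto intro: continuous_transform_within[OF _ zero_less_one])
qed

text \<open>Stone-Weierstrass gives a polynomial q close to g on the circle. As g is orthogonal to q
  by \<open>fourier_poly_zero\<close>, the integral of |g|^2 equals that of g times the conjugate of
  g - q and is arbitrarily small.\<close>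

lemma fourier_unique:
  assumes g: "continuous_on UNIV g" and per: "\<And>t. g (t + 2 * pi) = g t" and z: "\<And>n. fourier g n = 0"
  shows "g t = 0"
proof -
  define h where "h z = g (Arg z)" for z
  have hc: "h (cis t) = g t" for t unfolding h_def by (rule periodic_Arg_cis[of g, OF per])
  have "continuous_on S\<^sup>1 h" unfolding h_def[abs_def] by (rule continuous_on_Arg_periodic[OF g per])
  obtain B where B: "\<And>t. t \<in> {0..2*pi} \<Longrightarrow> cmod (g t) \<le> B"
  proof -
    have "compact (g ` {0..2*pi})" by (intro compact_continuous_image continuous_on_subset[OF g]) auto
    then show ?thesis using that by (metis bounded_iff compact_imp_bounded image_eqI)
  qed
  have sm: "integral {0..2*pi} (\<lambda>t. (cmod (g t))\<^sup>2) \<le> B * e * (2 * pi - 0)" if e: "e > 0" for e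
  proof -
    obtain q where q: "polynomial_function q" "\<And>x. x \<in> S\<^sup>1 \<Longrightarrow> cmod (h x - q x) < e"
      using Stone_Weierstrass_polynomial_function[OF _ \<open>continuous_on S\<^sup>1 h\<close> e] by auto
    have r: "real_polynomial_function (\<lambda>z. Re (q z))" "real_polynomial_function (\<lambda>z. Im (q z))"
      using q(1) bounded_linear_Re bounded_linear_Im unfolding polynomial_function_def o_def by auto
    note fp1 = fourier_poly_zero[OF r(1) g z]
    note fp2 = fourier_poly_zero[OF r(2) g z]
    have eq: "g t * cnj (q (cis t)) = 1 * (g t * of_real (Re (q (cis t)))) + (- \<i>) * (g t * of_real (Im (q (cis t))))" for t
      by (simp add: complex_eq_iff)
    have "fourier (\<lambda>t. g t * cnj (q (cis t))) 0 = 0"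
      unfolding eq by (subst fourier_lin_UNIV) (use fp1 fp2 in auto)
    then have i0: "integral {0..2*pi} (\<lambda>t. g t * cnj (q (cis t))) = 0"
      by (simp add: fourier_def)
    have cq: "continuous_on UNIV (\<lambda>t. g t * cnj (q (cis t)))"
      unfolding eq by (intro continuous_on_add continuous_on_mult continuous_on_const conjunct1[OF fp1] conjunct1[OF fp2])
    have "integral {0..2*pi} (\<lambda>t. of_real ((cmod (g t))\<^sup>2)) = integral {0..2*pi} (\<lambda>t. g t * cnj (g t))"
      by (simp only: complex_norm_square)
    also have "\<dots> = integral {0..2*pi} (\<lambda>t. g t * cnj (g t)) - integral {0..2*pi} (\<lambda>t. g t * cnj (q (cis t)))"
      using i0 by simp
    also have "\<dots> = integral {0..2*pi} (\<lambda>t. g t * cnj (g t) - g t * cnj (q (cis t)))"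
      by (rule Henstock_Kurzweil_Integration.integral_diff[symmetric])
        (auto intro!: integrable_continuous_real continuous_intros continuous_on_subset[OF g] continuous_on_subset[OF cq])
    finally have 1: "integral {0..2*pi} (\<lambda>t. complex_of_real ((cmod (g t))\<^sup>2)) = integral {0..2*pi} (\<lambda>t. g t * cnj (g t) - g t * cnj (q (cis t)))" .
    have 2: "cmod (integral {0..2*pi} (\<lambda>t. g t * cnj (g t) - g t * cnj (q (cis t)))) \<le> B * e * (2 * pi - 0)"
    proof (rule integral_bound)
      fix t :: real assume t: "t \<in> {0..2*pi}"
      have "g t * cnj (g t) - g t * cnj (q (cis t)) = g t * cnj (h (cis t) - q (cis t))"
        by (simp add: hc algebra_simps)
      then have "cmod (g t * cnj (g t) - g t * cnj (q (cis t))) = cmod (g t) * cmod (h (cis t) - q (cis t))"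
        by (simp only: norm_mult complex_mod_cnj)
      also have "\<dots> \<le> B * e"
        using B[OF t] q(2)[of "cis t"] e order_trans[OF norm_ge_zero B[OF t]] by (intro mult_mono) auto
      finally show "cmod (g t * cnj (g t) - g t * cnj (q (cis t))) \<le> B * e" .
    qed (auto intro!: continuous_intros continuous_on_subset[OF g] continuous_on_subset[OF cq])
    have 3: "integral {0..2*pi} (\<lambda>t. complex_of_real ((cmod (g t))\<^sup>2)) = of_real (integral {0..2*pi} (\<lambda>t. (cmod (g t))\<^sup>2))"
    proof -
      have "(\<lambda>t. (cmod (g t))\<^sup>2) integrable_on {0..2*pi}"
        by (intro integrable_continuous_real continuous_intros continuous_on_subset[OF g]) auto
      from integral_linear[OF this bounded_linear_of_real[where 'a=complex]]
      show ?thesis by (simp only: o_def)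
    qed
    show ?thesis using 2 unfolding 1[symmetric] 3 norm_of_real by linarith
  qed
  have "integral {0..2*pi} (\<lambda>t. (cmod (g t))\<^sup>2) \<le> 0"
  proof (rule ccontr)
    assume "\<not> ?thesis"
    then have pos: "integral {0..2*pi} (\<lambda>t. (cmod (g t))\<^sup>2) > 0" (is "?I > 0") by simp
    have B0: "0 \<le> B" using order_trans[OF norm_ge_zero B[of 0]] by simp
    \<comment> \<open>B + 1 instead of B keeps the divisor positive when B = 0.\<close>
    define D where "D = (B + 1) * (2 * pi)"
    have D: "D > 0" unfolding D_def using B0 by simp
    define e where "e = ?I / (2 * D)"
    have "e > 0" unfolding e_def using pos D by simp
    from sm[OF this] have "?I \<le> B * e * (2 * pi)" by simp
    also have "\<dots> \<le> (B + 1) * e * (2 * pi)" using \<open>e > 0\<close> by (intro mult_right_mono) auto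
    also have "\<dots> = e * D" by (simp add: D_def)
    also have "\<dots> = ?I / 2" unfolding e_def using D by simp
    finally show False using pos by simp
  qed
  moreover have "integral {0..2*pi} (\<lambda>t. (cmod (g t))\<^sup>2) \<ge> 0"
    by (rule Henstock_Kurzweil_Integration.integral_nonneg)
      (auto intro!: integrable_continuous_real continuous_intros continuous_on_subset[OF g])
  ultimately have "integral {0..2*pi} (\<lambda>t. (cmod (g t))\<^sup>2) = 0" by simp
  then have "\<forall>t\<in>{0..2*pi}. (cmod (g t))\<^sup>2 = 0"
    by (subst (asm) integral_eq_0_iff) (auto intro!: continuous_intros continuous_on_subset[OF g])
  then show ?thesis using periodic_reduce[of g t] per by auto
qed

lemma cis_periodic: "cis (t + 2 * pi) = cis t" "cis (t + 2 * pi * of_int n) = cis t"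
  using periodic_int[of cis t n] by (simp_all add: cis.ctr)

definition fhat :: "(complex \<Rightarrow> complex) \<Rightarrow> int \<Rightarrow> complex" where
  "fhat f = fourier (\<lambda>t. f (cis t))"

lemma fourier_angle_deriv:
  assumes "f \<in> C\<^sup>\<infinity>"
  shows "fourier (angle_deriv j f) n = (\<i> * of_int n) ^ j * fhat f n"
proof (induction j)
  case 0
  have "angle_deriv 0 f = (\<lambda>t. f (cis t))" by (auto simp: angle_deriv_0)
  then show ?case by (simp add: fhat_def)
next
  case (Suc j)
  have "fourier (angle_deriv (Suc j) f) n = \<i> * of_int n * fourier (angle_deriv j f) n"
    using angle_deriv_periodic[OF assms, of j 0]
    by (intro fourier_deriv smooth_has_vector_derivative smooth_continuous assms) simp
  then show ?case using Suc by simp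
qed

text \<open>Each of j integrations by parts gains a factor n. Since 1 + |n| \<le> 2|n| for n
  \<noteq> 0, passing from |n| to 1 + |n| costs \<open>2 ^ j\<close>; the mode n = 0 is covered by
  the plain supremum bound.\<close>

lemma fourier_decay:
  assumes f: "f \<in> C\<^sup>\<infinity>"
  shows "cmod (fourier (angle_deriv i f) n) \<le> 2 ^ j * CN_norm (i + j) f / (1 + \<bar>of_int n\<bar>) ^ j"
proof -
  have le: "cmod (fourier (angle_deriv k f) n) \<le> CN_norm (i + j) f" if "k \<le> i + j" for k
    by (rule fourier_le) (use f that in \<open>auto intro: smooth_continuous angle_deriv_le_CN\<close>)
  have "(1 + \<bar>of_int n\<bar>) ^ j * cmod (fourier (angle_deriv i f) n) \<le> 2 ^ j * CN_norm (i + j) f"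
  proof (cases "n = 0")
    case True
    have "1 * CN_norm (i + j) f \<le> 2 ^ j * CN_norm (i + j) f"
      by (intro mult_right_mono CN_norm_nonneg f) simp
    with le[of i] True show ?thesis by simp
  next
    case False
    then have "1 + \<bar>of_int n\<bar> \<le> 2 * \<bar>of_int n :: real\<bar>" by linarith
    then have "(1 + \<bar>of_int n\<bar>) ^ j * cmod (fourier (angle_deriv i f) n) \<le> (2 * \<bar>of_int n\<bar>) ^ j * cmod (fourier (angle_deriv i f) n)"
      by (intro mult_right_mono power_mono) auto
    also have "\<dots> = 2 ^ j * cmod (fourier (angle_deriv (i + j) f) n)"
      by (simp add: fourier_angle_deriv[OF f] power_add norm_mult norm_power power_mult_distrib)
    also have "\<dots> \<le> 2 ^ j * CN_norm (i + j) f" using le[of "i + j"] by simp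
    finally show ?thesis .
  qed
  then show ?thesis by (simp add: field_simps)
qed

lemma fhat_decay:
  assumes f: "f \<in> C\<^sup>\<infinity>"
  shows "cmod (fhat f n) \<le> 2 ^ j * CN_norm j f / (1 + \<bar>of_int n\<bar>) ^ j"
  using fourier_decay[OF f, of 0 n j] by (simp add: fourier_angle_deriv[OF f])

definition fourier_sum :: "(int \<Rightarrow> complex) \<Rightarrow> nat \<Rightarrow> real \<Rightarrow> complex" where
  "fourier_sum b K t = (\<Sum>n\<in>{- int K..int K}. b n * cis (of_int n * t))"

lemma sum_symmetric_interval:
  fixes b :: "int \<Rightarrow> 'a::comm_monoid_add"
  shows "(\<Sum>n\<in>{- int K..int K}. b n) = b 0 + (\<Sum>k<K. b (int (Suc k)) + b (- int (Suc k)))"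
proof (induction K)
  case (Suc K)
  have "{- int (Suc K)..int (Suc K)} = insert (int (Suc K)) (insert (- int (Suc K)) {- int K..int K})" by auto
  then show ?case using Suc by (simp add: ac_simps)
qed simp

lemma fourier_trig_sum:
  assumes "finite A"
  shows "continuous_on UNIV (\<lambda>t. \<Sum>k\<in>A. b k * cis (of_int k * t)) \<and>
    fourier (\<lambda>t. \<Sum>k\<in>A. b k * cis (of_int k * t)) n = (if n \<in> A then b n else 0)"
  using assms
proof (induction A rule: finite_induct)
  case empty
  then show ?case by (simp add: fourier_def)
next
  case (insert x A)
  have c: "continuous_on UNIV (\<lambda>t. cis (of_int x * t))" "continuous_on UNIV (\<lambda>t. \<Sum>k\<in>A. b k * cis (of_int k * t))"
    by (intro continuous_intros)+
  have "fourier (\<lambda>t. b x * cis (of_int x * t) + 1 * (\<Sum>k\<in>A. b k * cis (of_int k * t))) n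
     = b x * fourier (\<lambda>t. cis (of_int x * t)) n + 1 * fourier (\<lambda>t. \<Sum>k\<in>A. b k * cis (of_int k * t)) n"
    by (rule fourier_lin_UNIV[OF c])
  then show ?case using insert c by (auto simp: fourier_cis intro!: continuous_intros)
qed

text \<open>Quadratic decay makes the series converge uniformly to some H. Coefficients pass to
  uniform limits, so H has the coefficients of g, and uniqueness identifies the two. Pairing n with
  -n writes the symmetric sums as partial sums of an ordinary series.\<close>

lemma fourier_sum_uniform_limit:
  assumes g: "continuous_on UNIV g" and per: "\<And>t. g (t + 2 * pi) = g t"
    and C: "\<And>n. cmod (fourier g n) \<le> C / (1 + \<bar>of_int n\<bar>) ^ 2"
  shows "uniform_limit UNIV (fourier_sum (fourier g)) g sequentially"
proof -
  let ?b = "fourier g"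
  define u where "u k t = ?b (int (Suc k)) * cis (of_int (int (Suc k)) * t) + ?b (- int (Suc k)) * cis (of_int (- int (Suc k)) * t)" for k t
  define H where "H t = ?b 0 + (\<Sum>k. u k t)" for t
  have fs: "fourier_sum ?b K t = ?b 0 + (\<Sum>k<K. u k t)" for K t
    unfolding fourier_sum_def sum_symmetric_interval u_def by simp
  have "C \<ge> 0" using order_trans[OF norm_ge_zero C[of 0]] by simp
  have "uniform_limit UNIV (\<lambda>K t. \<Sum>k<K. u k t) (\<lambda>t. \<Sum>k. u k t) sequentially"
  proof (rule Weierstrass_m_test)
    fix k t
    have "cmod (u k t) \<le> cmod (?b (int (Suc k))) + cmod (?b (- int (Suc k)))"
      unfolding u_def by (rule norm_triangle_mono) (simp_all add: norm_mult)
    also have "\<dots> \<le> C / (1 + \<bar>of_int (int (Suc k))\<bar>) ^ 2 + C / (1 + \<bar>of_int (- int (Suc k))\<bar>) ^ 2"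
      by (intro add_mono C)
    also have "\<dots> \<le> C / (real (Suc k)) ^ 2 + C / (real (Suc k)) ^ 2"
      using \<open>C \<ge> 0\<close> by (intro add_mono divide_left_mono power_mono) auto
    finally show "cmod (u k t) \<le> 2 * C * inverse (real (Suc k) ^ 2)" by (simp add: field_simps)
  next
    show "summable (\<lambda>k. 2 * C * inverse (real (Suc k) ^ 2))"
      using inverse_power_summable[of 2, where 'a=real]
      by (intro summable_mult) (subst summable_Suc_iff[of "\<lambda>k. inverse (real k ^ 2)"], simp)
  qed
  then have ul: "uniform_limit UNIV (fourier_sum ?b) H sequentially"
    unfolding H_def by (subst fs[abs_def]) (intro uniform_limit_add uniform_limit_const)
  have cont: "continuous_on UNIV (fourier_sum ?b K)" for K
    unfolding fourier_sum_def[abs_def] by (intro continuous_intros)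
  have H: "continuous_on UNIV H"
    by (rule uniform_limit_theorem[OF _ ul]) (auto simp: cont)
  have cper: "cis (of_int n * (t + 2 * pi)) = cis (of_int n * t)" for n :: int and t
    using cis_periodic(2)[of "of_int n * t" n] by (simp add: algebra_simps)
  have Hper: "H (t + 2 * pi) = H t" for t unfolding H_def u_def cper ..
  have fH: "fourier H n = ?b n" for n
  proof (rule ccontr)
    assume "fourier H n \<noteq> ?b n"
    then have pos: "cmod (fourier H n - ?b n) / 2 > 0" by simp
    from uniform_limitD[OF ul pos] obtain K0 where
      K0: "\<And>K t. K \<ge> K0 \<Longrightarrow> cmod (fourier_sum ?b K t - H t) < cmod (fourier H n - ?b n) / 2"
      by (auto simp: eventually_sequentially dist_norm)
    define K where "K = max K0 (nat \<bar>n\<bar>)"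
    have fK: "fourier (fourier_sum ?b K) n = ?b n"
      unfolding fourier_sum_def[abs_def] using fourier_trig_sum[of "{- int K..int K}" ?b n]
      by (auto simp: K_def)
    have "fourier (\<lambda>t. 1 * fourier_sum ?b K t + (-1) * H t) n = 1 * ?b n + (-1) * fourier H n"
      using fK by (subst fourier_lin_UNIV[OF cont H]) simp
    moreover have "cmod (fourier (\<lambda>t. 1 * fourier_sum ?b K t + (-1) * H t) n) \<le> cmod (fourier H n - ?b n) / 2"
    proof (rule fourier_le)
      have "continuous_on UNIV (\<lambda>t. 1 * fourier_sum ?b K t + (-1) * H t)"
        by (intro continuous_on_add continuous_on_mult continuous_on_const cont H)
      then show "continuous_on {0..2*pi} (\<lambda>t. 1 * fourier_sum ?b K t + (-1) * H t)"
        by (rule continuous_on_subset) simp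
      show "cmod (1 * fourier_sum ?b K t + (-1) * H t) \<le> cmod (fourier H n - ?b n) / 2" for t
        using K0[of K t] by (simp add: K_def)
    qed
    ultimately show False using pos by (simp add: norm_minus_commute)
  qed
  have "1 * g t + (-1) * H t = 0" for t
  proof (rule fourier_unique)
    show "continuous_on UNIV (\<lambda>t. 1 * g t + (-1) * H t)" by (intro continuous_intros g H)
    show "fourier (\<lambda>t. 1 * g t + (-1) * H t) n = 0" for n
      by (subst fourier_lin_UNIV[OF g H]) (simp add: fH)
  qed (simp add: per Hper)
  then have "g = H" by auto
  with ul show ?thesis by simp
qed

text \<open>Linearity and continuity for the Frechet topology, the latter expressed as a bound by a
  single seminorm \<open>CN_norm N\<close>.\<close>

definition distribution :: "((complex \<Rightarrow> complex) \<Rightarrow> complex) \<Rightarrow> bool" where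
  "distribution T \<longleftrightarrow> (\<forall>f\<in>C\<^sup>\<infinity>. \<forall>g\<in>C\<^sup>\<infinity>. T (\<lambda>z. f z + g z) = T f + T g) \<and>
     (\<forall>f\<in>C\<^sup>\<infinity>. \<forall>c. T (\<lambda>z. c * f z) = c * T f) \<and>
     (\<exists>C N. \<forall>f\<in>C\<^sup>\<infinity>. cmod (T f) \<le> C * CN_norm N f)"

lemma distribution_add:
  "distribution T \<Longrightarrow> f \<in> C\<^sup>\<infinity> \<Longrightarrow> g \<in> C\<^sup>\<infinity> \<Longrightarrow> T (\<lambda>z. f z + g z) = T f + T g"
  by (simp add: distribution_def)

lemma distribution_cmult: "distribution T \<Longrightarrow> f \<in> C\<^sup>\<infinity> \<Longrightarrow> T (\<lambda>z. c * f z) = c * T f"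
  by (simp add: distribution_def)

lemma distribution_sum:
  assumes T: "distribution T" and "finite A" "\<And>n. n \<in> A \<Longrightarrow> f n \<in> C\<^sup>\<infinity>"
  shows "T (\<lambda>z. \<Sum>n\<in>A. c n * f n z) = (\<Sum>n\<in>A. c n * T (f n))"
  using assms(2,3)
proof (induction A rule: finite_induct)
  case empty
  have "T (\<lambda>z. 0 * (0::complex)) = 0 * T (\<lambda>z. 0)"
    by (rule distribution_cmult[OF T smooth_zero])
  then show ?case by simp
next
  case (insert x A)
  have "T (\<lambda>z. c x * f x z + (\<Sum>n\<in>A. c n * f n z)) = T (\<lambda>z. c x * f x z) + T (\<lambda>z. \<Sum>n\<in>A. c n * f n z)"
    using T insert smooth_sum[of A "\<lambda>n z. c n * f n z"] unfolding distribution_def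
    by (auto simp: smooth_cmult)
  then show ?case using insert T by (simp add: distribution_def)
qed

lemma distribution_diff:
  assumes "distribution T" "f \<in> C\<^sup>\<infinity>" "g \<in> C\<^sup>\<infinity>"
  shows "T (\<lambda>z. f z - g z) = T f - T g"
proof -
  have "T (\<lambda>z. f z + (-1) * g z) = T f + T (\<lambda>z. (-1) * g z)"
    by (rule distribution_add[OF assms(1,2) smooth_cmult(1)[OF assms(3)]])
  moreover have "T (\<lambda>z. (-1) * g z) = (-1) * T g"
    by (rule distribution_cmult[OF assms(1,3)])
  ultimately show ?thesis by simp
qed

lemma CN_norm_fourier_sum:
  assumes f: "f \<in> C\<^sup>\<infinity>"
  shows "(\<lambda>K. CN_norm N (\<lambda>z. f z - (\<Sum>n\<in>{- int K..int K}. fhat f n * trig n z))) \<longlonglongrightarrow> 0"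
proof -
  define S where "S K = (\<lambda>z. \<Sum>n\<in>{- int K..int K}. fhat f n * trig n z)" for K
  have S: "S K \<in> C\<^sup>\<infinity>" and dS: "angle_deriv j (S K) = fourier_sum (fourier (angle_deriv j f)) K" for K j
    using smooth_sum[of "{- int K..int K}" "\<lambda>n z. fhat f n * trig n z" j, OF _ smooth_cmult(1)[OF trig_smooth(1)]]
    unfolding S_def
    by (simp_all add: smooth_cmult(2)[OF trig_smooth(1)] trig_smooth(2) fourier_sum_def
        fourier_angle_deriv[OF f] mult.assoc mult.left_commute fun_eq_iff)
  have ul: "uniform_limit UNIV (fourier_sum (fourier (angle_deriv j f))) (angle_deriv j f) sequentially" for j
    by (rule fourier_sum_uniform_limit[of _ "2^2 * CN_norm (j+2) f"])
      (use fourier_decay[OF f, of j _ 2] in \<open>auto intro: smooth_continuous angle_deriv_periodic f\<close>)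
  show ?thesis
  proof (rule LIMSEQ_I)
    fix e :: real assume e: "e > 0"
    define e' where "e' = e / (2 * (real N + 1))"
    have e': "e' > 0" using e by (simp add: e'_def)
    have "\<forall>j\<in>{..N}. \<forall>\<^sub>F K in sequentially. \<forall>t. cmod (fourier_sum (fourier (angle_deriv j f)) K t - angle_deriv j f t) < e'"
      using uniform_limitD[OF ul e'] by (auto simp: dist_norm)
    then have "\<forall>\<^sub>F K in sequentially. \<forall>j\<in>{..N}. \<forall>t. cmod (fourier_sum (fourier (angle_deriv j f)) K t - angle_deriv j f t) < e'"
      by (intro eventually_ball_finite) auto
    then obtain K0 where K0: "\<And>K j t. K \<ge> K0 \<Longrightarrow> j \<le> N \<Longrightarrow> cmod (fourier_sum (fourier (angle_deriv j f)) K t - angle_deriv j f t) < e'"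
      by (auto simp: eventually_sequentially)
    have "norm (CN_norm N (\<lambda>z. f z - S K z) - 0) < e" if "K \<ge> K0" for K
    proof -
      have "CN_norm N (\<lambda>z. f z - S K z) \<le> (\<Sum>j\<le>N. e')"
        by (rule CN_norm_leI)
          (use K0[OF that] in \<open>auto simp: smooth_diff(2)[OF f S] dS norm_minus_commute intro: less_imp_le\<close>)
      also have "\<dots> = e / 2" by (simp add: e'_def field_simps)
      finally show ?thesis using e CN_norm_nonneg[OF smooth_diff(1)[OF f S], of N K] by simp
    qed
    then show "\<exists>no. \<forall>K\<ge>no. norm (CN_norm N (\<lambda>z. f z - (\<Sum>n\<in>{- int K..int K}. fhat f n * trig n z)) - 0) < e"
      unfolding S_def by blast
  qed
qed

text \<open>Fourier series converge in every \<open>CN_norm\<close>, so a distribution is determined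
  by its values on the characters z^n. This reduces statements about smeared fields to statements
  about their modes.\<close>

theorem distribution_fourier:
  assumes T: "distribution T" and f: "f \<in> C\<^sup>\<infinity>"
  shows "(\<lambda>K. \<Sum>n\<in>{- int K..int K}. fhat f n * T (trig n)) \<longlonglongrightarrow> T f"
proof -
  obtain C N where C: "\<And>f. f \<in> C\<^sup>\<infinity> \<Longrightarrow> cmod (T f) \<le> C * CN_norm N f"
    using T unfolding distribution_def by blast
  define S where "S K = (\<lambda>z. \<Sum>n\<in>{- int K..int K}. fhat f n * trig n z)" for K
  have S: "S K \<in> C\<^sup>\<infinity>" for K
    using smooth_sum[of "{- int K..int K}" "\<lambda>n z. fhat f n * trig n z"]
    unfolding S_def by (auto simp: smooth_cmult trig_smooth)
  have "(\<lambda>K. T f - T (S K)) \<longlonglongrightarrow> 0"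
  proof (rule Lim_null_comparison)
    show "\<forall>\<^sub>F K in sequentially. norm (T f - T (S K)) \<le> C * CN_norm N (\<lambda>z. f z - S K z)"
      using C[OF smooth_diff(1)[OF f S]] distribution_diff[OF T f S] by simp
    show "(\<lambda>K. C * CN_norm N (\<lambda>z. f z - S K z)) \<longlonglongrightarrow> 0"
      unfolding S_def using tendsto_mult_left[OF CN_norm_fourier_sum[OF f, of N], of C] by simp
  qed
  then have "(\<lambda>K. T f - (T f - T (S K))) \<longlonglongrightarrow> T f - 0" by (intro tendsto_intros)
  moreover have "T (S K) = (\<Sum>n\<in>{- int K..int K}. fhat f n * T (trig n))" for K
    unfolding S_def by (rule distribution_sum[OF T]) (auto simp: trig_smooth)
  ultimately show ?thesis by simp
qed

text \<open>Dependent choice: in a class closed under differentiation every member has derivatives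
  of all orders, and no formula for the j-th derivative has to be found.\<close>

lemma derivation_sequence:
  assumes step: "\<And>h. h \<in> B \<Longrightarrow> \<exists>h'\<in>B. \<forall>t. (h has_vector_derivative h' t) (at t)" and "h0 \<in> B"
  obtains h :: "nat \<Rightarrow> real \<Rightarrow> complex" where "h 0 = h0" "\<And>j. h j \<in> B"
    "\<And>j t. (h j has_vector_derivative h (Suc j) t) (at t)"
proof -
  have "\<exists>f. \<forall>n. (f n \<in> B \<and> (n = 0 \<longrightarrow> f n = h0)) \<and> (\<forall>t. (f n has_vector_derivative f (Suc n) t) (at t))"
    by (rule dependent_nat_choice) (use step \<open>h0 \<in> B\<close> in auto)
  then show ?thesis using that by blast
qed

subsection \<open>Bump functions\<close>

text \<open>The germ x^{-k} e^{-1/x}. The powers are included because differentiation produces them: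
  up to linear combinations the family over k is closed under derivatives.\<close>

definition bump_germ :: "nat \<Rightarrow> real \<Rightarrow> real" where
  "bump_germ k x = (if x > 0 then inverse x ^ k * exp (- inverse x) else 0)"

lemma bump_germ_tendsto: "(bump_germ k \<longlongrightarrow> 0) (at 0)"
proof -
  have "((\<lambda>x::real. inverse x ^ k / exp (inverse x)) \<longlongrightarrow> 0) (at_right 0)"
    by (rule filterlim_compose[OF tendsto_power_div_exp_0 filterlim_inverse_at_top_right])
  then have "(bump_germ k \<longlongrightarrow> 0) (at_right 0)"
    by (rule Lim_transform_eventually)
      (auto simp: bump_germ_def eventually_at_filter exp_minus field_simps intro!: always_eventually)
  moreover have "(bump_germ k \<longlongrightarrow> 0) (at_left 0)"
    by (rule Lim_transform_eventually[OF tendsto_const])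
      (auto simp: bump_germ_def eventually_at_filter intro!: always_eventually)
  ultimately show ?thesis by (simp add: filterlim_split_at)
qed

lemma bump_germ_deriv:
  "(bump_germ k has_real_derivative - real k * bump_germ (k + 1) x + bump_germ (k + 2) x) (at x)"
proof -
  consider "x > 0" | "x < 0" | "x = 0" by linarith
  then show ?thesis
  proof cases
    case 1
    have "((\<lambda>x. inverse x ^ k * exp (- inverse x)) has_real_derivative
       - real k * bump_germ (k + 1) x + bump_germ (k + 2) x) (at x)"
      using 1 by (auto intro!: derivative_eq_intros simp: bump_germ_def power_Suc2[symmetric] simp del: power_Suc)
        (cases k; simp add: field_simps power2_eq_square)
    then show ?thesis
      by (rule has_field_derivative_transform_within_open[of _ _ _ "{0<..}"]) (use 1 in \<open>auto simp: bump_germ_def\<close>)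
  next
    case 2
    have "((\<lambda>x. 0) has_real_derivative 0) (at x)" by simp
    then have "(bump_germ k has_real_derivative 0) (at x)"
      by (rule has_field_derivative_transform_within_open[of _ _ _ "{..<0}"]) (use 2 in \<open>auto simp: bump_germ_def\<close>)
    then show ?thesis using 2 by (simp add: bump_germ_def)
  next
    case 3
    have "(\<lambda>h. (bump_germ k (0 + h) - bump_germ k 0) / h) = bump_germ (k + 1)"
      by (auto simp: bump_germ_def field_simps)
    then have "(bump_germ k has_real_derivative 0) (at 0)"
      unfolding DERIV_def using bump_germ_tendsto by simp
    then show ?thesis using 3 by (simp add: bump_germ_def)
  qed
qed

text \<open>A class that contains all derivatives of the bump. The chain rule brings out
  \<open>sin (t - \<alpha>)\<close>, a combination of e^{it} and e^{-it}, which is why characters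
  appear as factors.\<close>

inductive_set bump_terms :: "real \<Rightarrow> real \<Rightarrow> (real \<Rightarrow> complex) set" for \<alpha> c where
  base: "(\<lambda>t. b * cis (of_int n * t) * of_real (bump_germ k (cos (t - \<alpha>) - c))) \<in> bump_terms \<alpha> c"
| add: "f \<in> bump_terms \<alpha> c \<Longrightarrow> g \<in> bump_terms \<alpha> c \<Longrightarrow> (\<lambda>t. f t + g t) \<in> bump_terms \<alpha> c"

lemma bump_terms_deriv:
  "f \<in> bump_terms \<alpha> c \<Longrightarrow> \<exists>f'\<in>bump_terms \<alpha> c. \<forall>t. (f has_vector_derivative f' t) (at t)"
proof (induction rule: bump_terms.induct)
  case (base b n k)
  let ?g = "\<lambda>k t. of_real (bump_germ k (cos (t - \<alpha>) - c)) :: complex"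
  define p where "p = - (\<i> / 2) * cis (- \<alpha>)"
  define q where "q = \<i> / 2 * cis \<alpha>"
  have sin: "of_real (sin (t - \<alpha>)) = p * cis t + q * cis (- t)" for t
    by (simp add: p_def q_def complex_eq_iff sin_diff field_simps)
  have dg: "((\<lambda>t. ?g k t) has_vector_derivative
      of_real (- sin (t - \<alpha>) * (- real k * bump_germ (k + 1) (cos (t - \<alpha>) - c) + bump_germ (k + 2) (cos (t - \<alpha>) - c)))) (at t)" for t
  proof -
    have "((\<lambda>t. cos (t - \<alpha>) - c) has_real_derivative - sin (t - \<alpha>)) (at t)"
      by (auto intro!: derivative_eq_intros)
    from DERIV_chain2[OF bump_germ_deriv this]
    have "((\<lambda>t. bump_germ k (cos (t - \<alpha>) - c)) has_real_derivative (- real k * bump_germ (k + 1) (cos (t - \<alpha>) - c) + bump_germ (k + 2) (cos (t - \<alpha>) - c)) * - sin (t - \<alpha>)) (at t)"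
      .
    from has_vector_derivative_of_real[OF this] show ?thesis by (simp add: mult.commute)
  qed
  let ?T = "\<lambda>b n k t. b * cis (of_int n * t) * ?g k t"
  let ?D = "\<lambda>t. ?T (b * \<i> * of_int n) n k t + (?T (b * p * real k) (n + 1) (k + 1) t
    + (?T (b * q * real k) (n - 1) (k + 1) t + (?T (- b * p) (n + 1) (k + 2) t + ?T (- b * q) (n - 1) (k + 2) t)))"
  have "?D \<in> bump_terms \<alpha> c" by (intro bump_terms.intros)
  moreover have "(?T b n k has_vector_derivative ?D t) (at t)" for t
  proof -
    have "((\<lambda>t. b * cis (of_int n * t)) has_vector_derivative b * (\<i> * of_real (of_int n) * cis (of_int n * t))) (at t)"
      by (intro has_vector_derivative_mult_right cis_has_vector_derivative)
    from has_vector_derivative_mult[OF this dg]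
    have "(?T b n k has_vector_derivative b * cis (of_int n * t) * of_real (- sin (t - \<alpha>) * (- real k * bump_germ (k + 1) (cos (t - \<alpha>) - c) + bump_germ (k + 2) (cos (t - \<alpha>) - c)))
       + b * (\<i> * of_real (of_int n) * cis (of_int n * t)) * ?g k t) (at t)" .
    moreover have "cis (of_int (n + 1) * t) = cis (of_int n * t) * cis t" "cis (of_int (n - 1) * t) = cis (of_int n * t) * cis (- t)"
      by (simp_all add: cis_mult algebra_simps)
    then have "b * cis (of_int n * t) * of_real (- sin (t - \<alpha>) * (- real k * bump_germ (k + 1) (cos (t - \<alpha>) - c) + bump_germ (k + 2) (cos (t - \<alpha>) - c)))
       + b * (\<i> * of_real (of_int n) * cis (of_int n * t)) * ?g k t = ?D t"
      by (simp only: of_real_mult of_real_minus sin of_real_add) (simp add: algebra_simps)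
    ultimately show ?thesis by (rule has_vector_derivative_eq_rhs)
  qed
  ultimately show ?case by (intro bexI[of _ ?D] allI)
next
  case (add f g)
  then obtain f' g' where "f' \<in> bump_terms \<alpha> c" "g' \<in> bump_terms \<alpha> c"
    "\<And>t. (f has_vector_derivative f' t) (at t)" "\<And>t. (g has_vector_derivative g' t) (at t)" by metis
  then show ?case
    by (intro bexI[of _ "\<lambda>t. f' t + g' t"] allI bump_terms.add has_vector_derivative_add)
qed

text \<open>For c = cos \<delta> with 0 < \<delta> < \<pi> the support lies in the closed arc of
  angular radius \<delta> around e^{i\<alpha>}.\<close>

definition bump :: "real \<Rightarrow> real \<Rightarrow> complex \<Rightarrow> complex" where
  "bump \<alpha> c z = (if z \<in> S\<^sup>1 then of_real (bump_germ 0 (Re (z * cis (- \<alpha>)) - c)) else 0)"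

lemma bump_cis: "bump \<alpha> c (cis t) = of_real (bump_germ 0 (cos (t - \<alpha>) - c))"
  by (simp add: bump_def cis_mult)

lemma bump_smooth: "bump \<alpha> c \<in> C\<^sup>\<infinity>"
proof -
  have "(\<lambda>t. 1 * cis (of_int 0 * t) * of_real (bump_germ 0 (cos (t - \<alpha>) - c))) \<in> bump_terms \<alpha> c"
    by (rule bump_terms.base)
  then have "(\<lambda>t. bump \<alpha> c (cis t)) \<in> bump_terms \<alpha> c" by (simp add: bump_cis)
  from derivation_sequence[OF bump_terms_deriv this] obtain h where
    h: "h 0 = (\<lambda>t. bump \<alpha> c (cis t))" "\<And>j t. (h j has_vector_derivative h (Suc j) t) (at t)"
    by metis
  show ?thesis by (rule smoothI[of _ h]) (use h in \<open>auto simp: bump_def\<close>)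
qed

lemma bump_shift: "bump \<alpha> c (cis t) = bump 0 c (cis (t - \<alpha>))"
  by (simp add: bump_cis)

lemma supp_bump: "supp (bump \<alpha> c) \<subseteq> {z \<in> S\<^sup>1. c \<le> Re (z * cis (- \<alpha>))}"
proof -
  have "closed {z \<in> S\<^sup>1. c \<le> Re (z * cis (- \<alpha>))}"
    by (intro closed_Collect_conj closed_Collect_le continuous_intros closed_Collect_eq)
      (auto simp: sphere_def intro!: closed_Collect_eq continuous_intros)
  then show ?thesis unfolding supp_def
    by (intro closure_minimal) (auto simp: bump_def bump_germ_def split: if_splits)
qed

text \<open>A chord is at most as long as its arc: 2 - 2 cos \<delta> = 4 sin^2(\<delta>/2) \<le>
  \<delta>^2.\<close>

lemma bump_near:
  assumes "z \<in> S\<^sup>1" "cos \<delta> \<le> Re (z * cis (- \<alpha>))" "0 \<le> \<delta>"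
  shows "cmod (z - cis \<alpha>) \<le> \<delta>"
proof -
  have "(cmod (z - cis \<alpha>))\<^sup>2 = (cmod z)\<^sup>2 + 1 - 2 * Re (z * cis (- \<alpha>))"
    using sin_cos_squared_add[of \<alpha>] unfolding cmod_power2 by (simp add: power2_eq_square algebra_simps)
  also have "\<dots> \<le> 2 - 2 * cos \<delta>" using assms by simp
  also have "\<dots> = 4 * (sin (\<delta> / 2))\<^sup>2" using cos_double_sin[of "\<delta> / 2"] by simp
  also have "\<dots> \<le> 4 * (\<delta> / 2)\<^sup>2"
    using abs_sin_x_le_abs_x[of "\<delta>/2"] by (intro mult_left_mono) (simp_all only: abs_le_square_iff zero_le_numeral)
  also have "\<dots> = \<delta>\<^sup>2" by (simp add: power2_eq_square)
  finally show ?thesis using assms(3) by (rule power2_le_imp_le)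
qed

lemma integral_periodic_shift:
  fixes g :: "real \<Rightarrow> complex"
  assumes g: "continuous_on UNIV g" and per: "\<And>t. g (t + 2 * pi) = g t"
  shows "integral {0..2 * pi} (\<lambda>t. g (t + a)) = integral {0..2 * pi} g"
proof -
  have int: "g integrable_on {u..v}" for u v
    by (intro integrable_continuous_real continuous_on_subset[OF g]) auto
  have *: "integral {0..2 * pi} (\<lambda>t. g (t + a)) = integral {0..2 * pi} g" if a: "a \<ge> 0" for a
  proof -
    have "integral {0..2 * pi} (\<lambda>t. g (t + a)) = integral {a..2 * pi + a} g"
      using integral_shift_real_ivl[of a a "2 * pi + a" g] by simp
    moreover have "integral {0..a} g + integral {a..2 * pi + a} g = integral {0..2 * pi + a} g"
      using a by (intro Henstock_Kurzweil_Integration.integral_combine int) auto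
    moreover have "integral {0..2 * pi} g + integral {2 * pi..2 * pi + a} g = integral {0..2 * pi + a} g"
      using a by (intro Henstock_Kurzweil_Integration.integral_combine int) auto
    moreover have "integral {2 * pi..2 * pi + a} g = integral {0..a} g"
      using integral_shift_real_ivl[of "2 * pi" "2 * pi" "2 * pi + a" g] per by (simp add: add.commute)
    ultimately have "integral {0..a} g + integral {a..2 * pi + a} g = integral {0..a} g + integral {0..2 * pi} g"
      by (simp add: add.commute)
    then show ?thesis using \<open>integral {0..2 * pi} (\<lambda>t. g (t + a)) = _\<close> by simp
  qed
  define n where "n = \<lfloor>a / (2 * pi)\<rfloor>"
  have "of_int n \<le> a / (2 * pi)" unfolding n_def by linarith
  then have "a + 2 * pi * of_int (- n) \<ge> 0" by (simp add: field_simps)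
  from *[OF this] have "integral {0..2 * pi} (\<lambda>t. g (t + a + 2 * pi * of_int (- n))) = integral {0..2 * pi} g"
    by (simp add: add_diff_eq)
  then show ?thesis using periodic_int[of g _ "- n", OF per] by simp
qed

text \<open>Translating the bump multiplies its coefficients by phases. Paired with a distribution,
  the translates therefore give a Fourier series in the translation parameter.\<close>

lemma fhat_bump_shift: "fhat (bump \<alpha> c) n = cis (- (of_int n * \<alpha>)) * fhat (bump 0 c) n"
proof -
  let ?g = "\<lambda>t. bump \<alpha> c (cis t) * cis (- (of_int n * t))"
  have c: "continuous_on UNIV (\<lambda>t. bump \<alpha> c (cis t))"
    using smooth_continuous[OF bump_smooth, of UNIV 0 \<alpha> c] by (simp add: angle_deriv_0[abs_def])
  have "cis (- (of_int n * (t + 2 * pi))) = cis (- (of_int n * t))" for t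
    using cis_periodic(2)[of "- (of_int n * t)" "- n"] by (simp add: algebra_simps)
  then have "integral {0..2 * pi} (\<lambda>t. ?g (t + \<alpha>)) = integral {0..2 * pi} ?g"
    by (intro integral_periodic_shift continuous_intros c) (simp add: cis_periodic)
  moreover have "?g (t + \<alpha>) = cis (- (of_int n * \<alpha>)) * (bump 0 c (cis t) * cis (- (of_int n * t)))" for t
    by (simp add: bump_shift[of \<alpha>] cis_mult algebra_simps)
  ultimately have "integral {0..2 * pi} ?g = cis (- (of_int n * \<alpha>)) * integral {0..2 * pi} (\<lambda>t. bump 0 c (cis t) * cis (- (of_int n * t)))"
    by simp
  then show ?thesis by (simp add: fhat_def fourier_def)
qed

text \<open>Where the bump is nonzero, |t| < \<delta> modulo 2\<pi>, and |n|\<delta> < \<pi>/2 keeps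
  cos(nt) nonnegative there. The coefficient could vanish only if the integrand vanished throughout
  the period, but it is positive at t = 0.\<close>

lemma fhat_bump_nonzero:
  assumes \<delta>: "0 < \<delta>" "\<delta> < pi / 2" "\<bar>of_int n\<bar> * \<delta> < pi / 2"
  shows "fhat (bump 0 (cos \<delta>)) n \<noteq> 0"
proof
  assume z: "fhat (bump 0 (cos \<delta>)) n = 0"
  let ?g = "\<lambda>t. bump_germ 0 (cos t - cos \<delta>) * cos (of_int n * t)"
  have cb: "continuous_on A (bump_germ 0)" for A
    by (meson DERIV_isCont bump_germ_deriv continuous_at_imp_continuous_on)
  have c: "continuous_on {0..2*pi} (\<lambda>t. bump_germ 0 (cos t - cos \<delta>))"
    by (rule continuous_on_compose2[OF cb[of UNIV]]) (auto intro!: continuous_intros)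
  then have c1: "continuous_on {0..2*pi} ?g" by (intro continuous_intros)
  have i: "(\<lambda>t. bump 0 (cos \<delta>) (cis t) * cis (- (of_int n * t))) integrable_on {0..2*pi}"
    unfolding bump_cis by (intro integrable_continuous_real continuous_intros) (use c in simp)
  have "integral {0..2*pi} (\<lambda>t. bump 0 (cos \<delta>) (cis t) * cis (- (of_int n * t))) = 0"
    using z by (simp add: fhat_def fourier_def)
  then have "integral {0..2*pi} (Re \<circ> (\<lambda>t. bump 0 (cos \<delta>) (cis t) * cis (- (of_int n * t)))) = 0"
    using integral_linear[OF i bounded_linear_Re] by simp
  then have "integral {0..2*pi} ?g = 0" by (simp add: o_def bump_cis)
  moreover have nn: "?g t \<ge> 0" for t
  proof (cases "cos t > cos \<delta>")
    case True
    define s where "s = arccos (cos t)"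
    have s: "0 \<le> s" "s \<le> pi" "cos s = cos t"
      using arccos_lbound[of "cos t"] arccos_ubound[of "cos t"] cos_arccos[of "cos t"] by (auto simp: s_def)
    have "s < \<delta>"
    proof (rule ccontr)
      assume "\<not> s < \<delta>"
      then have "cos s \<le> cos \<delta>" using s \<delta> by (intro cos_monotone_0_pi_le) auto
      then show False using True s by simp
    qed
    obtain m :: int where "t = s + 2 * m * pi \<or> t = - s + 2 * m * pi"
      using s(3) cos_eq[of t s] by (auto elim!: Ints_cases)
    then have "cos (of_int n * t) = cos (of_int n * s)"
    proof
      assume "t = s + 2 * m * pi"
      then have "of_int n * t = of_int n * s + 2 * pi * of_int (n * m)"
        by (simp only:) (simp add: algebra_simps)
      then have "cos (of_int n * t) = Re (cis (of_int n * s + 2 * pi * of_int (n * m)))" by simp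
      then show ?thesis by (simp only: cis_periodic) simp
    next
      assume "t = - s + 2 * m * pi"
      then have "of_int n * t = - of_int n * s + 2 * pi * of_int (n * m)"
        by (simp only:) (simp add: algebra_simps)
      then have "cos (of_int n * t) = Re (cis (- of_int n * s + 2 * pi * of_int (n * m)))" by simp
      then show ?thesis by (simp only: cis_periodic) simp
    qed
    moreover have "\<bar>of_int n * s\<bar> \<le> \<bar>of_int n\<bar> * \<delta>"
      using s \<open>s < \<delta>\<close> by (simp add: abs_mult mult_left_mono)
    then have "cos (of_int n * s) \<ge> 0" using \<delta> by (intro cos_ge_zero) linarith+
    ultimately show ?thesis by (simp add: bump_germ_def)
  qed (simp add: bump_germ_def)
  ultimately have "\<forall>t\<in>{0..2*pi}. ?g t = 0"
    by (subst (asm) integral_eq_0_iff[OF c1 _ nn]) simp_all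
  then have "?g 0 = 0" by (rule bspec) simp
  moreover have "cos \<delta> < 1" using \<delta> cos_monotone_0_pi[of 0 \<delta>] by auto
  ultimately show False by (simp add: bump_germ_def)
qed

text \<open>The series need not continue past the unit circle, so the identity theorem cannot be
  applied on the arc. Instead, k rotated copies of the arc cover the circle: the product of the k
  rotated series vanishes on the whole circle, hence in the disk by the maximum modulus principle,
  whereas a series with a nonzero coefficient has no zeros in a small punctured disk around
  0.\<close>

lemma power_series_vanishing_on_arc:
  fixes a :: "nat \<Rightarrow> complex"
  assumes sm: "summable (\<lambda>m. cmod (a m))" and "s0 > 0"
    and z: "\<And>s. \<bar>s\<bar> < s0 \<Longrightarrow> (\<Sum>m. a m * cis s ^ m) = 0"
  shows "a m = 0"
proof -
  define P where "P w = (\<Sum>m. a m * w ^ m)" for w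
  have le: "cmod (a m * w ^ m) \<le> cmod (a m)" if "w \<in> cball 0 1" for w m
    using that by (simp add: norm_mult norm_power mult_left_le power_le_one)
  have sums: "(\<lambda>m. a m * w ^ m) sums P w" if "w \<in> cball 0 1" for w
    unfolding P_def using le[OF that] summable_comparison_test'[OF sm, of 0 "\<lambda>m. a m * w ^ m"]
    by (intro summable_sums) blast
  have "uniform_limit (cball 0 1) (\<lambda>n w. \<Sum>m<n. a m * w ^ m) (\<lambda>w. \<Sum>m. a m * w ^ m) sequentially"
    by (rule Weierstrass_m_test[OF le sm])
  then have contP: "continuous_on (cball 0 1) P"
    unfolding P_def[abs_def] by (rule uniform_limit_theorem[rotated]) (auto intro!: always_eventually continuous_intros)
  have "P holomorphic_on ball 0 1"
    using sums by (intro power_series_holomorphic[of 0 1 a]) auto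
  obtain k :: nat where k: "real k > 2 * pi / s0" using reals_Archimedean2 by blast
  have "2 * pi / s0 > 0" using \<open>s0 > 0\<close> by simp
  with k have k0: "k > 0" by (intro gr0I) auto
  define \<omega> where "\<omega> j = cis (2 * pi * real j / real k)" for j
  define Q where "Q w = (\<Prod>j<k. P (\<omega> j * w))" for w
  have \<omega>: "cmod (\<omega> j) = 1" for j by (simp add: \<omega>_def)
  have Q0: "Q w = 0" if w: "cmod w = 1" for w
  proof -
    define t where "t = Arg w"
    have wt: "w = cis t" using cis_Arg_circle[of w] w by (simp add: t_def)
    \<comment> \<open>The rotation index that carries w into the part 0 \<le> s < 2\<pi>/k of the
      arc; j is the same index modulo k.\<close>
    define i where "i = - \<lfloor>t * k / (2 * pi)\<rfloor>"
    define j where "j = nat (i mod int k)"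
    have j: "j < k" using k0 by (simp add: j_def nat_less_iff)
    have "of_int i + t * k / (2 * pi) \<ge> 0" "of_int i + t * k / (2 * pi) < 1" unfolding i_def by linarith+
    then have s: "0 \<le> 2 * pi * of_int i / k + t" "2 * pi * of_int i / k + t < 2 * pi / k"
    proof -
      have eq: "2 * pi * of_int i / k + t = (2 * pi) * (of_int i + t * k / (2 * pi)) / k"
        using k0 by (simp add: field_simps)
      show "0 \<le> 2 * pi * of_int i / k + t"
        unfolding eq using \<open>of_int i + t * k / (2 * pi) \<ge> 0\<close> by simp
      have "(2 * pi) * (of_int i + t * k / (2 * pi)) < 2 * pi * 1"
        using \<open>of_int i + t * k / (2 * pi) < 1\<close> by (intro mult_strict_left_mono) auto
      then show "2 * pi * of_int i / k + t < 2 * pi / k"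
        unfolding eq using k0 by (intro divide_strict_right_mono) auto
    qed
    have "2 * pi / k < s0" using k k0 \<open>s0 > 0\<close> by (simp add: field_simps)
    have ieq: "i = int j + int k * (i div int k)" using k0 by (simp add: j_def)
    have "real_of_int i / k = real j / k + of_int (i div int k)"
    proof -
      have "real_of_int i = real j + real k * of_int (i div int k)"
        using arg_cong[OF ieq, of real_of_int] by (simp only: of_int_add of_int_mult of_int_of_nat_eq)
      then show ?thesis using k0 by (simp add: field_simps)
    qed
    then have "2 * pi * (real_of_int i / k) + t = (2 * pi * (real j / k) + t) + 2 * pi * of_int (i div int k)"
      by (simp only:) (simp add: algebra_simps)
    then have "2 * pi * of_int i / k + t = (2 * pi * real j / k + t) + 2 * pi * of_int (i div int k)"
      by (simp only: times_divide_eq_right)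
    then have "\<omega> j * w = cis (2 * pi * of_int i / k + t)"
      unfolding \<omega>_def wt cis_mult by (simp only: cis_periodic)
    then have "P (\<omega> j * w) = 0"
      unfolding P_def using s \<open>2 * pi / k < s0\<close> by (simp only:) (rule z, linarith)
    then show ?thesis unfolding Q_def using j by (intro prod_zero) auto
  qed
  have Qz: "Q w = 0" if "w \<in> ball 0 1" for w
  proof -
    have "cmod (Q w) \<le> 0"
    proof (rule maximum_modulus_frontier[of Q "ball 0 1"])
      have "(\<lambda>w. P (\<omega> j * w)) holomorphic_on ball 0 1" for j
        by (rule holomorphic_on_compose_gen[of "\<lambda>w. \<omega> j * w" _ P "ball 0 1", unfolded o_def])
          (auto intro!: holomorphic_intros \<open>P holomorphic_on ball 0 1\<close> simp: norm_mult \<omega>)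
      then show "Q holomorphic_on interior (ball 0 1)" unfolding Q_def[abs_def] by (simp add: holomorphic_on_prod)
      have "continuous_on (cball 0 1) (\<lambda>w. P (\<omega> j * w))" for j
        by (rule continuous_on_compose2[OF contP]) (auto intro!: continuous_intros simp: norm_mult \<omega>)
      then show "continuous_on (closure (ball 0 1)) Q" unfolding Q_def[abs_def] by (auto intro!: continuous_on_prod)
    qed (use that Q0 in auto)
    then show ?thesis by simp
  qed
  show ?thesis
  proof (rule ccontr)
    assume am: "a m \<noteq> 0"
    \<comment> \<open>The extra factor w makes the function vanish at 0, so that the lemma on
      isolated zeros applies whatever \<open>a 0\<close> is; the coefficients move up by
      one.\<close>
    obtain r where r: "0 < r" "\<And>w. w \<in> cball 0 r - {0} \<Longrightarrow> w * P w \<noteq> 0"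
    proof (rule powser_0_nonzero[where r = 1 and a = "\<lambda>n. if n = 0 then 0 else a (n - 1)"
          and \<xi> = 0 and f = "\<lambda>w. w * P w" and m = "Suc m"])
      fix w :: complex assume "cmod (w - 0) < 1"
      then have "(\<lambda>n. w * (a n * w ^ n)) sums (w * P w)" by (intro sums_mult sums) auto
      then have "(\<lambda>n. (if Suc n = 0 then 0 else a (Suc n - 1)) * w ^ Suc n) sums (w * P w)"
        by (simp add: mult.left_commute)
      from sums_Suc[OF this] show "(\<lambda>n. (if n = 0 then 0 else a (n - 1)) * (w - 0) ^ n) sums (w * P w)" by simp
    qed (use am that in auto)
    define w where "w = complex_of_real (min r (1/2))"
    have w: "cmod w = min r (1/2)" "w \<noteq> 0" using r(1) by (auto simp: w_def)
    have "\<omega> j \<noteq> 0" for j by (simp add: \<omega>_def)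
    then have "P (\<omega> j * w) \<noteq> 0" for j
      using r(2)[of "\<omega> j * w"] w \<omega>[of j] by (auto simp: norm_mult)
    then have "Q w \<noteq> 0" unfolding Q_def by simp
    moreover have "Q w = 0" using w by (intro Qz) auto
    ultimately show False by simp
  qed
qed

text \<open>Applied to the translates by s of a bump inside I, the distribution becomes, up to a
  phase, a power series in e^{is}, because the modes above n0 drop out. It vanishes for small s,
  hence all its coefficients vanish, and since the n-th coefficient of the bump is nonzero, T(z^n) =
  0. This is the analytic core of the Reeh-Schlieder property.\<close>

theorem distribution_vanishing_on_arc:
  assumes T: "distribution T" and n0: "\<And>n. n > n0 \<Longrightarrow> T (trig n) = 0"
    and I: "openin (top_of_set S\<^sup>1) I" "I \<noteq> {}"
    and z: "\<And>f. f \<in> C\<^sup>\<infinity> \<Longrightarrow> supp f \<subseteq> I \<Longrightarrow> T f = 0"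
    and f: "f \<in> C\<^sup>\<infinity>"
  shows "T f = 0"
proof -
  obtain z0 where z0: "z0 \<in> I" using I(2) by blast
  then have "z0 \<in> S\<^sup>1" using I(1) openin_subset by fastforce
  define \<alpha> where "\<alpha> = Arg z0"
  have za: "z0 = cis \<alpha>" using cis_Arg_circle[OF \<open>z0 \<in> S\<^sup>1\<close>] by (simp add: \<alpha>_def)
  obtain e where e: "e > 0" "\<And>w. w \<in> S\<^sup>1 \<Longrightarrow> dist w z0 < e \<Longrightarrow> w \<in> I"
    using I(1) z0 unfolding openin_euclidean_subtopology_iff by blast
  define p where "p = nat n0"
  have p: "T (trig n) = 0" if "n > int p" for n
  proof (rule n0)
    show "n > n0" using that by (simp add: p_def split: if_splits)
  qed
  obtain C N where C: "\<And>f. f \<in> C\<^sup>\<infinity> \<Longrightarrow> cmod (T f) \<le> C * CN_norm N f"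
    using T unfolding distribution_def by blast
  have "T (trig n) = 0" for n
  proof (cases "n > int p")
    case False
    \<comment> \<open>A radius of at most e/4 and translations by less than e/4 keep the bump inside
      I; the second bound makes its n-th Fourier coefficient nonzero.\<close>
    define \<delta> where "\<delta> = min (e / 4) (1 / (1 + \<bar>of_int n\<bar>))"
    have \<delta>: "0 < \<delta>" "\<delta> \<le> e / 4" "\<delta> \<le> 1 / (1 + \<bar>of_int n\<bar>)" using e(1) by (auto simp: \<delta>_def)
    have "1 / (1 + \<bar>of_int n\<bar>) \<le> (1::real)" by (simp add: field_simps)
    then have d1: "\<delta> < pi / 2" using \<delta>(3) pi_gt3 by linarith
    have "\<bar>of_int n\<bar> * \<delta> \<le> \<bar>of_int n\<bar> * (1 / (1 + \<bar>of_int n\<bar>))" using \<delta>(3) by (intro mult_left_mono) auto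
    also have "\<dots> \<le> 1" by (simp add: field_simps)
    finally have d2: "\<bar>of_int n\<bar> * \<delta> < pi / 2" using pi_gt3 by linarith
    define \<rho> where "\<rho> s = bump (\<alpha> + s) (cos \<delta>)" for s
    define b where "b k = fhat (\<rho> 0) k * T (trig k)" for k
    have T0: "T (\<rho> s) = 0" if s: "\<bar>s\<bar> < e / 4" for s
    proof (rule z)
      show "\<rho> s \<in> C\<^sup>\<infinity>" unfolding \<rho>_def by (rule bump_smooth)
      show "supp (\<rho> s) \<subseteq> I"
      proof
        fix w assume "w \<in> supp (\<rho> s)"
        then have w: "w \<in> S\<^sup>1" "cos \<delta> \<le> Re (w * cis (- (\<alpha> + s)))"
          using supp_bump unfolding \<rho>_def by blast+
        have "cmod (w - cis (\<alpha> + s)) \<le> \<delta>" using bump_near[OF w] \<delta> by simp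
        moreover have "cmod (cis (\<alpha> + s) - cis \<alpha>) \<le> \<bar>s\<bar>"
        proof -
          have "cmod (cis (\<alpha> + s) - cis \<alpha>) = cmod (cis \<alpha> * (cis s - cis 0))" by (simp add: cis_mult algebra_simps)
          also have "\<dots> = cmod (cis s - cis 0)" by (simp add: norm_mult)
          also have "\<dots> \<le> \<bar>s\<bar>"
            using bump_near[of "cis s" "\<bar>s\<bar>" 0] by simp
          finally show ?thesis .
        qed
        moreover have "cmod (w - z0) \<le> cmod (w - cis (\<alpha> + s)) + cmod (cis (\<alpha> + s) - cis \<alpha>)"
          unfolding za using norm_triangle_ineq[of "w - cis (\<alpha> + s)" "cis (\<alpha> + s) - cis \<alpha>"] by simp
        ultimately show "w \<in> I" using e w s \<delta> by (auto simp: dist_norm)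
      qed
    qed
    have fh: "fhat (\<rho> s) k = cis (- (of_int k * s)) * fhat (\<rho> 0) k" for s k
      unfolding \<rho>_def by (subst (1 2) fhat_bump_shift) (simp add: cis_mult algebra_simps)
    have b0: "b k = 0" if "k > int p" for k using p[OF that] by (simp add: b_def)
    \<comment> \<open>The coefficients of the bump decay to order N + 2, T grows to order N on
      characters, and a summable quadratic decay remains.\<close>
    define B where "B = 2 ^ (N + 2) * CN_norm (N + 2) (\<rho> 0) * (\<bar>C\<bar> * (1 + real N))"
    have bb: "cmod (b k) \<le> B / (1 + \<bar>of_int k\<bar>) ^ 2" for k
    proof -
      have "cmod (T (trig k)) \<le> \<bar>C\<bar> * ((1 + real N) * (1 + \<bar>of_int k\<bar>) ^ N)"
        using C[OF trig_smooth(1), of k] CN_norm_trig[of N k] CN_norm_nonneg[OF trig_smooth(1), of N k]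
        by (intro order_trans[OF C[OF trig_smooth(1)]] mult_mono) auto
      then have "cmod (b k) \<le> (2 ^ (N + 2) * CN_norm (N + 2) (\<rho> 0) / (1 + \<bar>of_int k\<bar>) ^ (N + 2)) *
          (\<bar>C\<bar> * ((1 + real N) * (1 + \<bar>of_int k\<bar>) ^ N))"
        unfolding b_def norm_mult using fhat_decay[OF bump_smooth, of "\<alpha> + 0" "cos \<delta>" k "N + 2"]
        unfolding \<rho>_def by (rule mult_mono'[OF _ _ norm_ge_zero norm_ge_zero, rotated])
      also have "\<dots> = B / (1 + \<bar>of_int k\<bar>) ^ 2"
        by (simp add: B_def power_add power2_eq_square mult_ac)
      finally show ?thesis .
    qed
    have B: "B \<ge> 0" using order_trans[OF norm_ge_zero bb[of 0]] by simp
    \<comment> \<open>Counting modes downwards from p turns the one-sided Fourier series into a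
      power series in e^{is}, up to the phase e^{-ips}.\<close>
    define a where "a m = b (int p - int m)" for m
    have sum_eq: "(\<Sum>k\<in>{- int K..int K}. fhat (\<rho> s) k * T (trig k)) = cis (- (real p * s)) * (\<Sum>m<K + p + 1. a m * cis s ^ m)"
      if "K \<ge> p" for K s
    proof -
      have "(\<Sum>k\<in>{- int K..int K}. fhat (\<rho> s) k * T (trig k)) = (\<Sum>k\<in>{- int K..int K}. cis (- (of_int k * s)) * b k)"
        by (simp only: fh[of s] b_def mult.assoc)
      also have "\<dots> = (\<Sum>k\<in>{- int K..int p}. cis (- (of_int k * s)) * b k)"
        by (rule sum.mono_neutral_right) (use that b0 in auto)
      also have "\<dots> = (\<Sum>m<K + p + 1. cis (- (of_int (int p - int m) * s)) * b (int p - int m))"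
        by (rule sum.reindex_bij_witness[of _ "\<lambda>m. int p - int m" "\<lambda>k. nat (int p - k)"])
          (simp_all, linarith)
      also have "\<dots> = (\<Sum>m<K + p + 1. cis (- (real p * s)) * (a m * cis s ^ m))"
      proof (rule sum.cong)
        fix m
        have "cis (- (of_int (int p - int m) * s)) = cis (- (real p * s)) * cis s ^ m"
          by (simp add: Complex.DeMoivre cis_mult left_diff_distrib)
        then show "cis (- (of_int (int p - int m) * s)) * b (int p - int m) = cis (- (real p * s)) * (a m * cis s ^ m)"
          by (simp only: a_def mult_ac)
      qed simp
      finally show ?thesis by (simp only: sum_distrib_left)
    qed
    have sma: "summable (\<lambda>m. cmod (a m))"
    proof (rule summable_comparison_test_ev)
      show "\<forall>\<^sub>F m in sequentially. norm (cmod (a m)) \<le> 4 * B * inverse (real m ^ 2)"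
        using eventually_ge_at_top[of "2 * p + 1"]
      proof eventually_elim
        case (elim m)
        have "real m / 2 \<le> 1 + \<bar>of_int (int p - int m)\<bar>" using elim by linarith
        then have "(real m / 2) ^ 2 \<le> (1 + \<bar>of_int (int p - int m)\<bar>) ^ 2" by (intro power_mono) auto
        then have "B / (1 + \<bar>of_int (int p - int m)\<bar>) ^ 2 \<le> B / (real m / 2) ^ 2"
          by (intro divide_left_mono B mult_pos_pos zero_less_power) (use elim in linarith)+
        with bb[of "int p - int m"] have "cmod (a m) \<le> B / (real m / 2) ^ 2"
          unfolding a_def by (rule order_trans)
        also have "\<dots> = 4 * B * inverse (real m ^ 2)" by (simp add: power_divide inverse_eq_divide)
        finally show ?case by (simp only: real_norm_def abs_norm_cancel)
      qed
      show "summable (\<lambda>m. 4 * B * inverse (real m ^ 2))"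
        by (intro summable_mult inverse_power_summable) simp
    qed
    have "a m = 0" for m
    proof (rule power_series_vanishing_on_arc[OF sma, of "e / 4"])
      fix s assume s: "\<bar>s\<bar> < e / 4"
      have sm: "summable (\<lambda>m. a m * cis s ^ m)"
        by (rule summable_norm_cancel) (use sma in \<open>simp add: norm_mult norm_power\<close>)
      have "(\<lambda>K. \<Sum>m<K + p + 1. a m * cis s ^ m) \<longlonglongrightarrow> (\<Sum>m. a m * cis s ^ m)"
        using LIMSEQ_ignore_initial_segment[OF summable_LIMSEQ[OF sm], of "p + 1"] by (simp add: add.assoc)
      then have "(\<lambda>K. cis (- (real p * s)) * (\<Sum>m<K + p + 1. a m * cis s ^ m)) \<longlonglongrightarrow> cis (- (real p * s)) * (\<Sum>m. a m * cis s ^ m)"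
        by (intro tendsto_intros)
      then have "(\<lambda>K. \<Sum>k\<in>{- int K..int K}. fhat (\<rho> s) k * T (trig k)) \<longlonglongrightarrow> cis (- (real p * s)) * (\<Sum>m. a m * cis s ^ m)"
        by (rule Lim_transform_eventually) (rule eventually_sequentiallyI[of p], rule sum_eq[symmetric])
      moreover have "(\<lambda>K. \<Sum>k\<in>{- int K..int K}. fhat (\<rho> s) k * T (trig k)) \<longlonglongrightarrow> T (\<rho> s)"
        by (rule distribution_fourier[OF T]) (simp add: \<rho>_def bump_smooth)
      ultimately show "(\<Sum>m. a m * cis s ^ m) = 0"
        using T0[OF s] LIMSEQ_unique by fastforce
    qed (use e in auto)
    from this[of "nat (int p - n)"] False have "b n = 0" by (simp add: a_def)
    moreover have "fhat (\<rho> 0) n \<noteq> 0"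
      unfolding \<rho>_def by (subst fhat_bump_shift) (use fhat_bump_nonzero[OF \<delta>(1) d1 d2] in simp)
    ultimately show ?thesis by (simp add: b_def)
  next
    case True
    then show ?thesis by (rule p)
  qed
  then have "(\<lambda>K::nat. 0) \<longlonglongrightarrow> T f" using distribution_fourier[OF T f] by simp
  then show ?thesis by (simp add: LIMSEQ_const_iff)
qed

section \<open>Moebius transformations and their action on test functions\<close>

definition su11 :: "complex \<Rightarrow> complex \<Rightarrow> bool" where
  "su11 a b \<longleftrightarrow> (cmod a)\<^sup>2 - (cmod b)\<^sup>2 = 1"

lemma su11_alt: "su11 a b \<longleftrightarrow> a * cnj a - b * cnj b = 1"
proof -
  have "a * cnj a - b * cnj b = of_real ((cmod a)\<^sup>2 - (cmod b)\<^sup>2)"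
    by (simp only: complex_norm_square of_real_diff)
  then show ?thesis unfolding su11_def by (metis of_real_1 of_real_eq_iff)
qed

lemma Mob_iff: "\<gamma> \<in> Mob \<longleftrightarrow> (\<exists>a b. su11 a b \<and> \<gamma> = su11_action a b)"
  unfolding Mob_def su11_def by auto

lemma su11_less: "su11 a b \<Longrightarrow> cmod b < cmod a"
  unfolding su11_def by (rule power_less_imp_less_base[of _ 2]) auto

lemma su11_denom: "su11 a b \<Longrightarrow> cmod z \<le> 1 \<Longrightarrow> cnj b * z + cnj a \<noteq> 0"
proof
  assume *: "su11 a b" "cmod z \<le> 1" "cnj b * z + cnj a = 0"
  then have "cmod (cnj a) = cmod (cnj b * z)" by (metis add_eq_0_iff2 norm_minus_cancel)
  also have "\<dots> \<le> cmod b * 1" unfolding norm_mult complex_mod_cnj by (intro mult_left_mono * norm_ge_zero)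
  finally show False using su11_less[OF *(1)] by simp
qed

lemma su11_uminus: "su11 a b \<Longrightarrow> su11 (cnj a) (- b)"
  by (simp add: su11_def)

lemma su11_denom': "su11 a b \<Longrightarrow> cmod z \<le> 1 \<Longrightarrow> a - cnj b * z \<noteq> 0"
  using su11_denom[OF su11_uminus, of a b z] by (simp add: algebra_simps)

text \<open>The matrix preserves the Hermitian form of signature (1,1); applied to the vector (z, 1)
  this gives the invariance of the disk and of the circle at once.\<close>

lemma su11_norm_diff:
  assumes "su11 a b"
  shows "(cmod (a * z + b))\<^sup>2 - (cmod (cnj b * z + cnj a))\<^sup>2 = (cmod z)\<^sup>2 - 1"
proof -
  have "complex_of_real ((cmod (a * z + b))\<^sup>2 - (cmod (cnj b * z + cnj a))\<^sup>2)
     = (a * z + b) * cnj (a * z + b) - (cnj b * z + cnj a) * cnj (cnj b * z + cnj a)"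
    by (simp only: complex_norm_square of_real_diff)
  also have "\<dots> = (a * cnj a - b * cnj b) * (z * cnj z - 1)" by (simp add: algebra_simps)
  also have "\<dots> = complex_of_real ((cmod z)\<^sup>2 - 1)"
    using assms unfolding su11_alt by (simp add: complex_norm_square[symmetric])
  finally show ?thesis by (metis of_real_eq_iff)
qed

lemma su11_action_norm:
  assumes "su11 a b"
  shows "cmod (su11_action a b z) \<le> 1 \<longleftrightarrow> cmod z \<le> 1"
    and "cmod (su11_action a b z) = 1 \<longleftrightarrow> cmod z = 1"
proof -
  have "(cmod (su11_action a b z) \<le> 1 \<longleftrightarrow> cmod z \<le> 1) \<and> (cmod (su11_action a b z) = 1 \<longleftrightarrow> cmod z = 1)"
  proof (cases "cmod z \<le> 1")
    case True
    have n: "cmod (su11_action a b z) = cmod (a * z + b) / cmod (cnj b * z + cnj a)"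
      using True by (simp add: su11_action_def norm_divide)
    have pos: "cmod (cnj b * z + cnj a) > 0" using su11_denom[OF assms True] by simp
    have sq: "(cmod z)\<^sup>2 \<le> 1" "(cmod z)\<^sup>2 = 1 \<longleftrightarrow> cmod z = 1"
      using True by (auto simp: power_le_one power2_eq_1_iff) (metis norm_ge_zero neg_0_le_iff_le not_one_le_zero)
    have "cmod (a * z + b) \<le> cmod (cnj b * z + cnj a)"
      using su11_norm_diff[OF assms, of z] sq by (intro power2_le_imp_le[OF _ norm_ge_zero]) linarith
    moreover have "cmod (a * z + b) = cmod (cnj b * z + cnj a) \<longleftrightarrow> cmod z = 1"
      using su11_norm_diff[OF assms, of z] sq by (metis add_diff_cancel diff_0_right eq_iff_diff_eq_0 norm_ge_zero power2_eq_iff_nonneg)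
    ultimately show ?thesis unfolding n using pos True by (auto simp: divide_le_eq_1)
  qed (auto simp: su11_action_def)
  then show "cmod (su11_action a b z) \<le> 1 \<longleftrightarrow> cmod z \<le> 1"
    and "cmod (su11_action a b z) = 1 \<longleftrightarrow> cmod z = 1" by blast+
qed

lemma su11_comp:
  assumes "su11 a b" "su11 c d"
  shows "su11 (a * c + b * cnj d) (a * d + b * cnj c)"
    and "su11_action a b \<circ> su11_action c d = su11_action (a * c + b * cnj d) (a * d + b * cnj c)"
proof -
  have "(a * c + b * cnj d) * cnj (a * c + b * cnj d) - (a * d + b * cnj c) * cnj (a * d + b * cnj c)
     = (a * cnj a - b * cnj b) * (c * cnj c - d * cnj d)" by (simp add: algebra_simps)
  then show 1: "su11 (a * c + b * cnj d) (a * d + b * cnj c)"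
    using assms by (simp add: su11_alt)
  show "su11_action a b \<circ> su11_action c d = su11_action (a * c + b * cnj d) (a * d + b * cnj c)"
  proof
    fix z
    show "(su11_action a b \<circ> su11_action c d) z = su11_action (a * c + b * cnj d) (a * d + b * cnj c) z"
    proof (cases "cmod z \<le> 1")
      case True
      define D where "D = cnj d * z + cnj c"
      have D: "D \<noteq> 0" using su11_denom[OF assms(2) True] by (simp add: D_def)
      have w: "su11_action c d z = (c * z + d) / D" using True by (simp add: su11_action_def D_def)
      have "(su11_action a b \<circ> su11_action c d) z
          = (a * ((c * z + d) / D) + b) / (cnj b * ((c * z + d) / D) + cnj a)"
        using su11_action_norm(1)[OF assms(2), of z] True w by (simp add: su11_action_def[of a b])
      also have "\<dots> = ((a * (c * z + d) + b * D) / D) / ((cnj b * (c * z + d) + cnj a * D) / D)"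
        using D by (simp add: field_simps)
      also have "\<dots> = (a * (c * z + d) + b * D) / (cnj b * (c * z + d) + cnj a * D)" using D by simp
      also have "\<dots> = su11_action (a * c + b * cnj d) (a * d + b * cnj c) z"
        using True by (simp add: su11_action_def D_def algebra_simps)
      finally show ?thesis .
    qed (simp add: su11_action_def)
  qed
qed

lemma su11_action_id: "su11_action 1 0 = id"
  by (auto simp: su11_action_def)

lemma su11_inverse:
  assumes "su11 a b"
  shows "su11_action a b \<circ> su11_action (cnj a) (- b) = id" "su11_action (cnj a) (- b) \<circ> su11_action a b = id"
  using su11_comp(2)[OF assms su11_uminus[OF assms]] su11_comp(2)[OF su11_uminus[OF assms] assms] assms
  by (simp_all add: su11_alt su11_action_id[symmetric] mult.commute)

lemma inv_su11_action: "su11 a b \<Longrightarrow> inv (su11_action a b) = su11_action (cnj a) (- b)"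
  using su11_inverse by (metis inv_unique_comp)

lemma bij_su11_action: "su11 a b \<Longrightarrow> bij (su11_action a b)"
  using su11_inverse by (metis o_bij)

lemma Mob_comp: "\<gamma> \<in> Mob \<Longrightarrow> \<delta> \<in> Mob \<Longrightarrow> \<gamma> \<circ> \<delta> \<in> Mob"
  unfolding Mob_iff using su11_comp by metis

lemma Mob_inv: "\<gamma> \<in> Mob \<Longrightarrow> inv \<gamma> \<in> Mob"
  unfolding Mob_iff using inv_su11_action su11_uminus by metis

lemma Mob_bij: "\<gamma> \<in> Mob \<Longrightarrow> bij \<gamma>"
  unfolding Mob_iff using bij_su11_action by metis

lemma Mob_circle: "\<gamma> \<in> Mob \<Longrightarrow> \<gamma> z \<in> S\<^sup>1 \<longleftrightarrow> z \<in> S\<^sup>1"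
  unfolding Mob_iff using su11_action_norm(2) by auto

lemma Mob_inv_comp: "\<gamma> \<in> Mob \<Longrightarrow> \<gamma> \<circ> inv \<gamma> = id" "\<gamma> \<in> Mob \<Longrightarrow> inv \<gamma> \<circ> \<gamma> = id"
  using Mob_bij by (auto simp: bij_is_surj surj_iff[symmetric] bij_is_inj inj_iff[symmetric])

lemma rotation_Mob: "rotation t \<in> Mob" and rotation_su11: "rotation t = su11_action (cis (t / 2)) 0" "su11 (cis (t / 2)) 0"
proof -
  show *: "su11 (cis (t / 2)) 0" by (simp add: su11_def)
  have "cis (t / 2) / cis (- (t / 2)) = cis t" by (simp add: cis_divide)
  then show "rotation t = su11_action (cis (t / 2)) 0"
    by (auto simp: rotation_def su11_action_def fun_eq_iff cis_cnj) (metis times_divide_eq_left)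
  with * show "rotation t \<in> Mob" unfolding Mob_iff by blast
qed

lemma Mob_continuous: "\<gamma> \<in> Mob \<Longrightarrow> continuous_on S\<^sup>1 \<gamma>"
proof -
  assume "\<gamma> \<in> Mob"
  then obtain a b where ab: "su11 a b" "\<gamma> = su11_action a b" unfolding Mob_iff by blast
  have "continuous_on S\<^sup>1 (\<lambda>z. (a * z + b) / (cnj b * z + cnj a))"
    by (intro continuous_intros) (use su11_denom[OF ab(1)] in auto)
  then show ?thesis
    by (rule continuous_on_eq) (auto simp: ab su11_action_def)
qed

lemma circle_cnj: "z \<in> S\<^sup>1 \<Longrightarrow> z * cnj z = 1"
  by (simp add: complex_norm_square[symmetric])

lemma su11_cis_deriv:
  assumes "su11 a b"
  shows "((\<lambda>t. (a * cis t + b) / (cnj b * cis t + cnj a)) has_vector_derivative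
     \<i> * cis t / (cnj b * cis t + cnj a)\<^sup>2) (at t)"
proof -
  have d: "cnj b * cis t + cnj a \<noteq> 0" using su11_denom[OF assms, of "cis t"] by simp
  have c: "(cis has_vector_derivative \<i> * cis t) (at t)"
    using cis_has_vector_derivative[of 1 t UNIV] by simp
  have "((\<lambda>z. (a * z + b) / (cnj b * z + cnj a)) has_field_derivative
      (a * (cnj b * cis t + cnj a) - (a * cis t + b) * cnj b) / ((cnj b * cis t + cnj a) * (cnj b * cis t + cnj a))) (at (cis t))"
    by (auto intro!: derivative_eq_intros simp: d)
  also have "a * (cnj b * cis t + cnj a) - (a * cis t + b) * cnj b = 1"
    using assms by (simp add: su11_alt algebra_simps)
  finally have "((\<lambda>z. (a * z + b) / (cnj b * z + cnj a)) has_field_derivative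
     1 / ((cnj b * cis t + cnj a) * (cnj b * cis t + cnj a))) (at (cis t))" .
  from field_vector_diff_chain_at[OF c this] show ?thesis
    by (simp add: o_def power2_eq_square)
qed

lemma angular_speed_su11:
  assumes ab: "su11 a b" and z: "z \<in> S\<^sup>1"
  shows "X\<^bsub>su11_action a b\<^esub> z = 1 / ((cnj b * z + cnj a) * cnj (cnj b * z + cnj a))"
proof -
  define D where "D = cnj b * z + cnj a"
  have D: "D \<noteq> 0" using su11_denom[OF ab, of z] z by (simp add: D_def)
  have z1: "z * cnj z = 1" by (rule circle_cnj[OF z])
  then have z0: "z \<noteq> 0" by auto
  have cz: "cis (Arg z) = z" by (rule cis_Arg_circle[OF z])
  have "vector_derivative (\<lambda>t. su11_action a b (cis t)) (at (Arg z)) = \<i> * z / D\<^sup>2"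
    using vector_derivative_at[OF su11_cis_deriv[OF ab, of "Arg z"]]
    by (simp add: su11_action_def cz D_def)
  moreover have "a * z + b = z * cnj D"
    using z1 by (simp add: algebra_simps D_def)
  then have "su11_action a b z = (z * cnj D) / D" using z by (simp add: su11_action_def D_def)
  moreover have "- \<i> * ((\<i> * z / D\<^sup>2) / ((z * cnj D) / D)) = 1 / (D * cnj D)"
    using D z0 by (simp add: field_simps power2_eq_square)
  ultimately show ?thesis unfolding angular_speed_def D_def by simp
qed

text \<open>The angular speed of \<gamma> at \<gamma>^{-1}(z), equal to the square of |a -
  \<open>cnj b\<close> z|. The product form exhibits it on the circle as a trigonometric polynomial
  with coefficients built from a and b.\<close>

definition pole_factor :: "complex \<Rightarrow> complex \<Rightarrow> complex \<Rightarrow> complex" where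
  "pole_factor a b z = (a - cnj b * z) * cnj (a - cnj b * z)"

lemma beta_su11:
  assumes ab: "su11 a b" and z: "z \<in> S\<^sup>1"
  shows "beta d (su11_action a b) f z = pole_factor a b z powi (int d - 1) * f ((cnj a * z - b) / (a - cnj b * z))"
proof -
  let ?w = "(cnj a * z - b) / (a - cnj b * z)"
  have w: "inv (su11_action a b) z = ?w"
    using z by (simp add: inv_su11_action[OF ab] su11_action_def)
  have wc: "?w \<in> S\<^sup>1"
    using su11_action_norm(2)[OF su11_uminus[OF ab], of z] z by (simp add: su11_action_def)
  have D: "a - cnj b * z \<noteq> 0" using su11_denom'[OF ab, of z] z by simp
  have "cnj b * ?w + cnj a = (cnj b * (cnj a * z - b) + cnj a * (a - cnj b * z)) / (a - cnj b * z)"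
    using D by (simp add: field_simps)
  also have "cnj b * (cnj a * z - b) + cnj a * (a - cnj b * z) = 1"
    using ab by (simp add: su11_alt algebra_simps)
  finally have "cnj b * ?w + cnj a = 1 / (a - cnj b * z)" .
  then have "X\<^bsub>su11_action a b\<^esub> ?w = pole_factor a b z"
    unfolding angular_speed_su11[OF ab wc] pole_factor_def by simp
  then show ?thesis unfolding beta_def w by simp
qed

lemma beta_off_circle:
  assumes "\<gamma> \<in> Mob" "f \<in> C\<^sup>\<infinity>" "z \<notin> S\<^sup>1"
  shows "beta d \<gamma> f z = 0"
proof -
  have "inv \<gamma> z \<notin> S\<^sup>1" using Mob_circle[OF Mob_inv[OF assms(1)]] assms(3) by blast
  then show ?thesis using smooth_off_circle[OF assms(2)] by (simp add: beta_def)
qed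

lemma Mob_inv_inv: "\<gamma> \<in> Mob \<Longrightarrow> \<gamma> (inv \<gamma> z) = z" "\<gamma> \<in> Mob \<Longrightarrow> inv \<gamma> (\<gamma> z) = z"
  using Mob_inv_comp[of \<gamma>] by (auto simp: fun_eq_iff)

lemma smooth_supp_circle: "f \<in> C\<^sup>\<infinity> \<Longrightarrow> supp f \<subseteq> S\<^sup>1"
  unfolding supp_def by (rule closure_minimal) (auto dest: smooth_off_circle)

lemma supp_beta:
  assumes g: "\<gamma> \<in> Mob" and f: "f \<in> C\<^sup>\<infinity>" and I: "supp f \<subseteq> I"
  shows "supp (beta d \<gamma> f) \<subseteq> \<gamma> ` I"
proof -
  have "compact (supp f)"
    using smooth_supp_circle[OF f] unfolding supp_def
    by (auto simp: compact_eq_bounded_closed intro: bounded_subset[of "S\<^sup>1"])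
  then have "closed (\<gamma> ` supp f)"
    by (intro compact_imp_closed compact_continuous_image
         continuous_on_subset[OF Mob_continuous[OF g] smooth_supp_circle[OF f]])
  moreover have "{z. beta d \<gamma> f z \<noteq> 0} \<subseteq> \<gamma> ` supp f"
  proof
    fix z assume "z \<in> {z. beta d \<gamma> f z \<noteq> 0}"
    then have "f (inv \<gamma> z) \<noteq> 0" by (auto simp: beta_def)
    then have "inv \<gamma> z \<in> supp f" unfolding supp_def by (intro subsetD[OF closure_subset]) simp
    then show "z \<in> \<gamma> ` supp f" by (rule image_eqI[rotated]) (simp add: Mob_inv_inv(1)[OF g])
  qed
  ultimately have "supp (beta d \<gamma> f) \<subseteq> \<gamma> ` supp f"
    unfolding supp_def[of "beta d \<gamma> f"] by (rule closure_minimal[rotated])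
  then show ?thesis using I by blast
qed

section \<open>Seminorm bounds along paths of Moebius transformations\<close>

definition moderate :: "(real \<Rightarrow> real \<Rightarrow> complex) \<Rightarrow> bool" where
  "moderate h \<longleftrightarrow> continuous_on UNIV (\<lambda>(s, t). h s t) \<and>
     (\<exists>C M. 0 \<le> C \<and> 0 \<le> M \<and> (\<forall>s t. cmod (h s t) \<le> C * exp (M * \<bar>s\<bar>)))"

lemma moderateI:
  assumes "continuous_on UNIV (\<lambda>(s, t). h s t)" "\<And>s t. cmod (h s t) \<le> C * exp (M * \<bar>s\<bar>)" "0 \<le> C" "0 \<le> M"
  shows "moderate h"
  using assms unfolding moderate_def by blast

lemma exp_le_larger: "0 \<le> M \<Longrightarrow> M \<le> M' \<Longrightarrow> exp (M * \<bar>s\<bar>) \<le> exp (M' * \<bar>s::real\<bar>)"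
  by (simp add: mult_right_mono)

lemma moderate_add:
  assumes "moderate g" "moderate h" shows "moderate (\<lambda>s t. g s t + h s t)"
proof -
  obtain C M C' M' where g: "0 \<le> C" "0 \<le> M" "\<And>s t. cmod (g s t) \<le> C * exp (M * \<bar>s\<bar>)"
    and h: "0 \<le> C'" "0 \<le> M'" "\<And>s t. cmod (h s t) \<le> C' * exp (M' * \<bar>s\<bar>)"
    using assms unfolding moderate_def by blast
  show ?thesis
  proof (rule moderateI)
    show "continuous_on UNIV (\<lambda>(s, t). g s t + h s t)"
      using assms unfolding moderate_def case_prod_unfold by (intro continuous_on_add) auto
    fix s t
    have "cmod (g s t + h s t) \<le> C * exp (M * \<bar>s\<bar>) + C' * exp (M' * \<bar>s\<bar>)"
      by (intro norm_triangle_mono g h)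
    also have "\<dots> \<le> C * exp ((M + M') * \<bar>s\<bar>) + C' * exp ((M + M') * \<bar>s\<bar>)"
      using g h by (intro add_mono mult_left_mono exp_le_larger) auto
    finally show "cmod (g s t + h s t) \<le> (C + C') * exp ((M + M') * \<bar>s\<bar>)" by (simp add: algebra_simps)
  qed (use g h in auto)
qed

lemma moderate_mult:
  assumes "moderate g" "moderate h" shows "moderate (\<lambda>s t. g s t * h s t)"
proof -
  obtain C M C' M' where g: "0 \<le> C" "0 \<le> M" "\<And>s t. cmod (g s t) \<le> C * exp (M * \<bar>s\<bar>)"
    and h: "0 \<le> C'" "0 \<le> M'" "\<And>s t. cmod (h s t) \<le> C' * exp (M' * \<bar>s\<bar>)"
    using assms unfolding moderate_def by blast
  show ?thesis
  proof (rule moderateI)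
    show "continuous_on UNIV (\<lambda>(s, t). g s t * h s t)"
      using assms unfolding moderate_def case_prod_unfold by (intro continuous_on_mult) auto
    fix s t
    have "cmod (g s t * h s t) \<le> (C * exp (M * \<bar>s\<bar>)) * (C' * exp (M' * \<bar>s\<bar>))"
      unfolding norm_mult using g h by (intro mult_mono) auto
    then show "cmod (g s t * h s t) \<le> (C * C') * exp ((M + M') * \<bar>s\<bar>)" by (simp add: algebra_simps exp_add)
  qed (use g h in auto)
qed

text \<open>A continuous family of exponential growth in SU(1,1); as |b| < |a|, the bound on a
  controls b too. It is used for the dilations and, with constant paths, for single
  transformations.\<close>

locale su11_path =
  fixes a b :: "real \<Rightarrow> complex"
  assumes su11: "su11 (a s) (b s)"
    and cont_a: "continuous_on UNIV a" and cont_b: "continuous_on UNIV b"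
    and growth: "\<exists>C M. 0 \<le> C \<and> 0 \<le> M \<and> (\<forall>s. cmod (a s) \<le> C * exp (M * \<bar>s\<bar>))"
begin

abbreviation \<gamma> :: "real \<Rightarrow> complex \<Rightarrow> complex" where
  "\<gamma> s \<equiv> su11_action (a s) (b s)"

abbreviation m :: "real \<Rightarrow> real \<Rightarrow> complex" where
  "m s t \<equiv> pole_factor (a s) (b s) (cis t)"

definition preimage :: "real \<Rightarrow> real \<Rightarrow> complex" where
  "preimage s t = (cnj (a s) * cis t - b s) / (a s - cnj (b s) * cis t)"

text \<open>An algebra of moderate functions closed under differentiation in t. Differentiating the
  angle of the preimage brings in the inverse of m; m itself is a polynomial in the other
  generators.\<close>

inductive_set coeffs :: "(real \<Rightarrow> real \<Rightarrow> complex) set" where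
  const: "(\<lambda>s t. c) \<in> coeffs"
| cis: "(\<lambda>s t. cis (of_int n * t)) \<in> coeffs"
| a: "(\<lambda>s t. a s) \<in> coeffs"
| b: "(\<lambda>s t. b s) \<in> coeffs"
| cnj_a: "(\<lambda>s t. cnj (a s)) \<in> coeffs"
| cnj_b: "(\<lambda>s t. cnj (b s)) \<in> coeffs"
| inverse_m: "(\<lambda>s t. inverse (m s t)) \<in> coeffs"
| add: "g \<in> coeffs \<Longrightarrow> h \<in> coeffs \<Longrightarrow> (\<lambda>s t. g s t + h s t) \<in> coeffs"
| mult: "g \<in> coeffs \<Longrightarrow> h \<in> coeffs \<Longrightarrow> (\<lambda>s t. g s t * h s t) \<in> coeffs"

lemma denom_nonzero: "a s - cnj (b s) * cis t \<noteq> 0"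
  using su11_denom'[OF su11] by simp

lemma m_nonzero: "m s t \<noteq> 0"
  using denom_nonzero unfolding pole_factor_def by (metis complex_cnj_zero_iff mult_eq_0_iff)

lemma m_eq: "m s t = a s * cnj (a s) + b s * cnj (b s) - a s * b s * cis (- t) - cnj (a s) * cnj (b s) * cis t"
proof -
  have "cis t * cis (- t) = 1" by (simp add: cis_mult)
  then show ?thesis by (simp add: pole_factor_def cis_cnj algebra_simps)
qed

lemma a_moderate: "moderate (\<lambda>s t. a s)"
proof -
  obtain C M where "0 \<le> C" "0 \<le> M" "\<forall>s. cmod (a s) \<le> C * exp (M * \<bar>s\<bar>)" using growth by blast
  then show ?thesis
    by (intro moderateI[of _ C M])
      (auto simp: case_prod_unfold intro!: continuous_on_compose2[OF cont_a] continuous_intros)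
qed

lemma moderate_cong_norm:
  assumes "moderate h" "continuous_on UNIV (\<lambda>(s, t). g s t)" "\<And>s t. cmod (g s t) \<le> cmod (h s t)"
  shows "moderate g"
  using assms unfolding moderate_def by (meson order_trans)

text \<open>From 1 = (|a| - |b|)(|a| + |b|) the inverse of |a - \<open>cnj b\<close> z| is at most
  2|a|, and m is the square of that modulus.\<close>

lemma inverse_m_bound: "cmod (inverse (m s t)) \<le> cmod (4 * (a s * a s))"
proof -
  have "1 = (cmod (a s) - cmod (b s)) * (cmod (a s) + cmod (b s))"
    using su11[of s] by (simp add: su11_def power2_eq_square algebra_simps)
  also have "\<dots> \<le> cmod (a s - cnj (b s) * cis t) * (2 * cmod (a s))"
  proof (rule mult_mono)
    show "cmod (a s) - cmod (b s) \<le> cmod (a s - cnj (b s) * cis t)"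
      using norm_triangle_ineq2[of "a s" "cnj (b s) * cis t"] by (simp add: norm_mult)
  qed (use su11_less[OF su11, of s] in auto)
  finally have "inverse (cmod (a s - cnj (b s) * cis t)) \<le> 2 * cmod (a s)"
    using denom_nonzero[of s t] by (simp add: field_simps)
  then have "inverse (cmod (a s - cnj (b s) * cis t)) * inverse (cmod (a s - cnj (b s) * cis t))
      \<le> (2 * cmod (a s)) * (2 * cmod (a s))"
    by (intro mult_mono) auto
  then show ?thesis unfolding pole_factor_def norm_inverse norm_mult complex_mod_cnj by simp
qed

lemma cis_cont: "continuous_on UNIV (\<lambda>x::real \<times> real. cis (c * snd x))"
  by (intro continuous_intros)

lemma fst_cont: "continuous_on UNIV g \<Longrightarrow> continuous_on UNIV (\<lambda>x::real \<times> real. g (fst x))"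
  by (rule continuous_on_compose2[of UNIV g]) (auto intro!: continuous_intros)

lemma coeffs_moderate: "h \<in> coeffs \<Longrightarrow> moderate h"
proof (induction rule: coeffs.induct)
  case (const c)
  then show ?case by (intro moderateI[of _ "cmod c" 0]) (auto simp: case_prod_unfold)
next
  case (cis n)
  then show ?case by (intro moderateI[of _ 1 0]) (auto simp: case_prod_unfold intro!: cis_cont)
next
  case a
  then show ?case by (rule a_moderate)
next
  case b
  then show ?case
    by (rule moderate_cong_norm[OF a_moderate])
      (use su11_less[OF su11] in \<open>auto simp: case_prod_unfold less_imp_le intro!: fst_cont cont_b\<close>)
next
  case cnj_a
  then show ?case
    by (rule moderate_cong_norm[OF a_moderate])
      (auto simp: case_prod_unfold intro!: fst_cont continuous_on_cnj cont_a)
next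
  case cnj_b
  then show ?case
    by (rule moderate_cong_norm[OF a_moderate])
      (use su11_less[OF su11] in \<open>auto simp: case_prod_unfold less_imp_le intro!: fst_cont continuous_on_cnj cont_b\<close>)
next
  case inverse_m
  have "moderate (\<lambda>s t. 4 * (a s * a s))"
  proof (intro moderate_mult a_moderate)
    show "moderate (\<lambda>s t. 4)" by (intro moderateI[of _ 4 0]) auto
  qed
  moreover have "continuous_on UNIV (\<lambda>(s, t). inverse (m s t))"
    unfolding case_prod_unfold
  proof (rule continuous_on_inverse)
    show "continuous_on UNIV (\<lambda>x. m (fst x) (snd x))"
      unfolding pole_factor_def
      by (intro continuous_intros fst_cont cont_a cont_b)
  qed (use m_nonzero in auto)
  ultimately show ?case by (rule moderate_cong_norm[OF _ _ inverse_m_bound])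
next
  case (add g h)
  then show ?case by (intro moderate_add)
next
  case (mult g h)
  then show ?case by (intro moderate_mult)
qed

lemma coeffs_deriv:
  "h \<in> coeffs \<Longrightarrow> \<exists>h'\<in>coeffs. \<forall>s t. ((\<lambda>t. h s t) has_vector_derivative h' s t) (at t)"
proof (induction rule: coeffs.induct)
  case (cis n)
  have "(\<lambda>s t. (\<i> * of_int n) * cis (of_int n * t)) \<in> coeffs" by (intro coeffs.intros)
  moreover have "((\<lambda>t. cis (of_int n * t)) has_vector_derivative (\<i> * of_int n) * cis (of_int n * t)) (at t)" for t
    using cis_has_vector_derivative[of "of_int n" t UNIV] by simp
  ultimately show ?case by (intro bexI[of _ "\<lambda>s t. (\<i> * of_int n) * cis (of_int n * t)"] allI)
next
  case inverse_m
  let ?m' = "\<lambda>s t. a s * (b s * (\<i> * cis (of_int (-1) * t))) + (- \<i>) * (cnj (a s) * (cnj (b s) * cis (of_int 1 * t)))"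
  let ?h = "\<lambda>s t. (-1) * (?m' s t * (inverse (m s t) * inverse (m s t)))"
  have "?h \<in> coeffs" by (intro coeffs.intros)
  moreover have "((\<lambda>t. inverse (m s t)) has_vector_derivative ?h s t) (at t)" for s t
  proof -
    have "((\<lambda>t. a s * cnj (a s) + b s * cnj (b s) - a s * b s * cis (- t) - cnj (a s) * cnj (b s) * cis t) has_vector_derivative
        0 - a s * b s * (\<i> * of_real (-1) * cis ((-1) * t)) - cnj (a s) * cnj (b s) * (\<i> * of_real 1 * cis (1 * t))) (at t)"
      using has_vector_derivative_diff[OF has_vector_derivative_diff[OF has_vector_derivative_const
         has_vector_derivative_mult_right[OF cis_has_vector_derivative[of "-1" t UNIV]]]
         has_vector_derivative_mult_right[OF cis_has_vector_derivative[of 1 t UNIV]],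
         of "a s * cnj (a s) + b s * cnj (b s)" "a s * b s" "cnj (a s) * cnj (b s)"] by simp
    then have "((\<lambda>t. m s t) has_vector_derivative ?m' s t) (at t)"
      unfolding m_eq by (simp add: algebra_simps)
    moreover have "(inverse has_field_derivative - (inverse (m s t) * 1 * inverse (m s t))) (at (m s t))"
      by (rule derivative_eq_intros m_nonzero refl)+
    ultimately have "(inverse \<circ> (\<lambda>t. m s t) has_vector_derivative ?m' s t * - (inverse (m s t) * 1 * inverse (m s t))) (at t)"
      by (rule field_vector_diff_chain_at)
    then show ?thesis by (simp add: o_def)
  qed
  ultimately show ?case by (intro bexI[of _ ?h] allI)
next
  case (add g h)
  then obtain g' h' where "g' \<in> coeffs" "h' \<in> coeffs"
    "\<And>s t. ((\<lambda>t. g s t) has_vector_derivative g' s t) (at t)"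
    "\<And>s t. ((\<lambda>t. h s t) has_vector_derivative h' s t) (at t)" by metis
  then show ?case
    by (intro bexI[of _ "\<lambda>s t. g' s t + h' s t"] allI coeffs.add has_vector_derivative_add)
next
  case (mult g h)
  then obtain g' h' where gh: "g' \<in> coeffs" "h' \<in> coeffs"
    "\<And>s t. ((\<lambda>t. g s t) has_vector_derivative g' s t) (at t)"
    "\<And>s t. ((\<lambda>t. h s t) has_vector_derivative h' s t) (at t)" by metis
  show ?case
    by (intro bexI[of _ "\<lambda>s t. g s t * h' s t + g' s t * h s t"] allI has_vector_derivative_mult gh
       coeffs.add coeffs.mult mult.hyps)
qed (auto intro!: bexI[of _ "\<lambda>s t. 0"] coeffs.const)

lemma preimage_circle: "preimage s t \<in> S\<^sup>1"
  using su11_action_norm(2)[OF su11_uminus[OF su11], of s "cis t"]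
  by (simp add: preimage_def su11_action_def)

lemma preimage_deriv:
  "((\<lambda>t. preimage s t) has_vector_derivative \<i> * inverse (m s t) * preimage s t) (at t)"
proof -
  define D where "D = a s - cnj (b s) * cis t"
  have D: "D \<noteq> 0" using denom_nonzero by (simp add: D_def)
  have "cis t * cis (- t) = 1" by (simp add: cis_mult)
  then have 1: "cnj (a s) * cis t - b s = cis t * cnj D"
    by (simp add: D_def cis_cnj algebra_simps)
  have "((\<lambda>t. preimage s t) has_vector_derivative \<i> * cis t / D\<^sup>2) (at t)"
    using su11_cis_deriv[OF su11_uminus[OF su11], of s t]
    by (simp add: preimage_def[abs_def] D_def algebra_simps)
  moreover have "\<i> * cis t / D\<^sup>2 = \<i> * inverse (m s t) * preimage s t"
    unfolding preimage_def pole_factor_def 1 D_def[symmetric]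
    using D by (simp add: field_simps power2_eq_square)
  ultimately show ?thesis by simp
qed

definition pull :: "nat \<Rightarrow> (complex \<Rightarrow> complex) \<Rightarrow> real \<Rightarrow> real \<Rightarrow> complex" where
  "pull j f s t = angle_deriv j f (Arg (preimage s t))"

text \<open>The angle of the preimage has derivative 1/m. As \<open>Arg\<close> is discontinuous, a
  local lift \<tau> of the angle is built from \<open>Ln\<close> of a quotient close to 1;
  periodicity of the derivatives of f makes the choice of lift irrelevant.\<close>

lemma pull_deriv:
  assumes f: "f \<in> C\<^sup>\<infinity>"
  shows "((\<lambda>t. pull j f s t) has_vector_derivative inverse (m s t) * pull (Suc j) f s t) (at t)"
proof -
  let ?w = "preimage s"
  define x where "x = inverse ((cmod (a s - cnj (b s) * cis t))\<^sup>2)"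
  have x: "inverse (m s t) = of_real x"
  proof -
    have "m s t = of_real ((cmod (a s - cnj (b s) * cis t))\<^sup>2)"
      by (simp only: pole_factor_def complex_norm_square)
    then show ?thesis by (simp add: x_def)
  qed
  define \<tau> where "\<tau> u = Arg (?w t) + Im (Ln (?w u / ?w t))" for u
  have w1: "cmod (?w u) = 1" for u using preimage_circle by simp
  have w0: "?w u \<noteq> 0" for u using w1[of u] by auto
  have cis\<tau>: "cis (\<tau> u) = ?w u" for u
  proof -
    have "cmod (?w u / ?w t) = 1" by (simp add: norm_divide w1)
    moreover have "?w u / ?w t \<noteq> 0" using w0 by simp
    ultimately have "cis (Im (Ln (?w u / ?w t))) = ?w u / ?w t"
      by (metis Arg_eq_Im_Ln cis_Arg_circle dist_0_norm mem_sphere)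
    then show ?thesis unfolding \<tau>_def using cis_Arg_circle[OF preimage_circle, of s t] w0
      by (simp add: cis_mult[symmetric])
  qed
  have eq: "pull j f s u = angle_deriv j f (\<tau> u)" for u
    unfolding pull_def cis\<tau>[symmetric]
    by (rule periodic_Arg_cis[of "angle_deriv j f", OF angle_deriv_periodic[OF f]])
  have "((\<lambda>u. ?w u / ?w t) has_vector_derivative \<i> * of_real x) (at t)"
    using has_vector_derivative_divide[OF preimage_deriv[of s t], of "?w t"] w0 by (simp add: x)
  moreover have "(Ln has_field_derivative inverse 1) (at (?w t / ?w t))"
    using has_field_derivative_Ln[of 1] w0 by simp
  ultimately have "(Ln \<circ> (\<lambda>u. ?w u / ?w t) has_vector_derivative (\<i> * of_real x) * inverse 1) (at t)"
    by (rule field_vector_diff_chain_at)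
  then have "((\<lambda>u. Im (Ln (?w u / ?w t))) has_vector_derivative x) (at t)"
    by (simp add: o_def has_vector_derivative_complex_iff has_real_derivative_iff_has_vector_derivative)
  then have "(\<tau> has_vector_derivative 0 + x) (at t)"
    unfolding \<tau>_def[abs_def] by (intro has_vector_derivative_add has_vector_derivative_const)
  from vector_diff_chain_at[OF this smooth_has_vector_derivative[OF f, of j]]
  have "((\<lambda>u. angle_deriv j f (\<tau> u)) has_vector_derivative x *\<^sub>R angle_deriv (Suc j) f (\<tau> t)) (at t)"
    by (simp add: o_def)
  moreover have "angle_deriv (Suc j) f (\<tau> t) = pull (Suc j) f s t"
    unfolding pull_def cis\<tau>[symmetric]
    by (rule periodic_Arg_cis[of "angle_deriv (Suc j) f", OF angle_deriv_periodic[OF f], symmetric])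
  ultimately show ?thesis unfolding eq[abs_def] x by (simp add: scaleR_conv_of_real)
qed

lemma preimage_cont: "continuous_on UNIV (\<lambda>x. preimage (fst x) (snd x))"
proof -
  have "a s \<noteq> cnj (b s) * cis t" for s t using denom_nonzero[of s t] by auto
  then show ?thesis
    unfolding preimage_def by (intro continuous_intros fst_cont cont_a cont_b) simp
qed

lemma pull_cont:
  assumes f: "f \<in> C\<^sup>\<infinity>" shows "continuous_on UNIV (\<lambda>(s, t). pull j f s t)"
proof -
  have "continuous_on S\<^sup>1 (\<lambda>z. angle_deriv j f (Arg z))"
    by (intro continuous_on_Arg_periodic smooth_continuous f angle_deriv_periodic)
  from continuous_on_compose2[OF this preimage_cont] show ?thesis
    unfolding case_prod_unfold pull_def using preimage_circle by blast
qed

text \<open>The test function is an argument of each term, so that one formula serves all f and the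
  constants in the seminorm bounds do not depend on f.\<close>

inductive_set beta_terms :: "((complex \<Rightarrow> complex) \<Rightarrow> real \<Rightarrow> real \<Rightarrow> complex) set" where
  base: "c \<in> coeffs \<Longrightarrow> (\<lambda>f s t. c s t * pull j f s t) \<in> beta_terms"
| add: "g \<in> beta_terms \<Longrightarrow> h \<in> beta_terms \<Longrightarrow> (\<lambda>f s t. g f s t + h f s t) \<in> beta_terms"

lemma beta_terms_deriv:
  "h \<in> beta_terms \<Longrightarrow> \<exists>h'\<in>beta_terms. \<forall>f\<in>C\<^sup>\<infinity>. \<forall>s t. ((\<lambda>t. h f s t) has_vector_derivative h' f s t) (at t)"
proof (induction rule: beta_terms.induct)
  case (base c j)
  then obtain c' where c': "c' \<in> coeffs" "\<And>s t. ((\<lambda>t. c s t) has_vector_derivative c' s t) (at t)"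
    using coeffs_deriv by blast
  let ?h = "\<lambda>f s t. (c s t * inverse (m s t)) * pull (Suc j) f s t + c' s t * pull j f s t"
  have "?h \<in> beta_terms" by (intro beta_terms.intros coeffs.mult coeffs.inverse_m base c')
  moreover have "((\<lambda>t. c s t * pull j f s t) has_vector_derivative ?h f s t) (at t)" if "f \<in> C\<^sup>\<infinity>" for f s t
    using has_vector_derivative_mult[OF c'(2)[of s t] pull_deriv[OF that, of j s t]] by (simp add: mult.assoc)
  ultimately show ?case by (intro bexI[of _ ?h] ballI allI)
next
  case (add g h)
  then obtain g' h' where "g' \<in> beta_terms" "h' \<in> beta_terms"
    "\<And>f s t. f \<in> C\<^sup>\<infinity> \<Longrightarrow> ((\<lambda>t. g f s t) has_vector_derivative g' f s t) (at t)"
    "\<And>f s t. f \<in> C\<^sup>\<infinity> \<Longrightarrow> ((\<lambda>t. h f s t) has_vector_derivative h' f s t) (at t)" by metis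
  then show ?case
    by (intro bexI[of _ "\<lambda>f s t. g' f s t + h' f s t"] ballI allI beta_terms.add has_vector_derivative_add)
qed

lemma beta_terms_bound:
  "h \<in> beta_terms \<Longrightarrow> \<exists>C M N. 0 \<le> C \<and> 0 \<le> M \<and>
     (\<forall>f\<in>C\<^sup>\<infinity>. \<forall>s t. cmod (h f s t) \<le> C * exp (M * \<bar>s\<bar>) * CN_norm N f)"
proof (induction rule: beta_terms.induct)
  case (base c j)
  then obtain C M where C: "0 \<le> C" "0 \<le> M" "\<And>s t. cmod (c s t) \<le> C * exp (M * \<bar>s\<bar>)"
    using coeffs_moderate unfolding moderate_def by blast
  have "cmod (c s t * pull j f s t) \<le> C * exp (M * \<bar>s\<bar>) * CN_norm j f" if "f \<in> C\<^sup>\<infinity>" for f s t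
    unfolding norm_mult pull_def using C that by (intro mult_mono angle_deriv_le_CN) auto
  then show ?case using C by blast
next
  case (add g h)
  obtain C M N where g: "0 \<le> C" "0 \<le> M" "\<And>f s t. f \<in> C\<^sup>\<infinity> \<Longrightarrow> cmod (g f s t) \<le> C * exp (M * \<bar>s\<bar>) * CN_norm N f"
    using add.IH(1) by blast
  obtain C' M' N' where h: "0 \<le> C'" "0 \<le> M'" "\<And>f s t. f \<in> C\<^sup>\<infinity> \<Longrightarrow> cmod (h f s t) \<le> C' * exp (M' * \<bar>s\<bar>) * CN_norm N' f"
    using add.IH(2) by blast
  have "cmod (g f s t + h f s t) \<le> (C + C') * exp ((M + M') * \<bar>s\<bar>) * CN_norm (N + N') f" if f: "f \<in> C\<^sup>\<infinity>" for f s t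
  proof -
    have "cmod (g f s t + h f s t) \<le> C * exp (M * \<bar>s\<bar>) * CN_norm N f + C' * exp (M' * \<bar>s\<bar>) * CN_norm N' f"
      by (intro norm_triangle_mono g h f)
    also have "\<dots> \<le> C * exp ((M + M') * \<bar>s\<bar>) * CN_norm (N + N') f + C' * exp ((M + M') * \<bar>s\<bar>) * CN_norm (N + N') f"
      using g h by (intro add_mono mult_mono mult_left_mono exp_le_larger CN_norm_mono f CN_norm_nonneg) auto
    finally show ?thesis by (simp add: algebra_simps)
  qed
  moreover have "0 \<le> C + C'" "0 \<le> M + M'" using g h by auto
  ultimately show ?case by blast
qed

lemma beta_terms_cont: "h \<in> beta_terms \<Longrightarrow> f \<in> C\<^sup>\<infinity> \<Longrightarrow> continuous_on UNIV (\<lambda>(s, t). h f s t)"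
proof (induction rule: beta_terms.induct)
  case (base c j)
  then show ?case
    using coeffs_moderate[OF base(1)] pull_cont[OF base(2), of j]
    unfolding moderate_def case_prod_unfold by (intro continuous_on_mult) auto
next
  case (add g h)
  then show ?case unfolding case_prod_unfold by (intro continuous_on_add) auto
qed

lemma m_power_coeffs: "(\<lambda>s t. m s t powi (int d - 1)) \<in> coeffs"
proof (cases d)
  case 0
  then show ?thesis using coeffs.inverse_m by (simp add: power_int_minus)
next
  case (Suc k)
  have "(\<lambda>s t. a s * cnj (a s) + (b s * cnj (b s) + ((-1) * (a s * (b s * cis (of_int (-1) * t)))
      + (-1) * (cnj (a s) * (cnj (b s) * cis (of_int 1 * t)))))) \<in> coeffs"
    by (intro coeffs.intros)
  then have m: "m \<in> coeffs" unfolding m_eq[abs_def] by (simp add: algebra_simps)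
  have "(\<lambda>s t. m s t ^ k) \<in> coeffs"
  proof (induction k)
    case 0
    then show ?case using coeffs.const[of 1] by simp
  next
    case (Suc k)
    then show ?case using coeffs.mult[OF m] by simp
  qed
  then show ?thesis using Suc by simp
qed

text \<open>All angular derivatives of \<open>beta d (\<gamma> s) f\<close>, chosen once for every f
  and s. The chain starts from m^{d-1} times the pulled back f and is continued by dependent
  choice.\<close>

lemma beta_derivs:
  obtains H where "\<And>j. H j \<in> beta_terms"
    "\<And>f s. f \<in> C\<^sup>\<infinity> \<Longrightarrow> beta d (\<gamma> s) f \<in> C\<^sup>\<infinity>"
    "\<And>f s j. f \<in> C\<^sup>\<infinity> \<Longrightarrow> angle_deriv j (beta d (\<gamma> s) f) = H j f s"
proof -
  let ?h = "\<lambda>f s t. m s t powi (int d - 1) * pull 0 f s t"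
  have "?h \<in> beta_terms" by (intro beta_terms.base m_power_coeffs)
  then have "\<exists>H. \<forall>n. (H n \<in> beta_terms \<and> (n = 0 \<longrightarrow> H n = ?h)) \<and>
     (\<forall>f\<in>C\<^sup>\<infinity>. \<forall>s t. ((\<lambda>t. H n f s t) has_vector_derivative H (Suc n) f s t) (at t))"
  proof (intro dependent_nat_choice)
    fix h and n :: nat assume "h \<in> beta_terms \<and> (n = 0 \<longrightarrow> h = ?h)"
    then obtain h' where "h' \<in> beta_terms" "\<forall>f\<in>C\<^sup>\<infinity>. \<forall>s t. ((\<lambda>t. h f s t) has_vector_derivative h' f s t) (at t)"
      using beta_terms_deriv by metis
    then show "\<exists>y. (y \<in> beta_terms \<and> (Suc n = 0 \<longrightarrow> y = ?h)) \<and>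
        (\<forall>f\<in>C\<^sup>\<infinity>. \<forall>s t. ((\<lambda>t. h f s t) has_vector_derivative y f s t) (at t))"
      by (intro exI[of _ h'] conjI) simp_all
  qed (rule exI[of _ ?h], simp)
  then obtain H where H: "\<And>n. H n \<in> beta_terms" "H 0 = ?h"
    "\<And>n f s t. f \<in> C\<^sup>\<infinity> \<Longrightarrow> ((\<lambda>t. H n f s t) has_vector_derivative H (Suc n) f s t) (at t)" by blast
  have 0: "H 0 f s t = beta d (\<gamma> s) f (cis t)" for f s t
  proof -
    have "f (preimage s t) = pull 0 f s t"
      unfolding pull_def angle_deriv_0 using cis_Arg_circle[OF preimage_circle] by simp
    then show ?thesis unfolding H(2) by (simp add: beta_su11[OF su11] preimage_def)
  qed
  have M: "\<gamma> s \<in> Mob" for s using su11 unfolding Mob_iff by blast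
  show ?thesis
  proof (rule that[OF H(1)])
    fix f :: "complex \<Rightarrow> complex" and s assume f: "f \<in> C\<^sup>\<infinity>"
    note h = 0 H(3)[OF f]
    show "beta d (\<gamma> s) f \<in> C\<^sup>\<infinity>"
      by (rule smoothI[of _ "\<lambda>j. H j f s"]) (use beta_off_circle[OF M f] h in auto)
    show "angle_deriv j (beta d (\<gamma> s) f) = H j f s" for j
      by (rule angle_deriv_eqI[of "\<lambda>j. H j f s"]) (use h in auto)
  qed
qed

lemma beta_bound:
  "\<exists>C M N'. 0 \<le> C \<and> 0 \<le> M \<and> (\<forall>f\<in>C\<^sup>\<infinity>. \<forall>s. CN_norm N (beta d (\<gamma> s) f) \<le> C * exp (M * \<bar>s\<bar>) * CN_norm N' f)"
proof -
  obtain H where H: "\<And>j. H j \<in> beta_terms"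
    "\<And>f s. f \<in> C\<^sup>\<infinity> \<Longrightarrow> beta d (\<gamma> s) f \<in> C\<^sup>\<infinity>"
    "\<And>f s j. f \<in> C\<^sup>\<infinity> \<Longrightarrow> angle_deriv j (beta d (\<gamma> s) f) = H j f s" using beta_derivs[of d] by blast
  obtain C M K where C: "\<And>j. 0 \<le> C j" "\<And>j. 0 \<le> M j"
    "\<And>j f s t. f \<in> C\<^sup>\<infinity> \<Longrightarrow> cmod (H j f s t) \<le> C j * exp (M j * \<bar>s\<bar>) * CN_norm (K j) f"
    using beta_terms_bound[OF H(1)] by metis
  define M' where "M' = (\<Sum>j\<le>N. M j)"
  define K' where "K' = (\<Sum>j\<le>N. K j)"
  have le: "M j \<le> M'" "K j \<le> K'" if "j \<le> N" for j
    using that C(2) unfolding M'_def K'_def by (auto intro: member_le_sum)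
  have "CN_norm N (beta d (\<gamma> s) f) \<le> (\<Sum>j\<le>N. C j) * exp (M' * \<bar>s\<bar>) * CN_norm K' f" if f: "f \<in> C\<^sup>\<infinity>" for f s
  proof -
    have "CN_norm N (beta d (\<gamma> s) f) \<le> (\<Sum>j\<le>N. C j * exp (M' * \<bar>s\<bar>) * CN_norm K' f)"
    proof (rule CN_norm_leI)
      fix j t assume j: "j \<le> N"
      have "cmod (H j f s t) \<le> C j * exp (M j * \<bar>s\<bar>) * CN_norm (K j) f" by (rule C(3)[OF f])
      also have "\<dots> \<le> C j * exp (M' * \<bar>s\<bar>) * CN_norm K' f"
        using C le[OF j] by (intro mult_mono mult_left_mono exp_le_larger CN_norm_mono f CN_norm_nonneg) auto
      finally show "cmod (angle_deriv j (beta d (\<gamma> s) f) t) \<le> C j * exp (M' * \<bar>s\<bar>) * CN_norm K' f"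
        by (simp add: H(3)[OF f])
    qed
    then show ?thesis by (simp add: sum_distrib_right)
  qed
  moreover have "0 \<le> (\<Sum>j\<le>N. C j)" "0 \<le> M'" unfolding M'_def using C by (auto intro: sum_nonneg)
  ultimately show ?thesis by blast
qed

text \<open>Periodicity in t leaves only a compact rectangle around s0, on which each derivative is
  uniformly continuous; this gives convergence uniform in t.\<close>

lemma beta_continuous:
  assumes f: "f \<in> C\<^sup>\<infinity>"
  shows "((\<lambda>s. CN_norm N (\<lambda>z. beta d (\<gamma> s) f z - beta d (\<gamma> s0) f z)) \<longlongrightarrow> 0) (at s0)"
proof -
  obtain H where H: "\<And>j. H j \<in> beta_terms"
    "\<And>f s. f \<in> C\<^sup>\<infinity> \<Longrightarrow> beta d (\<gamma> s) f \<in> C\<^sup>\<infinity>"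
    "\<And>f s j. f \<in> C\<^sup>\<infinity> \<Longrightarrow> angle_deriv j (beta d (\<gamma> s) f) = H j f s" using beta_derivs[of d] by blast
  have near: "\<forall>\<^sub>F s in at s0. \<forall>t. cmod (H j f s t - H j f s0 t) < e" if e: "e > 0" for e j
  proof -
    let ?K = "{s0 - 1..s0 + 1} \<times> {0..2*pi}"
    have "compact ?K" by (intro compact_Times) auto
    then have "uniformly_continuous_on ?K (\<lambda>(s, t). H j f s t)"
      by (intro compact_uniformly_continuous continuous_on_subset[OF beta_terms_cont[OF H(1) f]]) auto
    then obtain \<delta> where \<delta>: "\<delta> > 0" "\<And>x y. x \<in> ?K \<Longrightarrow> y \<in> ?K \<Longrightarrow> dist y x < \<delta> \<Longrightarrow>
        dist ((\<lambda>(s, t). H j f s t) y) ((\<lambda>(s, t). H j f s t) x) < e"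
      using e unfolding uniformly_continuous_on_def by metis
    have "cmod (H j f s t - H j f s0 t) < e" if s: "dist s s0 < min \<delta> 1" for s t
    proof -
      have p: "H j f u (r + 2 * pi) = H j f u r" for u r
        using angle_deriv_periodic[OF H(2)[OF f], of j u r] H(3)[OF f] by simp
      obtain t' where t': "t' \<in> {0..2*pi}" "H j f s t - H j f s0 t = H j f s t' - H j f s0 t'"
        using periodic_reduce[of "\<lambda>t. H j f s t - H j f s0 t" t] p by auto
      have "dist (s, t') (s0, t') < \<delta>" using s by (simp add: dist_Pair_Pair)
      then have "dist (H j f s t') (H j f s0 t') < e"
        using \<delta>(2)[of "(s0, t')" "(s, t')"] s t'(1) by (simp add: dist_real_def abs_diff_less_iff less_imp_le)
      then show ?thesis using t' by (simp add: dist_norm)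
    qed
    then show ?thesis unfolding eventually_at using \<delta>(1)
      by (intro exI[of _ "min \<delta> 1"]) auto
  qed
  show ?thesis
  proof (rule tendstoI)
    fix e :: real assume e: "e > 0"
    define e' where "e' = e / (2 * (real N + 1))"
    have e': "e' > 0" using e by (simp add: e'_def)
    have "\<forall>\<^sub>F s in at s0. \<forall>j\<in>{..N}. \<forall>t. cmod (H j f s t - H j f s0 t) < e'"
      by (intro eventually_ball_finite ballI near e') auto
    then show "\<forall>\<^sub>F s in at s0. dist (CN_norm N (\<lambda>z. beta d (\<gamma> s) f z - beta d (\<gamma> s0) f z)) 0 < e"
    proof eventually_elim
      case (elim s)
      have "CN_norm N (\<lambda>z. beta d (\<gamma> s) f z - beta d (\<gamma> s0) f z) \<le> (\<Sum>j\<le>N. e')"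
        by (rule CN_norm_leI)
          (use elim in \<open>auto simp: smooth_diff(2)[OF H(2)[OF f] H(2)[OF f]] H(3)[OF f] intro: less_imp_le\<close>)
      also have "\<dots> = e / 2" by (simp add: e'_def field_simps)
      finally show ?case using e CN_norm_nonneg[OF smooth_diff(1)[OF H(2)[OF f] H(2)[OF f]], of N s s0] by simp
    qed
  qed
qed

end

lemma beta_smooth: "\<gamma> \<in> Mob \<Longrightarrow> f \<in> C\<^sup>\<infinity> \<Longrightarrow> beta d \<gamma> f \<in> C\<^sup>\<infinity>"
proof -
  assume g: "\<gamma> \<in> Mob" and f: "f \<in> C\<^sup>\<infinity>"
  then obtain a b where ab: "su11 a b" "\<gamma> = su11_action a b" unfolding Mob_iff by blast
  \<comment> \<open>A single transformation, viewed as a constant path.\<close>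
  interpret su11_path "\<lambda>s. a" "\<lambda>s. b"
  proof
    show "\<exists>C M. 0 \<le> C \<and> 0 \<le> M \<and> (\<forall>s. cmod a \<le> C * exp (M * \<bar>s\<bar>))"
      by (rule exI[of _ "cmod a"], rule exI[of _ 0]) simp
  qed (simp_all add: ab)
  show ?thesis using beta_derivs[of d] f ab(2) by metis
qed

section \<open>Gaussian integrals and contour shifts\<close>

lemma integrable_exp_abs: "integrable lborel (\<lambda>t::real. exp (- \<bar>t\<bar>))"
proof -
  have I: "integrable lborel (\<lambda>t::real. exp (- t) * indicator {0..} t)"
  proof (rule integrableI_nn_integral_finite)
    have "((\<lambda>t::real. - exp (- t)) \<longlongrightarrow> - 0) at_top"
      by (intro tendsto_minus filterlim_compose[OF exp_at_bot] filterlim_uminus_at_bot_at_top)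
    then have "(\<integral>\<^sup>+t. ennreal (exp (- t)) * indicator {0..} t \<partial>lborel) = ennreal (- 0 - (- exp (- 0::real)))"
      by (intro nn_integral_FTC_atLeast) (auto intro!: derivative_eq_intros)
    moreover have "ennreal (exp (- t)) * indicator {0..} t = ennreal (exp (- t) * indicator {0..} t)" for t :: real
      by (auto simp: indicator_def)
    ultimately show "(\<integral>\<^sup>+t. ennreal (exp (- t) * indicator {0..} t) \<partial>lborel) = ennreal 1" by simp
  qed auto
  have "integrable lborel (\<lambda>t::real. exp (- (0 + (-1) * t)) * indicator {0..} (0 + (-1) * t))"
    by (rule lborel_integrable_real_affine[OF I]) simp
  from Bochner_Integration.integrable_add[OF I this] show ?thesis
    by (rule Bochner_Integration.integrable_bound) (auto simp: indicator_def)
qed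

lemma integrable_gauss:
  assumes c: "0 < c"
  shows "integrable lborel (\<lambda>t::real. exp (M * \<bar>t\<bar> - c * t\<^sup>2))"
proof (rule Bochner_Integration.integrable_bound)
  show "integrable lborel (\<lambda>t::real. exp ((M + 1)\<^sup>2 / (4 * c)) * exp (- \<bar>t\<bar>))"
    by (intro integrable_mult_right integrable_exp_abs)
  have "M * \<bar>t\<bar> - c * t\<^sup>2 \<le> (M + 1)\<^sup>2 / (4 * c) - \<bar>t\<bar>" for t
  proof -
    have "0 \<le> (2 * c * \<bar>t\<bar> - (M + 1))\<^sup>2 / (4 * c)" using c by simp
    also have "\<dots> = c * t\<^sup>2 - (M + 1) * \<bar>t\<bar> + (M + 1)\<^sup>2 / (4 * c)"
      using c by (simp add: power2_eq_square field_simps)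
    finally show ?thesis by (simp add: algebra_simps)
  qed
  then have "exp (M * \<bar>t\<bar> - c * t\<^sup>2) \<le> exp ((M + 1)\<^sup>2 / (4 * c)) * exp (- \<bar>t\<bar>)" for t
    unfolding exp_add[symmetric] by simp
  then show "AE t in lborel. norm (exp (M * \<bar>t\<bar> - c * t\<^sup>2)) \<le> norm (exp ((M + 1)\<^sup>2 / (4 * c)) * exp (- \<bar>t\<bar>))"
    by simp
qed simp

text \<open>Complex b and c make the class stable under complex translations and under
  multiplication by a second Gaussian; the contour shifts use both.\<close>

definition gaussian :: "(complex \<Rightarrow> complex) \<Rightarrow> bool" where
  "gaussian g \<longleftrightarrow> (\<exists>a>0. \<exists>b c. g = (\<lambda>z. exp (- of_real a * z\<^sup>2 + b * z + c)))"

lemma gaussianI: "0 < a \<Longrightarrow> (\<And>z. g z = exp (- of_real a * z\<^sup>2 + b * z + c)) \<Longrightarrow> gaussian g"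
  unfolding gaussian_def by blast

lemma gaussian_shift:
  assumes "gaussian g" shows "gaussian (\<lambda>z. g (z + w))"
proof -
  obtain a b c where a: "a > 0" and g: "g = (\<lambda>z. exp (- of_real a * z\<^sup>2 + b * z + c))"
    using assms unfolding gaussian_def by blast
  show ?thesis
    by (rule gaussianI[OF a, of _ "b - 2 * of_real a * w" "- of_real a * w\<^sup>2 + b * w + c"])
      (simp add: g power2_eq_square algebra_simps)
qed

lemma gaussian_holomorphic: "gaussian g \<Longrightarrow> g holomorphic_on S"
  unfolding gaussian_def by (auto intro!: holomorphic_intros)

lemma gaussian_continuous: "gaussian g \<Longrightarrow> continuous_on S g"
  by (intro holomorphic_on_imp_continuous_on gaussian_holomorphic)

lemma gaussian_continuous_real: "gaussian g \<Longrightarrow> continuous_on S (\<lambda>t::real. g (of_real t))"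
  by (rule continuous_on_compose2[OF gaussian_continuous[of g UNIV]]) (auto intro: continuous_intros)

lemma gaussian_bound:
  assumes "gaussian g"
  obtains B c where "0 \<le> B" "0 < c"
    "\<And>t \<tau>. \<bar>\<tau>\<bar> \<le> Y \<Longrightarrow> cmod (g (of_real t + \<i> * of_real \<tau>)) \<le> B * exp (- c * t\<^sup>2)"
proof -
  obtain a b c where a: "a > 0" and g: "g = (\<lambda>z. exp (- of_real a * z\<^sup>2 + b * z + c))"
    using assms unfolding gaussian_def by blast
  \<comment> \<open>Half of the decay a t^2 absorbs the linear term Re b t at the cost (Re
    b)^2/(2a); the other terms of K bound the contributions of \<tau> and of c.\<close>
  define K where "K = a * Y\<^sup>2 + \<bar>Im b\<bar> * Y + Re c + (Re b)\<^sup>2 / (2 * a)"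
  show ?thesis
  proof (rule that[of "exp K" "a / 2"])
    fix t \<tau> :: real assume \<tau>: "\<bar>\<tau>\<bar> \<le> Y"
    have "cmod (g (of_real t + \<i> * of_real \<tau>)) = exp (- a * (t\<^sup>2 - \<tau>\<^sup>2) + Re b * t - Im b * \<tau> + Re c)"
      unfolding g norm_exp_eq_Re by (simp add: power2_eq_square algebra_simps)
    also have "\<dots> \<le> exp (K + - (a / 2) * t\<^sup>2)"
    proof (subst exp_le_cancel_iff)
      have "\<tau>\<^sup>2 \<le> Y\<^sup>2" using \<tau> by (metis abs_ge_zero power2_abs power_mono)
      then have 1: "a * \<tau>\<^sup>2 \<le> a * Y\<^sup>2" using a by simp
      have "- Im b * \<tau> \<le> \<bar>Im b * \<tau>\<bar>" by (simp add: abs_if)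
      also have "\<dots> \<le> \<bar>Im b\<bar> * Y" unfolding abs_mult using \<tau> by (intro mult_left_mono) auto
      finally have 2: "- Im b * \<tau> \<le> \<bar>Im b\<bar> * Y" .
      have "0 \<le> (a * t - Re b)\<^sup>2 / (2 * a)" using a by simp
      also have "\<dots> = a / 2 * t\<^sup>2 - Re b * t + (Re b)\<^sup>2 / (2 * a)"
        using a by (simp add: power2_eq_square field_simps)
      finally have 3: "Re b * t \<le> a / 2 * t\<^sup>2 + (Re b)\<^sup>2 / (2 * a)" by simp
      have "- a * (t\<^sup>2 - \<tau>\<^sup>2) = a * \<tau>\<^sup>2 - a / 2 * t\<^sup>2 - a / 2 * t\<^sup>2" by (simp add: algebra_simps)
      then show "- a * (t\<^sup>2 - \<tau>\<^sup>2) + Re b * t - Im b * \<tau> + Re c \<le> K + - (a / 2) * t\<^sup>2"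
        unfolding K_def using 1 2 3 by simp
    qed
    finally show "cmod (g (of_real t + \<i> * of_real \<tau>)) \<le> exp K * exp (- (a / 2) * t\<^sup>2)"
      by (simp only: exp_add)
  qed (use a in auto)
qed

lemma gaussian_bound_real:
  assumes "gaussian g"
  obtains B c where "0 \<le> B" "0 < c" "\<And>t. cmod (g (of_real t)) \<le> B * exp (- c * t\<^sup>2)"
proof -
  obtain B c where "0 \<le> B" "0 < c"
    "\<And>t \<tau>. \<bar>\<tau>\<bar> \<le> 0 \<Longrightarrow> cmod (g (of_real t + \<i> * of_real \<tau>)) \<le> B * exp (- c * t\<^sup>2)"
    using gaussian_bound[OF assms, of 0] by blast
  from that[OF this(1,2)] this(3)[of 0] show ?thesis by simp
qed

lemma integrable_mult_gaussian:
  fixes h :: "real \<Rightarrow> complex"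
  assumes h: "continuous_on UNIV h" "\<And>t. cmod (h t) \<le> C * exp (M * \<bar>t\<bar>)" and g: "gaussian g"
  shows "integrable lborel (\<lambda>t. h t * g (of_real t))"
proof -
  obtain B c where B: "0 \<le> B" "0 < c" "\<And>t. cmod (g (of_real t)) \<le> B * exp (- c * t\<^sup>2)"
    using gaussian_bound_real[OF g] by blast
  have C: "0 \<le> C" using order_trans[OF norm_ge_zero h(2)[of 0]] by simp
  show ?thesis
  proof (rule Bochner_Integration.integrable_bound)
    show "integrable lborel (\<lambda>t. (C * B) * exp (M * \<bar>t\<bar> - c * t\<^sup>2))"
      by (intro integrable_mult_right integrable_gauss B)
    have "cmod (h t * g (of_real t)) \<le> (C * exp (M * \<bar>t\<bar>)) * (B * exp (- c * t\<^sup>2))" for t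
      unfolding norm_mult using h(2) B C by (intro mult_mono) auto
    moreover have "(C * exp (M * \<bar>t\<bar>)) * (B * exp (- c * t\<^sup>2)) = (C * B) * exp (M * \<bar>t\<bar> - c * t\<^sup>2)" for t
      by (simp add: exp_add[symmetric] mult.assoc mult.left_commute)
    ultimately have le: "cmod (h t * g (of_real t)) \<le> (C * B) * exp (M * \<bar>t\<bar> - c * t\<^sup>2)" for t
      by metis
    show "AE t in lborel. norm (h t * g (of_real t)) \<le> norm ((C * B) * exp (M * \<bar>t\<bar> - c * t\<^sup>2))"
      unfolding real_norm_def by (rule AE_I2, rule order_trans[OF le abs_ge_self])
    have "continuous_on UNIV (\<lambda>t. h t * g (of_real t))"
      by (intro continuous_on_mult h gaussian_continuous_real g)
    then show "(\<lambda>t. h t * g (of_real t)) \<in> borel_measurable lborel"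
      by (simp add: borel_measurable_continuous_onI)
  qed
qed

lemma lborel_integral_shift:
  fixes f :: "real \<Rightarrow> complex"
  shows "(LBINT t. f (t + a)) = (LBINT t. f t)"
  using lborel_integral_real_affine[of 1 f a] by (simp add: add.commute)

lemma lborel_integral_uminus:
  fixes f :: "real \<Rightarrow> complex"
  shows "(LBINT t. f (- t)) = (LBINT t. f t)"
  using lborel_integral_real_affine[of "-1" f 0] by simp

text \<open>Cauchy's theorem on long rectangles, run with a primitive P on the strip. The truncated
  line integrals are differences of values of P, and the vertical sides are differences of P across
  a segment of length |y|, hence at most B e^{-c t^2} |y|.\<close>

lemma contour_shift:
  assumes h: "h holomorphic_on {z. l < Im z \<and> Im z < u}" and y: "l < min 0 y" "max 0 y < u"
    and B: "\<And>t \<tau>. min 0 y \<le> \<tau> \<Longrightarrow> \<tau> \<le> max 0 y \<Longrightarrow> cmod (h (of_real t + \<i> * of_real \<tau>)) \<le> B * exp (- c * t\<^sup>2)"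
    and c: "0 < c"
  shows "(LBINT t. h (of_real t)) = (LBINT t. h (of_real t + \<i> * of_real y))"
proof -
  let ?S = "{z. l < Im z \<and> Im z < u}"
  have "open ?S" by (intro open_Collect_conj open_Collect_less continuous_intros)
  have "convex ?S"
  proof -
    have "?S = {z. Im z > l} \<inter> {z. Im z < u}" by auto
    then show ?thesis by (simp add: convex_Int convex_halfspace_Im_gt convex_halfspace_Im_lt)
  qed
  obtain P where P: "\<And>z. z \<in> ?S \<Longrightarrow> (P has_field_derivative h z) (at z)"
  proof -
    obtain P where "\<And>z. z \<in> ?S \<Longrightarrow> (P has_field_derivative h z) (at z within ?S)"
      using holomorphic_convex_primitive'[OF \<open>convex ?S\<close> \<open>open ?S\<close> h] by blast
    then show ?thesis using that at_within_open[OF _ \<open>open ?S\<close>] by metis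
  qed
  have B0: "0 \<le> B" using order_trans[OF norm_ge_zero B[of 0 0]] y by simp
  have hc: "continuous_on ?S h" by (rule holomorphic_on_imp_continuous_on[OF h])
  have lim: "(\<lambda>n. P (of_real (real n) + \<i> * of_real \<tau>) - P (of_real (- real n) + \<i> * of_real \<tau>))
      \<longlonglongrightarrow> (LBINT t. h (of_real t + \<i> * of_real \<tau>))" if \<tau>: "min 0 y \<le> \<tau>" "\<tau> \<le> max 0 y" for \<tau>
  proof -
    let ?k = "\<lambda>t. h (of_real t + \<i> * of_real \<tau>)"
    have S: "of_real t + \<i> * of_real \<tau> \<in> ?S" for t using \<tau> y by auto
    have kc: "continuous_on UNIV ?k"
      by (rule continuous_on_compose2[OF hc]) (use S in \<open>auto intro!: continuous_intros\<close>)
    have d: "((\<lambda>t. P (of_real t + \<i> * of_real \<tau>)) has_vector_derivative ?k t) (at t within A)" for t A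
    proof -
      have "((\<lambda>t. of_real t + \<i> * of_real \<tau>) has_vector_derivative 1) (at t)"
        by (auto intro!: derivative_eq_intros)
      from field_vector_diff_chain_at[OF this P[OF S]] show ?thesis
        by (simp add: o_def has_vector_derivative_at_within)
    qed
    have I: "(LBINT t. indicator {- real n..real n} t *\<^sub>R ?k t)
       = P (of_real (real n) + \<i> * of_real \<tau>) - P (of_real (- real n) + \<i> * of_real \<tau>)" for n
      by (rule integral_FTC_atLeastAtMost) (simp, rule d, rule continuous_on_subset[OF kc], simp)
    have "(\<lambda>n. LBINT t. indicator {- real n..real n} t *\<^sub>R ?k t) \<longlonglongrightarrow> (LBINT t. ?k t)"
    proof (rule integral_dominated_convergence[where w="\<lambda>t. B * exp (0 * \<bar>t\<bar> - c * t\<^sup>2)"])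
      show "integrable lborel (\<lambda>t. B * exp (0 * \<bar>t\<bar> - c * t\<^sup>2))"
        by (intro integrable_mult_right integrable_gauss c)
      show "AE t in lborel. (\<lambda>n. indicator {- real n..real n} t *\<^sub>R ?k t) \<longlonglongrightarrow> ?k t"
      proof (rule AE_I2)
        fix t
        obtain N :: nat where N: "\<bar>t\<bar> \<le> real N" using real_arch_simple by blast
        have "\<forall>\<^sub>F n in sequentially. indicator {- real n..real n} t *\<^sub>R ?k t = ?k t"
          using eventually_ge_at_top[of N] by eventually_elim (use N in \<open>auto simp: indicator_def\<close>)
        then show "(\<lambda>n. indicator {- real n..real n} t *\<^sub>R ?k t) \<longlonglongrightarrow> ?k t" by (rule tendsto_eventually)
      qed
      show "AE t in lborel. norm (indicator {- real n..real n} t *\<^sub>R ?k t) \<le> B * exp (0 * \<bar>t\<bar> - c * t\<^sup>2)" for n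
        using B[OF \<tau>] B0 by (auto simp: indicator_def)
      show "?k \<in> borel_measurable lborel" using kc by (simp add: borel_measurable_continuous_onI)
      then show "(\<lambda>t. indicator {- real n..real n} t *\<^sub>R ?k t) \<in> borel_measurable lborel" for n by simp
    qed
    then show ?thesis unfolding I .
  qed
  have diff: "cmod (P (of_real t) - P (of_real t + \<i> * of_real y)) \<le> B * exp (- c * t\<^sup>2) * \<bar>y\<bar>" for t
  proof -
    let ?T = "closed_segment (of_real t) (of_real t + \<i> * of_real y)"
    have T: "\<exists>\<tau>. z = of_real t + \<i> * of_real \<tau> \<and> min 0 y \<le> \<tau> \<and> \<tau> \<le> max 0 y" if zT: "z \<in> ?T" for z
    proof -
      obtain v where v: "0 \<le> v" "v \<le> 1" "z = of_real t + \<i> * of_real (v * y)"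
        using zT unfolding closed_segment_def by (auto simp: algebra_simps scaleR_conv_of_real)
      have "min 0 y \<le> v * y \<and> v * y \<le> max 0 y"
        using v mult_right_mono[of v 1 y] mult_right_mono_neg[of v 1 y] mult_nonneg_nonneg[of v y] mult_nonneg_nonpos[of v y]
        by (cases "y \<ge> 0") auto
      then show ?thesis using v by blast
    qed
    have "cmod (P (of_real t) - P (of_real t + \<i> * of_real y)) \<le> B * exp (- c * t\<^sup>2) * cmod (of_real t - (of_real t + \<i> * of_real y))"
    proof (rule field_differentiable_bound[of ?T _ h])
      fix z assume "z \<in> ?T"
      then obtain \<tau> where \<tau>: "z = of_real t + \<i> * of_real \<tau>" "min 0 y \<le> \<tau>" "\<tau> \<le> max 0 y" using T by blast
      then have "z \<in> ?S" using y by auto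
      then show "(P has_field_derivative h z) (at z within ?T)" by (rule has_field_derivative_at_within[OF P])
      show "cmod (h z) \<le> B * exp (- c * t\<^sup>2)" using B \<tau> by simp
    qed auto
    then show ?thesis by (simp add: norm_mult)
  qed
  let ?d = "\<lambda>n. (P (of_real (real n) + \<i> * of_real 0) - P (of_real (- real n) + \<i> * of_real 0)) -
     (P (of_real (real n) + \<i> * of_real y) - P (of_real (- real n) + \<i> * of_real y))"
  have "?d \<longlonglongrightarrow> 0"
  proof (rule Lim_null_comparison)
    show "\<forall>\<^sub>F n in sequentially. norm (?d n) \<le> 2 * B * \<bar>y\<bar> * exp (- c * (real n)\<^sup>2)"
    proof (rule always_eventually, rule allI)
      fix n
      have "?d n = (P (of_real (real n)) - P (of_real (real n) + \<i> * of_real y)) -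
        (P (of_real (- real n)) - P (of_real (- real n) + \<i> * of_real y))" by simp
      then have "norm (?d n) \<le> B * exp (- c * (real n)\<^sup>2) * \<bar>y\<bar> + B * exp (- c * (- real n)\<^sup>2) * \<bar>y\<bar>"
        by (simp only:) (intro order_trans[OF norm_triangle_ineq4] add_mono diff)
      then show "norm (?d n) \<le> 2 * B * \<bar>y\<bar> * exp (- c * (real n)\<^sup>2)" by (simp add: algebra_simps)
    qed
    have "(\<lambda>n. exp (- c * (real n)\<^sup>2)) \<longlonglongrightarrow> 0"
    proof (rule filterlim_compose[OF exp_at_bot])
      have "filterlim (\<lambda>n. c * (real n)\<^sup>2) at_top sequentially"
        by (intro filterlim_tendsto_pos_mult_at_top[OF tendsto_const c] filterlim_pow_at_top filterlim_real_sequentially) simp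
      then show "filterlim (\<lambda>n. - c * (real n)\<^sup>2) at_bot sequentially"
        by (simp add: filterlim_uminus_at_top)
    qed
    then show "(\<lambda>n. 2 * B * \<bar>y\<bar> * exp (- c * (real n)\<^sup>2)) \<longlonglongrightarrow> 0"
      by (rule tendsto_mult_right_zero)
  qed
  moreover have "?d \<longlonglongrightarrow> (LBINT t. h (of_real t + \<i> * of_real 0)) - (LBINT t. h (of_real t + \<i> * of_real y))"
    by (intro tendsto_diff lim) auto
  ultimately have "(LBINT t. h (of_real t + \<i> * of_real 0)) - (LBINT t. h (of_real t + \<i> * of_real y)) = 0"
    using LIMSEQ_unique by blast
  then show ?thesis by simp
qed

lemma integrable_lborel_pair:
  fixes f :: "real \<Rightarrow> real \<Rightarrow> complex"
  assumes f: "continuous_on UNIV (\<lambda>(x, y). f x y)"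
    and le: "\<And>x y. cmod (f x y) \<le> u x * w y" and u: "integrable lborel u" and w: "integrable lborel w"
  shows "integrable (lborel \<Otimes>\<^sub>M lborel) (\<lambda>(x, y). f x y)"
proof (rule lborel_pair.Fubini_integrable)
  have fb: "(\<lambda>(x, y). f x y) \<in> borel_measurable borel"
    by (rule borel_measurable_continuous_onI[OF f])
  then show meas: "(\<lambda>(x, y). f x y) \<in> borel_measurable (lborel \<Otimes>\<^sub>M lborel)"
    by (simp add: lborel_prod)
  have fx: "f x \<in> borel_measurable lborel" for x
  proof -
    have "continuous_on UNIV (\<lambda>y. (\<lambda>(x, y). f x y) (x, y))"
      by (rule continuous_on_compose2[OF f]) (auto intro!: continuous_intros)
    then show ?thesis by (simp add: borel_measurable_continuous_onI)
  qed
  have fx1: "integrable lborel (f x)" for x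
    by (rule Bochner_Integration.integrable_bound[OF integrable_mult_right[OF w, of "u x"] fx])
      (use le in \<open>auto intro: order_trans[OF le abs_ge_self]\<close>)
  then show "AE x in lborel. integrable lborel (\<lambda>y. (\<lambda>(x, y). f x y) (x, y))" by simp
  show "integrable lborel (\<lambda>x. LBINT y. norm ((\<lambda>(x, y). f x y) (x, y)))"
  proof (rule Bochner_Integration.integrable_bound)
    show "integrable lborel (\<lambda>x. u x * (LBINT y. w y))" by (intro integrable_mult_left u)
    have "(LBINT y. norm (f x y)) \<le> u x * (LBINT y. w y)" for x
    proof -
      have "(LBINT y. norm (f x y)) \<le> (LBINT y. u x * w y)"
        by (intro integral_mono integrable_norm fx1 integrable_mult_right w le)
      then show ?thesis by simp
    qed
    moreover have "0 \<le> (LBINT y. norm (f x y))" for x by (intro Bochner_Integration.integral_nonneg) simp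
    ultimately show "AE x in lborel. norm (LBINT y. norm ((\<lambda>(x, y). f x y) (x, y))) \<le> norm (u x * (LBINT y. w y))"
      by (auto intro: order_trans[OF _ abs_ge_self])
    show "(\<lambda>x. LBINT y. norm ((\<lambda>(x, y). f x y) (x, y))) \<in> borel_measurable lborel"
      by (intro lborel.borel_measurable_lebesgue_integral) (use meas in \<open>simp add: case_prod_unfold\<close>)
  qed
qed

lemma fubini_lborel:
  fixes f :: "real \<Rightarrow> real \<Rightarrow> complex"
  assumes "continuous_on UNIV (\<lambda>(x, y). f x y)" "\<And>x y. cmod (f x y) \<le> u x * w y"
    "integrable lborel u" "integrable lborel w"
  shows "(LBINT y. (LBINT x. f x y)) = (LBINT x. (LBINT y. f x y))"
  using lborel_pair.Fubini_integral[OF integrable_lborel_pair[OF assms]] .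

lemma distribution_fhat: "distribution (\<lambda>f. fhat f n)"
proof -
  have c: "continuous_on UNIV (\<lambda>t. f (cis t))" if "f \<in> C\<^sup>\<infinity>" for f
    using smooth_continuous[OF that, of UNIV 0] by (simp add: angle_deriv_0[abs_def])
  have "fhat (\<lambda>z. f z + g z) n = fhat f n + fhat g n" if "f \<in> C\<^sup>\<infinity>" "g \<in> C\<^sup>\<infinity>" for f g
    using fourier_lin_UNIV[OF c[OF that(1)] c[OF that(2)], of 1 1 n] by (simp add: fhat_def)
  moreover have "fhat (\<lambda>z. a * f z) n = a * fhat f n" if "f \<in> C\<^sup>\<infinity>" for f a
    using fourier_lin_UNIV[OF c[OF that] c[OF that], of a 0 n] by (simp add: fhat_def)
  moreover have "cmod (fhat f n) \<le> 1 * CN_norm 0 f" if "f \<in> C\<^sup>\<infinity>" for f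
    using fhat_decay[OF that, of n 0] by simp
  ultimately show ?thesis unfolding distribution_def by (intro conjI ballI allI exI[of _ 1] exI[of _ 0])
qed

lemma (in su11_path) distribution_beta_bound:
  assumes T: "distribution T" and f: "f \<in> C\<^sup>\<infinity>"
  shows "\<exists>C M. 0 \<le> C \<and> (\<forall>s. cmod (T (beta d (\<gamma> s) f)) \<le> C * exp (M * \<bar>s\<bar>))"
proof -
  obtain C N where C: "\<And>f. f \<in> C\<^sup>\<infinity> \<Longrightarrow> cmod (T f) \<le> C * CN_norm N f"
    using T unfolding distribution_def by blast
  obtain C' M N' where C': "0 \<le> C'" "\<And>f s. f \<in> C\<^sup>\<infinity> \<Longrightarrow> CN_norm N (beta d (\<gamma> s) f) \<le> C' * exp (M * \<bar>s\<bar>) * CN_norm N' f"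
    using beta_bound[of N d] by blast
  have M: "\<gamma> s \<in> Mob" for s using su11 unfolding Mob_iff by blast
  have "cmod (T (beta d (\<gamma> s) f)) \<le> (\<bar>C\<bar> * (C' * CN_norm N' f)) * exp (M * \<bar>s\<bar>)" for s
  proof -
    have "cmod (T (beta d (\<gamma> s) f)) \<le> \<bar>C\<bar> * CN_norm N (beta d (\<gamma> s) f)"
      by (rule order_trans[OF C[OF beta_smooth[OF M f]]])
        (intro mult_right_mono CN_norm_nonneg beta_smooth M f abs_ge_self)
    also have "\<dots> \<le> \<bar>C\<bar> * (C' * exp (M * \<bar>s\<bar>) * CN_norm N' f)"
      by (intro mult_left_mono C' f) simp
    finally show ?thesis by (simp add: mult_ac)
  qed
  moreover have "0 \<le> \<bar>C\<bar> * (C' * CN_norm N' f)" using C' CN_norm_nonneg[OF f] by simp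
  ultimately show ?thesis by blast
qed

lemma (in su11_path) distribution_beta_continuous:
  assumes T: "distribution T" and f: "f \<in> C\<^sup>\<infinity>"
  shows "continuous_on UNIV (\<lambda>s. T (beta d (\<gamma> s) f))"
proof -
  obtain C N where C: "\<And>f. f \<in> C\<^sup>\<infinity> \<Longrightarrow> cmod (T f) \<le> C * CN_norm N f"
    using T unfolding distribution_def by blast
  have M: "\<gamma> s \<in> Mob" for s using su11 unfolding Mob_iff by blast
  note bs = beta_smooth[OF M f]
  have "((\<lambda>s. T (beta d (\<gamma> s) f) - T (beta d (\<gamma> s0) f)) \<longlongrightarrow> 0) (at s0)" for s0
  proof (rule Lim_null_comparison)
    show "\<forall>\<^sub>F s in at s0. norm (T (beta d (\<gamma> s) f) - T (beta d (\<gamma> s0) f))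
       \<le> C * CN_norm N (\<lambda>z. beta d (\<gamma> s) f z - beta d (\<gamma> s0) f z)"
      using C[OF smooth_diff(1)[OF bs bs]] distribution_diff[OF T bs bs] by (intro always_eventually allI) metis
    show "((\<lambda>s. C * CN_norm N (\<lambda>z. beta d (\<gamma> s) f z - beta d (\<gamma> s0) f z)) \<longlongrightarrow> 0) (at s0)"
      by (intro tendsto_mult_right_zero beta_continuous f)
  qed
  then have "isCont (\<lambda>s. T (beta d (\<gamma> s) f)) s0" for s0 unfolding isCont_def by (rule LIM_zero_cancel)
  then show ?thesis by (simp add: continuous_on_eq_continuous_at)
qed

section \<open>Dilations of the half circles\<close>

text \<open>The one-parameter subgroup fixing 1 and -1. With t/2 in the matrix it becomes the
  translation by t in the coordinate \<open>cayley\<close>.\<close>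

definition dil :: "real \<Rightarrow> complex \<Rightarrow> complex" where
  "dil t = su11_action (of_real (cosh (t / 2))) (of_real (sinh (t / 2)))"

lemma cosh_le_exp_abs: "cosh (t::real) \<le> exp \<bar>t\<bar>"
proof -
  have "exp t + exp (- t) \<le> exp \<bar>t\<bar> + exp \<bar>t\<bar>" by (intro add_mono) simp_all
  then show ?thesis by (simp add: cosh_field_def)
qed

lemma dil_su11: "su11 (of_real (cosh (t / 2))) (of_real (sinh (t / 2)))"
  using hyperbolic_pythagoras[of "t / 2"] by (simp add: su11_def)

interpretation dil: su11_path "\<lambda>t. of_real (cosh (t / 2))" "\<lambda>t. of_real (sinh (t / 2))"
  rewrites "su11_action (of_real (cosh (t / 2))) (of_real (sinh (t / 2))) = dil t"
proof -
  show "su11_path (\<lambda>t. of_real (cosh (t / 2))) (\<lambda>t. of_real (sinh (t / 2)))"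
  proof
    have "cosh (s / 2) \<le> 1 * exp (1 * \<bar>s\<bar>)" for s :: real
      by (rule order_trans[OF cosh_le_exp_abs]) simp
    then have "\<forall>s. cmod (of_real (cosh (s / 2))) \<le> 1 * exp (1 * \<bar>s\<bar>)"
      by (simp add: abs_of_pos)
    then show "\<exists>C M. 0 \<le> C \<and> 0 \<le> M \<and> (\<forall>s. cmod (of_real (cosh (s / 2))) \<le> C * exp (M * \<bar>s\<bar>))"
      by (intro exI[of _ 1] conjI) simp_all
    show "continuous_on UNIV (\<lambda>t. complex_of_real (cosh (t / 2)))" "continuous_on UNIV (\<lambda>t. complex_of_real (sinh (t / 2)))"
      by (intro continuous_intros; simp)+
  qed (rule dil_su11)
qed (simp add: dil_def)

lemma dil_Mob: "dil t \<in> Mob"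
  unfolding dil_def Mob_iff using dil_su11 by blast

lemma dil_comp: "dil s \<circ> dil t = dil (s + t)"
  unfolding dil_def su11_comp(2)[OF dil_su11 dil_su11]
  by (simp add: add_divide_distrib cosh_add sinh_add algebra_simps)

lemma dil_0: "dil 0 = id"
  by (simp add: dil_def su11_action_id)

lemma inv_dil: "inv (dil t) = dil (- t)"
  unfolding dil_def inv_su11_action[OF dil_su11] by simp

text \<open>The sign \<sigma> = 1 or -1 selects the upper or the lower half circle, so that both
  localizations share their proofs.\<close>

definition half_circle :: "real \<Rightarrow> complex set" where
  "half_circle \<sigma> = {z \<in> S\<^sup>1. 0 < \<sigma> * Im z}"

text \<open>Real w run through the upper half circle from -1 to 1. Replacing w by w + i\<pi> negates
  exp w and so inverts the value: here the shift by i\<pi> meets the reflection z \<mapsto>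
  1/z.\<close>

definition cayley :: "complex \<Rightarrow> complex" where
  "cayley w = (exp w + \<i>) / (exp w - \<i>)"

definition cayley_angle :: "real \<Rightarrow> real" where
  "cayley_angle w = 2 * arctan (exp (- w))"

lemma exp_minus_i_nonzero: "exp (complex_of_real w) - \<i> \<noteq> 0" "exp (complex_of_real w) + \<i> \<noteq> 0"
  by (auto simp: complex_eq_iff Re_exp Im_exp)

lemma cis_cayley_angle: "cis (cayley_angle w) = cayley (of_real w)"
proof -
  define s where "s = exp (- w)"
  have s: "s * exp w = 1" by (simp add: s_def exp_minus)
  have nz: "1 - \<i> * of_real s \<noteq> 0" "1 + s\<^sup>2 > 0" "sqrt (1 + s\<^sup>2) \<noteq> 0"
    by (auto simp: complex_eq_iff add_nonneg_eq_0_iff intro: add_pos_nonneg)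
  have "cis (arctan s) = (1 + \<i> * of_real s) / of_real (sqrt (1 + s\<^sup>2))"
    by (simp add: complex_eq_iff cos_arctan sin_arctan)
  then have "cis (cayley_angle w) = ((1 + \<i> * of_real s) / of_real (sqrt (1 + s\<^sup>2))) * ((1 + \<i> * of_real s) / of_real (sqrt (1 + s\<^sup>2)))"
    unfolding cayley_angle_def s_def[symmetric] by (metis cis_mult mult_2)
  also have "\<dots> = ((1 + \<i> * of_real s) * (1 + \<i> * of_real s)) / of_real (1 + s\<^sup>2)"
    using nz(2) by (simp flip: of_real_mult)
  also have "of_real (1 + s\<^sup>2) = (1 + \<i> * of_real s) * (1 - \<i> * of_real s)"
    by (simp add: power2_eq_square algebra_simps)
  also have "((1 + \<i> * of_real s) * (1 + \<i> * of_real s)) / ((1 + \<i> * of_real s) * (1 - \<i> * of_real s))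
      = (1 + \<i> * of_real s) / (1 - \<i> * of_real s)"
    by (simp add: complex_eq_iff)
  also have "\<dots> = ((1 + \<i> * of_real s) * exp (of_real w)) / ((1 - \<i> * of_real s) * exp (of_real w))"
    by simp
  also have "of_real s * exp (of_real w) = (1::complex)"
    using s by (metis exp_of_real of_real_1 of_real_mult)
  then have "((1 + \<i> * of_real s) * exp (of_real w)) / ((1 - \<i> * of_real s) * exp (of_real w)) = cayley (of_real w)"
    unfolding cayley_def by (simp add: algebra_simps)
  finally show ?thesis .
qed

lemma cosh_complex_exp:
  "complex_of_real (cosh w) = (exp (of_real w) + \<i>) * (exp (of_real w) - \<i>) / (2 * exp (of_real w))"
proof -
  have "complex_of_real (cosh w) = (exp (of_real w) + exp (- of_real w)) / 2"
    by (simp add: cosh_field_def exp_of_real[symmetric])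
  then show ?thesis by (simp add: exp_minus field_simps power2_eq_square)
qed

lemma cayley_real: "cayley (of_real w) = Complex (tanh w) (1 / cosh w)"
proof -
  let ?E = "exp (complex_of_real w)"
  have c: "cosh w \<noteq> 0" by simp
  have "cayley (of_real w) * of_real (cosh w) = (?E + \<i>) * (?E + \<i>) / (2 * ?E)"
    unfolding cayley_def cosh_complex_exp using exp_minus_i_nonzero[of w] by (simp add: field_simps)
  also have "\<dots> = of_real (sinh w) + \<i>"
  proof -
    have "complex_of_real (sinh w) = (?E - exp (- of_real w)) / 2"
      by (simp add: sinh_field_def exp_of_real[symmetric])
    then show ?thesis by (simp add: exp_minus field_simps power2_eq_square)
  qed
  finally have "cayley (of_real w) = (of_real (sinh w) + \<i>) / of_real (cosh w)" using c by (simp add: field_simps)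
  then show ?thesis using c by (simp add: complex_eq_iff tanh_def)
qed

lemma dil_cayley: "dil t (cayley (of_real w)) = cayley (of_real (w + t))"
proof -
  define E where "E = exp (complex_of_real w)"
  define p where "p = exp (complex_of_real (t / 2))"
  have nz: "E - \<i> \<noteq> 0" "p \<noteq> 0" using exp_minus_i_nonzero by (auto simp: E_def p_def)
  have nz2: "E * p - \<i> * inverse p \<noteq> 0"
  proof
    assume "E * p - \<i> * inverse p = 0"
    then have "E * p * p = \<i>" using nz by (simp add: field_simps)
    then have "exp (complex_of_real (w + t)) = \<i>" unfolding E_def p_def by (simp add: exp_add[symmetric] mult.assoc add.commute)
    then show False using exp_minus_i_nonzero(1)[of "w + t"] by simp
  qed
  have cs: "complex_of_real (cosh (t / 2)) = (p + inverse p) / 2" "complex_of_real (sinh (t / 2)) = (p - inverse p) / 2"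
    by (simp_all add: cosh_field_def sinh_field_def p_def exp_of_real[symmetric] exp_minus)
  have n1: "cmod (cayley (of_real w)) \<le> 1" by (simp flip: cis_cayley_angle)
  have "dil t (cayley (of_real w)) = ((p + inverse p) / 2 * ((E + \<i>) / (E - \<i>)) + (p - inverse p) / 2) /
      ((p - inverse p) / 2 * ((E + \<i>) / (E - \<i>)) + (p + inverse p) / 2)"
  proof -
    have "dil t (cayley (of_real w)) = (of_real (cosh (t / 2)) * cayley (of_real w) + of_real (sinh (t / 2))) /
        (of_real (sinh (t / 2)) * cayley (of_real w) + of_real (cosh (t / 2)))"
      using n1 by (simp add: dil_def su11_action_def)
    then show ?thesis unfolding cs by (simp only: cayley_def E_def)
  qed
  also have "\<dots> = (((p + inverse p) / 2 * (E + \<i>) + (p - inverse p) / 2 * (E - \<i>)) / (E - \<i>)) /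
      (((p - inverse p) / 2 * (E + \<i>) + (p + inverse p) / 2 * (E - \<i>)) / (E - \<i>))"
  proof -
    have "x * (y / (E - \<i>)) + z = (x * y + z * (E - \<i>)) / (E - \<i>)" for x y z
      using nz(1) by (simp add: divide_add_eq_iff)
    note frac = this
    show ?thesis unfolding frac ..
  qed
  also have "\<dots> = ((p + inverse p) / 2 * (E + \<i>) + (p - inverse p) / 2 * (E - \<i>)) /
      ((p - inverse p) / 2 * (E + \<i>) + (p + inverse p) / 2 * (E - \<i>))"
    using nz(1) by simp
  also have "(p + r) / 2 * (E + \<i>) + (p - r) / 2 * (E - \<i>) = E * p + \<i> * r" for r
    by (simp add: field_simps)
  also have "(p - r) / 2 * (E + \<i>) + (p + r) / 2 * (E - \<i>) = E * p - \<i> * r" for r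
    by (simp add: field_simps)
  also have "(E * p + \<i> * inverse p) / (E * p - \<i> * inverse p)
     = ((E * p + \<i> * inverse p) * p) / ((E * p - \<i> * inverse p) * p)" using nz by simp
  also have "\<dots> = (E * (p * p) + \<i>) / (E * (p * p) - \<i>)" using nz(2) by (simp add: algebra_simps)
  also have "E * (p * p) = exp (of_real (w + t))"
    unfolding E_def p_def by (simp add: exp_add[symmetric])
  finally show ?thesis by (simp add: cayley_def)
qed

text \<open>The angle of \<open>cayley w\<close> has derivative -1/cosh w, so a translation that
  ends at w and starts at w - t has angular speed cosh(w - t)/cosh w.\<close>

lemma pole_factor_dil:
  "pole_factor (of_real (cosh (t / 2))) (of_real (sinh (t / 2))) (cayley (of_real w)) = of_real (cosh (w - t) / cosh w)"
proof -
  have "pole_factor (of_real (cosh (t / 2))) (of_real (sinh (t / 2))) (cayley (of_real w))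
     = of_real ((cosh (t / 2) - sinh (t / 2) * tanh w)\<^sup>2 + (sinh (t / 2) / cosh w)\<^sup>2)"
    unfolding pole_factor_def complex_norm_square[symmetric] cmod_power2 cayley_real
    by (simp add: power_divide)
  also have "(cosh (t / 2) - sinh (t / 2) * tanh w)\<^sup>2 + (sinh (t / 2) / cosh w)\<^sup>2 = cosh (w - t) / cosh w"
  proof -
    have ct: "cosh t = (cosh (t/2))\<^sup>2 + (sinh (t/2))\<^sup>2" "sinh t = 2 * sinh (t/2) * cosh (t/2)"
      using cosh_add[of "t/2" "t/2"] sinh_add[of "t/2" "t/2"] by (simp_all add: power2_eq_square)
    have tn: "(tanh w)\<^sup>2 + (1 / cosh w)\<^sup>2 = 1"
    proof -
      have "(sinh w)\<^sup>2 + 1 = (cosh w)\<^sup>2" using hyperbolic_pythagoras[of w] by simp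
      moreover have "cosh w > 0" by simp
      ultimately show ?thesis by (simp add: tanh_def power_divide add_divide_distrib[symmetric])
    qed
    have "(cosh (t / 2) - sinh (t / 2) * tanh w)\<^sup>2 + (sinh (t / 2) / cosh w)\<^sup>2
       = (cosh (t/2))\<^sup>2 - 2 * sinh (t/2) * cosh (t/2) * tanh w + (sinh (t/2))\<^sup>2 * ((tanh w)\<^sup>2 + (1 / cosh w)\<^sup>2)"
      by (simp add: power2_eq_square algebra_simps)
    also have "\<dots> = cosh t - sinh t * tanh w" unfolding tn ct by simp
    also have "\<dots> = cosh (w - t) / cosh w" by (simp add: cosh_diff tanh_def field_simps)
    finally show ?thesis .
  qed
  finally show ?thesis .
qed

lemma cayley_circle: "cayley (of_real w) \<in> S\<^sup>1"
  by (simp flip: cis_cayley_angle)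

lemma beta_dil_cayley:
  "beta d (dil t) f (cayley (of_real w)) = of_real (cosh (w - t) / cosh w) powi (int d - 1) * f (cayley (of_real (w - t)))"
proof -
  have "inv (dil t) (cayley (of_real w)) = cayley (of_real (w - t))"
    by (simp only: inv_dil dil_cayley) simp
  moreover have "inv (dil t) z = (of_real (cosh (t / 2)) * z - of_real (sinh (t / 2))) / (of_real (cosh (t / 2)) - of_real (sinh (t / 2)) * z)"
    if "z \<in> S\<^sup>1" for z
    using that by (simp add: inv_dil) (simp add: dil_def su11_action_def)
  ultimately show ?thesis
    unfolding dil_def[of t] beta_su11[OF dil_su11 cayley_circle] pole_factor_dil
    using cayley_circle by simp
qed

lemma dil_half_circle: "dil t ` half_circle \<sigma> = half_circle \<sigma>"
proof -
  have sub: "dil t ` half_circle \<sigma> \<subseteq> half_circle \<sigma>" for t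
  proof (rule image_subsetI)
    fix z assume z: "z \<in> half_circle \<sigma>"
    then have zc: "z \<in> S\<^sup>1" by (simp add: half_circle_def)
    let ?c = "cosh (t / 2)" and ?s = "sinh (t / 2)"
    have dz: "dil t z = (of_real ?c * z + of_real ?s) / (of_real ?s * z + of_real ?c)"
      using zc by (simp add: dil_def su11_action_def)
    have nz: "of_real ?s * z + of_real ?c \<noteq> (0::complex)"
      using su11_denom[OF dil_su11, of z t] zc by simp
    have "Im (dil t z) = Im ((of_real ?c * z + of_real ?s) * cnj (of_real ?s * z + of_real ?c)) / (cmod (of_real ?s * z + of_real ?c))\<^sup>2"
      unfolding dz by (subst complex_div_cnj) (simp add: Im_divide_of_real flip: of_real_power)
    also have "Im ((of_real ?c * z + of_real ?s) * cnj (of_real ?s * z + of_real ?c)) = (?c\<^sup>2 - ?s\<^sup>2) * Im z"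
      by (simp add: power2_eq_square algebra_simps)
    finally have "Im (dil t z) = Im z / (cmod (of_real ?s * z + of_real ?c))\<^sup>2"
      using hyperbolic_pythagoras[of "t/2"] by simp
    then have "\<sigma> * Im (dil t z) > 0" using z nz by (simp add: half_circle_def)
    moreover have "dil t z \<in> S\<^sup>1" using Mob_circle[OF dil_Mob] zc by blast
    ultimately show "dil t z \<in> half_circle \<sigma>" by (simp add: half_circle_def)
  qed
  moreover have "half_circle \<sigma> \<subseteq> dil t ` half_circle \<sigma>"
  proof
    fix z assume "z \<in> half_circle \<sigma>"
    then have "dil (- t) z \<in> half_circle \<sigma>" using sub[of "- t"] by blast
    moreover have "z = dil t (dil (- t) z)" using fun_cong[OF dil_comp[of t "- t"], of z] by (simp add: dil_0)
    ultimately show "z \<in> dil t ` half_circle \<sigma>" by blast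
  qed
  ultimately show ?thesis by blast
qed

lemma beta_dil_supp: "f \<in> C\<^sup>\<infinity> \<Longrightarrow> supp f \<subseteq> half_circle \<sigma> \<Longrightarrow> supp (beta d (dil t) f) \<subseteq> half_circle \<sigma>"
  using supp_beta[OF dil_Mob, of f "half_circle \<sigma>" d t] by (simp add: dil_half_circle)

lemma zero_off_supp: "z \<notin> supp f \<Longrightarrow> f z = 0"
  unfolding supp_def using subsetD[OF closure_subset, of z "{z. f z \<noteq> 0}"] by blast

text \<open>The support is compact in the open half circle, so Im z, which is 1/cosh w, is bounded
  below on it by a positive number.\<close>

lemma cayley_cutoff:
  assumes f: "f \<in> C\<^sup>\<infinity>" and s: "supp f \<subseteq> half_circle 1"
  obtains R where "0 < R" "\<And>w. R \<le> \<bar>w\<bar> \<Longrightarrow> f (cayley (of_real w)) = 0"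
proof (cases "supp f = {}")
  case True
  then show ?thesis using that[of 1] zero_off_supp[of _ f] by simp
next
  case False
  have "compact (supp f)"
    using smooth_supp_circle[OF f] unfolding supp_def
    by (auto simp: compact_eq_bounded_closed intro: bounded_subset[of "S\<^sup>1"])
  moreover have "continuous_on (supp f) Im" by (intro continuous_intros)
  ultimately obtain z0 where z0: "z0 \<in> supp f" "\<And>z. z \<in> supp f \<Longrightarrow> Im z0 \<le> Im z"
    using continuous_attains_inf[of "supp f" Im] False by blast
  have pos: "Im z0 > 0" using s z0 by (auto simp: half_circle_def)
  show ?thesis
  proof (rule that[of "2 / Im z0"])
    fix w assume w: "2 / Im z0 \<le> \<bar>w\<bar>"
    show "f (cayley (of_real w)) = 0"
    proof (rule zero_off_supp[of _ f], rule notI)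
      assume "cayley (of_real w) \<in> supp f"
      then have "Im z0 \<le> 1 / cosh w" using z0(2) by (force simp: cayley_real)
      moreover have "cosh w > \<bar>w\<bar> / 2"
      proof -
        have "1 + \<bar>w\<bar> \<le> exp \<bar>w\<bar>" by (rule exp_ge_add_one_self)
        moreover have "exp \<bar>w\<bar> \<le> exp w + exp (- w)" by (simp add: abs_if)
        ultimately have "1 + \<bar>w\<bar> \<le> exp w + exp (- w)" by (rule order_trans)
        then show ?thesis by (simp add: cosh_field_def)
      qed
      then have "1 / Im z0 < cosh w" using w divide_divide_eq_left[of 2 "Im z0" 2] by simp
      then have "1 / cosh w < Im z0" using pos by (simp add: field_simps)
      ultimately show False by simp
    qed
  qed (use pos in simp)
qed

text \<open>The function f \<circ> z^{-1} of the PCT transformation. It exchanges the half circles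
  and commutes with the action of dilations, whose matrices are real.\<close>

definition reflect :: "(complex \<Rightarrow> complex) \<Rightarrow> complex \<Rightarrow> complex" where
  "reflect f z = f (inverse z)"

lemma reflect_smooth: "f \<in> C\<^sup>\<infinity> \<Longrightarrow> reflect f \<in> C\<^sup>\<infinity>"
  using smooth_inverse_arg by (simp add: reflect_def[abs_def])

lemma reflect_reflect: "reflect (reflect f) = f"
  by (simp add: reflect_def fun_eq_iff)

lemma inverse_circle: "z \<in> S\<^sup>1 \<Longrightarrow> inverse z = cnj z"
  using circle_cnj[of z] by (simp add: inverse_unique)

lemma reflect_supp:
  assumes f: "f \<in> C\<^sup>\<infinity>" and s: "supp f \<subseteq> half_circle \<sigma>" shows "supp (reflect f) \<subseteq> half_circle (- \<sigma>)"
proof -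
  have "compact (supp f)"
    using smooth_supp_circle[OF f] unfolding supp_def
    by (auto simp: compact_eq_bounded_closed intro: bounded_subset[of "S\<^sup>1"])
  then have "closed (cnj ` supp f)"
    by (intro compact_imp_closed compact_continuous_image continuous_intros)
  moreover have "{z. reflect f z \<noteq> 0} \<subseteq> cnj ` supp f"
  proof
    fix z assume "z \<in> {z. reflect f z \<noteq> 0}"
    then have nz: "f (inverse z) \<noteq> 0" by (simp add: reflect_def)
    then have "inverse z \<in> S\<^sup>1" using smooth_off_circle[OF f] by blast
    then have "z \<in> S\<^sup>1" by (simp add: norm_inverse)
    then have iz: "inverse z = cnj z" by (rule inverse_circle)
    have "cnj z \<in> supp f" using nz zero_off_supp[of "cnj z" f] iz by auto
    then show "z \<in> cnj ` supp f" by (rule image_eqI[rotated]) simp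
  qed
  ultimately have "supp (reflect f) \<subseteq> cnj ` supp f"
    unfolding supp_def[of "reflect f"] by (rule closure_minimal[rotated])
  moreover have "cnj y \<in> half_circle (- \<sigma>)" if "y \<in> supp f" for y
    using subsetD[OF s that] by (simp add: half_circle_def)
  ultimately show ?thesis by blast
qed

lemma beta_dil_reflect:
  assumes f: "f \<in> C\<^sup>\<infinity>"
  shows "beta d (dil t) (reflect f) = reflect (beta d (dil t) f)"
proof
  fix z
  show "beta d (dil t) (reflect f) z = reflect (beta d (dil t) f) z"
  proof (cases "z \<in> S\<^sup>1")
    case True
    then have c: "cnj z \<in> S\<^sup>1" by simp
    let ?c = "complex_of_real (cosh (t/2))" and ?s = "complex_of_real (sinh (t/2))"
    have "inverse ((?c * z - ?s) / (?c - ?s * z)) = (?c * cnj z - ?s) / (?c - ?s * cnj z)"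
    proof -
      have "(?c * z - ?s) / (?c - ?s * z) \<in> S\<^sup>1"
        using su11_action_norm(2)[OF su11_uminus[OF dil_su11], of t z] True by (simp add: su11_action_def)
      then show ?thesis by (subst inverse_circle) simp_all
    qed
    moreover have "pole_factor ?c ?s z = pole_factor ?c ?s (cnj z)"
      by (simp add: pole_factor_def mult.commute)
    ultimately show ?thesis
      unfolding reflect_def inverse_circle[OF True] dil_def beta_su11[OF dil_su11 True] beta_su11[OF dil_su11 c]
      by simp
  next
    case False
    then have "inverse z \<notin> S\<^sup>1" by (simp add: norm_inverse)
    then show ?thesis
      using beta_off_circle[OF dil_Mob f] beta_off_circle[OF dil_Mob reflect_smooth[OF f] False]
      by (simp add: reflect_def)
  qed
qed

lemma fhat_reflect:
  assumes f: "f \<in> C\<^sup>\<infinity>" shows "fhat (reflect f) n = fhat f (- n)"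
proof -
  let ?g = "\<lambda>t. f (cis t) * cis (of_int n * t)"
  have c: "continuous_on UNIV (\<lambda>t. f (cis t))"
    using smooth_continuous[OF f, of UNIV 0] by (simp add: angle_deriv_0[abs_def])
  have cp: "cis (of_int n * (t + 2 * pi)) = cis (of_int n * t)" for t
    using cis_periodic(2)[of "of_int n * t" n] by (simp add: algebra_simps)
  have per: "?g (t + 2 * pi) = ?g t" for t unfolding cp by (simp add: cis_periodic)
  have "integral {0..2*pi} (\<lambda>t. ?g (- t)) = integral {- (2*pi)..0} ?g"
    using Henstock_Kurzweil_Integration.integral_reflect_real[of 0 "- (2*pi)" ?g] by (simp only: minus_zero minus_minus)
  also have "\<dots> = integral {0..2*pi} (\<lambda>t. ?g (t + - (2 * pi)))"
    using integral_shift_real_ivl[of "- (2*pi)" "- (2*pi)" 0 ?g] by simp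
  also have "\<dots> = integral {0..2*pi} ?g"
    by (rule integral_periodic_shift[of ?g]) (intro continuous_intros c, rule per)
  finally show ?thesis by (simp add: fhat_def fourier_def reflect_def)
qed

section \<open>Fourier modes of functions supported in the upper half circle\<close>

lemma cayley_angle_deriv: "(cayley_angle has_real_derivative - (1 / cosh w)) (at w)"
proof -
  have "(cayley_angle has_real_derivative 2 * (inverse (1 + (exp (- w))\<^sup>2) * (exp (- w) * - 1))) (at w)"
    unfolding cayley_angle_def by (auto intro!: derivative_eq_intros)
  moreover have "2 * (inverse (1 + (exp (- w))\<^sup>2) * (exp (- w) * - 1)) = - (1 / cosh w)"
  proof -
    have "(1 + (exp (- w))\<^sup>2) * exp w = 2 * cosh w"
      by (simp add: cosh_field_def power2_eq_square algebra_simps flip: exp_add)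
    moreover have "1 + (exp (- w))\<^sup>2 \<noteq> 0" by (metis add_pos_nonneg less_numeral_extra(3) zero_le_power2 zero_less_one)
    ultimately show ?thesis by (simp add: exp_minus field_simps)
  qed
  ultimately show ?thesis by simp
qed

lemma cayley_angle_range: "0 < cayley_angle w" "cayley_angle w < pi"
  using arctan_ubound[of "exp (- w)"] zero_less_arctan_iff[of "exp (- w)"] by (auto simp: cayley_angle_def)

lemma cayley_angle_surj:
  assumes "0 < \<theta>" "\<theta> < pi" obtains w where "cayley_angle w = \<theta>"
proof -
  have t: "tan (\<theta> / 2) > 0" using assms by (intro tan_gt_zero) auto
  have "cayley_angle (- ln (tan (\<theta> / 2))) = 2 * arctan (tan (\<theta> / 2))"
    using t by (simp add: cayley_angle_def)
  also have "\<dots> = \<theta>" using assms by (subst arctan_tan) auto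
  finally show ?thesis by (rule that)
qed

lemma cayley_angle_antimono: "w \<le> w' \<Longrightarrow> cayley_angle w' \<le> cayley_angle w"
  by (simp add: cayley_angle_def arctan_le_iff)

lemma fhat_upper_half:
  assumes h: "h \<in> C\<^sup>\<infinity>" and s: "supp h \<subseteq> half_circle 1"
    and R: "\<And>w. R \<le> \<bar>w\<bar> \<Longrightarrow> h (cayley (of_real w)) = 0" "0 < R"
  shows "fhat h m = of_real (1 / (2 * pi)) *
    (LBINT w. h (cayley (of_real w)) * cis (- (of_int m * cayley_angle w)) / of_real (cosh w))"
proof -
  let ?G = "\<lambda>\<theta>. h (cis \<theta>) * cis (- (of_int m * \<theta>))"
  let ?\<psi> = "\<lambda>w. h (cayley (of_real w)) * cis (- (of_int m * cayley_angle w)) / of_real (cosh w)"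
  have c: "continuous_on UNIV (\<lambda>t. h (cis t))"
    using smooth_continuous[OF h, of UNIV 0] by (simp add: angle_deriv_0[abs_def])
  have cG: "continuous_on A ?G" for A
    by (intro continuous_intros continuous_on_subset[OF c]) auto
  have cang: "continuous_on A cayley_angle" for A
    by (meson DERIV_isCont cayley_angle_deriv continuous_at_imp_continuous_on)
  have c\<psi>: "continuous_on UNIV ?\<psi>"
    unfolding cis_cayley_angle[symmetric]
    by (intro continuous_intros continuous_on_compose2[OF c cang] cang) auto
  define l where "l = cayley_angle R"
  define u where "u = cayley_angle (- R)"
  have lu: "0 \<le> l" "l \<le> u" "u \<le> 2 * pi"
    using cayley_angle_range[of R] cayley_angle_range[of "- R"] cayley_angle_antimono[of "- R" R] R(2) by (auto simp: l_def u_def)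
  have G0: "?G \<theta> = 0" if \<theta>: "\<theta> \<in> {0..2*pi}" "\<theta> \<notin> {l..u}" for \<theta>
  proof -
    have "h (cis \<theta>) = 0"
    proof (cases "0 < \<theta> \<and> \<theta> < pi")
      case True
      then obtain w where w: "cayley_angle w = \<theta>" using cayley_angle_surj by blast
      have "R \<le> \<bar>w\<bar>"
      proof (rule ccontr)
        assume "\<not> R \<le> \<bar>w\<bar>"
        then have "- R \<le> w" "w \<le> R" by auto
        then have "l \<le> \<theta>" "\<theta> \<le> u" unfolding l_def u_def w[symmetric] by (auto intro: cayley_angle_antimono)
        then show False using \<theta> by simp
      qed
      then show ?thesis using R(1)[of w] w cis_cayley_angle[of w] by simp
    next
      case False
      then have "sin \<theta> \<le> 0"
      proof (cases "\<theta> = 0")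
        case False
        then have "pi \<le> \<theta>" "\<theta> \<le> 2 * pi" using \<open>\<not> (0 < \<theta> \<and> \<theta> < pi)\<close> \<theta> by auto
        then have "0 \<le> sin (\<theta> - pi)" by (intro sin_ge_zero) auto
        then show ?thesis by (simp add: sin_diff)
      qed simp
      then have "cis \<theta> \<notin> half_circle 1" by (simp add: half_circle_def)
      then show ?thesis using s zero_off_supp by blast
    qed
    then show ?thesis by simp
  qed
  have Glu: "integral {0..2*pi} ?G = integral {l..u} ?G"
  proof -
    have "integral {0..2*pi} ?G = integral {0..2*pi} (\<lambda>\<theta>. if \<theta> \<in> {l..u} then ?G \<theta> else 0)"
      by (rule Henstock_Kurzweil_Integration.integral_cong) (use G0 in auto)
    also have "\<dots> = integral {l..u} ?G"
    proof -
      have "{l..u} \<inter> {0..2*pi} = {l..u}" using lu by auto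
      then show ?thesis by (simp only: integral_restrict_Int)
    qed
    finally show ?thesis .
  qed
  \<comment> \<open>\<open>cayley_angle\<close> is decreasing, so the substitution uses -x; the sign
    is undone afterwards by reflecting the integral.\<close>
  have "((\<lambda>x. (1 / cosh x) *\<^sub>R ?G (cayley_angle (- x))) has_integral integral {cayley_angle (- (- R))..cayley_angle (- R)} ?G) {- R..R}"
  proof (rule has_integral_substitution[where c=0 and d=pi])
    show "cayley_angle (- (- R)) \<le> cayley_angle (- R)" using R(2) by (intro cayley_angle_antimono) simp
    show "(\<lambda>x. cayley_angle (- x)) ` {- R..R} \<subseteq> {0..pi}" by (auto intro!: less_imp_le[OF cayley_angle_range(1)] less_imp_le[OF cayley_angle_range(2)])
    show "((\<lambda>x. cayley_angle (- x)) has_real_derivative 1 / cosh x) (at x within {- R..R})" for x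
    proof (rule has_field_derivative_at_within)
      have "((\<lambda>x. cayley_angle (- x)) has_real_derivative - (1 / cosh (- x)) * - 1) (at x)"
        by (rule DERIV_chain2[OF cayley_angle_deriv DERIV_minus[OF DERIV_ident]])
      then show "((\<lambda>x. cayley_angle (- x)) has_real_derivative 1 / cosh x) (at x)" by simp
    qed
  qed (use R(2) cG in auto)
  from integral_unique[OF this]
  have "integral {0..2*pi} ?G = integral {- R..R} (\<lambda>x. (1 / cosh x) *\<^sub>R ?G (cayley_angle (- x)))"
    unfolding Glu l_def u_def by simp
  also have "\<dots> = integral {- R..R} (\<lambda>x. ?\<psi> (- x))"
    by (rule Henstock_Kurzweil_Integration.integral_cong)
      (simp only: cis_cayley_angle scaleR_conv_of_real of_real_divide of_real_1 cosh_minus times_divide_eq_left mult_1)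
  also have "\<dots> = integral {- R..R} ?\<psi>"
    using Henstock_Kurzweil_Integration.integral_reflect_real[of R "- R" ?\<psi>] by (simp only: minus_minus)
  also have "\<dots> = (LBINT w. indicator {- R..R} w *\<^sub>R ?\<psi> w)"
    using set_borel_integral_eq_integral(2)[OF borel_integrable_atLeastAtMost'[of "- R" R ?\<psi>]] continuous_on_subset[OF c\<psi>, of "{- R..R}"]
    by (simp add: set_lebesgue_integral_def)
  also have "\<dots> = (LBINT w. ?\<psi> w)"
    by (rule Bochner_Integration.integral_cong) (auto simp: indicator_def R(1))
  finally show ?thesis by (simp add: fhat_def fourier_def)
qed

text \<open>The kernel of the Fourier coefficient of order \<open>- n\<close> of a dilated function; it is holomorphic
  and bounded in the strip that connects the two half circles, because \<open>n \<ge> d\<close>.\<close>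

definition strip_kernel :: "nat \<Rightarrow> nat \<Rightarrow> complex \<Rightarrow> complex" where
  "strip_kernel d n w = (2 * exp w) ^ d * (exp w + \<i>) ^ (n - d) / (exp w - \<i>) ^ (n + d)"

text \<open>With E = exp w the quotient (E + \<i>)/(E - \<i>) is the point on the circle, so on the
  real line the kernel is the Fourier factor of the mode -n divided by cosh^d. On the line Im w =
  -\<pi> the value E becomes -E, which exchanges E + \<i> and E - \<i> up to sign: the mode becomes
  n, and the signs combine to (-1)^d.\<close>

lemma strip_kernel_real:
  assumes "d \<le> n"
  shows "strip_kernel d n (of_real w) = cis (of_nat n * cayley_angle w) / of_real (cosh w) ^ d"
    and "strip_kernel d n (of_real w + \<i> * of_real (- pi)) = (-1) ^ d * (cis (- (of_nat n * cayley_angle w)) / of_real (cosh w) ^ d)"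
proof -
  define E where "E = exp (complex_of_real w)"
  define p where "p = E + \<i>"
  define q where "q = E - \<i>"
  have nz: "p \<noteq> 0" "q \<noteq> 0" "E \<noteq> 0" using exp_minus_i_nonzero[of w] by (auto simp: E_def p_def q_def)
  have cosh: "complex_of_real (cosh w) = p * q / (2 * E)" unfolding cosh_complex_exp E_def p_def q_def ..
  have cay: "cis (of_nat n * cayley_angle w) = (p / q) ^ n"
    by (simp add: Complex.DeMoivre[symmetric] cis_cayley_angle cayley_def E_def p_def q_def)
  have pn: "p ^ n = p ^ (n - d) * p ^ d" "q ^ n = q ^ (n - d) * q ^ d"
    using assms by (simp_all flip: power_add)
  have cay': "cis (- (of_nat n * cayley_angle w)) = (q / p) ^ n"
  proof -
    have "cis (- (of_nat n * cayley_angle w)) = inverse (cis (of_nat n * cayley_angle w))" by (simp add: cis_inverse)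
    then show ?thesis unfolding cay by (simp add: power_divide)
  qed
  show "strip_kernel d n (of_real w) = cis (of_nat n * cayley_angle w) / of_real (cosh w) ^ d"
    unfolding cay cosh strip_kernel_def E_def[symmetric] p_def[symmetric] q_def[symmetric]
    using nz by (simp add: power_divide power_mult_distrib power_add pn(1) field_simps)
  have "exp (of_real w + \<i> * of_real (- pi)) = - E"
  proof -
    have "exp (of_real w + \<i> * of_real (- pi)) = E * cis (- pi)"
      by (simp only: E_def exp_add cis_conv_exp)
    also have "cis (- pi) = -1" by (simp add: complex_eq_iff)
    finally show ?thesis by simp
  qed
  then have "strip_kernel d n (of_real w + \<i> * of_real (- pi)) = (2 * (- E)) ^ d * (- q) ^ (n - d) / (- p) ^ (n + d)"
    unfolding strip_kernel_def p_def q_def by simp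
  also have "\<dots> = (-1) ^ d * ((2 * E) ^ d * q ^ (n - d) / p ^ (n + d))"
  proof -
    have cancel: "m \<noteq> 0 \<Longrightarrow> A * X * (m * Q) / (m * P) = A * (X * Q / P)" for A X m Q P :: complex
      by (cases "P = 0") (simp_all add: field_simps)
    have "(-1::complex) ^ (n + d) = (-1) ^ (n - d)"
      using assms by (simp add: power_add minus_one_power_iff)
    moreover have "(2 * (- E)) ^ d = (-1) ^ d * (2 * E) ^ d"
      using power_mult_distrib[of "-1" "2 * E" d] by simp
    ultimately show ?thesis
      unfolding power_minus[of q] power_minus[of p] by (simp only:) (rule cancel, simp)
  qed
  also have "(2 * E) ^ d * q ^ (n - d) / p ^ (n + d) = cis (- (of_nat n * cayley_angle w)) / of_real (cosh w) ^ d"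
    unfolding cay' cosh
    using nz by (simp add: power_divide power_mult_distrib power_add pn(2) field_simps)
  finally show "strip_kernel d n (of_real w + \<i> * of_real (- pi)) = (-1) ^ d * (cis (- (of_nat n * cayley_angle w)) / of_real (cosh w) ^ d)" .
qed

text \<open>For -\<pi> \<le> Im w \<le> 0 the point E = exp w lies in the closed lower half plane.
  Hence |E + \<i>| \<le> |E - \<i>| and 2|E| \<le> |E|^2 + 1 \<le> |E - \<i>|^2, so the numerator is
  at most the power 2d + (n - d) of |E - \<i>|, which is the denominator.\<close>

lemma strip_kernel_bound:
  assumes "d \<le> n" and w: "- pi \<le> Im w" "Im w \<le> 0"
  shows "cmod (strip_kernel d n w) \<le> 1"
proof -
  define E where "E = exp w"
  have "sin (Im w) \<le> 0"
    using sin_ge_zero[of "- Im w"] w by simp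
  then have ImE: "Im E \<le> 0" unfolding E_def Im_exp by (simp add: mult_le_0_iff)
  have n1: "(cmod (E - \<i>))\<^sup>2 = (cmod E)\<^sup>2 + 1 - 2 * Im E"
    unfolding cmod_power2 by (simp add: power2_eq_square algebra_simps)
  have n2: "(cmod (E + \<i>))\<^sup>2 = (cmod E)\<^sup>2 + 1 + 2 * Im E"
    unfolding cmod_power2 by (simp add: power2_eq_square algebra_simps)
  have pos: "cmod (E - \<i>) > 0" using n1 ImE by (metis add_pos_nonneg add.commute diff_ge_0_iff_ge dual_order.trans less_eq_real_def linorder_not_less mult_nonneg_nonpos norm_ge_zero not_one_le_zero power_zero_numeral zero_le_numeral zero_le_power2 zero_less_one_class.zero_less_one zero_less_norm_iff norm_eq_zero diff_add_cancel le_add_same_cancel2)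
  have a: "cmod (E + \<i>) \<le> cmod (E - \<i>)"
    using n1 n2 ImE by (intro power2_le_imp_le[OF _ norm_ge_zero]) linarith
  have b: "2 * cmod E \<le> cmod (E - \<i>) ^ 2"
  proof -
    have "0 \<le> (cmod E - 1)\<^sup>2" by simp
    then have "2 * cmod E \<le> (cmod E)\<^sup>2 + 1" by (simp add: power2_eq_square algebra_simps)
    then show ?thesis using n1 ImE by linarith
  qed
  have "cmod (strip_kernel d n w) = (2 * cmod E) ^ d * cmod (E + \<i>) ^ (n - d) / cmod (E - \<i>) ^ (n + d)"
    unfolding strip_kernel_def E_def[symmetric] by (simp add: norm_mult norm_divide norm_power)
  also have "\<dots> \<le> (cmod (E - \<i>) ^ 2) ^ d * cmod (E - \<i>) ^ (n - d) / cmod (E - \<i>) ^ (n + d)"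
    using a b pos by (intro divide_right_mono mult_mono power_mono) auto
  also have "(cmod (E - \<i>) ^ 2) ^ d * cmod (E - \<i>) ^ (n - d) = cmod (E - \<i>) ^ (n + d)"
    using assms(1) by (simp add: add.commute flip: power_mult power_add)
  finally show ?thesis using pos by simp
qed

text \<open>The poles exp w = \<i> next to the closed strip -\<pi> \<le> Im w \<le> 0 lie at the
  heights \<pi>/2 and -3\<pi>/2, the borders of this open strip.\<close>

lemma strip_kernel_holomorphic: "strip_kernel d n holomorphic_on {w. - (3 * pi / 2) < Im w \<and> Im w < pi / 2}"
  unfolding strip_kernel_def
proof (intro holomorphic_intros)
  fix w assume w: "w \<in> {w. - (3 * pi / 2) < Im w \<and> Im w < pi / 2}"
  have "exp w \<noteq> \<i>"
  proof
    assume e: "exp w = \<i>"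
    then have "exp (Re w) * cos (Im w) = 0" "exp (Re w) * sin (Im w) = 1"
      by (metis Re_exp imaginary_unit.simps(1), metis Im_exp imaginary_unit.simps(2))
    then have c: "cos (Im w) = 0" "sin (Im w) > 0" by (auto simp: zero_less_mult_iff) (metis exp_gt_zero zero_less_mult_pos zero_less_one)
    have "Im w < - pi"
    proof (rule ccontr)
      assume "\<not> Im w < - pi"
      then consider "- pi \<le> Im w" "Im w \<le> 0" | "0 < Im w" by linarith
      then show False
      proof cases
        case 1
        then show False using c sin_ge_zero[of "- Im w"] by simp
      next
        case 2
        then show False using c w cos_gt_zero[of "Im w"] by auto
      qed
    qed
    then have "cos (Im w + pi) > 0" using w by (intro cos_gt_zero_pi) auto
    then show False using c by simp
  qed
  then show "(exp w - \<i>) ^ (n + d) \<noteq> 0" by simp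
qed

lemma power_int_pred_mult: "x \<noteq> 0 \<Longrightarrow> x powi (int d - 1) * x = x ^ d" for x :: complex
  by (simp add: power_int_diff)

text \<open>The substitution w = v + t moves the dilation parameter from f, which is merely smooth,
  into the mode factor, which is analytic. The powers of cosh collect the Jacobian of
  \<open>cayley_angle\<close> and the weight d - 1 of \<open>beta\<close>.\<close>

lemma fhat_beta_dil:
  assumes f: "f \<in> C\<^sup>\<infinity>" and s: "supp f \<subseteq> half_circle 1"
  shows "fhat (beta d (dil t) f) m = of_real (1 / (2 * pi)) *
    (LBINT v. of_real (cosh v) powi (int d - 1) * f (cayley (of_real v)) *
       (cis (- (of_int m * cayley_angle (v + t))) / of_real (cosh (v + t)) ^ d))"
proof -
  obtain R where R: "0 < R" "\<And>w. R \<le> \<bar>w\<bar> \<Longrightarrow> f (cayley (of_real w)) = 0"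
    using cayley_cutoff[OF f s] by blast
  let ?h = "beta d (dil t) f"
  let ?\<psi> = "\<lambda>w. ?h (cayley (of_real w)) * cis (- (of_int m * cayley_angle w)) / of_real (cosh w)"
  have eq: "?\<psi> (v + t) = of_real (cosh v) powi (int d - 1) * f (cayley (of_real v)) *
       (cis (- (of_int m * cayley_angle (v + t))) / of_real (cosh (v + t)) ^ d)" for v
  proof -
    have c: "complex_of_real (cosh (v + t)) \<noteq> 0" by simp
    have "?h (cayley (of_real (v + t))) = (of_real (cosh v) / of_real (cosh (v + t))) powi (int d - 1) * f (cayley (of_real v))"
      unfolding beta_dil_cayley by simp
    also have "(of_real (cosh v) / of_real (cosh (v + t))) powi (int d - 1)
      = complex_of_real (cosh v) powi (int d - 1) / of_real (cosh (v + t)) powi (int d - 1)"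
      by (rule power_int_divide_distrib)
    finally show ?thesis
      unfolding power_int_pred_mult[OF c, of d, symmetric] by simp
  qed
  have "fhat ?h m = of_real (1 / (2 * pi)) * (LBINT w. ?\<psi> w)"
  proof (rule fhat_upper_half)
    show "?h \<in> C\<^sup>\<infinity>" by (rule beta_smooth[OF dil_Mob f])
    show "supp ?h \<subseteq> half_circle 1" by (rule beta_dil_supp[OF f s])
    show "0 < R + \<bar>t\<bar>" using R by simp
    fix w assume "R + \<bar>t\<bar> \<le> \<bar>w\<bar>"
    then have "R \<le> \<bar>w - t\<bar>" by linarith
    then show "?h (cayley (of_real w)) = 0" unfolding beta_dil_cayley by (simp only: R(2) mult_zero_right)
  qed
  also have "(LBINT w. ?\<psi> w) = (LBINT v. ?\<psi> (v + t))"
    by (rule lborel_integral_shift[symmetric])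
  finally show ?thesis unfolding eq .
qed

text \<open>Fubini applies because f has compact support in v, the mode factor has modulus at most 1
  and the Gaussian is integrable.\<close>

lemma integral_fhat_beta_dil:
  assumes f: "f \<in> C\<^sup>\<infinity>" and s: "supp f \<subseteq> half_circle 1" and g: "gaussian g"
  shows "(LBINT t. fhat (beta d (dil t) f) m * g (of_real t)) = of_real (1 / (2 * pi)) *
    (LBINT v. of_real (cosh v) powi (int d - 1) * f (cayley (of_real v)) *
       (LBINT t. cis (- (of_int m * cayley_angle (v + t))) / of_real (cosh (v + t)) ^ d * g (of_real t)))"
proof -
  obtain R where R: "0 < R" "\<And>w. R \<le> \<bar>w\<bar> \<Longrightarrow> f (cayley (of_real w)) = 0"
    using cayley_cutoff[OF f s] by blast
  let ?K = "\<lambda>v. complex_of_real (cosh v) powi (int d - 1) * f (cayley (of_real v))"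
  let ?q = "\<lambda>w. cis (- (of_int m * cayley_angle w)) / complex_of_real (cosh w) ^ d"
  have cang: "continuous_on A cayley_angle" for A
    by (meson DERIV_isCont cayley_angle_deriv continuous_at_imp_continuous_on)
  have cf: "continuous_on UNIV (\<lambda>t. f (cis t))"
    using smooth_continuous[OF f, of UNIV 0] by (simp add: angle_deriv_0[abs_def])
  have cK: "continuous_on UNIV ?K"
    unfolding cis_cayley_angle[symmetric]
    by (intro continuous_intros continuous_on_compose2[OF cf cang] continuous_on_power_int) auto
  have cq: "continuous_on UNIV ?q"
    by (intro continuous_intros cang) auto
  have cg: "continuous_on UNIV (\<lambda>t::real. g (of_real t))" by (rule gaussian_continuous_real[OF g])
  have q1: "cmod (?q w) \<le> 1" for w
  proof -
    have "1 \<le> cosh w ^ d" by (intro one_le_power cosh_real_ge_1)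
    then show ?thesis by (simp add: norm_divide norm_power abs_of_pos)
  qed
  have iK: "integrable lborel (\<lambda>v. cmod (?K v))"
  proof -
    have "set_integrable lborel {- R..R} (\<lambda>v. cmod (?K v))"
      by (rule borel_integrable_atLeastAtMost') (intro continuous_on_norm continuous_on_subset[OF cK] subset_UNIV)
    moreover have "indicator {- R..R} v *\<^sub>R cmod (?K v) = cmod (?K v)" for v
      by (cases "R \<le> \<bar>v\<bar>") (simp add: R(2), auto simp: indicator_def abs_if split: if_splits)
    ultimately show ?thesis by (simp only: set_integrable_def)
  qed
  have ig: "integrable lborel (\<lambda>t. cmod (g (of_real t)))"
    using integrable_mult_gaussian[of "\<lambda>t. 1" 1 0, OF _ _ g] by (intro integrable_norm) simp
  let ?F = "\<lambda>v t. ?K v * (?q (v + t) * g (of_real t))"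
  have cF: "continuous_on UNIV (\<lambda>(v, t). ?F v t)"
    unfolding case_prod_unfold
    by (intro continuous_on_mult continuous_on_compose2[OF cK] continuous_on_compose2[OF cq]
         continuous_on_compose2[OF cg] continuous_intros) auto
  have "(LBINT t. fhat (beta d (dil t) f) m * g (of_real t)) = (LBINT t. of_real (1 / (2 * pi)) * (LBINT v. ?F v t))"
  proof (rule Bochner_Integration.integral_cong[OF refl])
    fix t
    have "(LBINT v. ?F v t) = (LBINT v. (?K v * ?q (v + t)) * g (of_real t))"
      by (simp only: mult.assoc)
    also have "\<dots> = (LBINT v. ?K v * ?q (v + t)) * g (of_real t)"
      by (rule integral_mult_left_zero)
    finally show "fhat (beta d (dil t) f) m * g (of_real t) = of_real (1 / (2 * pi)) * (LBINT v. ?F v t)"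
      unfolding fhat_beta_dil[OF f s] by (simp only: mult.assoc)
  qed
  also have "\<dots> = of_real (1 / (2 * pi)) * (LBINT t. (LBINT v. ?F v t))"
    by (rule integral_mult_right_zero)
  also have "(LBINT t. (LBINT v. ?F v t)) = (LBINT v. (LBINT t. ?F v t))"
  proof (rule fubini_lborel[OF cF _ iK ig])
    fix v t
    have "cmod (?q (v + t)) * cmod (g (of_real t)) \<le> 1 * cmod (g (of_real t))"
      by (intro mult_right_mono q1) simp
    then show "cmod (?F v t) \<le> cmod (?K v) * cmod (g (of_real t))"
      unfolding norm_mult[of "?K v"] norm_mult[of "?q (v + t)"] by (intro mult_left_mono) auto
  qed
  finally show ?thesis by (simp only: integral_mult_right_zero)
qed

text \<open>Now t occurs only in the analytic kernel and in g, and for each v the contour is moved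
  from Im t = 0 to Im t = -\<pi>. This takes the kernel of the mode -n to that of the mode
  n.\<close>

lemma fourier_contour_shift:
  assumes f: "f \<in> C\<^sup>\<infinity>" and s: "supp f \<subseteq> half_circle 1" and dn: "d \<le> n" and g: "gaussian g"
  shows "(LBINT t. fhat (beta d (dil t) f) (- int n) * g (of_real t)) =
    (-1) ^ d * (LBINT t. fhat (beta d (dil t) f) (int n) * g (of_real t + \<i> * of_real (- pi)))"
proof -
  let ?g = "\<lambda>z. g (z + \<i> * of_real (- pi))"
  have gg: "gaussian ?g" by (rule gaussian_shift[OF g])
  obtain B c where B: "0 \<le> B" "0 < c"
    "\<And>t \<tau>. \<bar>\<tau>\<bar> \<le> pi \<Longrightarrow> cmod (g (of_real t + \<i> * of_real \<tau>)) \<le> B * exp (- c * t\<^sup>2)"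
    using gaussian_bound[OF g, of pi] by blast
  have sh: "(LBINT t. cis (- (of_int (- int n) * cayley_angle (v + t))) / of_real (cosh (v + t)) ^ d * g (of_real t))
     = (-1) ^ d * (LBINT t. cis (- (of_int (int n) * cayley_angle (v + t))) / of_real (cosh (v + t)) ^ d * ?g (of_real t))" for v
  proof -
    let ?h = "\<lambda>z. strip_kernel d n (of_real v + z) * g z"
    have "(LBINT t. ?h (of_real t)) = (LBINT t. ?h (of_real t + \<i> * of_real (- pi)))"
    proof (rule contour_shift[where l = "- (3 * pi / 2)" and u = "pi / 2" and B = B and c = c])
      show "?h holomorphic_on {z. - (3 * pi / 2) < Im z \<and> Im z < pi / 2}"
      proof (rule holomorphic_on_mult[OF _ gaussian_holomorphic[OF g]])
        show "(\<lambda>z. strip_kernel d n (of_real v + z)) holomorphic_on {z. - (3 * pi / 2) < Im z \<and> Im z < pi / 2}"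
          by (rule holomorphic_on_compose_gen[OF _ strip_kernel_holomorphic, unfolded o_def])
            (auto intro!: holomorphic_intros)
      qed
      fix t \<tau> :: real assume \<tau>: "min 0 (- pi) \<le> \<tau>" "\<tau> \<le> max 0 (- pi)"
      have \<tau>': "- pi \<le> \<tau>" "\<tau> \<le> 0" using \<tau> pi_ge_zero by (simp_all add: min_absorb2 max_absorb1)
      have "cmod (strip_kernel d n (of_real v + (of_real t + \<i> * of_real \<tau>))) \<le> 1"
        by (rule strip_kernel_bound[OF dn]) (use \<tau>' in auto)
      moreover have "cmod (g (of_real t + \<i> * of_real \<tau>)) \<le> B * exp (- c * t\<^sup>2)" using B(3) \<tau>' by simp
      ultimately have "cmod (?h (of_real t + \<i> * of_real \<tau>)) \<le> 1 * (B * exp (- c * t\<^sup>2))"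
        unfolding norm_mult by (intro mult_mono) auto
      then show "cmod (?h (of_real t + \<i> * of_real \<tau>)) \<le> B * exp (- c * t\<^sup>2)" by simp
    qed (use B in auto)
    moreover have "?h (of_real t) = cis (- (of_int (- int n) * cayley_angle (v + t))) / of_real (cosh (v + t)) ^ d * g (of_real t)" for t
      using strip_kernel_real(1)[OF dn, of "v + t"] by simp
    moreover have "?h (of_real t + \<i> * of_real (- pi)) = (-1) ^ d * (cis (- (of_int (int n) * cayley_angle (v + t))) / of_real (cosh (v + t)) ^ d * ?g (of_real t))" for t
    proof -
      have "of_real v + (of_real t + \<i> * of_real (- pi)) = of_real (v + t) + \<i> * of_real (- pi)" by simp
      then show ?thesis by (simp only: strip_kernel_real(2)[OF dn] of_int_of_nat_eq mult.assoc)
    qed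
    ultimately show ?thesis by (simp only: integral_mult_right_zero)
  qed
  have al: "a * ((-1) ^ d * b) = (-1) ^ d * (a * b)" for a b :: complex by simp
  show ?thesis
    unfolding integral_fhat_beta_dil[OF f s g] integral_fhat_beta_dil[OF f s gg] sh al integral_mult_right_zero ..
qed

section \<open>From single modes to distributions\<close>

lemma distribution_one_sided:
  assumes T: "distribution T" and T0: "\<And>m. m > - int d \<Longrightarrow> T (trig m) = 0" and h: "h \<in> C\<^sup>\<infinity>"
  shows "(\<lambda>K. \<Sum>n<K. fhat h (- int (d + n)) * T (trig (- int (d + n)))) \<longlonglongrightarrow> T h"
proof (rule LIMSEQ_offset)
  have "(\<Sum>m\<in>{- int (k + d)..int (k + d)}. fhat h m * T (trig m)) = (\<Sum>n<k + 1. fhat h (- int (d + n)) * T (trig (- int (d + n))))" for k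
  proof -
    have "(\<Sum>m\<in>{- int (k + d)..int (k + d)}. fhat h m * T (trig m)) = (\<Sum>m\<in>{- int (k + d)..- int d}. fhat h m * T (trig m))"
      by (rule sum.mono_neutral_right) (use T0 in auto)
    also have "\<dots> = (\<Sum>n<k + 1. fhat h (- int (d + n)) * T (trig (- int (d + n))))"
      by (rule sum.reindex_bij_witness[of _ "\<lambda>n. - int (d + n)" "\<lambda>m. nat (- m - int d)"]) auto
    finally show ?thesis .
  qed
  then show "(\<lambda>k. \<Sum>n<k + 1. fhat h (- int (d + n)) * T (trig (- int (d + n)))) \<longlonglongrightarrow> T h"
    using LIMSEQ_ignore_initial_segment[OF distribution_fourier[OF T h], of d] by simp
qed

text \<open>Partial sums are bounded uniformly in K, as dominated convergence requires. The
  hypothesis on m admits both m n = d + n and m n = -(d + n), the modes on the two sides of the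
  shift.\<close>

lemma distribution_series_bound:
  assumes T: "distribution T" and f: "f \<in> C\<^sup>\<infinity>"
  obtains A M where "0 \<le> A"
    "\<And>t n m K. (\<And>n. \<bar>m n\<bar> = int (d + n)) \<Longrightarrow>
      cmod (\<Sum>n<K. fhat (beta d (dil t) f) (m n) * T (trig (- int (d + n)))) \<le> A * exp (M * \<bar>t\<bar>)"
proof -
  obtain C N where C: "\<And>f. f \<in> C\<^sup>\<infinity> \<Longrightarrow> cmod (T f) \<le> C * CN_norm N f"
    using T unfolding distribution_def by blast
  obtain C' M N' where C': "0 \<le> C'" "\<And>f s. f \<in> C\<^sup>\<infinity> \<Longrightarrow> CN_norm (N + 2) (beta d (dil s) f) \<le> C' * exp (M * \<bar>s\<bar>) * CN_norm N' f"
    using dil.beta_bound[of "N + 2" d] by blast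
  define S where "S = (\<Sum>n. inverse (real (Suc n) ^ 2))"
  have sm: "summable (\<lambda>n. inverse (real (Suc n) ^ 2))"
    by (subst summable_Suc_iff[of "\<lambda>k. inverse (real k ^ 2)"]) (simp add: inverse_power_summable)
  have S: "(\<Sum>n<K. inverse (real (Suc n) ^ 2)) \<le> S" for K
    unfolding S_def by (intro sum_le_suminf sm) auto
  define D where "D = 2 ^ (N + 2) * (C' * CN_norm N' f) * (\<bar>C\<bar> * (1 + real N))"
  have D: "0 \<le> D" unfolding D_def using C'(1) CN_norm_nonneg[OF f] by simp
  show ?thesis
  proof (rule that[of "D * S" M])
    show "0 \<le> D * S" using D S[of 0] by simp
    fix t m K assume m: "\<And>n. \<bar>m n\<bar> = int (d + n)"
    let ?h = "beta d (dil t) f"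
    have h: "?h \<in> C\<^sup>\<infinity>" by (rule beta_smooth[OF dil_Mob f])
    have "cmod (fhat ?h (m n) * T (trig (- int (d + n)))) \<le> D * exp (M * \<bar>t\<bar>) * inverse (real (Suc n) ^ 2)" for n
    proof -
      let ?x = "1 + real (d + n)"
      have mn: "\<bar>real_of_int (m n)\<bar> = real (d + n)" using m[of n] by (metis of_int_abs of_int_of_nat_eq)
      have "cmod (fhat ?h (m n)) \<le> 2 ^ (N + 2) * CN_norm (N + 2) ?h / ?x ^ (N + 2)"
        using fhat_decay[OF h, of "m n" "N + 2"] unfolding mn .
      also have "\<dots> \<le> 2 ^ (N + 2) * (C' * exp (M * \<bar>t\<bar>) * CN_norm N' f) / ?x ^ (N + 2)"
        by (intro divide_right_mono mult_left_mono C' f) auto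
      finally have 1: "cmod (fhat ?h (m n)) \<le> 2 ^ (N + 2) * (C' * exp (M * \<bar>t\<bar>) * CN_norm N' f) / ?x ^ (N + 2)" .
      have "cmod (T (trig (- int (d + n)))) \<le> \<bar>C\<bar> * CN_norm N (trig (- int (d + n)))"
        by (rule order_trans[OF C[OF trig_smooth(1)]]) (intro mult_right_mono CN_norm_nonneg trig_smooth(1) abs_ge_self)
      also have "\<dots> \<le> \<bar>C\<bar> * ((1 + real N) * ?x ^ N)"
        using CN_norm_trig[of N "- int (d + n)"] by (intro mult_left_mono) (auto simp: add_ac)
      finally have 2: "cmod (T (trig (- int (d + n)))) \<le> \<bar>C\<bar> * ((1 + real N) * ?x ^ N)" .
      have "cmod (fhat ?h (m n) * T (trig (- int (d + n))))
        \<le> (2 ^ (N + 2) * (C' * exp (M * \<bar>t\<bar>) * CN_norm N' f) / ?x ^ (N + 2)) * (\<bar>C\<bar> * ((1 + real N) * ?x ^ N))"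
        unfolding norm_mult by (rule mult_mono'[OF 1 2]) auto
      also have "\<dots> = D * exp (M * \<bar>t\<bar>) * inverse (?x ^ 2)"
        by (simp add: D_def power_add inverse_eq_divide power2_eq_square mult_ac)
      also have "\<dots> \<le> D * exp (M * \<bar>t\<bar>) * inverse (real (Suc n) ^ 2)"
        using D by (intro mult_left_mono le_imp_inverse_le power_mono) auto
      finally show ?thesis .
    qed
    then have "cmod (\<Sum>n<K. fhat ?h (m n) * T (trig (- int (d + n)))) \<le> (\<Sum>n<K. D * exp (M * \<bar>t\<bar>) * inverse (real (Suc n) ^ 2))"
      by (rule sum_norm_le)
    also have "\<dots> = D * exp (M * \<bar>t\<bar>) * (\<Sum>n<K. inverse (real (Suc n) ^ 2))" by (simp only: sum_distrib_left)
    also have "\<dots> \<le> D * exp (M * \<bar>t\<bar>) * S" using D by (intro mult_left_mono S) auto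
    finally show "cmod (\<Sum>n<K. fhat ?h (m n) * T (trig (- int (d + n)))) \<le> D * S * exp (M * \<bar>t\<bar>)"
      by (simp add: mult_ac)
  qed
qed

text \<open>The shift of the modes is summed by dominated convergence. T sees only the modes -n with
  n \<ge> d; the shift replaces the coefficient of f at -n by the one at n, and the latter is the
  coefficient of the reflected function at -n.\<close>

lemma distribution_contour_shift_upper:
  assumes T: "distribution T" and T0: "\<And>m. m > - int d \<Longrightarrow> T (trig m) = 0"
    and f: "f \<in> C\<^sup>\<infinity>" and s: "supp f \<subseteq> half_circle 1" and g: "gaussian g"
  shows "(LBINT t. T (beta d (dil t) f) * g (of_real t)) =
    (-1) ^ d * (LBINT t. T (beta d (dil t) (reflect f)) * g (of_real t + \<i> * of_real (- pi)))"
proof -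
  let ?u = "\<lambda>n. T (trig (- int (d + n)))"
  obtain A M where A: "0 \<le> A"
    "\<And>t n m K. (\<And>n. \<bar>m n\<bar> = int (d + n)) \<Longrightarrow>
      cmod (\<Sum>n<K. fhat (beta d (dil t) f) (m n) * ?u n) \<le> A * exp (M * \<bar>t\<bar>)"
    using distribution_series_bound[OF T f, of d] by blast
  have cf: "continuous_on UNIV (\<lambda>t. fhat (beta d (dil t) f) m)" for m
    by (rule dil.distribution_beta_continuous[OF distribution_fhat f])
  have ifh: "integrable lborel (\<lambda>t. fhat (beta d (dil t) f) m * h (of_real t))" if "gaussian h" for m h
  proof -
    obtain C M' where "\<And>t. cmod (fhat (beta d (dil t) f) m) \<le> C * exp (M' * \<bar>t\<bar>)"
      using dil.distribution_beta_bound[OF distribution_fhat f] by metis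
    then show ?thesis by (rule integrable_mult_gaussian[OF cf _ that])
  qed
  have lim: "(\<lambda>K. \<Sum>n<K. (LBINT t. fhat (beta d (dil t) f) (m n) * h (of_real t)) * ?u n)
      \<longlonglongrightarrow> (LBINT t. T (F t) * h (of_real t))"
    if h: "gaussian h" and m: "\<And>n. \<bar>m n\<bar> = int (d + n)" and F: "continuous_on UNIV (\<lambda>t. T (F t))"
      "\<And>t. (\<lambda>K. \<Sum>n<K. fhat (beta d (dil t) f) (m n) * ?u n) \<longlonglongrightarrow> T (F t)" for h m F
  proof -
    let ?s = "\<lambda>K t. (\<Sum>n<K. fhat (beta d (dil t) f) (m n) * ?u n) * h (of_real t)"
    have ch: "continuous_on UNIV (\<lambda>t::real. h (of_real t))" by (rule gaussian_continuous_real[OF h])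
    have csum: "continuous_on UNIV (\<lambda>t. \<Sum>n<K. fhat (beta d (dil t) f) (m n) * ?u n)" for K
      by (intro continuous_on_sum continuous_on_mult cf continuous_on_const)
    have "(\<lambda>K. LBINT t. ?s K t) \<longlonglongrightarrow> (LBINT t. T (F t) * h (of_real t))"
    proof (rule integral_dominated_convergence[where w = "\<lambda>t. cmod (of_real (A * exp (M * \<bar>t\<bar>)) * h (of_real t))"])
      show "integrable lborel (\<lambda>t. cmod (of_real (A * exp (M * \<bar>t\<bar>)) * h (of_real t)))"
        by (intro integrable_norm integrable_mult_gaussian[OF _ _ h, of _ A M] continuous_intros) (use A in \<open>simp add: norm_mult\<close>)
      show "AE t in lborel. (\<lambda>K. ?s K t) \<longlonglongrightarrow> T (F t) * h (of_real t)"
        by (intro AE_I2 tendsto_mult F tendsto_const)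
      have "cmod (?s K t) \<le> cmod (of_real (A * exp (M * \<bar>t\<bar>)) * h (of_real t))" for K t
        unfolding norm_mult using A(1) by (intro mult_right_mono order_trans[OF A(2)[OF m]]) (auto simp: norm_mult)
      then show "AE t in lborel. norm (?s K t) \<le> cmod (of_real (A * exp (M * \<bar>t\<bar>)) * h (of_real t))" for K by simp
      have "continuous_on UNIV (\<lambda>t. T (F t) * h (of_real t))" by (intro continuous_on_mult F ch)
      then show "(\<lambda>t. T (F t) * h (of_real t)) \<in> borel_measurable lborel" by (simp add: borel_measurable_continuous_onI)
      have "continuous_on UNIV (?s K)" for K by (intro continuous_on_mult csum ch)
      then show "?s K \<in> borel_measurable lborel" for K by (simp add: borel_measurable_continuous_onI)
    qed
    moreover have "(LBINT t. ?s K t) = (\<Sum>n<K. (LBINT t. fhat (beta d (dil t) f) (m n) * h (of_real t)) * ?u n)" for K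
    proof -
      have "?s K t = (\<Sum>n<K. fhat (beta d (dil t) f) (m n) * h (of_real t) * ?u n)" for t
        unfolding sum_distrib_right by (intro sum.cong refl) (simp only: mult_ac)
      then have "(LBINT t. ?s K t) = (LBINT t. (\<Sum>n<K. fhat (beta d (dil t) f) (m n) * h (of_real t) * ?u n))" by simp
      also have "\<dots> = (\<Sum>n<K. (LBINT t. fhat (beta d (dil t) f) (m n) * h (of_real t) * ?u n))"
        by (intro Bochner_Integration.integral_sum integrable_mult_left ifh h)
      finally show ?thesis by simp
    qed
    ultimately show ?thesis by simp
  qed
  have gg: "gaussian (\<lambda>z. g (z + \<i> * of_real (- pi)))" by (rule gaussian_shift[OF g])
  have "(\<lambda>K. \<Sum>n<K. (LBINT t. fhat (beta d (dil t) f) (- int (d + n)) * g (of_real t)) * ?u n)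
      \<longlonglongrightarrow> (LBINT t. T (beta d (dil t) f) * g (of_real t))"
    by (rule lim[OF g _ dil.distribution_beta_continuous[OF T f]])
      (simp, rule distribution_one_sided[OF T _ beta_smooth[OF dil_Mob f]], rule T0)
  moreover have "(\<lambda>K. \<Sum>n<K. (LBINT t. fhat (beta d (dil t) f) (int (d + n)) * g (of_real t + \<i> * of_real (- pi))) * ?u n)
      \<longlonglongrightarrow> (LBINT t. T (beta d (dil t) (reflect f)) * g (of_real t + \<i> * of_real (- pi)))"
  proof (rule lim[OF gg _ dil.distribution_beta_continuous[OF T reflect_smooth[OF f]]])
    fix t
    have "fhat (beta d (dil t) (reflect f)) (- int (d + n)) = fhat (beta d (dil t) f) (int (d + n))" for n
      by (simp add: beta_dil_reflect[OF f] fhat_reflect[OF beta_smooth[OF dil_Mob f]] add.commute)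
    note eq = this
    have "(\<lambda>K. \<Sum>n<K. fhat (beta d (dil t) (reflect f)) (- int (d + n)) * ?u n) \<longlonglongrightarrow> T (beta d (dil t) (reflect f))"
      by (rule distribution_one_sided[OF T _ beta_smooth[OF dil_Mob reflect_smooth[OF f]]], rule T0)
    then show "(\<lambda>K. \<Sum>n<K. fhat (beta d (dil t) f) (int (d + n)) * ?u n) \<longlonglongrightarrow> T (beta d (dil t) (reflect f))"
      by (simp only: eq)
  qed simp
  then have "(\<lambda>K. (-1) ^ d * (\<Sum>n<K. (LBINT t. fhat (beta d (dil t) f) (int (d + n)) * g (of_real t + \<i> * of_real (- pi))) * ?u n))
      \<longlonglongrightarrow> (-1) ^ d * (LBINT t. T (beta d (dil t) (reflect f)) * g (of_real t + \<i> * of_real (- pi)))"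
    by (intro tendsto_mult tendsto_const)
  moreover have "(LBINT t. fhat (beta d (dil t) f) (- int (d + n)) * g (of_real t))
     = (-1) ^ d * (LBINT t. fhat (beta d (dil t) f) (int (d + n)) * g (of_real t + \<i> * of_real (- pi)))" for n
    by (rule fourier_contour_shift[OF f s _ g]) simp
  ultimately show ?thesis
    by (simp only: sum_distrib_left mult.assoc) (rule LIMSEQ_unique)
qed

theorem distribution_contour_shift:
  assumes T: "distribution T" and T0: "\<And>m. m > - int d \<Longrightarrow> T (trig m) = 0"
    and f: "f \<in> C\<^sup>\<infinity>" and s: "supp f \<subseteq> half_circle \<sigma>" and \<sigma>: "\<sigma> = 1 \<or> \<sigma> = -1" and g: "gaussian g"
  shows "(LBINT t. T (beta d (dil t) f) * g (of_real t)) =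
    (-1) ^ d * (LBINT t. T (beta d (dil t) (reflect f)) * g (of_real t + \<i> * of_real (- \<sigma> * pi)))"
proof (cases "\<sigma> = 1")
  case True
  then show ?thesis using distribution_contour_shift_upper[OF T T0 f _ g] s by simp
next
  case False
  then have \<sigma>1: "\<sigma> = -1" using \<sigma> by simp
  have "supp (reflect f) \<subseteq> half_circle 1" using reflect_supp[OF f s] \<sigma>1 by simp
  \<comment> \<open>The reflected function lives in the upper half circle. The upper case is applied
    to it with g advanced by i\<pi>, so that its downward shift lands on g itself.\<close>
  from distribution_contour_shift_upper[OF T T0 reflect_smooth[OF f] this gaussian_shift[OF g, of "\<i> * of_real pi"]]
  have "(LBINT t. T (beta d (dil t) (reflect f)) * g (of_real t + \<i> * of_real pi)) =
    (-1) ^ d * (LBINT t. T (beta d (dil t) f) * g (of_real t))"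
    by (simp add: reflect_reflect)
  then have "(-1) ^ d * (LBINT t. T (beta d (dil t) (reflect f)) * g (of_real t + \<i> * of_real pi))
     = ((-1) ^ d * (-1) ^ d) * (LBINT t. T (beta d (dil t) f) * g (of_real t))" by simp
  moreover have "(-1::complex) ^ d * (-1) ^ d = 1" by (simp flip: power_mult_distrib)
  ultimately show ?thesis using \<sigma>1 by simp
qed

section \<open>Words of smeared fields\<close>

type_synonym 'd smeared = "('d distr \<times> (complex \<Rightarrow> complex)) list"

text \<open>A word is a list of pairs of a field and a test function, which makes concatenation and
  induction immediate; \<open>word\<close> takes its test functions as an indexed tuple.\<close>

fun wop :: "'d smeared \<Rightarrow> 'd \<Rightarrow> 'd" where
  "wop [] v = v"
| "wop (p # ps) v = fst p (snd p) (wop ps v)"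

lemma wop_append: "wop (ps @ qs) v = wop ps (wop qs v)"
  by (induction ps) auto

lemma word_eq_wop: "word \<phi>s f v = wop (map (\<lambda>j. (\<phi>s ! j, f j)) [0..<length \<phi>s]) v"
proof -
  have "foldr (\<lambda>j. (\<phi>s ! j) (f j)) xs v = wop (map (\<lambda>j. (\<phi>s ! j, f j)) xs) v" for xs
    by (induction xs) auto
  then show ?thesis unfolding word_def .
qed

definition field_word :: "'d distr set \<Rightarrow> complex set \<Rightarrow> 'd smeared \<Rightarrow> bool" where
  "field_word F I ps \<longleftrightarrow> (\<forall>p\<in>set ps. fst p \<in> F \<and> snd p \<in> C\<^sup>\<infinity> \<and> supp (snd p) \<subseteq> I)"

lemma field_word_simps [simp]:
  "field_word F I []"
  "field_word F I (p # ps) \<longleftrightarrow> fst p \<in> F \<and> snd p \<in> C\<^sup>\<infinity> \<and> supp (snd p) \<subseteq> I \<and> field_word F I ps"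
  "field_word F I (ps @ qs) \<longleftrightarrow> field_word F I ps \<and> field_word F I qs"
  by (auto simp: field_word_def)

text \<open>The topology is generated by balls with arbitrary centres, so a generator containing 0
  is recentred by the triangle inequality. Intersections take the larger order and the smaller
  radius.\<close>

lemma smooth_topology_nbhd_zero:
  assumes "openin smooth_topology W" "(\<lambda>z. 0) \<in> W"
  shows "\<exists>N e. 0 < e \<and> {g \<in> C\<^sup>\<infinity>. CN_norm N g < e} \<subseteq> W"
proof -
  have "generate_topology_on {{g \<in> C\<^sup>\<infinity>. CN_norm N (\<lambda>z. g z - f z) < e} | f N e. f \<in> C\<^sup>\<infinity> \<and> 0 < e} W"
    using assms(1) unfolding smooth_topology_def by (simp only: openin_topology_generated_by)
  then show ?thesis using assms(2)
  proof induction
    case (Int a b)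
    from Int.IH(1) Int.prems obtain N e where 1: "0 < e" "{g \<in> C\<^sup>\<infinity>. CN_norm N g < e} \<subseteq> a" by auto
    from Int.IH(2) Int.prems obtain N' e' where 2: "0 < e'" "{g \<in> C\<^sup>\<infinity>. CN_norm N' g < e'} \<subseteq> b" by auto
    have "{g \<in> C\<^sup>\<infinity>. CN_norm (max N N') g < min e e'} \<subseteq> a \<inter> b"
    proof
      fix g assume g: "g \<in> {g \<in> C\<^sup>\<infinity>. CN_norm (max N N') g < min e e'}"
      then have "CN_norm N g \<le> CN_norm (max N N') g" "CN_norm N' g \<le> CN_norm (max N N') g"
        by (auto intro!: CN_norm_mono)
      then have "g \<in> {g \<in> C\<^sup>\<infinity>. CN_norm N g < e}" "g \<in> {g \<in> C\<^sup>\<infinity>. CN_norm N' g < e'}" using g by auto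
      with 1 2 show "g \<in> a \<inter> b" by blast
    qed
    then show ?case using 1 2 by (intro exI[of _ "max N N'"] exI[of _ "min e e'"]) simp
  next
    case (UN K)
    then obtain k where k: "k \<in> K" "(\<lambda>z. 0) \<in> k" by blast
    from UN.IH[OF this] obtain N e where "0 < e" "{g \<in> C\<^sup>\<infinity>. CN_norm N g < e} \<subseteq> k" by blast
    then show ?case using k by blast
  next
    case (Basis s)
    then obtain f N e where s: "s = {g \<in> C\<^sup>\<infinity>. CN_norm N (\<lambda>z. g z - f z) < e}" "f \<in> C\<^sup>\<infinity>" by blast
    then have e0: "CN_norm N (\<lambda>z. (-1) * f z) < e" using Basis.prems by simp
    have "{g \<in> C\<^sup>\<infinity>. CN_norm N g < e - CN_norm N (\<lambda>z. (-1) * f z)} \<subseteq> s"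
    proof
      fix g assume g: "g \<in> {g \<in> C\<^sup>\<infinity>. CN_norm N g < e - CN_norm N (\<lambda>z. (-1) * f z)}"
      then have "CN_norm N (\<lambda>z. g z + (-1) * f z) \<le> CN_norm N g + CN_norm N (\<lambda>z. (-1) * f z)"
        by (intro CN_norm_triangle smooth_cmult(1) s) simp
      then have "CN_norm N (\<lambda>z. g z - f z) < e" using g by simp
      then show "g \<in> s" using g s by simp
    qed
    then show ?case using e0 by (intro exI[of _ N] exI[of _ "e - CN_norm N (\<lambda>z. (-1) * f z)"]) simp
  qed simp
qed

lemma topspace_smooth: "topspace smooth_topology = C\<^sup>\<infinity>"
proof
  show "topspace smooth_topology \<subseteq> C\<^sup>\<infinity>"
    unfolding smooth_topology_def topology_generated_by_topspace by blast
  show "C\<^sup>\<infinity> \<subseteq> topspace smooth_topology"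
  proof
    fix f assume f: "f \<in> C\<^sup>\<infinity>"
    have "CN_norm 0 (\<lambda>z. 0 * f z) \<le> 0" using CN_norm_cmult[OF f, of 0 0] by simp
    then have "f \<in> {g \<in> C\<^sup>\<infinity>. CN_norm 0 (\<lambda>z. g z - f z) < 1}" using f by simp
    then show "f \<in> topspace smooth_topology"
      unfolding smooth_topology_def topology_generated_by_topspace using f zero_less_one by blast
  qed
qed

lemma smooth_eq_zero:
  assumes f: "f \<in> C\<^sup>\<infinity>" and "CN_norm N f = 0" shows "f = (\<lambda>z. 0)"
proof
  fix z
  show "f z = 0"
  proof (cases "z \<in> S\<^sup>1")
    case True
    have "cmod (f (cis (Arg z))) \<le> CN_norm N f" using angle_deriv_le_CN[OF f, of 0 N] by (simp add: angle_deriv_0)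
    then show ?thesis using True assms(2) by (simp add: cis_Arg_circle)
  qed (use smooth_off_circle[OF f] in simp)
qed

lemma smooth_tuple_nbhd_zero:
  assumes "openin (tuple_topology k) W" "(\<lambda>i\<in>{..<k}. \<lambda>z. 0) \<in> W"
  shows "\<exists>N e. 0 < e \<and> (\<forall>f. (\<forall>i<k. f i \<in> C\<^sup>\<infinity> \<and> CN_norm N (f i) < e) \<longrightarrow> restrict f {..<k} \<in> W)"
proof -
  obtain V where V: "\<And>i. i < k \<Longrightarrow> openin smooth_topology (V i)"
    "(\<lambda>i\<in>{..<k}. \<lambda>z. 0) \<in> Pi\<^sub>E {..<k} V" "Pi\<^sub>E {..<k} V \<subseteq> W"
    using assms(1)[unfolded openin_product_topology_alt, rule_format, OF assms(2)] by auto
  have "\<exists>N e. 0 < e \<and> {g \<in> C\<^sup>\<infinity>. CN_norm N g < e} \<subseteq> V i" if i: "i < k" for i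
  proof (rule smooth_topology_nbhd_zero[OF V(1)[OF i]])
    show "(\<lambda>z. 0) \<in> V i" using V(2) i by (auto simp: PiE_iff)
  qed
  then obtain N e where Ne: "\<And>i. i < k \<Longrightarrow> 0 < e i \<and> {g \<in> C\<^sup>\<infinity>. CN_norm (N i) g < e i} \<subseteq> V i" by metis
  define M where "M = (\<Sum>i<k. N i)"
  define \<epsilon> where "\<epsilon> = Min (insert 1 (e ` {..<k}))"
  have \<epsilon>: "0 < \<epsilon>" "\<And>i. i < k \<Longrightarrow> \<epsilon> \<le> e i" unfolding \<epsilon>_def using Ne by (auto simp: Min_gr_iff)
  have "restrict f {..<k} \<in> W" if f: "\<And>i. i < k \<Longrightarrow> f i \<in> C\<^sup>\<infinity> \<and> CN_norm M (f i) < \<epsilon>" for f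
  proof (rule subsetD[OF V(3)])
    have "f i \<in> V i" if i: "i < k" for i
    proof -
      have "N i \<le> M" unfolding M_def using i by (intro member_le_sum) auto
      then have "CN_norm (N i) (f i) \<le> CN_norm M (f i)" using f[OF i] by (intro CN_norm_mono) auto
      then have "CN_norm (N i) (f i) < e i" using f[OF i] \<epsilon>(2)[OF i] by linarith
      then show ?thesis using Ne[OF i] f[OF i] by blast
    qed
    then show "restrict f {..<k} \<in> Pi\<^sub>E {..<k} V" by auto
  qed
  then show ?thesis using \<epsilon>(1) by blast
qed

context wightman_cft
begin

lemma field_linear:
  assumes "\<phi> \<in> F" "f \<in> C\<^sup>\<infinity>" shows "Vector_Spaces.linear sc sc (\<phi> f)"
  using distributions[OF assms(1)] assms(2) unfolding op_distribution_def by blast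

lemma field_add:
  "\<phi> \<in> F \<Longrightarrow> f \<in> C\<^sup>\<infinity> \<Longrightarrow> g \<in> C\<^sup>\<infinity> \<Longrightarrow> \<phi> (\<lambda>z. f z + g z) v = \<phi> f v + \<phi> g v"
  using distributions unfolding op_distribution_def by blast

lemma field_cmult: "\<phi> \<in> F \<Longrightarrow> f \<in> C\<^sup>\<infinity> \<Longrightarrow> \<phi> (\<lambda>z. c * f z) v = sc c (\<phi> f v)"
  using distributions unfolding op_distribution_def by blast

lemma field_zero: "\<phi> \<in> F \<Longrightarrow> \<phi> (\<lambda>z. 0) v = 0"
  using field_cmult[OF _ smooth_zero, of \<phi> 0] by simp

lemma linear_id: "Vector_Spaces.linear sc sc id"
  by (simp add: Vector_Spaces.linear_iff vector_space_axioms)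

lemma wop_linear: "field_word F I ps \<Longrightarrow> Vector_Spaces.linear sc sc (wop ps)"
proof (induction ps)
  case Nil
  have "wop [] = (id :: 'd \<Rightarrow> 'd)" by auto
  then show ?case using linear_id by (simp only:)
next
  case (Cons p ps)
  have "wop (p # ps) = fst p (snd p) \<circ> wop ps" by auto
  then show ?case using Cons field_linear[of "fst p" "snd p"]
    by (simp only:) (rule Vector_Spaces.linear_compose, simp_all)
qed

lemma lin_add: "Vector_Spaces.linear sc sc x \<Longrightarrow> x (v + w) = x v + x w"
  and lin_scale: "Vector_Spaces.linear sc sc x \<Longrightarrow> x (sc c v) = sc c (x v)"
  by (simp_all add: Vector_Spaces.linear_iff)

lemma lin_zero: "Vector_Spaces.linear sc sc x \<Longrightarrow> x 0 = 0"
  using lin_scale[of x 0 0] by simp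

lemma wop_zero: "field_word F I ps \<Longrightarrow> (\<lambda>z. 0) \<in> snd ` set ps \<Longrightarrow> wop ps v = 0"
proof (induction ps)
  case (Cons p ps)
  show ?case
  proof (cases "snd p = (\<lambda>z. 0)")
    case True
    then show ?thesis using Cons field_zero[of "fst p"] by simp
  next
    case False
    then have "wop ps v = 0" using Cons by auto
    then show ?thesis using Cons lin_zero[OF field_linear[of "fst p" "snd p"]] by simp
  qed
qed simp

lemma wop_scaled:
  "field_word F I ps \<Longrightarrow> wop (map (\<lambda>p. (fst p, \<lambda>z. c (snd p) * snd p z)) ps) v = sc (\<Prod>p\<leftarrow>ps. c (snd p)) (wop ps v)"
proof (induction ps)
  case (Cons p ps)
  then have "wop (map (\<lambda>p. (fst p, \<lambda>z. c (snd p) * snd p z)) (p # ps)) v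
      = fst p (\<lambda>z. c (snd p) * snd p z) (sc (\<Prod>p\<leftarrow>ps. c (snd p)) (wop ps v))" by simp
  also have "\<dots> = sc (c (snd p)) (fst p (snd p) (sc (\<Prod>p\<leftarrow>ps. c (snd p)) (wop ps v)))"
    using Cons by (simp add: field_cmult)
  also have "\<dots> = sc (c (snd p)) (sc (\<Prod>p\<leftarrow>ps. c (snd p)) (fst p (snd p) (wop ps v)))"
    using Cons by (simp add: lin_scale[OF field_linear[of "fst p" "snd p"]])
  finally show ?case by simp
qed simp

text \<open>Functionals whose vacuum distributions have finite order: the only consequence of
  compatibility that the analytic arguments use.\<close>

definition tame :: "('d \<Rightarrow> complex) \<Rightarrow> bool" where
  "tame l \<longleftrightarrow> Vector_Spaces.linear sc (*) l \<and>
     (\<forall>\<phi>s. set \<phi>s \<subseteq> F \<longrightarrow> (\<exists>C N. 0 \<le> C \<and> (\<forall>ps. map fst ps = \<phi>s \<longrightarrow> snd ` set ps \<subseteq> C\<^sup>\<infinity> \<longrightarrow>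
        cmod (l (wop ps \<Omega>)) \<le> C * (\<Prod>p\<leftarrow>ps. CN_norm N (snd p)))))"

lemma tame_linear: "tame l \<Longrightarrow> Vector_Spaces.linear sc (*) l"
  by (simp add: tame_def)

lemma functional_add: "Vector_Spaces.linear sc (*) l \<Longrightarrow> l (v + w) = l v + l w"
  and functional_scale: "Vector_Spaces.linear sc (*) l \<Longrightarrow> l (sc c v) = c * l v"
  by (simp_all add: Vector_Spaces.linear_iff)

lemma functional_zero: "Vector_Spaces.linear sc (*) l \<Longrightarrow> l 0 = 0"
  using functional_scale[of l 0 0] by simp

lemma functional_diff: "Vector_Spaces.linear sc (*) l \<Longrightarrow> l (v - w) = l v - l w"
  using functional_add[of l v "sc (-1) w"] functional_scale[of l "-1" w] by simp

text \<open>Joint continuity at 0 bounds the functional by 1 on words with small letters.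
  Multilinearity then allows every letter to be rescaled to seminorm e/2, whence the constant
  \<open>(2 / e) ^ k\<close> for k letters. The empty word does not depend on test functions and is
  treated apart.\<close>

lemma compatible_tame:
  assumes l: "compatible_functional sc F l"
  shows "tame l"
  unfolding tame_def
proof (intro conjI allI impI)
  show lin: "Vector_Spaces.linear sc (*) l" using l by (simp add: compatible_functional_def)
  fix \<phi>s assume \<phi>s: "set \<phi>s \<subseteq> F"
  let ?k = "length \<phi>s"
  show "\<exists>C N. 0 \<le> C \<and> (\<forall>ps. map fst ps = \<phi>s \<longrightarrow> snd ` set ps \<subseteq> C\<^sup>\<infinity> \<longrightarrow>
        cmod (l (wop ps \<Omega>)) \<le> C * (\<Prod>p\<leftarrow>ps. CN_norm N (snd p)))"
  proof (cases "\<phi>s = []")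
    case True
    then show ?thesis by (intro exI[of _ "cmod (l \<Omega>)"] exI[of _ 0]) auto
  next
    case False
    define h where "h f = l (word \<phi>s f \<Omega>)" for f
    have "continuous_map (tuple_topology ?k) euclidean h"
      using l \<phi>s unfolding compatible_functional_def h_def[abs_def] by blast
    then have W: "openin (tuple_topology ?k) {f \<in> topspace (tuple_topology ?k). h f \<in> ball 0 1}"
      by (rule openin_continuous_map_preimage) auto
    have fw: "field_word F UNIV ps" if "map fst ps = \<phi>s" "snd ` set ps \<subseteq> C\<^sup>\<infinity>" for ps
    proof -
      have "fst p \<in> F" if "p \<in> set ps" for p
        using \<phi>s \<open>map fst ps = \<phi>s\<close> that by (metis image_eqI list.set_map subsetD)
      then show ?thesis using that(2) unfolding field_word_def by auto
    qed
    have "h (\<lambda>i\<in>{..<?k}. \<lambda>z. 0) = 0"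
    proof -
      have "wop (map (\<lambda>j. (\<phi>s ! j, (\<lambda>i\<in>{..<?k}. \<lambda>z. 0) j)) [0..<?k]) \<Omega> = 0"
      proof (rule wop_zero[of UNIV])
        show "field_word F UNIV (map (\<lambda>j. (\<phi>s ! j, (\<lambda>i\<in>{..<?k}. \<lambda>z. 0) j)) [0..<?k])"
          unfolding field_word_def using \<phi>s smooth_zero by auto
        show "(\<lambda>z. 0) \<in> snd ` set (map (\<lambda>j. (\<phi>s ! j, (\<lambda>i\<in>{..<?k}. \<lambda>z. 0) j)) [0..<?k])"
          using False by (force simp: image_iff)
      qed
      then show ?thesis unfolding h_def word_eq_wop using functional_zero[OF lin] by simp
    qed
    then have "(\<lambda>i\<in>{..<?k}. \<lambda>z. 0) \<in> {f \<in> topspace (tuple_topology ?k). h f \<in> ball 0 1}"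
      using smooth_zero by (auto simp: topspace_smooth)
    from smooth_tuple_nbhd_zero[OF W this] obtain N e where e: "0 < e"
      "\<And>f. (\<And>i. i < ?k \<Longrightarrow> f i \<in> C\<^sup>\<infinity> \<and> CN_norm N (f i) < e) \<Longrightarrow> h (restrict f {..<?k}) \<in> ball 0 1"
      by blast
    have small: "cmod (l (wop ps \<Omega>)) \<le> 1"
      if ps: "map fst ps = \<phi>s" "snd ` set ps \<subseteq> C\<^sup>\<infinity>" "\<And>p. p \<in> set ps \<Longrightarrow> CN_norm N (snd p) < e" for ps
    proof -
      have len: "length ps = ?k" using ps(1) by (metis length_map)
      have "h (restrict (\<lambda>i. snd (ps ! i)) {..<?k}) \<in> ball 0 1"
      proof (rule e(2))
        fix i assume "i < ?k"
        then have "ps ! i \<in> set ps" using len by simp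
        then show "snd (ps ! i) \<in> C\<^sup>\<infinity> \<and> CN_norm N (snd (ps ! i)) < e" using ps(2,3) by blast
      qed
      moreover have "word \<phi>s (restrict (\<lambda>i. snd (ps ! i)) {..<?k}) \<Omega> = wop ps \<Omega>"
      proof -
        have "map (\<lambda>j. (\<phi>s ! j, (restrict (\<lambda>i. snd (ps ! i)) {..<?k}) j)) [0..<?k] = ps"
        proof (rule nth_equalityI)
          fix i assume "i < length (map (\<lambda>j. (\<phi>s ! j, (restrict (\<lambda>i. snd (ps ! i)) {..<?k}) j)) [0..<?k])"
          then have i: "i < ?k" by simp
          then have "map fst ps ! i = fst (ps ! i)" using len by (intro nth_map) (simp only:)
          then have "\<phi>s ! i = fst (ps ! i)" by (simp only: ps(1))
          then show "map (\<lambda>j. (\<phi>s ! j, (restrict (\<lambda>i. snd (ps ! i)) {..<?k}) j)) [0..<?k] ! i = ps ! i"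
            using i by simp
        qed (use len in simp)
        then show ?thesis unfolding word_eq_wop by (simp only:)
      qed
      ultimately show ?thesis by (simp add: h_def)
    qed
    define c where "c f = complex_of_real (e / (2 * CN_norm N f))" for f
    have "cmod (l (wop ps \<Omega>)) \<le> (2 / e) ^ ?k * (\<Prod>p\<leftarrow>ps. CN_norm N (snd p))"
      if ps: "map fst ps = \<phi>s" "snd ` set ps \<subseteq> C\<^sup>\<infinity>" for ps
    \<comment> \<open>A letter of seminorm zero cannot be rescaled, but it is the zero function and
      annihilates the word.\<close>
    proof (cases "\<exists>p\<in>set ps. CN_norm N (snd p) = 0")
      case True
      then have "(\<lambda>z. 0) \<in> snd ` set ps" using ps(2) smooth_eq_zero by (metis image_eqI image_subset_iff)
      then have "l (wop ps \<Omega>) = 0" using wop_zero[OF fw[OF ps]] functional_zero[OF lin] by simp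
      moreover have "0 \<le> (\<Prod>p\<leftarrow>ps. CN_norm N (snd p))"
        by (rule prod_list_nonneg) (use ps(2) CN_norm_nonneg in auto)
      ultimately show ?thesis using e(1) by simp
    next
      case False
      have pos: "0 < CN_norm N (snd p)" if "p \<in> set ps" for p
      proof -
        have "0 \<le> CN_norm N (snd p)" using ps(2) that by (intro CN_norm_nonneg) blast
        moreover have "CN_norm N (snd p) \<noteq> 0" using False that by blast
        ultimately show ?thesis by simp
      qed
      let ?qs = "map (\<lambda>p. (fst p, \<lambda>z. c (snd p) * snd p z)) ps"
      have "cmod (l (wop ?qs \<Omega>)) \<le> 1"
      proof (rule small)
        show "map fst ?qs = \<phi>s" using ps(1) by (simp add: o_def)
        show "snd ` set ?qs \<subseteq> C\<^sup>\<infinity>" using ps(2) by (auto intro!: smooth_cmult(1))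
        fix q assume "q \<in> set ?qs"
        then obtain p where p: "p \<in> set ps" "q = (fst p, \<lambda>z. c (snd p) * snd p z)" by auto
        have "CN_norm N (snd q) \<le> cmod (c (snd p)) * CN_norm N (snd p)"
          using p ps(2) by (auto intro!: CN_norm_cmult)
        also have "\<dots> = e / 2" using pos[OF p(1)] e(1) by (simp add: c_def norm_divide norm_mult)
        finally show "CN_norm N (snd q) < e" using e(1) by simp
      qed
      then have "cmod (\<Prod>p\<leftarrow>ps. c (snd p)) * cmod (l (wop ps \<Omega>)) \<le> 1"
        unfolding wop_scaled[OF fw[OF ps]] functional_scale[OF lin] norm_mult .
      moreover have "cmod (\<Prod>p\<leftarrow>ps. c (snd p)) * ((2 / e) ^ length ps * (\<Prod>p\<leftarrow>ps. CN_norm N (snd p))) = 1"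
        using pos
      proof (induction ps)
        case (Cons p ps)
        have "cmod (c (snd p)) * ((2 / e) * CN_norm N (snd p)) = 1"
          using Cons.prems[of p] e(1) by (simp add: c_def norm_divide norm_mult)
        moreover have "cmod (\<Prod>p\<leftarrow>ps. c (snd p)) * ((2 / e) ^ length ps * (\<Prod>p\<leftarrow>ps. CN_norm N (snd p))) = 1"
          using Cons by simp
        ultimately have "(cmod (c (snd p)) * ((2 / e) * CN_norm N (snd p))) *
           (cmod (\<Prod>p\<leftarrow>ps. c (snd p)) * ((2 / e) ^ length ps * (\<Prod>p\<leftarrow>ps. CN_norm N (snd p)))) = 1" by (simp only: mult_1)
        then show ?case by (simp only: list.map prod_list.Cons list.size norm_mult power_Suc add_Suc_right add_0_right mult_ac)
      qed simp
      moreover have "length ps = ?k" using ps(1) by (metis length_map)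
      ultimately have *: "cmod (\<Prod>p\<leftarrow>ps. c (snd p)) * cmod (l (wop ps \<Omega>)) \<le>
         cmod (\<Prod>p\<leftarrow>ps. c (snd p)) * ((2 / e) ^ ?k * (\<Prod>p\<leftarrow>ps. CN_norm N (snd p)))"
         and "cmod (\<Prod>p\<leftarrow>ps. c (snd p)) \<noteq> 0" by auto
      then have "0 < cmod (\<Prod>p\<leftarrow>ps. c (snd p))" by simp
      from mult_left_le_imp_le[OF * this] show ?thesis .
    qed
    then show ?thesis using e(1) by (intro exI[of _ "(2 / e) ^ ?k"] exI[of _ N]) simp
  qed
qed

lemma tame_bound:
  assumes "tame l" "set \<phi>s \<subseteq> F"
  obtains C N where "0 \<le> C" "\<And>ps. map fst ps = \<phi>s \<Longrightarrow> snd ` set ps \<subseteq> C\<^sup>\<infinity> \<Longrightarrow>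
      cmod (l (wop ps \<Omega>)) \<le> C * (\<Prod>p\<leftarrow>ps. CN_norm N (snd p))"
  using assms unfolding tame_def by metis

lemma tame_distribution:
  assumes l: "tame l" and ps: "field_word F I ps" and qs: "field_word F J qs" and \<phi>: "\<phi> \<in> F"
  shows "distribution (\<lambda>f. l (wop ps (\<phi> f (wop qs \<Omega>))))"
proof -
  note lin = tame_linear[OF l]
  obtain C N where C: "0 \<le> C" "\<And>rs. map fst rs = map fst ps @ \<phi> # map fst qs \<Longrightarrow> snd ` set rs \<subseteq> C\<^sup>\<infinity> \<Longrightarrow>
      cmod (l (wop rs \<Omega>)) \<le> C * (\<Prod>p\<leftarrow>rs. CN_norm N (snd p))"
    by (rule tame_bound[OF l, of "map fst ps @ \<phi> # map fst qs"]) (use ps qs \<phi> in \<open>auto simp: field_word_def\<close>)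
  let ?D = "C * ((\<Prod>p\<leftarrow>ps. CN_norm N (snd p)) * (\<Prod>p\<leftarrow>qs. CN_norm N (snd p)))"
  have "cmod (l (wop ps (\<phi> f (wop qs \<Omega>)))) \<le> ?D * CN_norm N f" if f: "f \<in> C\<^sup>\<infinity>" for f
  proof -
    have "cmod (l (wop (ps @ (\<phi>, f) # qs) \<Omega>)) \<le> C * (\<Prod>p\<leftarrow>ps @ (\<phi>, f) # qs. CN_norm N (snd p))"
      by (rule C(2)) (use ps qs f in \<open>auto simp: field_word_def\<close>)
    then show ?thesis by (simp add: wop_append mult_ac)
  qed
  then show ?thesis
    unfolding distribution_def
    by (intro conjI exI[of _ ?D] exI[of _ N] ballI allI)
      (simp_all add: field_add[OF \<phi>] field_cmult[OF \<phi>] lin_add[OF wop_linear[OF ps]] lin_scale[OF wop_linear[OF ps]]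
        functional_add[OF lin] functional_scale[OF lin])
qed

lemma functional_comp:
  "Vector_Spaces.linear sc (*) l \<Longrightarrow> Vector_Spaces.linear sc sc x \<Longrightarrow> Vector_Spaces.linear sc (*) (\<lambda>v. l (x v))"
  by (simp add: Vector_Spaces.linear_iff)

text \<open>Letters on the left of a word can be absorbed into the functional; the inductions over
  words rely on this.\<close>

lemma tame_comp:
  assumes l: "tame l" and ps: "field_word F I ps"
  shows "tame (\<lambda>v. l (wop ps v))"
  unfolding tame_def
proof (intro conjI allI impI)
  show "Vector_Spaces.linear sc (*) (\<lambda>v. l (wop ps v))"
    by (rule functional_comp[OF tame_linear[OF l] wop_linear[OF ps]])
  fix \<phi>s assume \<phi>s: "set \<phi>s \<subseteq> F"
  obtain C N where C: "0 \<le> C" "\<And>rs. map fst rs = map fst ps @ \<phi>s \<Longrightarrow> snd ` set rs \<subseteq> C\<^sup>\<infinity> \<Longrightarrow>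
      cmod (l (wop rs \<Omega>)) \<le> C * (\<Prod>p\<leftarrow>rs. CN_norm N (snd p))"
    by (rule tame_bound[OF l, of "map fst ps @ \<phi>s"]) (use ps \<phi>s in \<open>auto simp: field_word_def\<close>)
  have nn: "0 \<le> (\<Prod>p\<leftarrow>ps. CN_norm N (snd p))"
    by (rule prod_list_nonneg) (use ps in \<open>auto simp: field_word_def intro: CN_norm_nonneg\<close>)
  have "cmod (l (wop ps (wop qs \<Omega>))) \<le> (C * (\<Prod>p\<leftarrow>ps. CN_norm N (snd p))) * (\<Prod>p\<leftarrow>qs. CN_norm N (snd p))"
    if "map fst qs = \<phi>s" "snd ` set qs \<subseteq> C\<^sup>\<infinity>" for qs
    using C(2)[of "ps @ qs"] that ps by (auto simp: wop_append field_word_def image_subset_iff mult_ac)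
  then show "\<exists>C N. 0 \<le> C \<and> (\<forall>qs. map fst qs = \<phi>s \<longrightarrow> snd ` set qs \<subseteq> C\<^sup>\<infinity> \<longrightarrow>
        cmod (l (wop ps (wop qs \<Omega>))) \<le> C * (\<Prod>p\<leftarrow>qs. CN_norm N (snd p)))"
    using C(1) nn by (intro exI[of _ "C * (\<Prod>p\<leftarrow>ps. CN_norm N (snd p))"] exI[of _ N]) simp
qed

lemma span_words: "span {wop ps \<Omega> | ps. field_word F UNIV ps} = UNIV"
proof -
  have "{word \<phi>s f \<Omega> | \<phi>s f. set \<phi>s \<subseteq> F \<and> (\<forall>j<length \<phi>s. f j \<in> C\<^sup>\<infinity>)} \<subseteq> {wop ps \<Omega> | ps. field_word F UNIV ps}"
  proof
    fix w assume "w \<in> {word \<phi>s f \<Omega> | \<phi>s f. set \<phi>s \<subseteq> F \<and> (\<forall>j<length \<phi>s. f j \<in> C\<^sup>\<infinity>)}"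
    then obtain \<phi>s f where w: "w = word \<phi>s f \<Omega>" "set \<phi>s \<subseteq> F" "\<And>j. j < length \<phi>s \<Longrightarrow> f j \<in> C\<^sup>\<infinity>" by blast
    have "field_word F UNIV (map (\<lambda>j. (\<phi>s ! j, f j)) [0..<length \<phi>s])"
      using w by (auto simp: field_word_def)
    then show "w \<in> {wop ps \<Omega> | ps. field_word F UNIV ps}" using w(1) unfolding word_eq_wop by blast
  qed
  from span_mono[OF this] show ?thesis unfolding vacuum_cyclic by blast
qed

lemma functional_eq_zero:
  assumes l: "Vector_Spaces.linear sc (*) l" and z: "\<And>ps. field_word F UNIV ps \<Longrightarrow> l (wop ps \<Omega>) = 0"
  shows "l v = 0"
proof -
  have "v \<in> span {wop ps \<Omega> | ps. field_word F UNIV ps}" using span_words by simp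
  then show ?thesis
    by (induction rule: span_induct_alt) (auto simp: functional_zero[OF l] functional_add[OF l] functional_scale[OF l] z)
qed

lemma U_linear: "\<gamma> \<in> Mob \<Longrightarrow> Vector_Spaces.linear sc sc (U \<gamma>)"
  using U_cont by (simp add: cont_ops_def)

lemma U_inv: "\<gamma> \<in> Mob \<Longrightarrow> U \<gamma> (U (inv \<gamma>) v) = v" "\<gamma> \<in> Mob \<Longrightarrow> U (inv \<gamma>) (U \<gamma> v) = v"
  using U_comp[of \<gamma> "inv \<gamma>"] U_comp[of "inv \<gamma>" \<gamma>] Mob_inv[of \<gamma>] Mob_inv_comp[of \<gamma>] U_id
  by (auto simp: fun_eq_iff)

lemma inv_U: "\<gamma> \<in> Mob \<Longrightarrow> inv (U \<gamma>) = U (inv \<gamma>)"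
  by (rule inv_unique_comp) (auto simp: U_inv fun_eq_iff)

lemma U_field:
  assumes "\<phi> \<in> F" "\<gamma> \<in> Mob" "f \<in> C\<^sup>\<infinity>"
  shows "U \<gamma> (\<phi> f v) = \<phi> (beta (d \<phi>) \<gamma> f) (U \<gamma> v)"
proof -
  have "(U \<gamma> \<circ> \<phi> f \<circ> inv (U \<gamma>)) (U \<gamma> v) = \<phi> (beta (d \<phi>) \<gamma> f) (U \<gamma> v)"
    unfolding covariance[OF assms] ..
  then show ?thesis using U_inv(2)[OF assms(2)] by (simp add: inv_U[OF assms(2)])
qed

section \<open>Covariance of words, energy, and the Reeh-Schlieder property\<close>

definition bword :: "(complex \<Rightarrow> complex) \<Rightarrow> 'd smeared \<Rightarrow> 'd smeared" where
  "bword \<gamma> ps = map (\<lambda>p. (fst p, beta (d (fst p)) \<gamma> (snd p))) ps"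

lemma bword_simps [simp]: "bword \<gamma> [] = []"
  "bword \<gamma> (p # ps) = (fst p, beta (d (fst p)) \<gamma> (snd p)) # bword \<gamma> ps"
  "bword \<gamma> (ps @ qs) = bword \<gamma> ps @ bword \<gamma> qs"
  by (simp_all add: bword_def)

lemma bword_field_word:
  "\<gamma> \<in> Mob \<Longrightarrow> field_word F I ps \<Longrightarrow> field_word F (\<gamma> ` I) (bword \<gamma> ps)"
  by (induction ps) (auto simp: beta_smooth dest: subsetD[OF supp_beta])

lemma U_wop: "\<gamma> \<in> Mob \<Longrightarrow> field_word F I ps \<Longrightarrow> U \<gamma> (wop ps v) = wop (bword \<gamma> ps) (U \<gamma> v)"
  by (induction ps) (auto simp: U_field)

lemma beta_rotation_trig: "beta k (rotation t) (trig n) = (\<lambda>z. cis (- (of_int n * t)) * trig n z)"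
proof
  fix z
  show "beta k (rotation t) (trig n) z = cis (- (of_int n * t)) * trig n z"
  proof (cases "z \<in> S\<^sup>1")
    case True
    have "pole_factor (cis (t / 2)) 0 z = 1" by (simp add: pole_factor_def cis_cnj cis_mult)
    moreover have "cis (- (t / 2)) * z / cis (t / 2) = cis (- t) * z"
    proof -
      have "cis (- (t / 2)) / cis (t / 2) = cis (- t)" by (simp add: cis_divide)
      then show ?thesis by (metis times_divide_eq_left)
    qed
    ultimately have "beta k (rotation t) (trig n) z = trig n (cis (- t) * z)"
      unfolding rotation_su11(1) beta_su11[OF rotation_su11(2) True] by (simp add: cis_cnj)
    also have "\<dots> = cis (- (of_int n * t)) * trig n z"
      using True by (simp add: trig_def norm_mult power_int_mult_distrib cis_power_int)
    finally show ?thesis .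
  next
    case False
    then show ?thesis using beta_off_circle[OF rotation_Mob trig_smooth(1) False] by (simp add: trig_def)
  qed
qed

text \<open>The mode \<phi>(z^m) lowers the energy by m. Together with \<open>spectrum\<close> this
  annihilates a vector of finite energy for all large m.\<close>

lemma U_rotation_field_trig:
  assumes \<phi>: "\<phi> \<in> F" and w: "U (rotation t) w = sc (cis (of_int n * t)) w"
  shows "U (rotation t) (\<phi> (trig m) w) = sc (cis (of_int (n - m) * t)) (\<phi> (trig m) w)"
proof -
  have "U (rotation t) (\<phi> (trig m) w) = \<phi> (\<lambda>z. cis (- (of_int m * t)) * trig m z) (sc (cis (of_int n * t)) w)"
    by (simp only: U_field[OF \<phi> rotation_Mob trig_smooth(1)] beta_rotation_trig w)
  also have "\<dots> = sc (cis (- (of_int m * t))) (sc (cis (of_int n * t)) (\<phi> (trig m) w))"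
    by (simp only: field_cmult[OF \<phi> trig_smooth(1)] lin_scale[OF field_linear[OF \<phi> trig_smooth(1)]])
  also have "\<dots> = sc (cis (of_int (n - m) * t)) (\<phi> (trig m) w)"
    unfolding scale_scale cis_mult by (simp add: left_diff_distrib)
  finally show ?thesis .
qed

lemma U_rotation_trig_word:
  "\<forall>p\<in>set qs. fst p \<in> F \<and> (\<exists>n. snd p = trig n) \<Longrightarrow>
   \<exists>n::int. \<forall>t. U (rotation t) (wop qs \<Omega>) = sc (cis (of_int n * t)) (wop qs \<Omega>)"
proof (induction qs)
  case Nil
  then show ?case by (intro exI[of _ 0]) (simp add: vacuum_invariant rotation_Mob)
next
  case (Cons p qs)
  then obtain n m where n: "\<And>t. U (rotation t) (wop qs \<Omega>) = sc (cis (of_int n * t)) (wop qs \<Omega>)"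
    and m: "snd p = trig m" by auto
  have p: "fst p \<in> F" using Cons.prems by simp
  have "U (rotation t) (wop (p # qs) \<Omega>) = sc (cis (of_int (n - m) * t)) (wop (p # qs) \<Omega>)" for t
    using U_rotation_field_trig[OF p n[of t], of m] m by simp
  then show ?case by blast
qed

lemma field_trig_negative:
  assumes qs: "\<forall>p\<in>set qs. fst p \<in> F \<and> (\<exists>n. snd p = trig n)" and \<phi>: "\<phi> \<in> F"
  shows "\<exists>n0. \<forall>m>n0. \<phi> (trig m) (wop qs \<Omega>) = 0"
proof -
  obtain n where n: "\<And>t. U (rotation t) (wop qs \<Omega>) = sc (cis (of_int n * t)) (wop qs \<Omega>)"
    using U_rotation_trig_word[OF qs] by blast
  have "\<phi> (trig m) (wop qs \<Omega>) = 0" if "m > n" for m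
  proof (rule spectrum[of "n - m"])
    show "\<forall>t. U (rotation t) (\<phi> (trig m) (wop qs \<Omega>)) = sc (cis (of_int (n - m) * t)) (\<phi> (trig m) (wop qs \<Omega>))"
      using U_rotation_field_trig[OF \<phi> n] by blast
  qed (use that in simp)
  then show ?thesis by blast
qed

text \<open>Unique continuation from I needs a spectrum bounded on one side, which is available for
  a field acting on a vector of finite energy. So the letters in I are first replaced by characters,
  beginning next to the vacuum (fact 1). Once all letters may be characters, Fourier expansion of
  each letter gives arbitrary test functions (fact 2).\<close>

theorem reeh_schlieder:
  assumes l: "tame l" and I: "openin (top_of_set S\<^sup>1) I" "I \<noteq> {}"
    and z: "\<And>ps. field_word F I ps \<Longrightarrow> l (wop ps \<Omega>) = 0"
  shows "l v = 0"
proof (rule functional_eq_zero[OF tame_linear[OF l]])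
  have IS: "field_word F UNIV qs" if "\<forall>p\<in>set qs. fst p \<in> F \<and> (\<exists>n. snd p = trig n)" for qs
    using that trig_smooth(1) by (auto simp: field_word_def)
  have 1: "l (wop (ps @ qs) \<Omega>) = 0"
    if "field_word F I ps" "\<forall>p\<in>set qs. fst p \<in> F \<and> (\<exists>n. snd p = trig n)" for ps qs
    using that
  proof (induction qs arbitrary: ps)
    case Nil
    then show ?case using z by simp
  next
    case (Cons p qs)
    obtain m where m: "snd p = trig m" using Cons.prems by auto
    have p: "fst p \<in> F" and qs: "\<forall>p\<in>set qs. fst p \<in> F \<and> (\<exists>n. snd p = trig n)" using Cons.prems by auto
    let ?T = "\<lambda>f. l (wop ps (fst p f (wop qs \<Omega>)))"
    have T: "distribution ?T" by (rule tame_distribution[OF l Cons.prems(1) IS[OF qs] p])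
    obtain n0 where n0: "\<And>m. m > n0 \<Longrightarrow> fst p (trig m) (wop qs \<Omega>) = 0" using field_trig_negative[OF qs p] by blast
    have "?T (trig m) = 0"
    proof (rule distribution_vanishing_on_arc[OF T _ I _ trig_smooth(1)])
      show "?T (trig k) = 0" if "k > n0" for k
        using n0[OF that] lin_zero[OF wop_linear[OF Cons.prems(1)]] functional_zero[OF tame_linear[OF l]] by simp
      fix f assume f: "f \<in> C\<^sup>\<infinity>" "supp f \<subseteq> I"
      have "l (wop ((ps @ [(fst p, f)]) @ qs) \<Omega>) = 0"
        by (rule Cons.IH) (use Cons.prems f p qs in auto)
      then show "?T f = 0" by (simp add: wop_append)
    qed
    then show ?case by (simp add: wop_append m)
  qed
  have 2: "l (wop (qs @ ps) \<Omega>) = 0"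
    if "field_word F UNIV ps" "\<forall>p\<in>set qs. fst p \<in> F \<and> (\<exists>n. snd p = trig n)" for ps qs
    using that
  proof (induction ps arbitrary: qs)
    case Nil
    then show ?case using 1[of "[]" qs] by simp
  next
    case (Cons p ps)
    let ?T = "\<lambda>f. l (wop qs (fst p f (wop ps \<Omega>)))"
    have T: "distribution ?T"
      by (rule tame_distribution[OF l IS[OF Cons.prems(2)]]) (use Cons.prems in auto)
    have "?T (trig n) = 0" for n
    proof -
      have "l (wop ((qs @ [(fst p, trig n)]) @ ps) \<Omega>) = 0"
        by (rule Cons.IH) (use Cons.prems in auto)
      then show ?thesis by (simp add: wop_append)
    qed
    then have "(\<lambda>K::nat. 0) \<longlonglongrightarrow> ?T (snd p)"
      using distribution_fourier[OF T, of "snd p"] Cons.prems by simp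
    then show ?case by (simp add: LIMSEQ_const_iff wop_append)
  qed
  show "l (wop ps \<Omega>) = 0" if "field_word F UNIV ps" for ps
    using 2[of ps "[]"] that by simp
qed

end

section \<open>Energy bounds on the vacuum\<close>

text \<open>At weight d = n + 1 the factor |c - s z|^{2n} cancels the denominator in the n-th power
  of (c z - s)/(c - s z) and leaves (c z - s)^{2n} z^{-n}. So z^n stays in the finite-dimensional
  span of z^{-n}, ..., z^n, and all of these characters occur in its expansion.\<close>

lemma beta_trig_binomial:
  fixes t :: real
  defines "c \<equiv> complex_of_real (cosh (t / 2))" and "s \<equiv> complex_of_real (sinh (t / 2))"
  shows "beta (Suc n) (dil t) (trig (int n)) =
    (\<lambda>z. \<Sum>k\<le>2 * n. (of_nat (2 * n choose k) * (- s) ^ k * c ^ (2 * n - k)) * trig (int n - int k) z)"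
proof
  fix z
  show "beta (Suc n) (dil t) (trig (int n)) z =
    (\<Sum>k\<le>2 * n. (of_nat (2 * n choose k) * (- s) ^ k * c ^ (2 * n - k)) * trig (int n - int k) z)"
  proof (cases "z \<in> S\<^sup>1")
    case True
    have z0: "z \<noteq> 0" using True by auto
    let ?w = "(c * z - s) / (c - s * z)"
    have cs: "su11 c s" unfolding c_def s_def by (rule dil_su11)
    have real: "cnj c = c" "cnj s = s" by (simp_all add: c_def s_def)
    have nz: "c - s * z \<noteq> 0" using su11_denom'[OF cs, of z] True real by simp
    have w: "?w \<in> S\<^sup>1"
      using su11_action_norm(2)[OF su11_uminus[OF cs], of z] True by (simp add: su11_action_def real)
    have zc: "cnj z = inverse z" using inverse_circle[OF True] by simp
    have "pole_factor c s z * ?w = (c - s * inverse z) * (c * z - s)"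
      using nz by (simp add: pole_factor_def real zc)
    also have "\<dots> = (- s + c * z)\<^sup>2 * inverse z"
      using z0 by (simp add: field_simps power2_eq_square)
    finally have *: "pole_factor c s z * ?w = (- s + c * z)\<^sup>2 * inverse z" .
    have "beta (Suc n) (dil t) (trig (int n)) z = (pole_factor c s z * ?w) ^ n"
      unfolding dil_def c_def[symmetric] s_def[symmetric] beta_su11[OF cs True] real
      using w by (simp only: trig_def if_True power_int_of_nat power_mult_distrib of_nat_Suc add_diff_cancel_left')
    also have "\<dots> = (- s + c * z) ^ (2 * n) * inverse z ^ n"
      unfolding * power_mult_distrib power_mult ..
    also have "\<dots> = (\<Sum>k\<le>2 * n. of_nat (2 * n choose k) * (- s) ^ k * (c * z) ^ (2 * n - k) * inverse z ^ n)"
      unfolding binomial_ring by (simp add: sum_distrib_right)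
    also have "\<dots> = (\<Sum>k\<le>2 * n. (of_nat (2 * n choose k) * (- s) ^ k * c ^ (2 * n - k)) * trig (int n - int k) z)"
    proof (rule sum.cong)
      fix k assume k: "k \<in> {..2 * n}"
      have "int n - int k = int (2 * n - k) + (- int n)" using k by simp
      then have "z powi (int n - int k) = z powi int (2 * n - k) * z powi (- int n)"
        using z0 by (metis power_int_add)
      also have "\<dots> = z ^ (2 * n - k) * inverse z ^ n"
        by (simp add: power_int_minus power_inverse)
      finally have "trig (int n - int k) z = z ^ (2 * n - k) * inverse z ^ n" using True by (simp add: trig_def)
      then show "of_nat (2 * n choose k) * (- s) ^ k * (c * z) ^ (2 * n - k) * inverse z ^ n
          = (of_nat (2 * n choose k) * (- s) ^ k * c ^ (2 * n - k)) * trig (int n - int k) z"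
        by (simp only: power_mult_distrib mult_ac)
    qed simp
    finally show ?thesis .
  next
    case False
    then show ?thesis using beta_off_circle[OF dil_Mob trig_smooth(1) False] by (simp add: trig_def)
  qed
qed

text \<open>At weight d = 1 there is no angular speed factor and h is (c z - s)/(c - s z). Clearing
  the denominator gives a two-term recursion for the coefficients. For n < 0 it reads
  \<open>fhat h n = x * fhat h (n - 1)\<close>; iterated towards negative infinity with |x| < 1 and
  bounded coefficients, it forces zero.\<close>

lemma fhat_beta_trig_1:
  fixes t :: real
  defines "h \<equiv> beta 1 (dil t) (trig 1)" and "x \<equiv> complex_of_real (tanh (t / 2))"
  shows "n < 0 \<Longrightarrow> fhat h n = 0" "fhat h 0 = - x"
proof -
  let ?c = "complex_of_real (cosh (t / 2))" and ?s = "complex_of_real (sinh (t / 2))"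
  have hs: "h \<in> C\<^sup>\<infinity>" unfolding h_def by (rule beta_smooth[OF dil_Mob trig_smooth(1)])
  have c0: "?c \<noteq> 0" using cosh_real_pos[of "t / 2"] by simp
  have hc: "?c * h (cis u) + (- ?s) * (h (cis u) * cis (of_int 1 * u)) =
      (\<Sum>k\<in>{0,1::int}. (if k = 0 then - ?s else ?c) * cis (of_int k * u))" for u
  proof -
    have z: "cis u \<in> S\<^sup>1" by simp
    have nz: "?c - ?s * cis u \<noteq> 0" using su11_denom'[OF dil_su11, of "cis u" t] by simp
    have w: "(?c * cis u - ?s) / (?c - ?s * cis u) \<in> S\<^sup>1"
      using su11_action_norm(2)[OF su11_uminus[OF dil_su11], of t "cis u"] by (simp add: su11_action_def)
    have "h (cis u) = (?c * cis u - ?s) / (?c - ?s * cis u)"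
      unfolding h_def dil_def beta_su11[OF dil_su11 z] using w by (simp add: trig_def)
    then have "h (cis u) * (?c - ?s * cis u) = ?c * cis u - ?s" using nz by simp
    then show ?thesis by (simp add: algebra_simps)
  qed
  have cont: "continuous_on UNIV (\<lambda>u. h (cis u))"
    using smooth_continuous[OF hs, of UNIV 0] by (simp add: angle_deriv_0[abs_def])
  have "?c * fhat h n + (- ?s) * fhat h (n - 1) = (if n \<in> {0, 1} then if n = 0 then - ?s else ?c else 0)" for n
  proof -
    have "?c * fhat h n + (- ?s) * fhat h (n - 1)
      = fourier (\<lambda>u. ?c * h (cis u) + (- ?s) * (h (cis u) * cis (of_int 1 * u))) n"
      unfolding fhat_def fourier_mult_cis[symmetric]
      by (rule fourier_lin_UNIV[symmetric]) (intro continuous_intros cont)+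
    also have "\<dots> = (if n \<in> {0, 1} then if n = 0 then - ?s else ?c else 0)"
      unfolding hc by (rule conjunct2[OF fourier_trig_sum]) simp
    finally show ?thesis .
  qed
  then have rec: "?c * fhat h n = ?s * fhat h (n - 1) + (if n \<in> {0, 1} then if n = 0 then - ?s else ?c else 0)" for n
    by (simp add: algebra_simps)
  have x: "x = ?s / ?c" by (simp add: x_def tanh_def)
  have step: "fhat h n = x * fhat h (n - 1)" if "n < 0" for n
    using rec[of n] that c0 by (simp add: x field_simps)
  have pow: "fhat h n = x ^ k * fhat h (n - int k)" if "n < 0" for n k
  proof (induction k)
    case (Suc k)
    then show ?case using step[of "n - int k"] that by (simp add: algebra_simps)
  qed simp
  have x1: "cmod x < 1" by (simp add: x_def abs_less_iff tanh_real_lt_1 tanh_real_gt_neg1 minus_less_iff)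
  show neg: "fhat h n = 0" if "n < 0" for n
  proof -
    have "cmod (fhat h n) \<le> cmod x ^ k * CN_norm 0 h" for k
    proof -
      have "cmod (fhat h (n - int k)) \<le> CN_norm 0 h" using fhat_decay[OF hs, of "n - int k" 0] by simp
      then have "cmod x ^ k * cmod (fhat h (n - int k)) \<le> cmod x ^ k * CN_norm 0 h" by (rule mult_left_mono) simp
      then show ?thesis unfolding pow[OF that, of k] norm_mult norm_power .
    qed
    moreover have "(\<lambda>k. cmod x ^ k * CN_norm 0 h) \<longlonglongrightarrow> 0"
      by (intro tendsto_mult_left_zero LIMSEQ_power_zero) (use x1 in simp)
    ultimately have "cmod (fhat h n) \<le> 0" by (intro LIMSEQ_le_const) auto
    then show ?thesis by simp
  qed
  have "?c * fhat h 0 = - ?s" using rec[of 0] neg[of "-1"] by simp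
  then have "fhat h 0 = - ?s / ?c" using c0 by (metis nonzero_mult_div_cancel_left)
  then show "fhat h 0 = - x" by (simp add: x)
qed

text \<open>For d = 0 the claim is the hypothesis on m > 0. For d = 1 only m = 0 is new, and it
  comes from the constant coefficient -tanh(t/2) of the dilated z. For d \<ge> 2 the dilated z^{d-1}
  gives, up to a power of cosh, a polynomial in tanh(t/2) with infinitely many roots; its
  coefficients are nonzero multiples of T(z^m) with |m| \<le> d - 1.\<close>

lemma distribution_low_modes_vanish:
  assumes T: "distribution T" and pos: "\<And>m. m > 0 \<Longrightarrow> T (trig m) = 0"
    and inv: "\<And>t m. m > 0 \<Longrightarrow> T (beta d (dil t) (trig m)) = 0"
    and m: "m > - int d"
  shows "T (trig m) = 0"
proof -
  consider "m > 0" | "m = 0" "d = 1" | n where "d = Suc (Suc n)" "m \<le> 0"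
  proof -
    have "d = 0 \<or> d = 1 \<or> (\<exists>n. d = Suc (Suc n))" by (metis One_nat_def nat.exhaust)
    then show ?thesis using that m by (cases "m > 0") auto
  qed
  then show ?thesis
  proof cases
    case 1
    then show ?thesis by (rule pos)
  next
    case 2
    let ?h = "beta 1 (dil 1) (trig 1)" and ?x = "complex_of_real (tanh (1 / 2))"
    have "fhat ?h n * T (trig n) = (if n = 0 then - ?x * T (trig 0) else 0)" for n
      using fhat_beta_trig_1[where t=1] pos[of n] by (cases "n < 0"; cases "n = 0") auto
    then have "(\<lambda>K. \<Sum>n\<in>{- int K..int K}. fhat ?h n * T (trig n)) = (\<lambda>K. - ?x * T (trig 0))"
      by (simp add: fun_eq_iff)
    then have "(\<lambda>K::nat. - ?x * T (trig 0)) \<longlonglongrightarrow> T ?h"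
      using distribution_fourier[OF T beta_smooth[OF dil_Mob trig_smooth(1)], of 1 1 1] by simp
    then have "- ?x * T (trig 0) = T ?h" by (simp add: LIMSEQ_const_iff)
    also have "\<dots> = 0" using inv[of 1 1] 2 by simp
    finally show ?thesis using 2 by simp
  next
    case (3 n)
    let ?n = "Suc n"
    let ?a = "\<lambda>k. of_nat (2 * ?n choose k) * T (trig (int ?n - int k))"
    have root: "(\<Sum>k\<le>2 * ?n. ?a k * (- complex_of_real (tanh (t / 2))) ^ k) = 0" for t :: real
    proof -
      let ?c = "complex_of_real (cosh (t / 2))" and ?s = "complex_of_real (sinh (t / 2))"
      have c0: "?c \<noteq> 0" using cosh_real_pos[of "t / 2"] by simp
      have "0 = T (beta d (dil t) (trig (int ?n)))" using inv by simp
      also have "\<dots> = (\<Sum>k\<le>2 * ?n. (of_nat (2 * ?n choose k) * (- ?s) ^ k * ?c ^ (2 * ?n - k)) * T (trig (int ?n - int k)))"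
        unfolding 3(1) beta_trig_binomial by (rule distribution_sum[OF T]) (auto intro: trig_smooth(1))
      also have "\<dots> = (\<Sum>k\<le>2 * ?n. ?c ^ (2 * ?n) * (?a k * (- complex_of_real (tanh (t / 2))) ^ k))"
      proof (rule sum.cong)
        fix k assume k: "k \<in> {..2 * ?n}"
        have "?c ^ (2 * ?n) = ?c ^ (2 * ?n - k) * ?c ^ k" using k by (simp flip: power_add)
        moreover have "?c ^ k * (- complex_of_real (tanh (t / 2))) ^ k = (- ?s) ^ k"
          unfolding power_mult_distrib[symmetric] using c0 by (simp add: tanh_def)
        ultimately have "?c ^ (2 * ?n) * (- complex_of_real (tanh (t / 2))) ^ k = ?c ^ (2 * ?n - k) * (- ?s) ^ k"
          by (simp only: mult.assoc)
        then show "(of_nat (2 * ?n choose k) * (- ?s) ^ k * ?c ^ (2 * ?n - k)) * T (trig (int ?n - int k))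
           = ?c ^ (2 * ?n) * (?a k * (- complex_of_real (tanh (t / 2))) ^ k)"
          by (simp only: mult_ac)
      qed simp
      finally have "?c ^ (2 * ?n) * (\<Sum>k\<le>2 * ?n. ?a k * (- complex_of_real (tanh (t / 2))) ^ k) = 0"
        by (simp only: sum_distrib_left)
      then show ?thesis using c0 by (simp only: mult_eq_0_iff power_eq_0_iff) simp
    qed
    have "infinite (range (\<lambda>t::real. - complex_of_real (tanh (t / 2))))"
    proof
      assume "finite (range (\<lambda>t::real. - complex_of_real (tanh (t / 2))))"
      moreover have "inj (\<lambda>t::real. - complex_of_real (tanh (t / 2)))" by (rule injI) simp
      ultimately show False using finite_imageD infinite_UNIV_char_0 by blast
    qed
    then have inf: "infinite {z. (\<Sum>k\<le>2 * ?n. ?a k * z ^ k) = 0}"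
      by (rule infinite_super[rotated]) (use root in auto)
    have a0: "?a k = 0" if "k \<le> 2 * ?n" for k
      using polyfun_finite_roots[of ?a "2 * ?n"] inf that by blast
    have le: "nat (int ?n - m) \<le> 2 * ?n" using m 3 by simp
    have "?a (nat (int ?n - m)) = 0" by (rule a0[OF le])
    moreover have "(2 * ?n choose nat (int ?n - m)) \<noteq> 0" using le by (metis binomial_eq_0_iff not_less)
    moreover have "int ?n - int (nat (int ?n - m)) = m" using 3 by simp
    ultimately show ?thesis by (metis mult_eq_0_iff of_nat_eq_0_iff)
  qed
qed

context wightman_cft
begin

lemma vacuum_word_distribution:
  assumes l: "tame l" and \<phi>: "\<phi> \<in> F" shows "distribution (\<lambda>f. l (\<phi> f \<Omega>))"
  using tame_distribution[OF l _ _ \<phi>, of UNIV "[]" UNIV "[]"] by simp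

text \<open>The kernel of \<open>f \<mapsto> \<phi>(f)\<Omega>\<close> is Moebius invariant, so that positivity of the energy
  improves from \<open>m > 0\<close> to \<open>m > - d\<close>.\<close>

lemma field_low_modes_vacuum:
  assumes \<phi>: "\<phi> \<in> F" and m: "m > - int (d \<phi>)" shows "\<phi> (trig m) \<Omega> = 0"
proof -
  have pos: "\<phi> (trig m) \<Omega> = 0" if "m > 0" for m
  proof (rule spectrum[of "0 - m"])
    have \<Omega>: "U (rotation t) \<Omega> = sc (cis (of_int 0 * t)) \<Omega>" for t
      by (simp add: vacuum_invariant rotation_Mob)
    show "\<forall>t. U (rotation t) (\<phi> (trig m) \<Omega>) = sc (cis (of_int (0 - m) * t)) (\<phi> (trig m) \<Omega>)"
      using U_rotation_field_trig[OF \<phi> \<Omega>] by blast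
  qed (use that in simp)
  have inv: "\<phi> (beta (d \<phi>) (dil t) (trig m)) \<Omega> = 0" if "m > 0" for t m
    using U_field[OF \<phi> dil_Mob trig_smooth(1), of t m \<Omega>] pos[OF that] lin_zero[OF U_linear[OF dil_Mob]]
    by (simp add: vacuum_invariant[OF dil_Mob])
  show ?thesis
  proof (rule ccontr)
    assume "\<phi> (trig m) \<Omega> \<noteq> 0"
    then obtain l where l: "compatible_functional sc F l" "l (\<phi> (trig m) \<Omega>) \<noteq> l 0"
      using regular unfolding acts_regularly_def by blast
    note t = compatible_tame[OF l(1)]
    have z: "l 0 = 0" by (rule functional_zero[OF tame_linear[OF t]])
    have "l (\<phi> (trig m) \<Omega>) = 0"
      by (rule distribution_low_modes_vanish[OF vacuum_word_distribution[OF t \<phi>] _ _ m]) (simp_all add: pos inv z)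
    then show False using l(2) z by simp
  qed
qed

end

section \<open>Gaussian approximate identities\<close>

lemma gauss_mass_nonzero: "(LBINT v. exp (- (v::real)\<^sup>2)) \<noteq> 0"
proof
  assume "(LBINT v. exp (- (v::real)\<^sup>2)) = 0"
  moreover have "integrable lborel (\<lambda>v::real. exp (- v\<^sup>2))" using integrable_gauss[of 1 0] by simp
  ultimately have "AE v in lborel. exp (- (v::real)\<^sup>2) = 0"
    using integral_nonneg_eq_0_iff_AE[of lborel "\<lambda>v::real. exp (- v\<^sup>2)"] by simp
  then have "AE v::real in lborel. False" by (rule AE_mp) simp
  then show False by (simp add: eventually_False ae_filter_eq_bot_iff)
qed

text \<open>The narrow Gaussian in x - y does not decay along the diagonal. Together with the decay
  of g in y it yields a positive definite quadratic form, so the integrand is dominated by a product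
  of Gaussians in x and in y despite the exponential growth of H.\<close>

lemma gaussian_swap:
  fixes H :: "real \<Rightarrow> real \<Rightarrow> complex"
  assumes H: "continuous_on UNIV (\<lambda>(x, y). H x y)" and le: "\<And>x y. cmod (H x y) \<le> C * exp (M * (\<bar>x\<bar> + \<bar>y\<bar>))"
    and g: "gaussian g" and n: "0 < n"
  shows "(LBINT y. (LBINT x. H x y * g (of_real y) * exp (- of_real n * (of_real x - of_real y + \<i> * of_real \<tau>)\<^sup>2))) =
    (LBINT x. (LBINT y. H x y * g (of_real y) * exp (- of_real n * (of_real x - of_real y + \<i> * of_real \<tau>)\<^sup>2)))"
proof -
  obtain B c where B: "0 \<le> B" "0 < c" "\<And>t. cmod (g (of_real t)) \<le> B * exp (- c * t\<^sup>2)"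
    using gaussian_bound_real[OF g] by blast
  have C: "0 \<le> C" using order_trans[OF norm_ge_zero le[of 0 0]] by simp
  define e where "e = min n c"
  have e: "0 < e" "e \<le> n" "e \<le> c" using n B(2) by (auto simp: e_def)
  define u where "u x = C * B * exp (n * \<tau>\<^sup>2) * exp (M * \<bar>x\<bar> - e / 4 * x\<^sup>2)" for x
  define w where "w y = exp (M * \<bar>y\<bar> - e / 2 * y\<^sup>2)" for y :: real
  have quad: "e / 4 * x\<^sup>2 + e / 2 * y\<^sup>2 \<le> n * (x - y)\<^sup>2 + c * y\<^sup>2" for x y :: real
  proof -
    have "e * (x - y)\<^sup>2 \<le> n * (x - y)\<^sup>2" "e * y\<^sup>2 \<le> c * y\<^sup>2" using e by (auto intro: mult_right_mono)
    \<comment> \<open>A square completed in x after a quarter of e x^2 is set aside; the factor 4/3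
      is what the mixed term 2xy requires.\<close>
    moreover have "e * (x - y)\<^sup>2 + e * y\<^sup>2 = e / 4 * x\<^sup>2 + e / 2 * y\<^sup>2 + e * (3 / 4 * (x - 4 / 3 * y)\<^sup>2 + 1 / 6 * y\<^sup>2)"
      by (simp add: power2_eq_square field_simps)
    moreover have "0 \<le> e * (3 / 4 * (x - 4 / 3 * y)\<^sup>2 + 1 / 6 * y\<^sup>2)" using e by simp
    ultimately show ?thesis by linarith
  qed
  have ng: "cmod (exp (- of_real n * (of_real x - of_real y + \<i> * of_real \<tau>)\<^sup>2)) = exp (n * \<tau>\<^sup>2) * exp (- n * (x - y)\<^sup>2)" for x y
    by (simp add: power2_eq_square algebra_simps flip: exp_add)
  show ?thesis
  proof (rule fubini_lborel)
    show "continuous_on UNIV (\<lambda>(x, y). H x y * g (of_real y) * exp (- of_real n * (of_real x - of_real y + \<i> * of_real \<tau>)\<^sup>2))"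
      unfolding case_prod_unfold
      by (intro continuous_intros H[unfolded case_prod_unfold]
          continuous_on_compose2[OF gaussian_continuous_real[OF g, of UNIV] continuous_on_snd[OF continuous_on_id]]) auto
    show "integrable lborel u" "integrable lborel w"
      unfolding u_def w_def by (intro integrable_mult_right integrable_gauss; use e in simp)+
    fix x y
    have "cmod (H x y * g (of_real y) * exp (- of_real n * (of_real x - of_real y + \<i> * of_real \<tau>)\<^sup>2))
       \<le> (C * exp (M * (\<bar>x\<bar> + \<bar>y\<bar>))) * (B * exp (- c * y\<^sup>2)) * (exp (n * \<tau>\<^sup>2) * exp (- n * (x - y)\<^sup>2))"
      unfolding norm_mult ng by (intro mult_mono le B(3) order_refl mult_nonneg_nonneg) (use C B in auto)
    also have "\<dots> = C * B * exp (n * \<tau>\<^sup>2) * exp (M * \<bar>x\<bar> + M * \<bar>y\<bar> - (n * (x - y)\<^sup>2 + c * y\<^sup>2))"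
      by (simp add: exp_add exp_diff exp_minus distrib_left divide_inverse)
    also have "\<dots> \<le> C * B * exp (n * \<tau>\<^sup>2) * exp (M * \<bar>x\<bar> + M * \<bar>y\<bar> - (e / 4 * x\<^sup>2 + e / 2 * y\<^sup>2))"
      using quad[of x y] C B by (intro mult_left_mono) auto
    also have "\<dots> = u x * w y"
      unfolding u_def w_def by (simp add: algebra_simps flip: exp_add)
    finally show "cmod (H x y * g (of_real y) * exp (- of_real n * (of_real x - of_real y + \<i> * of_real \<tau>)\<^sup>2)) \<le> u x * w y" .
  qed
qed

text \<open>The substitution x = y + v/(k + 1) brings the narrow Gaussian to width one. Its Jacobian
  cancels the prefactor k + 1, and dominated convergence, in v and then in y, leaves H on the
  diagonal times the mass of the Gaussian.\<close>

lemma diagonal_limit: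
  fixes H :: "real \<Rightarrow> real \<Rightarrow> complex"
  assumes H: "continuous_on UNIV (\<lambda>(x, y). H x y)" and M: "0 \<le> M"
    and le: "\<And>x y. cmod (H x y) \<le> C * exp (M * (\<bar>x\<bar> + \<bar>y\<bar>))" and g: "gaussian g"
  shows "(\<lambda>k. of_nat (Suc k) * (LBINT y. (LBINT x. H x y * g (of_real y) * exp (- of_real ((real (Suc k))\<^sup>2) * (of_real x - of_real y)\<^sup>2))))
    \<longlonglongrightarrow> (LBINT y. H y y * g (of_real y)) * of_real (LBINT v. exp (- v\<^sup>2))"
proof -
  obtain B c where B: "0 \<le> B" "0 < c" "\<And>t. cmod (g (of_real t)) \<le> B * exp (- c * t\<^sup>2)"
    using gaussian_bound_real[OF g] by blast
  have C: "0 \<le> C" using order_trans[OF norm_ge_zero le[of 0 0]] by simp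
  let ?r = "\<lambda>k. 1 / real (Suc k)"
  define J where "J k y v = H (y + ?r k * v) y * g (of_real y) * of_real (exp (- v\<^sup>2))" for k and y v :: real
  have contJ: "continuous_on UNIV (\<lambda>(y, v). J k y v)" for k
  proof -
    have "continuous_on UNIV (\<lambda>p. (\<lambda>(x, y). H x y) (fst p + ?r k * snd p, fst p))"
      by (rule continuous_on_compose2[OF H]) (auto intro!: continuous_intros)
    then show ?thesis unfolding J_def case_prod_unfold fst_conv snd_conv
      by (intro continuous_intros
          continuous_on_compose2[OF gaussian_continuous_real[OF g, of UNIV] continuous_on_fst[OF continuous_on_id]]) auto
  qed
  have bdJ: "cmod (J k y v) \<le> (C * B * exp (2 * M * \<bar>y\<bar> - c * y\<^sup>2)) * exp (M * \<bar>v\<bar> - 1 * v\<^sup>2)" for k y v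
  proof -
    have "\<bar>y + ?r k * v\<bar> \<le> \<bar>y\<bar> + \<bar>v\<bar>"
    proof -
      have "\<bar>?r k * v\<bar> \<le> 1 * \<bar>v\<bar>" unfolding abs_mult by (intro mult_right_mono) auto
      then show ?thesis by linarith
    qed
    then have "M * (\<bar>y + ?r k * v\<bar> + \<bar>y\<bar>) \<le> M * (\<bar>y\<bar> + \<bar>v\<bar> + \<bar>y\<bar>)" using M by (intro mult_left_mono) auto
    then have h: "cmod (H (y + ?r k * v) y) \<le> C * exp (M * (\<bar>y\<bar> + \<bar>v\<bar> + \<bar>y\<bar>))"
      using C by (intro order_trans[OF le] mult_left_mono) auto
    have "cmod (J k y v) \<le> (C * exp (M * (\<bar>y\<bar> + \<bar>v\<bar> + \<bar>y\<bar>))) * (B * exp (- c * y\<^sup>2)) * exp (- v\<^sup>2)"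
      unfolding J_def norm_mult by (intro mult_mono h B(3) mult_nonneg_nonneg) (use C B in auto)
    also have "\<dots> = (C * B * exp (2 * M * \<bar>y\<bar> - c * y\<^sup>2)) * exp (M * \<bar>v\<bar> - 1 * v\<^sup>2)"
      by (simp add: algebra_simps flip: exp_add)
    finally show ?thesis .
  qed
  have int1: "integrable lborel (\<lambda>v::real. exp (M * \<bar>v\<bar> - 1 * v\<^sup>2))" by (rule integrable_gauss) simp
  have measJ: "(\<lambda>v. J k y v) \<in> borel_measurable lborel" for k y
  proof -
    have "continuous_on UNIV (\<lambda>v. (\<lambda>(y, v). J k y v) (y, v))"
      by (rule continuous_on_compose2[OF contJ]) (auto intro!: continuous_intros)
    then show ?thesis by (simp add: borel_measurable_continuous_onI)
  qed
  have scale: "of_nat (Suc k) * (LBINT x. H x y * g (of_real y) * exp (- of_real ((real (Suc k))\<^sup>2) * (of_real x - of_real y)\<^sup>2))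
      = (LBINT v. J k y v)" for k y
  proof -
    let ?h = "\<lambda>x. H x y * g (of_real y) * exp (- of_real ((real (Suc k))\<^sup>2) * (of_real x - of_real y)\<^sup>2)"
    have "(LBINT x. ?h x) = \<bar>?r k\<bar> *\<^sub>R (LBINT v. ?h (y + ?r k * v))"
      by (rule lborel_integral_real_affine) simp
    also have "(\<lambda>v. ?h (y + ?r k * v)) = J k y"
    proof
      fix v
      have "(- of_real ((real (Suc k))\<^sup>2) * (of_real (y + ?r k * v) - of_real y)\<^sup>2 :: complex) = of_real (- ((real (Suc k))\<^sup>2 * (?r k * v)\<^sup>2))"
        by (simp only: of_real_add add_diff_cancel_left' of_real_mult of_real_minus of_real_power mult_minus_left)
      also have "\<dots> = of_real (- v\<^sup>2)" by (simp add: power_mult_distrib power_divide del: of_nat_Suc)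
      finally show "?h (y + ?r k * v) = J k y v" unfolding J_def by (simp only: exp_of_real)
    qed
    finally have "(LBINT x. ?h x) = ?r k *\<^sub>R (LBINT v. J k y v)" by simp
    then show ?thesis by (simp only: scaleR_conv_of_real) (simp del: of_nat_Suc)
  qed
  have inner: "(\<lambda>k. LBINT v. J k y v) \<longlonglongrightarrow> H y y * g (of_real y) * of_real (LBINT v. exp (- v\<^sup>2))" for y
  proof -
    have "(\<lambda>k. LBINT v. J k y v) \<longlonglongrightarrow> (LBINT v. H y y * g (of_real y) * of_real (exp (- v\<^sup>2)))"
    proof (rule integral_dominated_convergence)
      show "integrable lborel (\<lambda>v. (C * B * exp (2 * M * \<bar>y\<bar> - c * y\<^sup>2)) * exp (M * \<bar>v\<bar> - 1 * v\<^sup>2))"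
        by (intro integrable_mult_right int1)
      show "AE v in lborel. (\<lambda>k. J k y v) \<longlonglongrightarrow> H y y * g (of_real y) * of_real (exp (- v\<^sup>2))"
      proof (rule AE_I2)
        fix v
        have r: "?r \<longlonglongrightarrow> 0" using LIMSEQ_inverse_real_of_nat by (simp add: inverse_eq_divide)
        have "(\<lambda>k. (y + ?r k * v, y)) \<longlonglongrightarrow> (y + 0 * v, y)"
          by (intro tendsto_intros r)
        moreover have "isCont (\<lambda>(x, y). H x y) (y + 0 * v, y)"
          using H unfolding continuous_on_eq_continuous_at[OF open_UNIV] by blast
        ultimately have "(\<lambda>k. (\<lambda>(x, y). H x y) (y + ?r k * v, y)) \<longlonglongrightarrow> (\<lambda>(x, y). H x y) (y + 0 * v, y)"
          by (rule isCont_tendsto_compose[rotated])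
        then show "(\<lambda>k. J k y v) \<longlonglongrightarrow> H y y * g (of_real y) * of_real (exp (- v\<^sup>2))"
          unfolding J_def by (intro tendsto_mult tendsto_const) simp
      qed
      show "(\<lambda>v. H y y * g (of_real y) * of_real (exp (- v\<^sup>2))) \<in> borel_measurable lborel"
        by simp
    qed (use measJ bdJ in auto)
    then show ?thesis by simp
  qed
  have "(\<lambda>k. LBINT y. (LBINT v. J k y v)) \<longlonglongrightarrow> (LBINT y. H y y * g (of_real y) * of_real (LBINT v. exp (- v\<^sup>2)))"
  proof (rule integral_dominated_convergence)
    let ?m = "LBINT v. exp (M * \<bar>v\<bar> - 1 * v\<^sup>2)"
    have "continuous_on UNIV (\<lambda>y. (\<lambda>(x, y). H x y) (y, y))"
      by (rule continuous_on_compose2[OF H]) (auto intro!: continuous_intros)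
    then have "continuous_on UNIV (\<lambda>y. H y y * g (of_real y) * of_real (LBINT v. exp (- v\<^sup>2)))"
      by (intro continuous_intros gaussian_continuous_real[OF g]) simp_all
    then show "(\<lambda>y. H y y * g (of_real y) * of_real (LBINT v. exp (- v\<^sup>2))) \<in> borel_measurable lborel"
      using borel_measurable_continuous_onI[of "\<lambda>y. H y y * g (of_real y) * of_real (LBINT v. exp (- v\<^sup>2))"] by simp
    show "(\<lambda>y. LBINT v. J k y v) \<in> borel_measurable lborel" for k
    proof (rule lborel.borel_measurable_lebesgue_integral)
      show "(\<lambda>(y, v). J k y v) \<in> borel_measurable (lborel \<Otimes>\<^sub>M lborel)"
        using borel_measurable_continuous_onI[OF contJ] by (simp add: lborel_prod)
    qed
    show "integrable lborel (\<lambda>y. ?m * (C * B * exp (2 * M * \<bar>y\<bar> - c * y\<^sup>2)))"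
      by (intro integrable_mult_right integrable_gauss B(2))
    show "AE y in lborel. (\<lambda>k. LBINT v. J k y v) \<longlonglongrightarrow> H y y * g (of_real y) * of_real (LBINT v. exp (- v\<^sup>2))"
      by (rule AE_I2) (rule inner)
    show "AE y in lborel. cmod (LBINT v. J k y v) \<le> ?m * (C * B * exp (2 * M * \<bar>y\<bar> - c * y\<^sup>2))" for k
    proof (rule AE_I2)
      fix y
      have i: "integrable lborel (\<lambda>v. (C * B * exp (2 * M * \<bar>y\<bar> - c * y\<^sup>2)) * exp (M * \<bar>v\<bar> - 1 * v\<^sup>2))"
        by (intro integrable_mult_right int1)
      have "cmod (LBINT v. J k y v) \<le> (LBINT v. (C * B * exp (2 * M * \<bar>y\<bar> - c * y\<^sup>2)) * exp (M * \<bar>v\<bar> - 1 * v\<^sup>2))"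
      proof (rule Bochner_Integration.integral_norm_bound_integral[OF _ i])
        show "integrable lborel (J k y)"
        proof (rule Bochner_Integration.integrable_bound[OF i measJ])
          show "AE v in lborel. cmod (J k y v) \<le> norm ((C * B * exp (2 * M * \<bar>y\<bar> - c * y\<^sup>2)) * exp (M * \<bar>v\<bar> - 1 * v\<^sup>2))"
            unfolding real_norm_def by (rule AE_I2) (rule order_trans[OF bdJ abs_ge_self])
        qed
      qed (rule bdJ)
      then show "cmod (LBINT v. J k y v) \<le> ?m * (C * B * exp (2 * M * \<bar>y\<bar> - c * y\<^sup>2))"
        by (simp add: mult.commute)
    qed
  qed
  moreover have "of_nat (Suc k) * (LBINT y. (LBINT x. H x y * g (of_real y) * exp (- of_real ((real (Suc k))\<^sup>2) * (of_real x - of_real y)\<^sup>2)))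
     = (LBINT y. (LBINT v. J k y v))" for k
    unfolding scale[symmetric] by (rule integral_mult_right_zero[symmetric])
  ultimately show ?thesis by (simp only: integral_mult_left_zero)
qed

section \<open>Families of words\<close>

text \<open>Families of test functions with two real parameters, so that the letters of one word can
  be dilated independently. Continuity and exponential growth in every seminorm are what Fubini and
  dominated convergence ask of the resulting matrix elements.\<close>

definition tempered_family :: "(real \<times> real \<Rightarrow> complex \<Rightarrow> complex) \<Rightarrow> bool" where
  "tempered_family c \<longleftrightarrow> (\<forall>x. c x \<in> C\<^sup>\<infinity>) \<and>
     (\<forall>N x0. ((\<lambda>x. CN_norm N (\<lambda>z. c x z - c x0 z)) \<longlongrightarrow> 0) (at x0)) \<and>
     (\<forall>N. \<exists>C M. 0 \<le> C \<and> 0 \<le> M \<and> (\<forall>s t. CN_norm N (c (s, t)) \<le> C * exp (M * (\<bar>s\<bar> + \<bar>t\<bar>))))"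

lemma tempered_family_smooth: "tempered_family c \<Longrightarrow> c x \<in> C\<^sup>\<infinity>"
  and tempered_family_diff: "tempered_family c \<Longrightarrow> ((\<lambda>x. CN_norm N (\<lambda>z. c x z - c x0 z)) \<longlongrightarrow> 0) (at x0)"
  and tempered_family_bound: "tempered_family c \<Longrightarrow> \<exists>C M. 0 \<le> C \<and> 0 \<le> M \<and> (\<forall>s t. CN_norm N (c (s, t)) \<le> C * exp (M * (\<bar>s\<bar> + \<bar>t\<bar>)))"
  unfolding tempered_family_def by blast+

lemma tempered_family_norm_tendsto:
  assumes "tempered_family c" shows "((\<lambda>x. CN_norm N (c x)) \<longlongrightarrow> CN_norm N (c x0)) (at x0)"
proof -
  have c: "c x \<in> C\<^sup>\<infinity>" for x by (rule tempered_family_smooth[OF assms])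
  have 1: "CN_norm N (c x) \<le> CN_norm N (c y) + CN_norm N (\<lambda>z. c x z - c y z)" for x y
    using CN_norm_triangle[OF c[of y] smooth_diff(1)[OF c[of x] c[of y]]] by simp
  have 2: "CN_norm N (\<lambda>z. c y z - c x z) \<le> CN_norm N (\<lambda>z. c x z - c y z)" for x y
    using CN_norm_cmult[OF smooth_diff(1)[OF c[of x] c[of y]], of N "-1"] by simp
  have 3: "\<bar>CN_norm N (c x) - CN_norm N (c x0)\<bar> \<le> CN_norm N (\<lambda>z. c x z - c x0 z)" for x
    using 1[of x x0] 1[of x0 x] 2[of x0 x] by linarith
  have "((\<lambda>x. CN_norm N (c x) - CN_norm N (c x0)) \<longlongrightarrow> 0) (at x0)"
    by (rule Lim_null_comparison[of _ "\<lambda>x. CN_norm N (\<lambda>z. c x z - c x0 z)"])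
      (use 3 tempered_family_diff[OF assms] in auto)
  then show ?thesis by (simp only: LIM_zero_iff)
qed

lemma CN_norm_zero: "CN_norm N (\<lambda>z. 0) = 0"
  using CN_norm_cmult[OF smooth_zero, of N 0] CN_norm_nonneg[OF smooth_zero, of N] by simp

lemma tempered_family_dil:
  assumes f: "f \<in> C\<^sup>\<infinity>" and p: "p = fst \<or> p = snd"
  shows "tempered_family (\<lambda>x. beta k (dil (p x)) f)"
  unfolding tempered_family_def
proof (intro conjI allI)
  show "beta k (dil (p x)) f \<in> C\<^sup>\<infinity>" for x by (rule beta_smooth[OF dil_Mob f])
  fix N and x0 :: "real \<times> real"
  let ?h = "\<lambda>s. CN_norm N (\<lambda>z. beta k (dil s) f z - beta k (dil (p x0)) f z)"
  have "isCont ?h (p x0)"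
    using dil.beta_continuous[OF f, of N k "p x0"] by (simp add: isCont_def CN_norm_zero)
  moreover have "(p \<longlongrightarrow> p x0) (at x0)" using p by (auto intro: tendsto_intros)
  ultimately have "((\<lambda>x. ?h (p x)) \<longlongrightarrow> ?h (p x0)) (at x0)" by (rule isCont_tendsto_compose)
  then show "((\<lambda>x. CN_norm N (\<lambda>z. beta k (dil (p x)) f z - beta k (dil (p x0)) f z)) \<longlongrightarrow> 0) (at x0)"
    by (simp add: CN_norm_zero)
next
  fix N
  obtain C M N' where C: "0 \<le> C" "0 \<le> M"
    "\<And>f s. f \<in> C\<^sup>\<infinity> \<Longrightarrow> CN_norm N (beta k (dil s) f) \<le> C * exp (M * \<bar>s\<bar>) * CN_norm N' f"
    using dil.beta_bound[of N k] by blast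
  have "CN_norm N (beta k (dil (p (s, t))) f) \<le> (C * CN_norm N' f) * exp (M * (\<bar>s\<bar> + \<bar>t\<bar>))" for s t
  proof -
    have "\<bar>p (s, t)\<bar> \<le> \<bar>s\<bar> + \<bar>t\<bar>" using p by auto
    then have "exp (M * \<bar>p (s, t)\<bar>) \<le> exp (M * (\<bar>s\<bar> + \<bar>t\<bar>))" using C(2) by (simp add: mult_left_mono)
    then have "C * exp (M * \<bar>p (s, t)\<bar>) * CN_norm N' f \<le> C * exp (M * (\<bar>s\<bar> + \<bar>t\<bar>)) * CN_norm N' f"
      using C(1) CN_norm_nonneg[OF f] by (intro mult_right_mono mult_left_mono) auto
    with C(3)[OF f, of "p (s, t)"] show ?thesis by (simp add: mult_ac)
  qed
  then show "\<exists>C M. 0 \<le> C \<and> 0 \<le> M \<and> (\<forall>s t. CN_norm N (beta k (dil (p (s, t))) f) \<le> C * exp (M * (\<bar>s\<bar> + \<bar>t\<bar>)))"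
    using C CN_norm_nonneg[OF f] by (intro exI[of _ "C * CN_norm N' f"] exI[of _ M]) simp
qed

definition family_at :: "('d distr \<times> (real \<times> real \<Rightarrow> complex \<Rightarrow> complex)) list \<Rightarrow> real \<times> real \<Rightarrow> 'd smeared" where
  "family_at cs x = map (\<lambda>q. (fst q, snd q x)) cs"

lemma map_fst_family_at: "map fst (family_at cs x) = map fst cs"
  by (simp add: family_at_def o_def)

lemma family_at_smooth: "\<forall>q\<in>set cs. fst q \<in> F \<and> tempered_family (snd q) \<Longrightarrow> snd ` set (family_at cs x) \<subseteq> C\<^sup>\<infinity>"
  by (auto simp: family_at_def dest!: bspec intro: tempered_family_smooth)

lemma prod_family_tendsto:
  "\<forall>q\<in>set cs. tempered_family (snd q) \<Longrightarrow>
   ((\<lambda>x. \<Prod>p\<leftarrow>family_at cs x. CN_norm N (snd p)) \<longlongrightarrow> (\<Prod>p\<leftarrow>family_at cs x0. CN_norm N (snd p))) (at x0)"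
  unfolding family_at_def by (induction cs) (auto intro!: tendsto_mult tempered_family_norm_tendsto)

lemma prod_family_bound:
  "\<forall>q\<in>set cs. tempered_family (snd q) \<Longrightarrow>
   \<exists>C M. 0 \<le> C \<and> 0 \<le> M \<and> (\<forall>s t. 0 \<le> (\<Prod>p\<leftarrow>family_at cs (s, t). CN_norm N (snd p)) \<and>
     (\<Prod>p\<leftarrow>family_at cs (s, t). CN_norm N (snd p)) \<le> C * exp (M * (\<bar>s\<bar> + \<bar>t\<bar>)))"
proof (induction cs)
  case Nil
  then show ?case by (intro exI[of _ 1] exI[of _ 0]) (simp add: family_at_def)
next
  case (Cons q cs)
  then obtain C M where C: "0 \<le> C" "0 \<le> M" "\<And>s t. 0 \<le> (\<Prod>p\<leftarrow>family_at cs (s, t). CN_norm N (snd p))"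
     "\<And>s t. (\<Prod>p\<leftarrow>family_at cs (s, t). CN_norm N (snd p)) \<le> C * exp (M * (\<bar>s\<bar> + \<bar>t\<bar>))" by auto
  have q: "tempered_family (snd q)" using Cons.prems by simp
  then obtain D L where D: "0 \<le> D" "0 \<le> L" "\<And>s t. CN_norm N (snd q (s, t)) \<le> D * exp (L * (\<bar>s\<bar> + \<bar>t\<bar>))"
    using tempered_family_bound by blast
  have q0: "0 \<le> CN_norm N (snd q x)" for x by (intro CN_norm_nonneg tempered_family_smooth q)
  have "CN_norm N (snd q (s, t)) * (\<Prod>p\<leftarrow>family_at cs (s, t). CN_norm N (snd p))
      \<le> (D * C) * exp ((L + M) * (\<bar>s\<bar> + \<bar>t\<bar>))" for s t
  proof -
    have "CN_norm N (snd q (s, t)) * (\<Prod>p\<leftarrow>family_at cs (s, t). CN_norm N (snd p))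
      \<le> (D * exp (L * (\<bar>s\<bar> + \<bar>t\<bar>))) * (C * exp (M * (\<bar>s\<bar> + \<bar>t\<bar>)))"
      using D(1) by (intro mult_mono D(3) C(3,4)) auto
    then show ?thesis by (simp add: distrib_right exp_add mult_ac)
  qed
  then show ?case using C(1-3) D(1,2) q0
    by (intro exI[of _ "D * C"] exI[of _ "L + M"]) (simp add: family_at_def)
qed

context wightman_cft
begin

text \<open>Multilinear telescoping. The increment of the first letter is controlled by the tame
  bound, the seminorms of the other letters staying bounded near x0; what remains is the induction
  hypothesis for l composed with the first letter frozen at x0.\<close>

lemma family_isCont:
  assumes "tame l" "\<forall>q\<in>set cs. fst q \<in> F \<and> tempered_family (snd q)"
  shows "isCont (\<lambda>x. l (wop (family_at cs x) \<Omega>)) x0"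
  using assms
proof (induction cs arbitrary: l)
  case Nil
  then show ?case by (simp add: family_at_def)
next
  case (Cons q cs)
  obtain \<phi> c where q: "q = (\<phi>, c)" by (cases q)
  have \<phi>: "\<phi> \<in> F" and c: "tempered_family c" and cs: "\<forall>q\<in>set cs. fst q \<in> F \<and> tempered_family (snd q)"
    using Cons.prems(2) by (auto simp: q)
  have cC: "c x \<in> C\<^sup>\<infinity>" for x by (rule tempered_family_smooth[OF c])
  note lin = tame_linear[OF Cons.prems(1)]
  have "set (\<phi> # map fst cs) \<subseteq> F" using \<phi> cs by auto
  from tame_bound[OF Cons.prems(1) this] obtain C N where C: "0 \<le> C" "\<And>ps. map fst ps = \<phi> # map fst cs \<Longrightarrow> snd ` set ps \<subseteq> C\<^sup>\<infinity> \<Longrightarrow>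
      cmod (l (wop ps \<Omega>)) \<le> C * (\<Prod>p\<leftarrow>ps. CN_norm N (snd p))" by metis
  let ?P = "\<lambda>x. \<Prod>p\<leftarrow>family_at cs x. CN_norm N (snd p)"
  have le: "cmod (l (\<phi> (\<lambda>z. c x z - c x0 z) (wop (family_at cs x) \<Omega>))) \<le> C * (CN_norm N (\<lambda>z. c x z - c x0 z) * ?P x)" for x
    using C(2)[of "(\<phi>, \<lambda>z. c x z - c x0 z) # family_at cs x"] smooth_diff(1)[OF cC[of x] cC[of x0]] family_at_smooth[OF cs]
    by (simp add: map_fst_family_at)
  have "((\<lambda>x. C * (CN_norm N (\<lambda>z. c x z - c x0 z) * ?P x)) \<longlongrightarrow> C * (0 * ?P x0)) (at x0)"
    using cs by (intro tendsto_mult tendsto_const prod_family_tendsto tempered_family_diff[OF c]) blast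
  then have lim1: "((\<lambda>x. l (\<phi> (\<lambda>z. c x z - c x0 z) (wop (family_at cs x) \<Omega>))) \<longlongrightarrow> 0) (at x0)"
    by (intro Lim_null_comparison[OF always_eventually[OF allI[OF le]]]) (simp only: mult_zero_left mult_zero_right)
  have "tame (\<lambda>v. l (wop [(\<phi>, c x0)] v))"
    by (rule tame_comp[OF Cons.prems(1), of UNIV]) (simp add: \<phi> cC)
  from Cons.IH[OF this cs] have lim2: "((\<lambda>x. l (\<phi> (c x0) (wop (family_at cs x) \<Omega>))) \<longlongrightarrow> l (\<phi> (c x0) (wop (family_at cs x0) \<Omega>))) (at x0)"
    by (simp add: isCont_def)
  have split: "l (wop (family_at (q # cs) x) \<Omega>) = l (\<phi> (\<lambda>z. c x z - c x0 z) (wop (family_at cs x) \<Omega>)) + l (\<phi> (c x0) (wop (family_at cs x) \<Omega>))" for x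
    using field_add[OF \<phi> smooth_diff(1)[OF cC[of x] cC[of x0]] cC[of x0], of "wop (family_at cs x) \<Omega>"]
    by (simp add: family_at_def q functional_add[OF lin])
  have at0: "l (wop (family_at (q # cs) x0) \<Omega>) = l (\<phi> (c x0) (wop (family_at cs x0) \<Omega>))"
    by (simp add: family_at_def q)
  show ?case
    using tendsto_add[OF lim1 lim2] unfolding isCont_def split[symmetric] at0 add_0 .
qed

lemma family_continuous:
  assumes "tame l" "\<forall>q\<in>set cs. fst q \<in> F \<and> tempered_family (snd q)"
  shows "continuous_on UNIV (\<lambda>(s, t). l (wop (family_at cs (s, t)) \<Omega>))"
  using family_isCont[OF assms] by (simp add: continuous_on_eq_continuous_at case_prod_unfold)

lemma family_bound:
  assumes "tame l" "\<forall>q\<in>set cs. fst q \<in> F \<and> tempered_family (snd q)"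
  obtains C M where "0 \<le> C" "0 \<le> M" "\<And>s t. cmod (l (wop (family_at cs (s, t)) \<Omega>)) \<le> C * exp (M * (\<bar>s\<bar> + \<bar>t\<bar>))"
proof -
  have "set (map fst cs) \<subseteq> F" using assms(2) by auto
  from tame_bound[OF assms(1) this] obtain C N where C: "0 \<le> C" "\<And>ps. map fst ps = map fst cs \<Longrightarrow> snd ` set ps \<subseteq> C\<^sup>\<infinity> \<Longrightarrow>
      cmod (l (wop ps \<Omega>)) \<le> C * (\<Prod>p\<leftarrow>ps. CN_norm N (snd p))" by metis
  obtain D M where D: "0 \<le> D" "0 \<le> M" "\<And>s t. (\<Prod>p\<leftarrow>family_at cs (s, t). CN_norm N (snd p)) \<le> D * exp (M * (\<bar>s\<bar> + \<bar>t\<bar>))"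
    using prod_family_bound[of cs N] assms(2) by blast
  have "cmod (l (wop (family_at cs (s, t)) \<Omega>)) \<le> (C * D) * exp (M * (\<bar>s\<bar> + \<bar>t\<bar>))" for s t
  proof -
    have "cmod (l (wop (family_at cs (s, t)) \<Omega>)) \<le> C * (\<Prod>p\<leftarrow>family_at cs (s, t). CN_norm N (snd p))"
      by (rule C(2)) (use family_at_smooth[OF assms(2)] in \<open>simp_all add: map_fst_family_at\<close>)
    also have "\<dots> \<le> C * (D * exp (M * (\<bar>s\<bar> + \<bar>t\<bar>)))" by (intro mult_left_mono D(3) C(1))
    finally show ?thesis by simp
  qed
  then show ?thesis using that[of "C * D" M] C(1) D(1,2) by simp
qed

end

section \<open>The contour shift for words\<close>

lemma gaussian_mult_exp:
  assumes "gaussian g" "0 < n" shows "gaussian (\<lambda>z. g z * exp (- of_real n * (w - z)\<^sup>2))"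
proof -
  obtain a b c where a: "a > 0" and g: "g = (\<lambda>z. exp (- of_real a * z\<^sup>2 + b * z + c))"
    using assms unfolding gaussian_def by blast
  show ?thesis
    by (rule gaussianI[of "a + n" _ "b + 2 * of_real n * w" "c - of_real n * w\<^sup>2"])
      (use a assms(2) in \<open>simp_all add: g power2_eq_square algebra_simps flip: exp_add\<close>)
qed

lemma gaussian_exp: "0 < n \<Longrightarrow> gaussian (\<lambda>z. exp (- of_real n * (z + w)\<^sup>2))"
  by (rule gaussianI[of n _ "- 2 * of_real n * w" "- of_real n * w\<^sup>2"]) (simp_all add: power2_eq_square algebra_simps)

lemma gaussian_contour_shift:
  assumes g: "gaussian g" and y: "\<bar>y\<bar> \<le> pi"
  shows "(LBINT t. g (of_real t)) = (LBINT t. g (of_real t + \<i> * of_real y))"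
proof -
  obtain B c where B: "0 \<le> B" "0 < c"
    "\<And>t \<tau>. \<bar>\<tau>\<bar> \<le> pi \<Longrightarrow> cmod (g (of_real t + \<i> * of_real \<tau>)) \<le> B * exp (- c * t\<^sup>2)"
    using gaussian_bound[OF g, of pi] by blast
  show ?thesis
  proof (rule contour_shift[OF gaussian_holomorphic[OF g], of "- 2 * pi" _ "2 * pi" B c])
    have "- (2 * pi) < y" "y < 2 * pi" using y pi_gt_zero unfolding abs_le_iff by linarith+
    then show "- 2 * pi < min 0 y" "max 0 y < 2 * pi" by simp_all
    show "cmod (g (of_real t + \<i> * of_real \<tau>)) \<le> B * exp (- c * t\<^sup>2)" if "min 0 y \<le> \<tau>" "\<tau> \<le> max 0 y" for t \<tau>
      by (rule B(3)) (use that y in auto)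
  qed (rule B(2))
qed

lemma beta_cmult: "beta k \<gamma> (\<lambda>z. c * f z) = (\<lambda>z. c * beta k \<gamma> f z)"
  by (simp add: beta_def fun_eq_iff)

lemma supp_cmult: "supp (\<lambda>z. c * f z) \<subseteq> supp f"
  unfolding supp_def by (rule closure_mono) auto

lemma half_circle_disjoint: "half_circle \<sigma> \<inter> half_circle (- \<sigma>) = {}"
  by (auto simp: half_circle_def)

context wightman_cft
begin

text \<open>In an involutive theory \<open>wop (sharp ps)\<close> is the adjoint of
  \<open>wop ps\<close> conjugated by \<theta>. The definition on test functions makes sense without
  the form and is what the contour shift produces.\<close>

definition sharp :: "'d smeared \<Rightarrow> 'd smeared" where
  "sharp ps = rev (map (\<lambda>p. (fst p, \<lambda>z. (-1) ^ d (fst p) * reflect (snd p) z)) ps)"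

lemma sharp_field_word:
  assumes "field_word F (half_circle \<sigma>) ps" shows "field_word F (half_circle (- \<sigma>)) (sharp ps)"
proof -
  have "supp (\<lambda>z. c * reflect f z) \<subseteq> half_circle (- \<sigma>)" if "f \<in> C\<^sup>\<infinity>" "supp f \<subseteq> half_circle \<sigma>" for f c
    using supp_cmult reflect_supp[OF that] by (rule order_trans)
  then show ?thesis using assms unfolding field_word_def sharp_def
    by (auto intro!: smooth_cmult(1) reflect_smooth)
qed

lemma wop_commute:
  assumes "field_word F I ps" "\<phi> \<in> F" "r \<in> C\<^sup>\<infinity>" "supp r \<subseteq> J" "I \<inter> J = {}"
  shows "\<phi> r (wop ps v) = wop ps (\<phi> r v)"
  using assms(1)
proof (induction ps)
  case (Cons p ps)
  have "supp (snd p) \<subseteq> I" and p: "fst p \<in> F" "snd p \<in> C\<^sup>\<infinity>" and ps: "field_word F I ps" using Cons.prems by simp_all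
  then have "supp r \<inter> supp (snd p) = {}" using assms(4,5) by blast
  from locality[OF assms(2) p(1) assms(3) p(2) this]
  have "\<phi> r (fst p (snd p) (wop ps v)) = fst p (snd p) (\<phi> r (wop ps v))" unfolding o_def by (rule fun_cong)
  then show ?case by (simp only: wop.simps Cons.IH[OF ps])
qed simp

lemma bword_dil_field_word:
  "field_word F (half_circle \<sigma>) ps \<Longrightarrow> field_word F (half_circle \<sigma>) (bword (dil t) ps)"
  using bword_field_word[OF dil_Mob, of "half_circle \<sigma>" ps t] by (simp add: dil_half_circle)

definition dil_family :: "'d smeared \<Rightarrow> ('d distr \<times> (real \<times> real \<Rightarrow> complex \<Rightarrow> complex)) list" where
  "dil_family ps = map (\<lambda>p. (fst p, \<lambda>x. beta (d (fst p)) (dil (fst x)) (snd p))) ps"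

lemma dil_family_at: "family_at (dil_family ps) (s, t) = bword (dil s) ps"
  by (simp add: family_at_def dil_family_def bword_def)

lemma family_at_simps: "family_at (cs @ cs') x = family_at cs x @ family_at cs' x"
  "family_at (q # cs) x = (fst q, snd q x) # family_at cs x" "family_at [] x = []"
  by (simp_all add: family_at_def)

lemma dil_family_tempered:
  "field_word F I ps \<Longrightarrow> \<forall>q\<in>set (dil_family ps). fst q \<in> F \<and> tempered_family (snd q)"
  by (auto simp: dil_family_def field_word_def intro!: tempered_family_dil)

text \<open>The last factor is shifted with the one-variable contour shift, moved to the left by
  locality, and the remaining word is shifted by induction.  The factors are dilated by independent
  parameters, which a narrow Gaussian in their difference identifies in the limit.\<close>

theorem word_contour_shift:
  assumes l: "tame l" and ps: "field_word F (half_circle \<sigma>) ps" and g: "gaussian g" and \<sigma>: "\<sigma> = 1 \<or> \<sigma> = -1"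
  shows "(LBINT t. l (wop (bword (dil t) ps) \<Omega>) * g (of_real t)) =
    (LBINT t. l (wop (bword (dil t) (sharp ps)) \<Omega>) * g (of_real t + \<i> * of_real (- \<sigma> * pi)))"
  using l ps g
proof (induction ps arbitrary: l g rule: rev_induct)
  case Nil
  have "\<bar>- \<sigma> * pi\<bar> \<le> pi" using \<sigma> by auto
  from gaussian_contour_shift[OF Nil(3) this] show ?case by (simp add: sharp_def)
next
  case (snoc p ps)
  obtain \<phi> f where p: "p = (\<phi>, f)" by (cases p)
  have \<phi>: "\<phi> \<in> F" and f: "f \<in> C\<^sup>\<infinity>" "supp f \<subseteq> half_circle \<sigma>" and ps: "field_word F (half_circle \<sigma>) ps"
    using snoc.prems(2) by (auto simp: p)
  note l = snoc.prems(1) and g = snoc.prems(3)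
  let ?D = "d \<phi>" let ?r = "reflect f"
  have r: "?r \<in> C\<^sup>\<infinity>" "supp ?r \<subseteq> half_circle (- \<sigma>)" by (rule reflect_smooth[OF f(1)], rule reflect_supp[OF f])
  define w where "w = \<i> * complex_of_real (- \<sigma> * pi)"
  define g' where "g' z = g (z + w)" for z
  have g': "gaussian g'" unfolding g'_def[abs_def] by (rule gaussian_shift[OF g])
  define A where "A s t = l (wop (bword (dil s) ps) (\<phi> (beta ?D (dil t) f) \<Omega>))" for s t
  define B where "B s t = l (wop (bword (dil s) ps) (\<phi> (beta ?D (dil t) ?r) \<Omega>))" for s t
  define C where "C s t = l (\<phi> (beta ?D (dil t) ?r) (wop (bword (dil s) (sharp ps)) \<Omega>))" for s t
  have fam: "\<exists>K M. continuous_on UNIV (\<lambda>(s, t). H s t) \<and> 0 \<le> M \<and> (\<forall>s t. cmod (H s t) \<le> K * exp (M * (\<bar>s\<bar> + \<bar>t\<bar>)))"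
    if cs: "\<forall>q\<in>set cs. fst q \<in> F \<and> tempered_family (snd q)" and H: "\<And>s t. H s t = l (wop (family_at cs (s, t)) \<Omega>)" for H cs
    unfolding H using family_continuous[OF l cs] family_bound[OF l cs] by metis
  obtain KA MA where A: "continuous_on UNIV (\<lambda>(s, t). A s t)" "0 \<le> MA" "\<And>s t. cmod (A s t) \<le> KA * exp (MA * (\<bar>s\<bar> + \<bar>t\<bar>))"
  proof -
    have "\<forall>q\<in>set (dil_family ps @ [(\<phi>, \<lambda>x. beta ?D (dil (snd x)) f)]). fst q \<in> F \<and> tempered_family (snd q)"
      using dil_family_tempered[OF ps] tempered_family_dil[OF f(1), of snd ?D] \<phi> by simp
    from fam[OF this, of A] show ?thesis using that by (auto simp: A_def family_at_simps dil_family_at wop_append)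
  qed
  obtain KB MB where B: "continuous_on UNIV (\<lambda>(s, t). B s t)" "0 \<le> MB" "\<And>s t. cmod (B s t) \<le> KB * exp (MB * (\<bar>s\<bar> + \<bar>t\<bar>))"
  proof -
    have "\<forall>q\<in>set (dil_family ps @ [(\<phi>, \<lambda>x. beta ?D (dil (snd x)) ?r)]). fst q \<in> F \<and> tempered_family (snd q)"
      using dil_family_tempered[OF ps] tempered_family_dil[OF r(1), of snd ?D] \<phi> by simp
    from fam[OF this, of B] show ?thesis using that by (auto simp: B_def family_at_simps dil_family_at wop_append)
  qed
  obtain KC MC where C: "continuous_on UNIV (\<lambda>(s, t). C s t)" "0 \<le> MC" "\<And>s t. cmod (C s t) \<le> KC * exp (MC * (\<bar>s\<bar> + \<bar>t\<bar>))"
  proof -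
    have "\<forall>q\<in>set ((\<phi>, \<lambda>x. beta ?D (dil (snd x)) ?r) # dil_family (sharp ps)). fst q \<in> F \<and> tempered_family (snd q)"
      using dil_family_tempered[OF sharp_field_word[OF ps]] tempered_family_dil[OF r(1), of snd ?D] \<phi> by simp
    from fam[OF this, of C] show ?thesis using that by (auto simp: C_def family_at_simps dil_family_at)
  qed
  \<comment> \<open>The reflected letter lives on the complementary half circle, so it commutes past
    the remaining letters and can be absorbed into the functional.\<close>
  have B_comm: "B s t = l (\<phi> (beta ?D (dil t) ?r) (wop (bword (dil s) ps) \<Omega>))" for s t
    unfolding B_def
    by (subst wop_commute[OF bword_dil_field_word[OF ps] \<phi> beta_smooth[OF dil_Mob r(1)] beta_dil_supp[OF r] half_circle_disjoint]) simp
  have LA: "(LBINT y. (LBINT x. A x y * g (of_real y) * exp (- of_real n * (of_real x - of_real y)\<^sup>2)))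
      = (-1) ^ ?D * (LBINT y. (LBINT x. C x y * g' (of_real y) * exp (- of_real n * (of_real x - of_real y)\<^sup>2)))"
    if n: "0 < n" for n :: real
  proof -
    \<comment> \<open>The narrow Gaussian after the shift in y: its argument has acquired the
      imaginary part \<sigma>\<pi>, which the later shift in x removes.\<close>
    let ?E = "\<lambda>x y. exp (- of_real n * (of_real x - of_real y + \<i> * of_real (\<sigma> * pi))\<^sup>2)"
    have shift: "(LBINT y. A x y * g (of_real y) * exp (- of_real n * (of_real x - of_real y)\<^sup>2))
       = (-1) ^ ?D * (LBINT y. B x y * g' (of_real y) * ?E x y)" for x
    proof -
      let ?g = "\<lambda>z. g z * exp (- of_real n * (of_real x - z)\<^sup>2)"
      have T: "distribution (\<lambda>f. l (wop (bword (dil x) ps) (\<phi> f \<Omega>)))"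
        using tame_distribution[OF l bword_dil_field_word[OF ps] _ \<phi>, of UNIV "[]"] by simp
      have "(LBINT y. A x y * ?g (of_real y)) = (-1) ^ ?D * (LBINT y. B x y * ?g (of_real y + \<i> * of_real (- \<sigma> * pi)))"
        unfolding A_def B_def
      proof (rule distribution_contour_shift[OF T _ f \<sigma> gaussian_mult_exp[OF g n]])
        show "l (wop (bword (dil x) ps) (\<phi> (trig m) \<Omega>)) = 0" if "m > - int ?D" for m
          by (simp add: field_low_modes_vacuum[OF \<phi> that] lin_zero[OF wop_linear[OF bword_dil_field_word[OF ps]]]
              functional_zero[OF tame_linear[OF l]])
      qed
      moreover have "?g (of_real y + \<i> * of_real (- \<sigma> * pi)) = g' (of_real y) * ?E x y" for y
        by (simp add: g'_def w_def algebra_simps)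
      ultimately show ?thesis by (simp only: mult.assoc)
    qed
    \<comment> \<open>The induction hypothesis in the variable x, with the reflected letter absorbed
      into the functional. Its shift by -i\<sigma>\<pi> turns \<open>?E\<close> back into the real
      Gaussian in x - y.\<close>
    have IH: "(LBINT x. B x y * ?E x y) = (LBINT x. C x y * exp (- of_real n * (of_real x - of_real y)\<^sup>2))" for y
    proof -
      let ?g = "\<lambda>z. exp (- of_real n * (z + (\<i> * of_real (\<sigma> * pi) - of_real y))\<^sup>2)"
      have t: "tame (\<lambda>v. l (wop [(\<phi>, beta ?D (dil y) ?r)] v))"
        by (rule tame_comp[OF l, of UNIV]) (simp add: \<phi> beta_smooth[OF dil_Mob r(1)])
      have "?g (of_real x) = ?E x y" for x by (simp add: algebra_simps)
      moreover have "?g (of_real x + \<i> * of_real (- \<sigma> * pi)) = exp (- of_real n * (of_real x - of_real y)\<^sup>2)" for x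
        by (simp add: algebra_simps)
      ultimately show ?thesis
        using snoc.IH[OF t ps gaussian_exp[OF n, of "\<i> * of_real (\<sigma> * pi) - of_real y"]]
        by (simp only: B_comm C_def wop.simps fst_conv snd_conv)
    qed
    have "(LBINT y. (LBINT x. A x y * g (of_real y) * exp (- of_real n * (of_real x - of_real y)\<^sup>2)))
       = (LBINT x. (LBINT y. A x y * g (of_real y) * exp (- of_real n * (of_real x - of_real y)\<^sup>2)))"
      using gaussian_swap[OF A(1,3) g n, of 0] by simp
    also have "\<dots> = (-1) ^ ?D * (LBINT x. (LBINT y. B x y * g' (of_real y) * ?E x y))"
      unfolding shift by (rule integral_mult_right_zero)
    also have "(LBINT x. (LBINT y. B x y * g' (of_real y) * ?E x y))
       = (LBINT y. (LBINT x. B x y * g' (of_real y) * ?E x y))"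
      by (rule gaussian_swap[OF B(1,3) g' n, symmetric])
    also have "(\<lambda>y. LBINT x. B x y * g' (of_real y) * ?E x y)
       = (\<lambda>y. LBINT x. C x y * g' (of_real y) * exp (- of_real n * (of_real x - of_real y)\<^sup>2))"
    proof
      fix y
      have "(LBINT x. B x y * g' (of_real y) * ?E x y) = g' (of_real y) * (LBINT x. B x y * ?E x y)"
        unfolding integral_mult_right_zero[symmetric] by (simp only: mult_ac)
      also have "\<dots> = (LBINT x. C x y * g' (of_real y) * exp (- of_real n * (of_real x - of_real y)\<^sup>2))"
        unfolding IH integral_mult_right_zero[symmetric] by (simp only: mult_ac)
      finally show "(LBINT x. B x y * g' (of_real y) * ?E x y)
         = (LBINT x. C x y * g' (of_real y) * exp (- of_real n * (of_real x - of_real y)\<^sup>2))" .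
    qed
    finally show ?thesis .
  qed
  let ?K = "complex_of_real (LBINT v. exp (- v\<^sup>2))"
  have "(LBINT y. A y y * g (of_real y)) * ?K = (-1) ^ ?D * ((LBINT y. C y y * g' (of_real y)) * ?K)"
  proof (rule LIMSEQ_unique)
    show "(\<lambda>k. of_nat (Suc k) * (LBINT y. (LBINT x. A x y * g (of_real y) * exp (- of_real ((real (Suc k))\<^sup>2) * (of_real x - of_real y)\<^sup>2))))
      \<longlonglongrightarrow> (LBINT y. A y y * g (of_real y)) * ?K"
      by (rule diagonal_limit[OF A g])
    have "(\<lambda>k. (-1) ^ ?D * (of_nat (Suc k) * (LBINT y. (LBINT x. C x y * g' (of_real y) * exp (- of_real ((real (Suc k))\<^sup>2) * (of_real x - of_real y)\<^sup>2)))))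
      \<longlonglongrightarrow> (-1) ^ ?D * ((LBINT y. C y y * g' (of_real y)) * ?K)"
      by (rule tendsto_mult_left[OF diagonal_limit[OF C g']])
    moreover have "of_nat (Suc k) * (LBINT y. (LBINT x. A x y * g (of_real y) * exp (- of_real ((real (Suc k))\<^sup>2) * (of_real x - of_real y)\<^sup>2)))
      = (-1) ^ ?D * (of_nat (Suc k) * (LBINT y. (LBINT x. C x y * g' (of_real y) * exp (- of_real ((real (Suc k))\<^sup>2) * (of_real x - of_real y)\<^sup>2))))" for k
      by (subst LA) (simp_all only: zero_less_power of_nat_0_less_iff zero_less_Suc mult.left_commute)
    ultimately show "(\<lambda>k. of_nat (Suc k) * (LBINT y. (LBINT x. A x y * g (of_real y) * exp (- of_real ((real (Suc k))\<^sup>2) * (of_real x - of_real y)\<^sup>2))))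
      \<longlonglongrightarrow> (-1) ^ ?D * ((LBINT y. C y y * g' (of_real y)) * ?K)"
      by (simp only:)
  qed
  then have "(LBINT y. A y y * g (of_real y)) * ?K = ((-1) ^ ?D * (LBINT y. C y y * g' (of_real y))) * ?K"
    by (simp only: mult.assoc)
  moreover have "?K \<noteq> 0" using gauss_mass_nonzero by (simp only: of_real_eq_0_iff not_False_eq_True)
  ultimately have main: "(LBINT y. A y y * g (of_real y)) = (-1) ^ ?D * (LBINT y. C y y * g' (of_real y))"
    by (simp only: mult_cancel_right simp_thms)
  have "l (wop (bword (dil t) (sharp (ps @ [p]))) \<Omega>) = (-1) ^ ?D * C t t" for t
    unfolding C_def
    by (simp add: sharp_def p beta_cmult field_cmult[OF \<phi> beta_smooth[OF dil_Mob r(1)]] functional_scale[OF tame_linear[OF l]])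
  moreover have "l (wop (bword (dil t) (ps @ [p])) \<Omega>) = A t t" for t
    by (simp add: A_def p wop_append)
  ultimately show ?case
    unfolding g'_def w_def using main by (simp only: g'_def w_def mult.assoc integral_mult_right_zero)
qed

end

section \<open>Dilation averages of functionals\<close>

lemma half_circle_openin: "openin (top_of_set S\<^sup>1) (half_circle \<sigma>)"
proof -
  have "open {z. 0 < \<sigma> * Im z}" by (intro open_Collect_less continuous_intros)
  moreover have "half_circle \<sigma> = S\<^sup>1 \<inter> {z. 0 < \<sigma> * Im z}" by (auto simp: half_circle_def)
  ultimately show ?thesis by (simp add: openin_open_Int)
qed

lemma half_circle_nonempty: "\<sigma> = 1 \<or> \<sigma> = -1 \<Longrightarrow> half_circle \<sigma> \<noteq> {}"
proof -
  assume "\<sigma> = 1 \<or> \<sigma> = -1"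
  then have "\<i> * of_real \<sigma> \<in> half_circle \<sigma>" by (auto simp: half_circle_def)
  then show ?thesis by blast
qed

text \<open>This is \<open>diagonal_limit\<close> for H x y = h(x - y), which is constant on the
  diagonal: averages against arbitrarily narrow Gaussians determine h(0).\<close>

lemma gaussian_point_evaluation:
  fixes h :: "real \<Rightarrow> complex"
  assumes h: "continuous_on UNIV h" and le: "\<And>t. cmod (h t) \<le> C * exp (M * \<bar>t\<bar>)" and M: "0 \<le> M"
    and z: "\<And>n. 0 < n \<Longrightarrow> (LBINT t. h t * exp (- of_real n * (of_real t)\<^sup>2)) = 0"
  shows "h 0 = 0"
proof -
  define H where "H x y = h (x - y)" for x y
  let ?g = "\<lambda>z::complex. exp (- of_real 1 * (z + 0)\<^sup>2)"
  have g: "gaussian ?g" by (rule gaussian_exp) simp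
  have C: "0 \<le> C" using order_trans[OF norm_ge_zero le[of 0]] by simp
  have contH: "continuous_on UNIV (\<lambda>(x, y). H x y)"
    unfolding H_def case_prod_unfold by (rule continuous_on_compose2[OF h]) (auto intro!: continuous_intros)
  have leH: "cmod (H x y) \<le> C * exp (M * (\<bar>x\<bar> + \<bar>y\<bar>))" for x y
  proof -
    have "M * \<bar>x - y\<bar> \<le> M * (\<bar>x\<bar> + \<bar>y\<bar>)" using M by (intro mult_left_mono) auto
    then have "C * exp (M * \<bar>x - y\<bar>) \<le> C * exp (M * (\<bar>x\<bar> + \<bar>y\<bar>))" using C by (intro mult_left_mono) auto
    with le[of "x - y"] show ?thesis unfolding H_def by (rule order_trans)
  qed
  have zero: "(LBINT x. H x y * ?g (of_real y) * exp (- of_real ((real (Suc k))\<^sup>2) * (of_real x - of_real y)\<^sup>2)) = 0" for k y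
  proof -
    let ?f = "\<lambda>t. h t * exp (- of_real ((real (Suc k))\<^sup>2) * (of_real t)\<^sup>2)"
    have "(LBINT x. H x y * ?g (of_real y) * exp (- of_real ((real (Suc k))\<^sup>2) * (of_real x - of_real y)\<^sup>2))
      = (LBINT x. ?g (of_real y) * ?f (x + (- y)))"
      by (simp add: H_def mult_ac)
    also have "\<dots> = ?g (of_real y) * (LBINT x. ?f (x + (- y)))" by (rule integral_mult_right_zero)
    also have "(LBINT x. ?f (x + (- y))) = (LBINT x. ?f x)" by (rule lborel_integral_shift)
    also have "\<dots> = 0" by (rule z) simp
    finally show ?thesis by simp
  qed
  have "(\<lambda>k. 0) \<longlonglongrightarrow> (LBINT y. H y y * ?g (of_real y)) * of_real (LBINT v. exp (- v\<^sup>2))"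
    using diagonal_limit[OF contH M leH g] unfolding zero by simp
  then have "(LBINT y. H y y * ?g (of_real y)) = 0"
    using gauss_mass_nonzero by (simp add: LIMSEQ_const_iff)
  moreover have "H y y * ?g (of_real y) = h 0 * of_real (exp (- y\<^sup>2))" for y
    by (simp add: H_def exp_of_real[symmetric])
  ultimately have "h 0 * (LBINT y. of_real (exp (- (y::real)\<^sup>2))) = 0" by simp
  then show ?thesis using gauss_mass_nonzero by simp
qed

context wightman_cft
begin

text \<open>The constants depend on the list of fields only and not on the test functions, which is
  the uniformity that \<open>tame\<close> demands of an averaged functional.\<close>

lemma bword_norm_bound:
  "\<exists>C M N'. 0 \<le> C \<and> 0 \<le> M \<and> (\<forall>ps t. map fst ps = \<phi>s \<longrightarrow> snd ` set ps \<subseteq> C\<^sup>\<infinity> \<longrightarrow>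
     (\<Prod>p\<leftarrow>bword (dil t) ps. CN_norm N (snd p)) \<le> C * exp (M * \<bar>t\<bar>) * (\<Prod>p\<leftarrow>ps. CN_norm N' (snd p)))"
proof (induction \<phi>s)
  case Nil
  show ?case by (intro exI[of _ 1] exI[of _ 0]) simp
next
  case (Cons \<phi> \<phi>s)
  then obtain C M K where C: "0 \<le> C" "0 \<le> M" "\<And>ps t. map fst ps = \<phi>s \<Longrightarrow> snd ` set ps \<subseteq> C\<^sup>\<infinity> \<Longrightarrow>
     (\<Prod>p\<leftarrow>bword (dil t) ps. CN_norm N (snd p)) \<le> C * exp (M * \<bar>t\<bar>) * (\<Prod>p\<leftarrow>ps. CN_norm K (snd p))" by metis
  obtain D L K' where D: "0 \<le> D" "0 \<le> L"
    "\<And>f s. f \<in> C\<^sup>\<infinity> \<Longrightarrow> CN_norm N (beta (d \<phi>) (dil s) f) \<le> D * exp (L * \<bar>s\<bar>) * CN_norm K' f"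
    using dil.beta_bound[of N "d \<phi>"] by blast
  have nn: "0 \<le> (\<Prod>p\<leftarrow>ps. CN_norm J (snd p))" if "snd ` set ps \<subseteq> C\<^sup>\<infinity>" for ps :: "'d smeared" and J
    by (rule prod_list_nonneg) (use that in \<open>auto intro: CN_norm_nonneg\<close>)
  have mono: "(\<Prod>p\<leftarrow>ps. CN_norm K (snd p)) \<le> (\<Prod>p\<leftarrow>ps. CN_norm (max K K') (snd p))"
    if "snd ` set ps \<subseteq> C\<^sup>\<infinity>" for ps :: "'d smeared"
    using that
  proof (induction ps)
    case (Cons p ps)
    then show ?case using nn[of ps K]
      by (auto intro!: mult_mono CN_norm_mono CN_norm_nonneg)
  qed simp
  have "(\<Prod>p\<leftarrow>bword (dil t) ps. CN_norm N (snd p)) \<le> (D * C) * exp ((L + M) * \<bar>t\<bar>) * (\<Prod>p\<leftarrow>ps. CN_norm (max K K') (snd p))"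
    if ps: "map fst ps = \<phi> # \<phi>s" "snd ` set ps \<subseteq> C\<^sup>\<infinity>" for ps t
  proof -
    obtain f qs where qs: "ps = (\<phi>, f) # qs" using ps(1) by (cases ps) auto
    have f: "f \<in> C\<^sup>\<infinity>" and q: "map fst qs = \<phi>s" "snd ` set qs \<subseteq> C\<^sup>\<infinity>" using ps by (auto simp: qs)
    have bw: "snd ` set (bword (dil t) qs) \<subseteq> C\<^sup>\<infinity>" using q(2) by (auto simp: bword_def intro!: beta_smooth dil_Mob)
    have "(\<Prod>p\<leftarrow>bword (dil t) ps. CN_norm N (snd p))
       = CN_norm N (beta (d \<phi>) (dil t) f) * (\<Prod>p\<leftarrow>bword (dil t) qs. CN_norm N (snd p))" by (simp add: qs)
    also have "\<dots> \<le> (D * exp (L * \<bar>t\<bar>) * CN_norm K' f) * (C * exp (M * \<bar>t\<bar>) * (\<Prod>p\<leftarrow>qs. CN_norm K (snd p)))"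
      using D(1) CN_norm_nonneg[OF f] by (intro mult_mono D(3) f C(3) q nn bw) auto
    also have "\<dots> \<le> (D * exp (L * \<bar>t\<bar>) * CN_norm (max K K') f) * (C * exp (M * \<bar>t\<bar>) * (\<Prod>p\<leftarrow>qs. CN_norm (max K K') (snd p)))"
      using D(1) C(1) CN_norm_nonneg[OF f] nn[OF q(2)]
      by (intro mult_mono mult_left_mono CN_norm_mono f mono q mult_nonneg_nonneg) auto
    also have "\<dots> = (D * C) * (exp (L * \<bar>t\<bar>) * exp (M * \<bar>t\<bar>)) * (CN_norm (max K K') f * (\<Prod>p\<leftarrow>qs. CN_norm (max K K') (snd p)))"
      by (simp only: mult_ac)
    finally show ?thesis by (simp only: exp_add[symmetric] distrib_right[symmetric] qs list.map prod_list.Cons snd_conv)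
  qed
  then show ?case using C D by (intro exI[of _ "D * C"] exI[of _ "L + M"] exI[of _ "max K K'"]) simp
qed

lemma U_wop_vacuum: "\<gamma> \<in> Mob \<Longrightarrow> field_word F I ps \<Longrightarrow> U \<gamma> (wop ps \<Omega>) = wop (bword \<gamma> ps) \<Omega>"
  by (simp add: U_wop vacuum_invariant)

lemma tame_word_orbit_bound:
  assumes l: "tame l" and \<phi>s: "set \<phi>s \<subseteq> F"
  obtains C M N where "0 \<le> C" "0 \<le> M" "\<And>ps t. map fst ps = \<phi>s \<Longrightarrow> snd ` set ps \<subseteq> C\<^sup>\<infinity> \<Longrightarrow>
     cmod (l (U (dil t) (wop ps \<Omega>))) \<le> C * exp (M * \<bar>t\<bar>) * (\<Prod>p\<leftarrow>ps. CN_norm N (snd p))"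
proof -
  from tame_bound[OF l \<phi>s] obtain C N where C: "0 \<le> C" "\<And>ps. map fst ps = \<phi>s \<Longrightarrow> snd ` set ps \<subseteq> C\<^sup>\<infinity> \<Longrightarrow>
      cmod (l (wop ps \<Omega>)) \<le> C * (\<Prod>p\<leftarrow>ps. CN_norm N (snd p))" by metis
  obtain D M N' where D: "0 \<le> D" "0 \<le> M" "\<And>ps t. map fst ps = \<phi>s \<Longrightarrow> snd ` set ps \<subseteq> C\<^sup>\<infinity> \<Longrightarrow>
     (\<Prod>p\<leftarrow>bword (dil t) ps. CN_norm N (snd p)) \<le> D * exp (M * \<bar>t\<bar>) * (\<Prod>p\<leftarrow>ps. CN_norm N' (snd p))"
    using bword_norm_bound[of \<phi>s N] by metis
  show ?thesis
  proof (rule that[of "C * D" M N'])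
    fix ps :: "'d smeared" and t
    assume ps: "map fst ps = \<phi>s" "snd ` set ps \<subseteq> C\<^sup>\<infinity>"
    have fw: "field_word F UNIV ps"
      unfolding field_word_def
    proof
      fix p assume p: "p \<in> set ps"
      then have "fst p \<in> set \<phi>s" unfolding ps(1)[symmetric] by simp
      then show "fst p \<in> F \<and> snd p \<in> C\<^sup>\<infinity> \<and> supp (snd p) \<subseteq> UNIV" using \<phi>s ps(2) p by blast
    qed
    have "map fst (bword (dil t) ps) = \<phi>s" using ps(1) by (simp add: bword_def o_def)
    moreover have "snd ` set (bword (dil t) ps) \<subseteq> C\<^sup>\<infinity>" using ps(2) by (auto simp: bword_def intro!: beta_smooth dil_Mob)
    ultimately have "cmod (l (U (dil t) (wop ps \<Omega>))) \<le> C * (\<Prod>p\<leftarrow>bword (dil t) ps. CN_norm N (snd p))"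
      unfolding U_wop_vacuum[OF dil_Mob fw] by (rule C(2))
    also have "\<dots> \<le> C * (D * exp (M * \<bar>t\<bar>) * (\<Prod>p\<leftarrow>ps. CN_norm N' (snd p)))"
      by (intro mult_left_mono D(3) ps C(1))
    finally show "cmod (l (U (dil t) (wop ps \<Omega>))) \<le> C * D * exp (M * \<bar>t\<bar>) * (\<Prod>p\<leftarrow>ps. CN_norm N' (snd p))"
      by (simp add: mult_ac)
  qed (use C(1) D(1,2) in auto)
qed

text \<open>Every vector is a finite combination of words applied to \<Omega>, and the orbit of a
  word is the word with dilated letters. Continuity and exponential growth pass to linear
  combinations.\<close>

lemma tame_orbit:
  assumes l: "tame l"
  shows "continuous_on UNIV (\<lambda>t. l (U (dil t) v)) \<and> (\<exists>C M. 0 \<le> C \<and> 0 \<le> M \<and> (\<forall>t. cmod (l (U (dil t) v)) \<le> C * exp (M * \<bar>t\<bar>)))"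
proof -
  note lin = tame_linear[OF l]
  have "v \<in> span {wop ps \<Omega> | ps. field_word F UNIV ps}" using span_words by simp
  then show ?thesis
  proof (induction rule: span_induct_alt)
    case base
    then show ?case by (auto simp: lin_zero[OF U_linear[OF dil_Mob]] functional_zero[OF lin] intro!: exI[of _ 0])
  next
    case (step c x y)
    then obtain ps where x: "x = wop ps \<Omega>" and ps: "field_word F UNIV ps" by blast
    have eq: "l (U (dil t) (sc c x + y)) = c * l (U (dil t) x) + l (U (dil t) y)" for t
      by (simp add: lin_add[OF U_linear[OF dil_Mob]] lin_scale[OF U_linear[OF dil_Mob]] functional_add[OF lin] functional_scale[OF lin])
    have "set (map fst ps) \<subseteq> F" "snd ` set ps \<subseteq> C\<^sup>\<infinity>" using ps by (auto simp: field_word_def)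
    then obtain C M where C: "0 \<le> C" "0 \<le> M" "\<And>t. cmod (l (U (dil t) x)) \<le> C * exp (M * \<bar>t\<bar>)"
    proof -
      assume F: "set (map fst ps) \<subseteq> F" and s: "snd ` set ps \<subseteq> C\<^sup>\<infinity>"
      obtain C M N where C: "0 \<le> C" "0 \<le> M" "\<And>qs t. map fst qs = map fst ps \<Longrightarrow> snd ` set qs \<subseteq> C\<^sup>\<infinity> \<Longrightarrow>
        cmod (l (U (dil t) (wop qs \<Omega>))) \<le> C * exp (M * \<bar>t\<bar>) * (\<Prod>p\<leftarrow>qs. CN_norm N (snd p))"
        using tame_word_orbit_bound[OF l F] by blast
      have nn: "0 \<le> (\<Prod>p\<leftarrow>ps. CN_norm N (snd p))"
        by (rule prod_list_nonneg) (use s in \<open>auto intro: CN_norm_nonneg\<close>)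
      show thesis
        by (rule that[of "C * (\<Prod>p\<leftarrow>ps. CN_norm N (snd p))" M])
          (use C(1,2) nn C(3)[OF refl s] in \<open>auto simp: x mult_ac\<close>)
    qed
    obtain D L where D: "0 \<le> D" "0 \<le> L" "\<And>t. cmod (l (U (dil t) y)) \<le> D * exp (L * \<bar>t\<bar>)" using step.IH by blast
    have "continuous_on UNIV (\<lambda>t. (\<lambda>(s, t). l (wop (family_at (dil_family ps) (s, t)) \<Omega>)) (t, 0))"
      by (rule continuous_on_compose2[OF family_continuous[OF l dil_family_tempered[OF ps]]]) (auto intro!: continuous_intros)
    then have cx: "continuous_on UNIV (\<lambda>t. l (U (dil t) x))" by (simp add: dil_family_at x U_wop_vacuum[OF dil_Mob ps])
    have "cmod (l (U (dil t) (sc c x + y))) \<le> (cmod c * C + D) * exp ((M + L) * \<bar>t\<bar>)" for t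
    proof -
      have e: "exp (M * \<bar>t\<bar>) \<le> exp ((M + L) * \<bar>t\<bar>)" "exp (L * \<bar>t\<bar>) \<le> exp ((M + L) * \<bar>t\<bar>)"
        using C(2) D(2) by (auto intro!: mult_right_mono)
      have "cmod (l (U (dil t) (sc c x + y))) \<le> cmod c * cmod (l (U (dil t) x)) + cmod (l (U (dil t) y))"
        unfolding eq by (rule order_trans[OF norm_triangle_ineq]) (simp add: norm_mult)
      also have "\<dots> \<le> cmod c * (C * exp ((M + L) * \<bar>t\<bar>)) + D * exp ((M + L) * \<bar>t\<bar>)"
        by (intro add_mono mult_left_mono order_trans[OF C(3)] order_trans[OF D(3)] e C(1) D(1)) auto
      finally show ?thesis by (simp add: algebra_simps)
    qed
    moreover have "continuous_on UNIV (\<lambda>t. l (U (dil t) (sc c x + y)))"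
      unfolding eq using step.IH by (intro continuous_intros cx) blast
    ultimately show ?case using C(1,2) D(1,2)
      by (intro conjI exI[of _ "cmod c * C + D"] exI[of _ "M + L"]) auto
  qed
qed

lemma tame_orbit_integrable:
  assumes l: "tame l" and g: "gaussian g"
  shows "integrable lborel (\<lambda>t. l (U (dil t) v) * g (of_real t))"
proof -
  obtain C M where "\<And>t. cmod (l (U (dil t) v)) \<le> C * exp (M * \<bar>t\<bar>)" using tame_orbit[OF l, of v] by blast
  from integrable_mult_gaussian[OF conjunct1[OF tame_orbit[OF l]] this g] show ?thesis .
qed

text \<open>Gaussian decay beats the exponential growth of orbits, uniformly over words with given
  fields. This makes Reeh-Schlieder applicable to relations between integrals over orbits.\<close>

lemma tame_orbit_average:
  assumes l: "tame l" and g: "gaussian g"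
  shows "tame (\<lambda>v. LBINT t. l (U (dil t) v) * g (of_real t))"
  unfolding tame_def
proof (intro conjI allI impI)
  note lin = tame_linear[OF l]
  note int = tame_orbit_integrable[OF l g]
  have "(LBINT t. l (U (dil t) (v + w)) * g (of_real t)) =
     (LBINT t. l (U (dil t) v) * g (of_real t)) + (LBINT t. l (U (dil t) w) * g (of_real t))" for v w
    unfolding Bochner_Integration.integral_add[OF int int, symmetric]
    by (simp add: lin_add[OF U_linear[OF dil_Mob]] functional_add[OF lin] distrib_right)
  moreover have "(LBINT t. l (U (dil t) (sc c v)) * g (of_real t)) = c * (LBINT t. l (U (dil t) v) * g (of_real t))" for c v
    unfolding integral_mult_right_zero[symmetric]
    by (simp add: lin_scale[OF U_linear[OF dil_Mob]] functional_scale[OF lin] mult_ac)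
  ultimately show "Vector_Spaces.linear sc (*) (\<lambda>v. LBINT t. l (U (dil t) v) * g (of_real t))"
    using lin unfolding Vector_Spaces.linear_iff by (simp only: simp_thms)
  fix \<phi>s assume \<phi>s: "set \<phi>s \<subseteq> F"
  obtain C M N where C: "0 \<le> C" "0 \<le> M" "\<And>ps t. map fst ps = \<phi>s \<Longrightarrow> snd ` set ps \<subseteq> C\<^sup>\<infinity> \<Longrightarrow>
     cmod (l (U (dil t) (wop ps \<Omega>))) \<le> C * exp (M * \<bar>t\<bar>) * (\<Prod>p\<leftarrow>ps. CN_norm N (snd p))"
    using tame_word_orbit_bound[OF l \<phi>s] by blast
  obtain B c where B: "0 \<le> B" "0 < c" "\<And>t. cmod (g (of_real t)) \<le> B * exp (- c * t\<^sup>2)"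
    using gaussian_bound_real[OF g] by blast
  let ?m = "LBINT t. exp (M * \<bar>t\<bar> - c * t\<^sup>2)"
  have m: "0 \<le> ?m" by (rule Bochner_Integration.integral_nonneg) simp
  have "cmod (LBINT t. l (U (dil t) (wop ps \<Omega>)) * g (of_real t)) \<le> (C * B * ?m) * (\<Prod>p\<leftarrow>ps. CN_norm N (snd p))"
    if ps: "map fst ps = \<phi>s" "snd ` set ps \<subseteq> C\<^sup>\<infinity>" for ps
  proof -
    let ?P = "\<Prod>p\<leftarrow>ps. CN_norm N (snd p)"
    have P: "0 \<le> ?P" by (rule prod_list_nonneg) (use ps in \<open>auto intro: CN_norm_nonneg\<close>)
    have "cmod (LBINT t. l (U (dil t) (wop ps \<Omega>)) * g (of_real t)) \<le> (LBINT t. (C * B * ?P) * exp (M * \<bar>t\<bar> - c * t\<^sup>2))"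
    proof (rule Bochner_Integration.integral_norm_bound_integral[OF int])
      show "integrable lborel (\<lambda>t. (C * B * ?P) * exp (M * \<bar>t\<bar> - c * t\<^sup>2))"
        by (intro integrable_mult_right integrable_gauss B(2))
      fix t
      have "cmod (l (U (dil t) (wop ps \<Omega>)) * g (of_real t)) \<le> (C * exp (M * \<bar>t\<bar>) * ?P) * (B * exp (- c * t\<^sup>2))"
        unfolding norm_mult using C(1) P by (intro mult_mono C(3) ps B(3)) auto
      also have "\<dots> = (C * B * ?P) * exp (M * \<bar>t\<bar> - c * t\<^sup>2)"
        by (simp add: exp_diff exp_minus divide_inverse)
      finally show "cmod (l (U (dil t) (wop ps \<Omega>)) * g (of_real t)) \<le> (C * B * ?P) * exp (M * \<bar>t\<bar> - c * t\<^sup>2)" .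
    qed
    also have "\<dots> = (C * B * ?m) * ?P" by simp
    finally show ?thesis .
  qed
  then show "\<exists>C N. 0 \<le> C \<and> (\<forall>ps. map fst ps = \<phi>s \<longrightarrow> snd ` set ps \<subseteq> C\<^sup>\<infinity> \<longrightarrow>
        cmod (LBINT t. l (U (dil t) (wop ps \<Omega>)) * g (of_real t)) \<le> C * (\<Prod>p\<leftarrow>ps. CN_norm N (snd p)))"
    using C(1) B(1) m by (intro exI[of _ "C * B * ?m"] exI[of _ N]) simp
qed

lemma tame_diff:
  assumes l: "tame l" and k: "tame k" shows "tame (\<lambda>v. l v - k v)"
  unfolding tame_def
proof (intro conjI allI impI)
  show "Vector_Spaces.linear sc (*) (\<lambda>v. l v - k v)"
    using tame_linear[OF l] tame_linear[OF k] unfolding Vector_Spaces.linear_iff by (simp add: algebra_simps)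
  fix \<phi>s assume \<phi>s: "set \<phi>s \<subseteq> F"
  obtain C N where C: "0 \<le> C" "\<And>ps. map fst ps = \<phi>s \<Longrightarrow> snd ` set ps \<subseteq> C\<^sup>\<infinity> \<Longrightarrow>
      cmod (l (wop ps \<Omega>)) \<le> C * (\<Prod>p\<leftarrow>ps. CN_norm N (snd p))" using tame_bound[OF l \<phi>s] by metis
  obtain D K where D: "0 \<le> D" "\<And>ps. map fst ps = \<phi>s \<Longrightarrow> snd ` set ps \<subseteq> C\<^sup>\<infinity> \<Longrightarrow>
      cmod (k (wop ps \<Omega>)) \<le> D * (\<Prod>p\<leftarrow>ps. CN_norm K (snd p))" using tame_bound[OF k \<phi>s] by metis
  have mono: "0 \<le> (\<Prod>p\<leftarrow>ps. CN_norm J (snd p)) \<and> (\<Prod>p\<leftarrow>ps. CN_norm J (snd p)) \<le> (\<Prod>p\<leftarrow>ps. CN_norm (max N K) (snd p))"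
    if "snd ` set ps \<subseteq> C\<^sup>\<infinity>" "J \<le> max N K" for ps :: "'d smeared" and J
    using that by (induction ps) (auto intro!: mult_mono mult_nonneg_nonneg CN_norm_mono CN_norm_nonneg)
  have "cmod (l (wop ps \<Omega>) - k (wop ps \<Omega>)) \<le> (C + D) * (\<Prod>p\<leftarrow>ps. CN_norm (max N K) (snd p))"
    if ps: "map fst ps = \<phi>s" "snd ` set ps \<subseteq> C\<^sup>\<infinity>" for ps
  proof -
    have "cmod (l (wop ps \<Omega>) - k (wop ps \<Omega>)) \<le> C * (\<Prod>p\<leftarrow>ps. CN_norm N (snd p)) + D * (\<Prod>p\<leftarrow>ps. CN_norm K (snd p))"
      by (intro order_trans[OF norm_triangle_ineq4] add_mono C(2) D(2) ps)
    also have "\<dots> \<le> C * (\<Prod>p\<leftarrow>ps. CN_norm (max N K) (snd p)) + D * (\<Prod>p\<leftarrow>ps. CN_norm (max N K) (snd p))"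
      using mono[OF ps(2)] C(1) D(1) by (intro add_mono mult_left_mono) auto
    finally show ?thesis by (simp add: distrib_right)
  qed
  then show "\<exists>C N. 0 \<le> C \<and> (\<forall>ps. map fst ps = \<phi>s \<longrightarrow> snd ` set ps \<subseteq> C\<^sup>\<infinity> \<longrightarrow>
        cmod (l (wop ps \<Omega>) - k (wop ps \<Omega>)) \<le> C * (\<Prod>p\<leftarrow>ps. CN_norm N (snd p)))"
    using C(1) D(1) by (intro exI[of _ "C + D"] exI[of _ "max N K"]) simp
qed

end

section \<open>Commutation of operators with complementary localization\<close>

lemma supp_cmult_cnj: "supp (\<lambda>z. c * cnj (f z)) \<subseteq> supp f"
  unfolding supp_def by (rule closure_mono) auto

context wightman_cft
begin

lemma strong_functional_compatible:
  assumes l: "Vector_Spaces.linear sc (*) l" and c: "continuous_map (strong_topology sc F) euclidean l"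
  shows "compatible_functional sc F l"
  unfolding compatible_functional_def
proof (intro conjI allI impI l)
  fix \<phi>s :: "'d distr list" and v assume "set \<phi>s \<subseteq> F"
  then have "continuous_map (tuple_topology (length \<phi>s)) (strong_topology sc F) (\<lambda>f. word \<phi>s f v)"
    using strong_topology_words_continuous[of F sc] unfolding words_continuous_def by blast
  from continuous_map_compose[OF this c] show "continuous_map (tuple_topology (length \<phi>s)) euclidean (\<lambda>f. l (word \<phi>s f v))"
    by (simp only: o_def)
qed

end

context involutive_wightman_cft
begin

lemma form_add_right: "form u (v + w) = form u v + form u w"
  and form_scale_right: "form u (sc c v) = cnj c * form u v"
  by (simp_all add: form_hermitian[of u] form_add form_scale)

lemma form_linear: "Vector_Spaces.linear sc (*) (\<lambda>v. form v u)"
  using vector_space_axioms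
  by (simp add: Vector_Spaces.linear_iff form_add form_scale vector_space_def algebra_simps)

lemma form_continuous_left: "continuous_map (strong_topology sc F) euclidean (\<lambda>v. form v u)"
proof -
  have "continuous_map (strong_topology sc F) (prod_topology (strong_topology sc F) (strong_topology sc F)) (\<lambda>v. (v, u))"
    by (simp add: continuous_map_pairwise o_def topspace_strong_topology)
  from continuous_map_compose[OF this form_continuous] show ?thesis by (simp only: o_def case_prod_conv)
qed

lemma form_tame: "tame (\<lambda>v. form v u)"
  by (rule compatible_tame[OF strong_functional_compatible[OF form_linear form_continuous_left]])

lemma form_diff: "form (v - w) u = form v u - form w u"
  using functional_diff[OF form_linear] .

lemma form_eqI: "(\<And>u. form v u = form w u) \<Longrightarrow> v = w"
  using form_nondegenerate[of "v - w"] by (simp add: form_diff)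

lemma is_adjoint_sym: "is_adjoint form x y \<Longrightarrow> is_adjoint form y x"
  unfolding is_adjoint_def by (metis form_hermitian)

lemma form_pct: "form (\<theta> v) u = form (\<theta> u) v"
  using pct_antiunitary[of v "\<theta> u"] form_hermitian[of "\<theta> u" v] by (simp add: pct_involution)

text \<open>The test function for which \<phi>(\<open>conj_fn \<phi> f\<close>) is the adjoint of
  \<phi>(f) conjugated by \<theta>. It is linear in f, because taking adjoints and conjugating by
  \<theta> are both antilinear.\<close>

definition conj_fn :: "'d distr \<Rightarrow> (complex \<Rightarrow> complex) \<Rightarrow> complex \<Rightarrow> complex" where
  "conj_fn \<phi> f = (\<lambda>z. (-1) ^ d \<phi> * reflect f z)"

lemma conj_fn_smooth: "f \<in> C\<^sup>\<infinity> \<Longrightarrow> conj_fn \<phi> f \<in> C\<^sup>\<infinity>"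
  unfolding conj_fn_def by (intro smooth_cmult(1) reflect_smooth)

lemma conj_fn_involution: "conj_fn \<phi> (conj_fn \<phi> f) = f"
  by (simp add: conj_fn_def reflect_def fun_eq_iff mult.assoc[symmetric] flip: power_add)

lemma sharp_simps: "sharp [] = []" "sharp (p # ps) = sharp ps @ [(fst p, conj_fn (fst p) (snd p))]"
  by (simp_all add: sharp_def conj_fn_def)

lemma field_adjoint:
  assumes \<phi>: "\<phi> \<in> F" and f: "f \<in> C\<^sup>\<infinity>"
  shows "form (\<phi> f v) u = form v (\<theta> (\<phi> (conj_fn \<phi> f) (\<theta> u)))"
proof -
  have "dagger sc \<theta> (d \<phi>) \<phi> (\<lambda>z. cnj (f z)) u = sc ((-1) ^ d \<phi>) (\<theta> (\<phi> (reflect f) (\<theta> u)))"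
    by (simp add: dagger_def reflect_def[abs_def])
  also have "\<dots> = \<theta> (\<phi> (conj_fn \<phi> f) (\<theta> u))"
    unfolding conj_fn_def field_cmult[OF \<phi> reflect_smooth[OF f]] pct_scale by simp
  finally show ?thesis using form_invariant[OF \<phi> f, of v u] by simp
qed

text \<open>The adjoint of a smeared field is a smeared field with the conjugate test function up to
  sign, because the dagger of a field is a field up to sign. Adjoints of words therefore stay words
  in the same region.\<close>

lemma field_adjoint_field:
  assumes \<phi>: "\<phi> \<in> F"
  shows "\<exists>\<psi>\<in>F. \<forall>f\<in>C\<^sup>\<infinity>. is_adjoint form (\<phi> f) (\<psi> (\<lambda>z. (-1) ^ d \<phi> * cnj (f z)))"
proof (rule bexI[OF _ dagger_field[OF \<phi>]], rule ballI)
  fix f assume f: "f \<in> C\<^sup>\<infinity>"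
  have "dagger sc \<theta> (d \<phi>) \<phi> (\<lambda>z. (-1) ^ d \<phi> * cnj (f z)) u = sc ((-1) ^ d \<phi>) (\<theta> (\<phi> (conj_fn \<phi> f) (\<theta> u)))" for u
    by (simp add: dagger_def reflect_def[abs_def] conj_fn_def)
  then have "sc ((-1) ^ d \<phi>) (dagger sc \<theta> (d \<phi>) \<phi> (\<lambda>z. (-1) ^ d \<phi> * cnj (f z)) u) = \<theta> (\<phi> (conj_fn \<phi> f) (\<theta> u))" for u
    by (simp flip: power_add)
  then show "is_adjoint form (\<phi> f) (\<lambda>v. sc ((-1) ^ d \<phi>) (dagger sc \<theta> (d \<phi>) \<phi> (\<lambda>z. (-1) ^ d \<phi> * cnj (f z)) v))"
    unfolding is_adjoint_def using field_adjoint[OF \<phi> f] by simp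
qed

lemma wop_adjoint_wop: "field_word F I ps \<Longrightarrow> \<exists>qs. field_word F I qs \<and> is_adjoint form (wop ps) (wop qs)"
proof (induction ps)
  case Nil
  show ?case by (rule exI[of _ "[]"]) (simp add: is_adjoint_def)
next
  case (Cons p ps)
  then obtain qs where qs: "field_word F I qs" "is_adjoint form (wop ps) (wop qs)" by auto
  obtain \<psi> where \<psi>: "\<psi> \<in> F" "\<And>f. f \<in> C\<^sup>\<infinity> \<Longrightarrow> is_adjoint form (fst p f) (\<psi> (\<lambda>z. (-1) ^ d (fst p) * cnj (f z)))"
    using field_adjoint_field[of "fst p"] Cons.prems by auto
  let ?g = "\<lambda>z. (-1) ^ d (fst p) * cnj (snd p z)"
  have p: "snd p \<in> C\<^sup>\<infinity>" "supp (snd p) \<subseteq> I" using Cons.prems by auto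
  have "?g \<in> C\<^sup>\<infinity>" "supp ?g \<subseteq> I"
    using smooth_cmult(1)[OF smooth_cnj[OF p(1)]] order_trans[OF supp_cmult_cnj p(2)] by auto
  then have "field_word F I (qs @ [(\<psi>, ?g)])" using qs(1) \<psi>(1) by simp
  moreover have "is_adjoint form (wop (p # ps)) (wop (qs @ [(\<psi>, ?g)]))"
    using \<psi>(2)[OF p(1)] qs(2) by (simp add: is_adjoint_def wop_append)
  ultimately show ?case by blast
qed

lemma wop_adjoint: "field_word F I ps \<Longrightarrow> form (wop ps v) u = form v (\<theta> (wop (sharp ps) (\<theta> u)))"
  by (induction ps arbitrary: v u) (simp_all add: sharp_simps pct_involution wop_append field_adjoint)

lemma U_adjoint: "form (U (dil t) v) u = form v (U (dil (- t)) u)"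
  using U_unitary[OF dil_Mob, of "- t" "U (dil t) v" u] U_inv(2)[OF dil_Mob, of t v] by (simp add: inv_dil)

lemma pct_field_adjoint:
  assumes \<phi>: "\<phi> \<in> F" and f: "f \<in> C\<^sup>\<infinity>"
  shows "form (\<theta> (\<phi> f (\<theta> v))) u = form v (\<phi> (conj_fn \<phi> f) u)"
  using field_adjoint[OF \<phi> conj_fn_smooth[OF f], of \<phi> u v] unfolding conj_fn_involution
  by (metis form_hermitian)

lemma beta_dil_conj_fn: "f \<in> C\<^sup>\<infinity> \<Longrightarrow> beta k (dil t) (conj_fn \<phi> f) = conj_fn \<phi> (beta k (dil t) f)"
  by (simp add: conj_fn_def beta_cmult beta_dil_reflect)

text \<open>Read through the form, the adjoint of \<theta>\<phi>(f)\<theta> is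
  \<phi>(\<open>conj_fn \<phi> f\<close>). The covariance of the latter is known, and dilations
  commute with the reflection inside \<open>conj_fn\<close>.\<close>

lemma U_pct_field:
  assumes \<phi>: "\<phi> \<in> F" and f: "f \<in> C\<^sup>\<infinity>"
  shows "U (dil t) (\<theta> (\<phi> f (\<theta> v))) = \<theta> (\<phi> (beta (d \<phi>) (dil t) f) (\<theta> (U (dil t) v)))"
proof (rule form_eqI)
  fix u
  let ?u = "U (dil (- t)) u"
  have u: "U (dil t) ?u = u" using U_inv(1)[OF dil_Mob, of t u] by (simp add: inv_dil)
  have "form (U (dil t) (\<theta> (\<phi> f (\<theta> v)))) u = form v (\<phi> (conj_fn \<phi> f) ?u)"
    by (simp add: U_adjoint pct_field_adjoint[OF \<phi> f])
  also have "\<dots> = form (U (dil t) v) (U (dil t) (\<phi> (conj_fn \<phi> f) ?u))" by (simp add: U_unitary[OF dil_Mob])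
  also have "\<dots> = form (U (dil t) v) (\<phi> (conj_fn \<phi> (beta (d \<phi>) (dil t) f)) u)"
    by (simp add: U_field[OF \<phi> dil_Mob conj_fn_smooth[OF f]] u beta_dil_conj_fn[OF f])
  also have "\<dots> = form (\<theta> (\<phi> (beta (d \<phi>) (dil t) f) (\<theta> (U (dil t) v)))) u"
    by (simp add: pct_field_adjoint[OF \<phi> beta_smooth[OF dil_Mob f]])
  finally show "form (U (dil t) (\<theta> (\<phi> f (\<theta> v)))) u = form (\<theta> (\<phi> (beta (d \<phi>) (dil t) f) (\<theta> (U (dil t) v)))) u" .
qed

lemma pct_zero: "\<theta> 0 = 0"
  using pct_scale[of 0 0] by simp

text \<open>Derived from covariance: by \<open>U_pct_field\<close> a dilation passes through
  \<theta> one letter at a time down to the invariant vacuum, and words applied to \<Omega>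
  span.\<close>

lemma U_pct: "U (dil t) (\<theta> v) = \<theta> (U (dil t) v)"
proof -
  have w: "U (dil t) (\<theta> (wop ps \<Omega>)) = \<theta> (U (dil t) (wop ps \<Omega>))" if "field_word F UNIV ps" for ps
    using that
  proof (induction ps)
    case Nil
    then show ?case by (simp add: pct_vacuum vacuum_invariant[OF dil_Mob])
  next
    case (Cons p ps)
    then have p: "fst p \<in> F" "snd p \<in> C\<^sup>\<infinity>" and ps: "field_word F UNIV ps" by auto
    have "U (dil t) (\<theta> (wop (p # ps) \<Omega>)) = \<theta> (fst p (beta (d (fst p)) (dil t) (snd p)) (U (dil t) (wop ps \<Omega>)))"
      using U_pct_field[OF p, of t "\<theta> (wop ps \<Omega>)"] by (simp add: pct_involution Cons.IH[OF ps])
    also have "\<dots> = \<theta> (U (dil t) (wop (p # ps) \<Omega>))" by (simp add: U_field[OF p(1) dil_Mob p(2)])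
    finally show ?case .
  qed
  have "v \<in> span {wop ps \<Omega> | ps. field_word F UNIV ps}" using span_words by simp
  then show ?thesis
  proof (induction rule: span_induct_alt)
    case base
    show ?case by (simp add: pct_zero lin_zero[OF U_linear[OF dil_Mob]])
  next
    case (step c x y)
    then show ?case using w
      by (auto simp: pct_add pct_scale lin_add[OF U_linear[OF dil_Mob]] lin_scale[OF U_linear[OF dil_Mob]])
  qed
qed

lemma sharp_bword: "field_word F I ps \<Longrightarrow> sharp (bword (dil t) ps) = bword (dil t) (sharp ps)"
  by (induction ps) (simp_all add: sharp_simps beta_dil_conj_fn)

section \<open>Operators commuting with the fields of a half circle\<close>

definition commutes_with_fields :: "complex set \<Rightarrow> ('d \<Rightarrow> 'd) \<Rightarrow> bool" where
  "commutes_with_fields I x \<longleftrightarrow>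
     (\<forall>\<phi>\<in>F. \<forall>f\<in>C\<^sup>\<infinity>. supp f \<subseteq> I \<longrightarrow> (\<forall>v. x (\<phi> f v) = \<phi> f (x v)))"

lemma commutes_with_fieldsD:
  "commutes_with_fields I x \<Longrightarrow> \<phi> \<in> F \<Longrightarrow> f \<in> C\<^sup>\<infinity> \<Longrightarrow> supp f \<subseteq> I \<Longrightarrow> x (\<phi> f v) = \<phi> f (x v)"
  unfolding commutes_with_fields_def by blast

lemma commutes_with_wop: "commutes_with_fields I x \<Longrightarrow> field_word F I ps \<Longrightarrow> x (wop ps v) = wop ps (x v)"
  by (induction ps) (simp_all add: commutes_with_fieldsD)

text \<open>A KMS-type relation.  By the Reeh-Schlieder property it suffices to test it on words localized
  in the half circle, where it is the contour shift.\<close>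

lemma vacuum_orbit_shift:
  assumes adj: "is_adjoint form x x'" and \<sigma>: "\<sigma> = 1 \<or> \<sigma> = -1" and g: "gaussian g"
    and comm: "commutes_with_fields (half_circle \<sigma>) x"
  shows "(LBINT t. form (U (dil t) v) (x' \<Omega>) * g (of_real t)) =
    (LBINT t. form (U (dil t) v) (\<theta> (x \<Omega>)) * g (of_real t + \<i> * of_real (\<sigma> * pi)))"
proof -
  \<comment> \<open>The shift for words goes by -i\<sigma>\<pi>, so it is started from g advanced by
    i\<sigma>\<pi> and ends at g.\<close>
  define g' where "g' z = g (z + \<i> * of_real (\<sigma> * pi))" for z
  have g': "gaussian g'" unfolding g'_def[abs_def] by (rule gaussian_shift[OF g])
  let ?L = "\<lambda>v. (LBINT t. form (U (dil t) v) (x' \<Omega>) * g (of_real t)) - (LBINT t. form (U (dil t) v) (\<theta> (x \<Omega>)) * g' (of_real t))"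
  have "?L v = 0"
  proof (rule reeh_schlieder[OF _ half_circle_openin half_circle_nonempty[OF \<sigma>], where l = ?L])
    show "tame ?L" by (intro tame_diff tame_orbit_average form_tame g g')
    fix ps assume ps: "field_word F (half_circle \<sigma>) ps"
    note xw = commutes_with_wop[OF comm]
    have "form (U (dil t) (wop ps \<Omega>)) (x' \<Omega>) = form (wop (bword (dil t) (sharp ps)) \<Omega>) (\<theta> (x \<Omega>))" for t
    proof -
      have bw: "field_word F (half_circle \<sigma>) (bword (dil t) ps)" by (rule bword_dil_field_word[OF ps])
      have "form (U (dil t) (wop ps \<Omega>)) (x' \<Omega>) = form (x (wop (bword (dil t) ps) \<Omega>)) \<Omega>"
        using adj by (simp add: U_wop_vacuum[OF dil_Mob ps] is_adjoint_def)
      also have "\<dots> = form (x \<Omega>) (\<theta> (wop (bword (dil t) (sharp ps)) \<Omega>))"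
        by (simp add: xw[OF bw] wop_adjoint[OF bw] sharp_bword[OF ps] pct_vacuum)
      also have "\<dots> = cnj (form (\<theta> (wop (bword (dil t) (sharp ps)) \<Omega>)) (x \<Omega>))" by (rule form_hermitian)
      also have "\<dots> = cnj (form (\<theta> (x \<Omega>)) (wop (bword (dil t) (sharp ps)) \<Omega>))" by (simp only: form_pct)
      also have "\<dots> = form (wop (bword (dil t) (sharp ps)) \<Omega>) (\<theta> (x \<Omega>))" by (rule form_hermitian[symmetric])
      finally show ?thesis .
    qed
    moreover have "(LBINT t. form (U (dil t) (wop ps \<Omega>)) (\<theta> (x \<Omega>)) * g' (of_real t))
       = (LBINT t. form (wop (bword (dil t) (sharp ps)) \<Omega>) (\<theta> (x \<Omega>)) * g (of_real t))"
      using word_contour_shift[OF form_tame ps g' \<sigma>, of "\<theta> (x \<Omega>)"]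
      by (simp add: U_wop_vacuum[OF dil_Mob ps] g'_def add.assoc)
    ultimately show "?L (wop ps \<Omega>) = 0" by simp
  qed
  then show ?thesis by (simp add: g'_def)
qed

text \<open>The orbit relation is used with \<sigma> = -1 for x and with \<sigma> = 1 for y. Moving
  \<theta> and the dilation across the form turns one right-hand side into the other with t
  reversed, and for centred Gaussians, which are even, reversing t turns the shift by -i\<pi> into
  one by i\<pi>. So both orbit functions have the same Gaussian averages, hence the same value at t
  = 0.\<close>

lemma vacuum_expectation_commute:
  assumes x: "is_adjoint form x x'" "commutes_with_fields (half_circle (-1)) x"
    and y: "is_adjoint form y y'" "commutes_with_fields (half_circle 1) y"
  shows "form (x (y \<Omega>)) \<Omega> = form (y (x \<Omega>)) \<Omega>"
proof -
  let ?a = "\<lambda>t. form (U (dil t) (y \<Omega>)) (x' \<Omega>)" and ?b = "\<lambda>t. form (U (dil t) (x \<Omega>)) (y' \<Omega>)"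
  have eq: "(LBINT t. (?a t - ?b t) * exp (- of_real n * (of_real t)\<^sup>2)) = 0" if n: "0 < n" for n :: real
  proof -
    define g :: "complex \<Rightarrow> complex" where "g z = exp (- of_real n * z\<^sup>2)" for z
    have g: "gaussian g" using gaussian_exp[OF n, of 0] by (simp add: g_def[abs_def])
    have even: "g (- z) = g z" for z by (simp add: g_def)
    have flip: "form (U (dil t) (y \<Omega>)) (\<theta> (x \<Omega>)) = form (U (dil (- t)) (x \<Omega>)) (\<theta> (y \<Omega>))" for t
    proof -
      have "form (U (dil t) (y \<Omega>)) (\<theta> (x \<Omega>)) = cnj (form (\<theta> (U (dil t) (y \<Omega>))) (x \<Omega>))"
        by (metis form_hermitian form_pct)
      also have "\<dots> = form (x \<Omega>) (U (dil t) (\<theta> (y \<Omega>)))" by (metis form_hermitian U_pct)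
      also have "\<dots> = form (U (dil (- t)) (x \<Omega>)) (\<theta> (y \<Omega>))" by (simp add: U_adjoint)
      finally show ?thesis .
    qed
    have "(LBINT t. ?a t * g (of_real t))
       = (LBINT t. form (U (dil (- t)) (x \<Omega>)) (\<theta> (y \<Omega>)) * g (of_real (- (- t)) + \<i> * of_real (-1 * pi)))"
      using vacuum_orbit_shift[OF x(1) _ g x(2), of "y \<Omega>"] by (simp add: flip)
    also have "\<dots> = (LBINT t. form (U (dil t) (x \<Omega>)) (\<theta> (y \<Omega>)) * g (of_real (- t) + \<i> * of_real (-1 * pi)))"
      by (rule lborel_integral_uminus)
    also have "\<dots> = (LBINT t. form (U (dil t) (x \<Omega>)) (\<theta> (y \<Omega>)) * g (of_real t + \<i> * of_real (1 * pi)))"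
    proof -
      have "g (of_real (- t) + \<i> * of_real (-1 * pi)) = g (of_real t + \<i> * of_real (1 * pi))" for t
        using even[of "of_real t + \<i> * of_real (1 * pi)"] by simp
      then show ?thesis by (simp only:)
    qed
    also have "\<dots> = (LBINT t. ?b t * g (of_real t))"
      using vacuum_orbit_shift[OF y(1) _ g y(2), of "x \<Omega>"] by simp
    finally have "(LBINT t. ?a t * g (of_real t)) - (LBINT t. ?b t * g (of_real t)) = 0" by simp
    then have "(LBINT t. ?a t * g (of_real t) - ?b t * g (of_real t)) = 0"
      by (simp add: Bochner_Integration.integral_diff tame_orbit_integrable[OF form_tame g])
    then show ?thesis by (simp only: left_diff_distrib g_def)
  qed
  obtain C M where C: "0 \<le> C" "0 \<le> M" "\<And>t. cmod (?a t) \<le> C * exp (M * \<bar>t\<bar>)"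
    using tame_orbit[OF form_tame] by blast
  obtain D L where D: "0 \<le> D" "0 \<le> L" "\<And>t. cmod (?b t) \<le> D * exp (L * \<bar>t\<bar>)"
    using tame_orbit[OF form_tame] by blast
  have "?a 0 - ?b 0 = 0"
  proof (rule gaussian_point_evaluation[of "\<lambda>t. ?a t - ?b t"])
    show "continuous_on UNIV (\<lambda>t. ?a t - ?b t)"
      by (intro continuous_on_diff conjunct1[OF tame_orbit[OF form_tame]])
    show "cmod (?a t - ?b t) \<le> (C + D) * exp ((M + L) * \<bar>t\<bar>)" for t
    proof -
      have e: "exp (M * \<bar>t\<bar>) \<le> exp ((M + L) * \<bar>t\<bar>)" "exp (L * \<bar>t\<bar>) \<le> exp ((M + L) * \<bar>t\<bar>)"
        using C(2) D(2) by (auto intro!: mult_right_mono)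
      have "cmod (?a t - ?b t) \<le> C * exp ((M + L) * \<bar>t\<bar>) + D * exp ((M + L) * \<bar>t\<bar>)"
        by (intro order_trans[OF norm_triangle_ineq4] add_mono order_trans[OF C(3)] order_trans[OF D(3)] mult_left_mono e C(1) D(1))
      then show ?thesis by (simp add: distrib_right)
    qed
    show "0 \<le> M + L" using C D by simp
  qed (rule eq)
  then have "form (y \<Omega>) (x' \<Omega>) = form (x \<Omega>) (y' \<Omega>)" by (simp add: dil_0 U_id)
  then show ?thesis using x(1) y(1) by (simp add: is_adjoint_def)
qed

text \<open>Words in the upper half circle may be placed around x: they commute with the fields of
  the lower half circle, which preserves the hypothesis on x, and with y, which lets them be moved
  out again. This gives the matrix elements of the commutator between such words; Reeh-Schlieder is
  then applied in each argument of the form separately.\<close>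

theorem half_circle_commute:
  assumes x: "is_adjoint form x x'" "commutes_with_fields (half_circle (-1)) x"
    and y: "is_adjoint form y y'" "commutes_with_fields (half_circle 1) y"
  shows "x (y v) = y (x v)"
proof -
  note yw = commutes_with_wop[OF y(2)]
  have words: "form (x (y (wop ps \<Omega>)) - y (x (wop ps \<Omega>))) (wop qs \<Omega>) = 0"
    if ps: "field_word F (half_circle 1) ps" and qs: "field_word F (half_circle 1) qs" for ps qs
  proof -
    obtain ps' where ps': "is_adjoint form (wop ps) (wop ps')" using wop_adjoint_wop[OF ps] by blast
    obtain qs' where qs': "field_word F (half_circle 1) qs'" "is_adjoint form (wop qs) (wop qs')"
      using wop_adjoint_wop[OF qs] by blast
    have qa: "form (wop qs' a) b = form a (wop qs b)" for a b
      using is_adjoint_sym[OF qs'(2)] by (simp add: is_adjoint_def)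
    let ?a = "\<lambda>v. wop qs' (x (wop ps v))"
    have "form (?a (y \<Omega>)) \<Omega> = form (y (?a \<Omega>)) \<Omega>"
    proof (rule vacuum_expectation_commute[OF _ _ y])
      show "is_adjoint form ?a (\<lambda>v. wop ps' (x' (wop qs v)))"
        using ps' qa x(1) by (simp add: is_adjoint_def)
      show "commutes_with_fields (half_circle (-1)) ?a"
        unfolding commutes_with_fields_def
      proof (intro ballI impI allI)
        fix \<phi> f v assume f: "\<phi> \<in> F" "f \<in> C\<^sup>\<infinity>" "supp f \<subseteq> half_circle (-1)"
        note c = wop_commute[OF _ f half_circle_disjoint]
        show "?a (\<phi> f v) = \<phi> f (?a v)"
          by (simp add: c[OF ps, symmetric] commutes_with_fieldsD[OF x(2) f] c[OF qs'(1)])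
      qed
    qed
    then have "form (x (wop ps (y \<Omega>))) (wop qs \<Omega>) = form (y (x (wop ps \<Omega>))) (wop qs \<Omega>)"
      unfolding yw[OF qs'(1)] qa .
    then show ?thesis unfolding form_diff yw[OF ps] by simp
  qed
  \<comment> \<open>With the operators moved to the other side, the matrix element is a difference
    of two tame functionals of v, as Reeh-Schlieder requires.\<close>
  have adj: "form (x (y v) - y (x v)) u = form v (y' (x' u)) - form v (x' (y' u))" for v u
    using x(1) y(1) by (simp add: is_adjoint_def form_diff)
  have all_v: "form (x (y v) - y (x v)) (wop qs \<Omega>) = 0" if qs: "field_word F (half_circle 1) qs" for v qs
    unfolding adj
  proof (rule reeh_schlieder[OF _ half_circle_openin[of 1] half_circle_nonempty,
        where l = "\<lambda>v. form v (y' (x' (wop qs \<Omega>))) - form v (x' (y' (wop qs \<Omega>)))"])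
    show "tame (\<lambda>v. form v (y' (x' (wop qs \<Omega>))) - form v (x' (y' (wop qs \<Omega>))))" by (intro tame_diff form_tame)
    show "form (wop ps \<Omega>) (y' (x' (wop qs \<Omega>))) - form (wop ps \<Omega>) (x' (y' (wop qs \<Omega>))) = 0"
      if "field_word F (half_circle 1) ps" for ps
      using words[OF that qs] unfolding adj .
  qed simp
  have "form u (x (y v) - y (x v)) = 0" for u
  proof (rule reeh_schlieder[OF form_tame half_circle_openin[of 1] half_circle_nonempty])
    show "form (wop qs \<Omega>) (x (y v) - y (x v)) = 0" if "field_word F (half_circle 1) qs" for qs
      using all_v[OF that, of v] by (subst form_hermitian) simp
  qed simp
  then have "form (x (y v) - y (x v)) u = 0" for u by (subst form_hermitian) simp
  then show ?thesis using form_nondegenerate[of "x (y v) - y (x v)"] by simp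
qed

end

section \<open>A Hahn-Banach theorem\<close>

context wightman_cft
begin

abbreviation rsc :: "real \<Rightarrow> 'd \<Rightarrow> 'd" where "rsc r \<equiv> sc (of_real r)"

text \<open>Homogeneity is asked for positive real factors only, which covers the gauge of a convex
  set that need not be balanced.\<close>

definition sublinear :: "('d \<Rightarrow> real) \<Rightarrow> bool" where
  "sublinear q \<longleftrightarrow> (\<forall>x y. q (x + y) \<le> q x + q y) \<and> (\<forall>r x. 0 < r \<longrightarrow> q (rsc r x) = r * q x)"

lemma sublinear_add: "sublinear q \<Longrightarrow> q (x + y) \<le> q x + q y"
  and sublinear_scale: "sublinear q \<Longrightarrow> 0 < r \<Longrightarrow> q (rsc r x) = r * q x"
  unfolding sublinear_def by blast+

lemma sublinear_zero: "sublinear q \<Longrightarrow> q 0 = 0"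
  using sublinear_scale[of q 2 0] by simp

lemma sublinear_scale_nonneg: "sublinear q \<Longrightarrow> 0 \<le> r \<Longrightarrow> q (rsc r x) = r * q x"
  by (cases "r = 0") (simp_all add: sublinear_zero sublinear_scale)

lemma sublinear_uminus: "sublinear q \<Longrightarrow> - q (- x) \<le> q x"
  using sublinear_add[of q x "- x"] sublinear_zero[of q] by simp

lemma sublinearI:
  assumes add: "\<And>x y. q (x + y) \<le> q x + q y" and sc: "\<And>r x. 0 < r \<Longrightarrow> q (rsc r x) \<le> r * q x"
  shows "sublinear q"
proof -
  have "q (rsc r x) = r * q x" if r: "0 < r" for r x
  proof (rule antisym[OF sc[OF r]])
    have "q (rsc (1 / r) (rsc r x)) \<le> (1 / r) * q (rsc r x)" by (rule sc) (use r in simp)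
    moreover have "rsc (1 / r) (rsc r x) = x" using r by (simp flip: of_real_mult)
    ultimately show "r * q x \<le> q (rsc r x)" using r by (simp add: field_simps)
  qed
  with add show ?thesis unfolding sublinear_def by blast
qed

text \<open>The infimum over t \<ge> 0 of q(y + t x) - t q(x) is the largest modification needed to
  make q odd along x. A minimal sublinear functional cannot decrease any further, so it equals its
  modifications and is linear.\<close>

lemma sublinear_directional:
  assumes q: "sublinear q"
  shows "\<exists>q'. sublinear q' \<and> q' \<le> q \<and> q' (- x) \<le> - q x"
proof -
  let ?h = "\<lambda>y t. q (y + rsc t x) - t * q x"
  define q' where "q' y = (INF t\<in>{0..}. ?h y t)" for y
  have lb: "- q (- y) \<le> ?h y t" if "0 \<le> t" for y t
  proof -
    have "q (rsc t x) \<le> q (y + rsc t x) + q (- y)" using sublinear_add[OF q, of "y + rsc t x" "- y"] by simp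
    then show ?thesis using sublinear_scale_nonneg[OF q that, of x] by simp
  qed
  have bdd: "bdd_below (?h y ` {0..})" for y
    by (rule bdd_belowI[of _ "- q (- y)"]) (use lb in auto)
  have le: "q' y \<le> ?h y t" if "0 \<le> t" for y t
    unfolding q'_def by (rule cINF_lower[OF bdd]) (use that in simp)
  have greatest: "c \<le> q' y" if "\<And>t. 0 \<le> t \<Longrightarrow> c \<le> ?h y t" for c y
    unfolding q'_def by (rule cINF_greatest) (use that in auto)
  have "sublinear q'"
  proof (rule sublinearI)
    fix y z
    have sum: "q' (y + z) \<le> ?h y s + ?h z t" if "0 \<le> s" "0 \<le> t" for s t
    proof -
      have "q' (y + z) \<le> ?h (y + z) (s + t)" using that by (intro le) simp
      also have "(y + z) + rsc (s + t) x = (y + rsc s x) + (z + rsc t x)"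
        by (simp add: scale_left_distrib algebra_simps)
      finally show ?thesis using sublinear_add[OF q, of "y + rsc s x" "z + rsc t x"] by (simp add: algebra_simps)
    qed
    have "q' (y + z) - ?h z t \<le> ?h y s" if "0 \<le> s" "0 \<le> t" for s t using sum[OF that] by linarith
    then have *: "q' (y + z) - ?h z t \<le> q' y" if "0 \<le> t" for t using that by (intro greatest)
    have "q' (y + z) - q' y \<le> ?h z t" if "0 \<le> t" for t using *[OF that] by linarith
    then have "q' (y + z) - q' y \<le> q' z" by (rule greatest)
    then show "q' (y + z) \<le> q' y + q' z" by simp
  next
    fix r :: real and y assume r: "0 < r"
    have "q' (rsc r y) / r \<le> ?h y t" if t: "0 \<le> t" for t
    proof -
      have e: "rsc r y + rsc (r * t) x = rsc r (y + rsc t x)" by (simp add: scale_right_distrib)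
      have "q' (rsc r y) \<le> ?h (rsc r y) (r * t)" using r t by (intro le) simp
      also have "\<dots> = ?h y t * r" unfolding e sublinear_scale[OF q r] by (simp add: algebra_simps)
      finally show ?thesis using r by (simp only: pos_divide_le_eq)
    qed
    then have "q' (rsc r y) / r \<le> q' y" by (rule greatest)
    then show "q' (rsc r y) \<le> r * q' y" using r by (simp add: field_simps)
  qed
  moreover have "q' y \<le> q y" for y using le[of 0 y] by simp
  moreover have "q' (- x) \<le> - q x" using le[of 1 "- x"] sublinear_zero[OF q] by simp
  ultimately show ?thesis by (intro exI[of _ q']) (simp add: le_fun_def)
qed

text \<open>Zorn's lemma for the reversed order. The pointwise infimum of a chain is finite because
  each member satisfies q(x) \<ge> -q(-x) \<ge> -p(-x), and it is subadditive because any two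
  members are comparable.\<close>

lemma sublinear_minimal:
  assumes p: "sublinear p"
  shows "\<exists>m. sublinear m \<and> m \<le> p \<and> (\<forall>q. sublinear q \<longrightarrow> q \<le> m \<longrightarrow> q = m)"
proof -
  let ?A = "{q. sublinear q \<and> q \<le> p}" and ?P = "\<lambda>a b :: 'd \<Rightarrow> real. b \<le> a"
  have "\<exists>m\<in>?A. \<forall>a\<in>?A. ?P m a \<longrightarrow> a = m"
  proof (rule predicate_Zorn)
    show "partial_order_on ?A (relation_of ?P ?A)"
      by (rule partial_order_on_relation_ofI) (auto intro: order_trans order_antisym)
    fix C assume C: "C \<in> Chains (relation_of ?P ?A)"
    then have sub: "q \<in> ?A" if "q \<in> C" for q using that by (auto simp: Chains_def relation_of_def)
    have chain: "q \<le> q' \<or> q' \<le> q" if "q \<in> C" "q' \<in> C" for q q'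
      using C that by (auto simp: Chains_def relation_of_def)
    show "\<exists>u\<in>?A. \<forall>a\<in>C. ?P a u"
    proof (cases "C = {}")
      case True
      then show ?thesis using p by blast
    next
      case False
      define u where "u x = (INF q\<in>C. q x)" for x
      have lb: "- p (- x) \<le> q x" if "q \<in> C" for q x
      proof -
        have "q (- x) \<le> p (- x)" using sub[OF that] by (simp add: le_fun_def)
        moreover have "- q (- x) \<le> q x" using sub[OF that] sublinear_uminus by blast
        ultimately show ?thesis by simp
      qed
      have bdd: "bdd_below ((\<lambda>q. q x) ` C)" for x by (rule bdd_belowI[of _ "- p (- x)"]) (use lb in auto)
      have le: "u x \<le> q x" if "q \<in> C" for q x unfolding u_def by (rule cINF_lower[OF bdd that])
      have greatest: "c \<le> u x" if "\<And>q. q \<in> C \<Longrightarrow> c \<le> q x" for c x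
        unfolding u_def by (rule cINF_greatest[OF False]) (rule that)
      have "sublinear u"
      proof (rule sublinearI)
        fix x y
        have sum: "u (x + y) \<le> q x + q' y" if "q \<in> C" "q' \<in> C" for q q'
        proof -
          have *: "u (x + y) \<le> m x + m y" if "m \<in> C" for m
            using le[OF that, of "x + y"] sublinear_add[of m x y] sub[OF that] by simp
          from chain[OF that] show ?thesis
          proof
            assume "q \<le> q'"
            then show ?thesis using *[OF that(1)] le_funD[of q q' y] by simp
          next
            assume "q' \<le> q"
            then show ?thesis using *[OF that(2)] le_funD[of q' q x] by simp
          qed
        qed
        have "u (x + y) - q' y \<le> q x" if "q \<in> C" "q' \<in> C" for q q' using sum[OF that] by linarith
        then have *: "u (x + y) - q' y \<le> u x" if "q' \<in> C" for q' using that by (intro greatest) simp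
        have "u (x + y) - u x \<le> q' y" if "q' \<in> C" for q' using *[OF that] by linarith
        then have "u (x + y) - u x \<le> u y" by (rule greatest)
        then show "u (x + y) \<le> u x + u y" by simp
      next
        fix r :: real and x assume r: "0 < r"
        have "u (rsc r x) / r \<le> q x" if "q \<in> C" for q
          using le[OF that, of "rsc r x"] sublinear_scale[of q r x] sub[OF that] r by (simp add: field_simps)
        then have "u (rsc r x) / r \<le> u x" by (rule greatest)
        then show "u (rsc r x) \<le> r * u x" using r by (simp add: field_simps)
      qed
      moreover have "u \<le> p"
      proof -
        obtain q where q: "q \<in> C" using False by blast
        have "u x \<le> p x" for x using le[OF q, of x] le_funD[of q p x] sub[OF q] by simp
        then show ?thesis by (simp add: le_fun_def)
      qed
      ultimately show ?thesis using le by (intro bexI[of _ u]) (auto simp: le_fun_def)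
    qed
  qed
  then obtain m where m: "m \<in> ?A" "\<And>a. a \<in> ?A \<Longrightarrow> a \<le> m \<Longrightarrow> a = m" by blast
  show ?thesis
  proof (intro exI conjI allI impI)
    show "sublinear m" "m \<le> p" using m(1) by auto
    show "q = m" if "sublinear q" "q \<le> m" for q
      using that m(1) order_trans[OF that(2), of p] by (intro m(2)) auto
  qed
qed

lemma minimal_sublinear_linear:
  assumes m: "sublinear m" and min: "\<And>q. sublinear q \<Longrightarrow> q \<le> m \<Longrightarrow> q = m"
  shows "m (x + y) = m x + m y" "m (rsc r x) = r * m x"
proof -
  have neg: "m (- x) = - m x" for x
  proof (rule antisym)
    show "m (- x) \<le> - m x" using sublinear_directional[OF m, of x] min by metis
    show "- m x \<le> m (- x)" using sublinear_uminus[OF m, of "- x"] by simp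
  qed
  show "m (x + y) = m x + m y"
  proof (rule antisym[OF sublinear_add[OF m]])
    have "m x \<le> m (x + y) + m (- y)" using sublinear_add[OF m, of "x + y" "- y"] by simp
    then show "m x + m y \<le> m (x + y)" by (simp add: neg)
  qed
  show "m (rsc r x) = r * m x"
  proof (cases "0 \<le> r")
    case False
    then have "m (rsc (- r) x) = - r * m x" by (intro sublinear_scale_nonneg[OF m]) simp
    then show ?thesis using neg[of "rsc r x"] by (simp add: scale_minus_left)
  qed (rule sublinear_scale_nonneg[OF m])
qed

text \<open>A minimal functional m is real-linear, and L(x) = m(x) - i m(ix) is the complex-linear
  functional with real part m. Starting from the modification of p along v prevents m from dropping
  below p at v.\<close>

lemma hahn_banach_complex:
  assumes p: "sublinear p"
  obtains L where "Vector_Spaces.linear sc (*) L" "\<And>x. Re (L x) \<le> p x" "p v \<le> Re (L v)"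
proof -
  obtain q where q: "sublinear q" "q \<le> p" "q (- v) \<le> - p v" using sublinear_directional[OF p] by blast
  obtain m where m: "sublinear m" "m \<le> q" "\<And>q. sublinear q \<Longrightarrow> q \<le> m \<Longrightarrow> q = m" using sublinear_minimal[OF q(1)] by blast
  have add: "m (x + y) = m x + m y" and scl: "m (rsc r x) = r * m x" for x y r
    by (rule minimal_sublinear_linear[OF m(1,3)], assumption+)+
  define L where "L x = Complex (m x) (- m (sc \<i> x))" for x
  have "L (x + y) = L x + L y" for x y by (simp add: L_def add scale_right_distrib complex_eq_iff)
  moreover have "L (sc c x) = c * L x" for c x
  proof -
    have cx: "sc c x = rsc (Re c) x + rsc (Im c) (sc \<i> x)"
      unfolding scale_scale scale_left_distrib[symmetric]
      by (rule arg_cong[of _ _ "\<lambda>c. sc c x"]) (simp add: complex_eq_iff)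
    have "sc \<i> (sc c x) = sc (of_real (Re c)) (sc \<i> x) + sc (of_real (- Im c)) x"
      unfolding scale_scale scale_left_distrib[symmetric]
      by (rule arg_cong[of _ _ "\<lambda>c. sc c x"]) (simp add: complex_eq_iff)
    then have cix: "sc \<i> (sc c x) = rsc (Re c) (sc \<i> x) + rsc (- Im c) x" .
    have "m (sc c x) = Re c * m x + Im c * m (sc \<i> x)" unfolding cx add scl ..
    moreover have "m (sc \<i> (sc c x)) = Re c * m (sc \<i> x) - Im c * m x" unfolding cix add scl by simp
    ultimately show ?thesis by (simp add: L_def complex_eq_iff)
  qed
  ultimately have "Vector_Spaces.linear sc (*) L"
    using vector_space_axioms by (simp add: Vector_Spaces.linear_iff vector_space_def algebra_simps)
  moreover have "Re (L x) \<le> p x" for x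
    using le_funD[OF m(2), of x] le_funD[OF q(2), of x] by (simp add: L_def)
  moreover have "p v \<le> Re (L v)"
    using le_funD[OF m(2), of "- v"] q(3) scl[of "-1" v] by (simp add: L_def)
  ultimately show ?thesis by (rule that)
qed

section \<open>Continuity in the strong topology\<close>

abbreviation T :: "'d topology" where "T \<equiv> strong_topology sc F"

lemma strong_continuous_add:
  assumes "continuous_map X T h" "continuous_map X T k"
  shows "continuous_map X T (\<lambda>x. h x + k x)"
proof -
  have "continuous_map X (prod_topology T T) (\<lambda>x. (h x, k x))"
    using assms by (simp add: continuous_map_pairwise o_def)
  moreover have "continuous_map (prod_topology T T) T (\<lambda>(v, w). v + w)"
    using strong_topology_locally_convex[of sc F] unfolding locally_convex_topology_def by blast
  ultimately have "continuous_map X T ((\<lambda>(v, w). v + w) \<circ> (\<lambda>x. (h x, k x)))" by (rule continuous_map_compose)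
  then show ?thesis by (simp only: o_def case_prod_conv)
qed

lemma strong_continuous_scale:
  assumes "continuous_map X T h"
  shows "continuous_map X T (\<lambda>x. sc c (h x))"
proof -
  have "continuous_map X (prod_topology euclidean T) (\<lambda>x. (c, h x))"
    using assms by (simp add: continuous_map_pairwise o_def)
  moreover have "continuous_map (prod_topology euclidean T) T (\<lambda>(c, v). sc c v)"
    using strong_topology_locally_convex[of sc F] unfolding locally_convex_topology_def by blast
  ultimately have "continuous_map X T ((\<lambda>(c, v). sc c v) \<circ> (\<lambda>x. (c, h x)))" by (rule continuous_map_compose)
  then show ?thesis by (simp only: o_def case_prod_conv)
qed

lemma strong_continuous_const: "continuous_map X T (\<lambda>x. v)"
  by (simp add: topspace_strong_topology)

lemma strong_open_affine:
  assumes "openin T V" shows "openin T {u. w + sc c u \<in> V}"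
proof -
  have "continuous_map T T (\<lambda>u. w + sc c (id u))"
    by (intro strong_continuous_add strong_continuous_scale strong_continuous_const continuous_map_id)
  from openin_continuous_map_preimage[OF this assms] show ?thesis by (simp add: topspace_strong_topology)
qed

lemma strong_absorbing:
  assumes V: "openin T V" "0 \<in> V" shows "\<exists>r>0. rsc (1 / r) x \<in> V"
proof -
  have "continuous_map euclidean (prod_topology euclidean T) (\<lambda>r::real. (of_real r :: complex, x))"
    by (simp add: continuous_map_pairwise o_def topspace_strong_topology continuous_intros)
  moreover have "continuous_map (prod_topology euclidean T) T (\<lambda>(c, v). sc c v)"
    using strong_topology_locally_convex[of sc F] unfolding locally_convex_topology_def by blast
  ultimately have "continuous_map euclidean T ((\<lambda>(c, v). sc c v) \<circ> (\<lambda>r::real. (of_real r, x)))" by (rule continuous_map_compose)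
  from openin_continuous_map_preimage[OF this V(1)] have "open {r::real. rsc r x \<in> V}" by simp
  moreover have "0 \<in> {r::real. rsc r x \<in> V}" using V(2) by simp
  ultimately obtain e where e: "0 < e" "ball 0 e \<subseteq> {r. rsc r x \<in> V}" unfolding open_contains_ball by blast
  have "e / 2 \<in> ball 0 e" using e(1) by simp
  then have "rsc (e / 2) x \<in> V" using e(2) by blast
  then show ?thesis using e(1) by (intro exI[of _ "2 / e"]) simp
qed

lemma strong_continuous_functional:
  assumes L: "Vector_Spaces.linear sc (*) L" and V: "openin T V" "0 \<in> V" and le: "\<And>u. u \<in> V \<Longrightarrow> cmod (L u) \<le> B"
  shows "continuous_map T euclidean L"
  unfolding continuous_map_def
proof (intro conjI allI impI)
  fix O' :: "complex set" assume O': "openin euclidean O'"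
  have B: "0 \<le> B" using le[OF V(2)] norm_ge_zero order_trans by blast
  show "openin T {v \<in> topspace T. L v \<in> O'}"
  proof (subst openin_subopen, intro ballI)
    fix v assume "v \<in> {v \<in> topspace T. L v \<in> O'}"
    then obtain e where e: "0 < e" "ball (L v) e \<subseteq> O'" using O' by (auto simp: open_contains_ball)
    \<comment> \<open>B + 1 keeps the factor positive for B = 0 and makes the final estimate
      strict.\<close>
    define c where "c = complex_of_real ((B + 1) / e)"
    have "0 < (B + 1) / e" using B e(1) by simp
    then have c: "cmod c = (B + 1) / e" unfolding c_def norm_of_real by (rule abs_of_pos)
    have "L u \<in> O'" if u: "sc (- c) v + sc c u \<in> V" for u
    proof -
      have "sc (- c) v + sc c u = sc c (u - v)" by (simp add: scale_right_diff_distrib scale_minus_left)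
      then have "cmod c * cmod (L u - L v) \<le> B"
        using le[OF u] by (simp add: functional_scale[OF L] functional_diff[OF L] norm_mult)
      then have "(B + 1) * cmod (L u - L v) \<le> B * e" unfolding c using e(1) by (simp add: field_simps)
      also have "\<dots> < (B + 1) * e" using e(1) by simp
      finally have "cmod (L u - L v) < e" using B by simp
      then show ?thesis using e(2) by (auto simp: dist_norm norm_minus_commute)
    qed
    then show "\<exists>N. openin T N \<and> v \<in> N \<and> N \<subseteq> {v \<in> topspace T. L v \<in> O'}"
      using strong_open_affine[OF V(1), of "sc (- c) v" c] V(2)
      by (intro exI[of _ "{u. sc (- c) v + sc c u \<in> V}"]) (auto simp: topspace_strong_topology scale_minus_left)
  qed
qed simp

text \<open>The Hahn-Banach theorem for the gauge of \<open>M + V\<close>, with V a convex neighbourhood of 0.\<close>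

lemma strong_separation:
  assumes M: "0 \<in> M" "\<And>x y. x \<in> M \<Longrightarrow> y \<in> M \<Longrightarrow> x + y \<in> M" "\<And>c x. x \<in> M \<Longrightarrow> sc c x \<in> M"
    and v: "v \<notin> T closure_of M"
  obtains L where "compatible_functional sc F L" "\<And>x. x \<in> M \<Longrightarrow> L x = 0" "L v \<noteq> 0"
proof -
  obtain W where W: "openin T W" "v \<in> W" "W \<inter> M = {}"
    using v unfolding in_closure_of by (auto simp: topspace_strong_topology)
  have W': "openin T {u. v + sc (-1) u \<in> W}" by (rule strong_open_affine[OF W(1)])
  moreover have "0 \<in> {u. v + sc (-1) u \<in> W}" using W(2) by simp
  ultimately obtain V where V: "openin T V" "0 \<in> V" "V \<subseteq> {u. v + sc (-1) u \<in> W}"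
    and cvx: "\<And>x y t. x \<in> V \<Longrightarrow> y \<in> V \<Longrightarrow> t \<in> {0..1} \<Longrightarrow> rsc t x + rsc (1 - t) y \<in> V"
    using strong_topology_locally_convex[of sc F] unfolding locally_convex_topology_def by meson
  \<comment> \<open>The radii r with x in M + r V. As M is a subspace this set is r(M + V), and p is
    its gauge.\<close>
  define R where "R x = {r. 0 < r \<and> (\<exists>m\<in>M. rsc (1 / r) (x - m) \<in> V)}" for x
  define p where "p x = Inf (R x)" for x
  have RI: "r \<in> R x" if "0 < r" "m \<in> M" "rsc (1 / r) (x - m) \<in> V" for r m x using that by (auto simp: R_def)
  have ne: "R x \<noteq> {}" for x using strong_absorbing[OF V(1,2), of x] RI[OF _ M(1), of _ x] by auto
  have bdd: "bdd_below (R x)" for x by (rule bdd_belowI[of _ 0]) (auto simp: R_def)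
  have p_le: "p x \<le> r" if "r \<in> R x" for r x unfolding p_def by (rule cInf_lower[OF that bdd])
  have p_ge: "c \<le> p x" if "\<And>r. r \<in> R x \<Longrightarrow> c \<le> r" for c x unfolding p_def by (rule cInf_greatest[OF ne that])
  have Radd: "r + s \<in> R (x + y)" if "r \<in> R x" "s \<in> R y" for r s x y
  proof -
    obtain m n where m: "0 < r" "m \<in> M" "rsc (1 / r) (x - m) \<in> V" and n: "0 < s" "n \<in> M" "rsc (1 / s) (y - n) \<in> V"
      using \<open>r \<in> R x\<close> \<open>s \<in> R y\<close> by (auto simp: R_def)
    let ?t = "r / (r + s)"
    have t: "?t \<in> {0..1}" "1 - ?t = s / (r + s)" using m(1) n(1) by (auto simp: field_simps)
    have "rsc ?t (rsc (1 / r) (x - m)) + rsc (1 - ?t) (rsc (1 / s) (y - n)) \<in> V" by (rule cvx[OF m(3) n(3) t(1)])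
    moreover have "rsc ?t (rsc (1 / r) (x - m)) = rsc (1 / (r + s)) (x - m)"
      unfolding scale_scale of_real_mult[symmetric] using m(1) by simp
    moreover have "rsc (1 - ?t) (rsc (1 / s) (y - n)) = rsc (1 / (r + s)) (y - n)"
      unfolding scale_scale of_real_mult[symmetric] t(2) using n(1) by simp
    moreover have "rsc (1 / (r + s)) (x - m) + rsc (1 / (r + s)) (y - n) = rsc (1 / (r + s)) ((x + y) - (m + n))"
      by (simp add: scale_right_distrib[symmetric])
    ultimately have "rsc (1 / (r + s)) ((x + y) - (m + n)) \<in> V" by (simp only:)
    then show ?thesis using m n by (intro RI[of _ "m + n"] M(2)) auto
  qed
  have "sublinear p"
  proof (rule sublinearI)
    fix x y
    have *: "p (x + y) - s \<le> p x" if s: "s \<in> R y" for s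
    proof (rule p_ge)
      show "p (x + y) - s \<le> r" if "r \<in> R x" for r using p_le[OF Radd[OF that s]] by linarith
    qed
    have "p (x + y) - p x \<le> p y"
    proof (rule p_ge)
      show "p (x + y) - p x \<le> s" if "s \<in> R y" for s using *[OF that] by linarith
    qed
    then show "p (x + y) \<le> p x + p y" by simp
  next
    fix t :: real and x assume t: "0 < t"
    have "p (rsc t x) / t \<le> r" if "r \<in> R x" for r
    proof -
      obtain m where m: "0 < r" "m \<in> M" "rsc (1 / r) (x - m) \<in> V" using \<open>r \<in> R x\<close> by (auto simp: R_def)
      have "rsc (1 / (t * r)) (rsc t x - rsc t m) = rsc (1 / r) (x - m)"
        unfolding scale_right_diff_distrib[symmetric] scale_scale of_real_mult[symmetric] using t by simp
      then have "t * r \<in> R (rsc t x)" using m t by (intro RI[of _ "rsc t m"] M(3)) auto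
      from p_le[OF this] show ?thesis using t by (simp add: field_simps)
    qed
    then have "p (rsc t x) / t \<le> p x" by (rule p_ge)
    then show "p (rsc t x) \<le> t * p x" using t by (simp add: field_simps)
  qed
  from hahn_banach_complex[OF this, of v] obtain L where L: "Vector_Spaces.linear sc (*) L"
    "\<And>x. Re (L x) \<le> p x" "p v \<le> Re (L v)" by blast
  \<comment> \<open>If some r < 1 were admissible, convexity and 0 \<in> V would put v - m into V,
    hence m into W, which avoids M.\<close>
  have "1 \<le> p v"
  proof (rule p_ge)
    fix r assume "r \<in> R v"
    then obtain m where m: "0 < r" "m \<in> M" "rsc (1 / r) (v - m) \<in> V" by (auto simp: R_def)
    show "1 \<le> r"
    proof (rule ccontr)
      assume r: "\<not> 1 \<le> r"
      then have "rsc r (rsc (1 / r) (v - m)) + rsc (1 - r) 0 \<in> V" using m by (intro cvx V(2)) auto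
      moreover have "rsc r (rsc (1 / r) (v - m)) = v - m"
        unfolding scale_scale of_real_mult[symmetric] using m(1) by simp
      ultimately have "v + sc (-1) (v - m) \<in> W" using V(3) by auto
      then show False using W(3) m(2) by auto
    qed
  qed
  then have "L v \<noteq> 0" using L(3) by auto
  moreover have "L x = 0" if x: "x \<in> M" for x
  proof -
    have "Re (L y) \<le> 0" if y: "y \<in> M" for y
    proof (rule ccontr)
      assume "\<not> Re (L y) \<le> 0"
      then have "Re (L y) / 2 \<in> R y" using V(2) by (intro RI[OF _ y]) auto
      then show False using p_le[of "Re (L y) / 2" y] L(2)[of y] \<open>\<not> Re (L y) \<le> 0\<close> by simp
    qed
    \<comment> \<open>Testing on the multiple of x by the conjugate of L x turns the bound on real
      parts into one on |L x|^2.\<close>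
    from this[OF M(3)[OF x, of "cnj (L x)"]] have "Re (cnj (L x) * L x) \<le> 0" by (simp add: functional_scale[OF L(1)])
    then show ?thesis by (simp add: complex_eq_iff sum_squares_le_zero_iff)
  qed
  moreover have "compatible_functional sc F L"
  proof (rule strong_functional_compatible[OF L(1)])
    \<comment> \<open>The gauge bounds only Re L, and V need not be balanced; the factors 1, -1,
      \<i> and -\<i> together bound the moduli of both parts of L.\<close>
    let ?N = "\<lambda>c. {u. 0 + sc c u \<in> V}"
    show "continuous_map T euclidean L"
    proof (rule strong_continuous_functional[OF L(1), of "?N 1 \<inter> ?N (-1) \<inter> ?N \<i> \<inter> ?N (- \<i>)" 2])
      show "openin T (?N 1 \<inter> ?N (-1) \<inter> ?N \<i> \<inter> ?N (- \<i>))" by (intro openin_Int strong_open_affine V(1))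
      show "0 \<in> ?N 1 \<inter> ?N (-1) \<inter> ?N \<i> \<inter> ?N (- \<i>)" using V(2) by simp
      fix u assume u: "u \<in> ?N 1 \<inter> ?N (-1) \<inter> ?N \<i> \<inter> ?N (- \<i>)"
      have le: "Re (c * L u) \<le> 1" if "sc c u \<in> V" for c
      proof -
        have "1 \<in> R (sc c u)" using that by (intro RI[OF _ M(1)]) auto
        from p_le[OF this] L(2)[of "sc c u"] show ?thesis by (simp add: functional_scale[OF L(1)])
      qed
      have "\<bar>Re (L u)\<bar> \<le> 1" "\<bar>Im (L u)\<bar> \<le> 1"
        using le[of 1] le[of "-1"] le[of \<i>] le[of "- \<i>"] u by (auto simp: abs_le_iff)
      then show "cmod (L u) \<le> 2" using cmod_le[of "L u"] by linarith
    qed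
  qed
  ultimately show ?thesis by (intro that[of L])
qed

end

section \<open>Arcs of the circle\<close>

lemma opposite_half_circle: "opposite (half_circle 1) = half_circle (-1)"
proof -
  have sub: "half_circle 1 \<subseteq> S\<^sup>1" by (auto simp: half_circle_def)
  have cl: "(top_of_set S\<^sup>1) closure_of half_circle 1 = S\<^sup>1 \<inter> closure (half_circle 1)"
    by (simp add: closure_of_subtopology Int_absorb1[OF sub])
  have cl': "S\<^sup>1 \<inter> closure (half_circle 1) = {z \<in> S\<^sup>1. 0 \<le> Im z}"
  proof
    have "closure (half_circle 1) \<subseteq> {z. 0 \<le> Im z}"
      by (rule closure_minimal) (auto simp: half_circle_def intro!: closed_Collect_le continuous_intros)
    then show "S\<^sup>1 \<inter> closure (half_circle 1) \<subseteq> {z \<in> S\<^sup>1. 0 \<le> Im z}" by blast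
    have "z \<in> closure (half_circle 1)" if z: "z \<in> S\<^sup>1" "Im z = 0" for z
    proof -
      have re: "(Re z)\<^sup>2 = 1" using z cmod_power2[of z] by simp
      \<comment> \<open>Here z is 1 or -1, and the rotation by the small angle Re z/(n + 1) moves
        either of them into the upper half circle.\<close>
      define w where "w n = z * cis (Re z / real (Suc n))" for n
      have "w n \<in> half_circle 1" for n
      proof -
        have "Im (w n) = sin (1 / real (Suc n))"
        proof (cases "Re z = 1")
          case False
          then have "Re z = -1" using re by (simp add: power2_eq_1_iff)
          then show ?thesis using z(2) by (simp add: w_def)
        qed (use z(2) in \<open>simp add: w_def\<close>)
        moreover have "0 < sin (1 / real (Suc n))"
        proof (rule sin_gt_zero)
          have "1 / real (Suc n) \<le> 1" by simp
          then show "1 / real (Suc n) < pi" using pi_gt3 by linarith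
        qed simp
        moreover have "w n \<in> S\<^sup>1" using z(1) by (simp add: w_def norm_mult)
        ultimately show ?thesis by (simp add: half_circle_def)
      qed
      moreover have "w \<longlonglongrightarrow> z * cis 0"
      proof -
        have "(\<lambda>n. Re z / real (Suc n)) \<longlonglongrightarrow> 0"
          using tendsto_mult_right_zero[OF LIMSEQ_inverse_real_of_nat, of "Re z"] by (simp add: divide_inverse)
        then have "(\<lambda>n. cis (Re z / real (Suc n))) \<longlonglongrightarrow> cis 0"
          unfolding cis_conv_exp by (intro tendsto_exp tendsto_mult_left tendsto_of_real)
        then show ?thesis unfolding w_def by (rule tendsto_mult_left)
      qed
      ultimately show ?thesis unfolding closure_sequential by (intro exI[of _ w]) simp
    qed
    moreover have "z \<in> closure (half_circle 1)" if "z \<in> S\<^sup>1" "0 < Im z" for z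
      using that subsetD[OF closure_subset, of z "half_circle 1"] by (simp add: half_circle_def)
    ultimately have "z \<in> closure (half_circle 1)" if "z \<in> S\<^sup>1" "0 \<le> Im z" for z
      using that by (cases "Im z = 0") auto
    then show "{z \<in> S\<^sup>1. 0 \<le> Im z} \<subseteq> S\<^sup>1 \<inter> closure (half_circle 1)" by blast
  qed
  have "opposite (half_circle 1) = S\<^sup>1 - {z \<in> S\<^sup>1. 0 \<le> Im z}"
    using interior_of_complement[of "top_of_set S\<^sup>1" "half_circle 1"]
    unfolding opposite_def topspace_euclidean_subtopology cl cl' .
  also have "\<dots> = half_circle (-1)" by (rule set_eqI) (auto simp: half_circle_def)
  finally show ?thesis .
qed

lemma Mob_image_circle: "\<gamma> \<in> Mob \<Longrightarrow> \<gamma> ` {z \<in> S\<^sup>1. P z} = {z \<in> S\<^sup>1. P (inv \<gamma> z)}"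
proof -
  assume \<gamma>: "\<gamma> \<in> Mob"
  show ?thesis
  proof (intro set_eqI iffI)
    fix z assume "z \<in> \<gamma> ` {z \<in> S\<^sup>1. P z}"
    then show "z \<in> {z \<in> S\<^sup>1. P (inv \<gamma> z)}" using Mob_circle[OF \<gamma>] by (auto simp: Mob_inv_inv[OF \<gamma>])
  next
    fix z assume "z \<in> {z \<in> S\<^sup>1. P (inv \<gamma> z)}"
    then have "inv \<gamma> z \<in> {z \<in> S\<^sup>1. P z}" using Mob_circle[OF Mob_inv[OF \<gamma>], of z] by simp
    then have "\<gamma> (inv \<gamma> z) \<in> \<gamma> ` {z \<in> S\<^sup>1. P z}" by (rule imageI)
    then show "z \<in> \<gamma> ` {z \<in> S\<^sup>1. P z}" by (simp only: Mob_inv_inv(1)[OF \<gamma>])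
  qed
qed

lemma opposite_Mob:
  assumes \<gamma>: "\<gamma> \<in> Mob" and I: "I \<subseteq> S\<^sup>1" shows "opposite (\<gamma> ` I) = \<gamma> ` opposite I"
proof -
  have im: "\<gamma> ` S\<^sup>1 = S\<^sup>1" using Mob_image_circle[OF \<gamma>, of "\<lambda>z. True"] by (simp only: simp_thms Collect_mem_eq)
  have "homeomorphic_maps (top_of_set S\<^sup>1) (top_of_set S\<^sup>1) \<gamma> (inv \<gamma>)"
    unfolding homeomorphic_maps_def
    using Mob_continuous[OF \<gamma>] Mob_continuous[OF Mob_inv[OF \<gamma>]] Mob_circle[OF \<gamma>] Mob_circle[OF Mob_inv[OF \<gamma>]] Mob_inv_inv[OF \<gamma>]
    by (auto simp: continuous_map_in_subtopology)
  then have "homeomorphic_map (top_of_set S\<^sup>1) (top_of_set S\<^sup>1) \<gamma>" using homeomorphic_maps_map by blast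
  then have "(top_of_set S\<^sup>1) interior_of (\<gamma> ` (S\<^sup>1 - I)) = \<gamma> ` ((top_of_set S\<^sup>1) interior_of (S\<^sup>1 - I))"
    by (rule homeomorphic_map_interior_of) simp
  moreover have "\<gamma> ` (S\<^sup>1 - I) = S\<^sup>1 - \<gamma> ` I"
    using image_set_diff[OF bij_is_inj[OF Mob_bij[OF \<gamma>]], of "S\<^sup>1" I] im by simp
  ultimately show ?thesis by (simp add: opposite_def)
qed

text \<open>A dilation acts on real parts by the real Moebius map Re z \<mapsto> (S + C Re z)/(C + S
  Re z) with C = cosh t and S = sinh t. It sends 0 to tanh t, so t is chosen with tanh t =
  r.\<close>

lemma arc_dil:
  assumes r: "-1 < r" "r < 1"
  shows "\<exists>t. {z \<in> S\<^sup>1. r < Re z} = dil t ` {z \<in> S\<^sup>1. 0 < Re z}"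
proof -
  define t where "t = ln ((1 + r) / (1 - r)) / 2"
  have e: "exp (- 2 * t) = (1 - r) / (1 + r)" using r by (simp add: t_def exp_minus)
  have th: "tanh t = r" unfolding tanh_real_altdef e using r by (simp add: field_simps)
  let ?c = "cosh (t / 2)" and ?s = "sinh (t / 2)"
  define C where "C = cosh t" define S where "S = sinh t"
  have C: "C = ?c\<^sup>2 + ?s\<^sup>2" "S = 2 * ?s * ?c" using cosh_double[of "t / 2"] sinh_double[of "t / 2"] by (simp_all add: C_def S_def)
  have C0: "0 < C" and CS: "C\<^sup>2 - S\<^sup>2 = 1" and rC: "r = S / C"
    using hyperbolic_pythagoras[of t] th by (simp_all add: C_def S_def tanh_def)
  have iff: "r < Re (dil t z) \<longleftrightarrow> 0 < Re z" if z: "z \<in> S\<^sup>1" for z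
  proof -
    have n: "(Re z)\<^sup>2 + (Im z)\<^sup>2 = 1" using z cmod_power2[of z] by simp
    have nz: "of_real ?s * z + of_real ?c \<noteq> (0::complex)" using su11_denom[OF dil_su11, of z t] z by simp
    have N: "(Re (of_real ?s * z + of_real ?c))\<^sup>2 + (Im (of_real ?s * z + of_real ?c))\<^sup>2 = C + S * Re z"
    proof -
      have "(?s * Re z + ?c)\<^sup>2 + (?s * Im z)\<^sup>2 = ?s\<^sup>2 * ((Re z)\<^sup>2 + (Im z)\<^sup>2) + ?c\<^sup>2 + 2 * ?s * ?c * Re z"
        by (simp add: power2_eq_square algebra_simps)
      then show ?thesis by (simp add: n C)
    qed
    have "0 < (cmod (of_real ?s * z + of_real ?c))\<^sup>2" using nz by simp
    then have pos: "0 < C + S * Re z" unfolding cmod_power2 N .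
    have num: "Re (of_real ?c * z + of_real ?s) * Re (of_real ?s * z + of_real ?c) + Im (of_real ?c * z + of_real ?s) * Im (of_real ?s * z + of_real ?c) = S + C * Re z"
    proof -
      have "(?c * Re z + ?s) * (?s * Re z + ?c) + ?c * Im z * (?s * Im z) = ?s * ?c * ((Re z)\<^sup>2 + (Im z)\<^sup>2) + ?s * ?c + (?c\<^sup>2 + ?s\<^sup>2) * Re z"
        by (simp add: power2_eq_square algebra_simps)
      then show ?thesis by (simp add: n C)
    qed
    have d: "dil t z = (of_real ?c * z + of_real ?s) / (of_real ?s * z + of_real ?c)"
      using z by (simp add: dil_def su11_action_def)
    have "Re (dil t z) = (S + C * Re z) / (C + S * Re z)" unfolding d Re_divide N num ..
    then have "r < Re (dil t z) \<longleftrightarrow> S * (C + S * Re z) < (S + C * Re z) * C"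
      unfolding rC using pos C0 by (simp add: divide_less_eq less_divide_eq mult.commute)
    also have "\<dots> \<longleftrightarrow> 0 < (C\<^sup>2 - S\<^sup>2) * Re z" by (simp add: power2_eq_square algebra_simps)
    finally show ?thesis by (simp add: CS)
  qed
  have "{z \<in> S\<^sup>1. r < Re z} = dil t ` {z \<in> S\<^sup>1. 0 < Re z}"
    unfolding Mob_image_circle[OF dil_Mob]
  proof (rule Collect_cong)
    fix z
    have "inv (dil t) z \<in> S\<^sup>1 \<longleftrightarrow> z \<in> S\<^sup>1" by (rule Mob_circle[OF Mob_inv[OF dil_Mob]])
    then show "(z \<in> S\<^sup>1 \<and> r < Re z) = (z \<in> S\<^sup>1 \<and> 0 < Re (inv (dil t) z))"
      using iff[of "inv (dil t) z"] Mob_inv_inv(1)[OF dil_Mob, of t z] by auto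
  qed
  then show ?thesis by blast
qed

lemma rotation_image: "rotation t ` {z \<in> S\<^sup>1. P z} = {z \<in> S\<^sup>1. P (cis (- t) * z)}"
proof -
  have "inv (rotation t) z = cis (- t) * z" if "z \<in> S\<^sup>1" for z
  proof -
    have "rotation t (cis (- t) * z) = z"
      using that by (simp add: rotation_def norm_mult cis_mult flip: mult.assoc)
    then show ?thesis using Mob_inv_inv(2)[OF rotation_Mob, of t "cis (- t) * z"] by simp
  qed
  then show ?thesis unfolding Mob_image_circle[OF rotation_Mob] by auto
qed

text \<open>A point p outside the closure of I serves as branch point: measured from the antipode of
  p, the angle is continuous on I and maps it onto an open connected set of reals, an interval (a,
  b). The length 2\<pi> is excluded, since p would then lie in the closure. The midpoint gives
  \<mu>, and the half-length \<delta> gives r = cos \<delta>.\<close>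

lemma circle_interval_arc:
  assumes I: "circle_interval I"
  obtains \<mu> r where "-1 < r" "r < 1" "I = {z \<in> S\<^sup>1. r < Re (cis (- \<mu>) * z)}"
proof -
  have op: "openin (top_of_set S\<^sup>1) I" and conn: "connected I" and ne: "I \<noteq> {}" and nd: "\<not> S\<^sup>1 \<subseteq> closure I"
    using I by (auto simp: circle_interval_def)
  obtain O' where O': "open O'" "I = S\<^sup>1 \<inter> O'" using op by (auto simp: openin_open)
  obtain p where p: "p \<in> S\<^sup>1" "p \<notin> closure I" using nd by blast
  define \<alpha> where "\<alpha> = Arg p"
  have pa: "p = cis \<alpha>" using p(1) by (simp add: \<alpha>_def cis_Arg_circle)
  have pI: "p \<notin> I" using p(2) subsetD[OF closure_subset] by blast
  define q where "q t = cis (\<alpha> + pi + t)" for t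
  define h where "h z = Arg (cis (- \<alpha> - pi) * z)" for z
  have hc: "cis (h z) = cis (- \<alpha> - pi) * z" if "z \<in> S\<^sup>1" for z
    unfolding h_def by (rule cis_Arg_circle) (use that in \<open>simp add: norm_mult\<close>)
  have qh: "q (h z) = z" if "z \<in> S\<^sup>1" for z
  proof -
    have "q (h z) = cis (\<alpha> + pi) * cis (h z)" by (simp add: q_def cis_mult)
    also have "\<dots> = cis ((\<alpha> + pi) + (- \<alpha> - pi)) * z" unfolding hc[OF that] cis_mult[symmetric] by (simp only: mult.assoc)
    finally show ?thesis by simp
  qed
  have q_pi: "q pi = p" "q (- pi) = p" by (simp_all add: q_def pa complex_eq_iff cos_add sin_add)
  define J where "J = h ` I"
  have J_bd: "- pi < t \<and> t < pi" if t: "t \<in> J" for t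
  proof -
    obtain z where z: "z \<in> I" "t = h z" using t by (auto simp: J_def)
    then have "q t = z" using qh O'(2) by auto
    then have "t \<noteq> pi" using q_pi(1) z(1) pI by auto
    moreover have "- pi < t \<and> t \<le> pi" unfolding z(2) h_def by (rule Arg_bounded)
    ultimately show ?thesis by simp
  qed
  have J_eq: "J = {- pi<..<pi} \<inter> q -` O'"
  proof (intro set_eqI iffI)
    fix t assume t: "t \<in> J"
    then obtain z where z: "z \<in> I" "t = h z" by (auto simp: J_def)
    then have "q t = z" using qh O'(2) by auto
    then show "t \<in> {- pi<..<pi} \<inter> q -` O'" using J_bd[OF t] z O'(2) by auto
  next
    fix t assume t: "t \<in> {- pi<..<pi} \<inter> q -` O'"
    have "cis (- \<alpha> - pi) * q t = cis t" by (simp add: q_def cis_mult)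
    then have "h (q t) = t" unfolding h_def using t by (simp add: Arg_cis)
    moreover have "q t \<in> I" using t O'(2) by (simp add: q_def)
    ultimately show "t \<in> J" unfolding J_def by (metis imageI)
  qed
  have contq: "continuous_on UNIV q" unfolding q_def by (intro continuous_intros)
  have openJ: "open J"
    unfolding J_eq by (intro open_Int open_greaterThanLessThan open_vimage O'(1) contq)
  have "continuous_on I h"
  proof (rule continuous_at_imp_continuous_on, rule ballI)
    fix z assume z: "z \<in> I"
    then have zS: "z \<in> S\<^sup>1" using O'(2) by blast
    let ?w = "cis (- \<alpha> - pi) * z"
    have "?w \<notin> \<real>\<^sub>\<le>\<^sub>0"
    proof
      assume w: "?w \<in> \<real>\<^sub>\<le>\<^sub>0"
      then have "Arg ?w = pi \<or> ?w = 0" using Arg_eq_pi by (auto simp: complex_nonpos_Reals_iff complex_eq_iff)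
      moreover have "?w \<noteq> 0" using zS by auto
      ultimately have "q pi = z" using qh[OF zS] by (simp add: h_def)
      then show False using q_pi(1) z pI by simp
    qed
    then show "isCont h z" unfolding h_def by (intro continuous_intros isCont_o2[OF _ continuous_at_Arg]) auto
  qed
  then have connJ: "connected J" unfolding J_def by (rule connected_continuous_image[OF _ conn])
  have neJ: "J \<noteq> {}" using ne by (simp add: J_def)
  have bddJ: "bdd_below J" "bdd_above J"
    using J_bd by (auto intro!: bdd_belowI[of _ "- pi"] bdd_aboveI[of _ pi] less_imp_le)
  define a where "a = Inf J" define b where "b = Sup J"
  have J_ab: "t \<in> J \<longleftrightarrow> a < t \<and> t < b" for t
  proof
    assume t: "t \<in> J"
    then obtain e where e: "0 < e" "ball t e \<subseteq> J" using openJ unfolding open_contains_ball by blast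
    have "t - e / 2 \<in> ball t e" "t + e / 2 \<in> ball t e" using e(1) by (auto simp: dist_real_def)
    then have "a \<le> t - e / 2" "t + e / 2 \<le> b"
      unfolding a_def b_def using e(2) bddJ by (auto intro!: cInf_lower cSup_upper)
    then show "a < t \<and> t < b" using e(1) by linarith
  next
    assume t: "a < t \<and> t < b"
    then obtain y z where "y \<in> J" "y < t" "z \<in> J" "t < z"
      unfolding a_def b_def using cInf_less_iff[OF neJ bddJ(1)] less_cSup_iff[OF neJ bddJ(2)] by auto
    then show "t \<in> J" using connected_contains_Icc[OF connJ, of y z] by auto
  qed
  have ab: "a < b" using neJ J_ab by fastforce
  have "- pi \<le> a" "b \<le> pi"
    unfolding a_def b_def by (rule cInf_greatest[OF neJ], use J_bd in force) (rule cSup_least[OF neJ], use J_bd in force)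
  have lt: "b - a < 2 * pi"
  proof (rule ccontr)
    assume "\<not> b - a < 2 * pi"
    then have eq: "a = - pi" "b = pi" using \<open>- pi \<le> a\<close> \<open>b \<le> pi\<close> by linarith+
    obtain e where e: "0 < e" "\<And>y. y \<in> I \<Longrightarrow> \<not> dist y p < e"
      using p(2) unfolding closure_approachable by blast
    have "isCont q pi" using contq by (simp add: continuous_on_eq_continuous_at)
    then obtain \<delta> where \<delta>: "0 < \<delta>" "\<And>t. dist t pi < \<delta> \<Longrightarrow> dist (q t) (q pi) < e"
      using e(1) unfolding continuous_at_eps_delta by blast
    define t where "t = pi - min (\<delta> / 2) pi"
    have "dist t pi < \<delta>" "t < pi" "- pi < t" using \<delta>(1) pi_gt_zero by (auto simp: t_def dist_real_def min_def)
    then have "dist (q t) p < e" "t \<in> J" using \<delta>(2)[of t] J_ab[of t] by (auto simp: q_pi eq dist_commute)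
    moreover have "q t \<in> I" using \<open>t \<in> J\<close> J_eq O'(2) by (auto simp: q_def)
    ultimately show False using e(2) by blast
  qed
  define \<delta> where "\<delta> = (b - a) / 2" define m where "m = (a + b) / 2" define \<mu> where "\<mu> = \<alpha> + pi + m"
  have \<delta>: "0 < \<delta>" "\<delta> < pi" using ab lt by (auto simp: \<delta>_def)
  have "I = {z \<in> S\<^sup>1. cos \<delta> < Re (cis (- \<mu>) * z)}"
  proof (intro set_eqI iffI)
    fix z assume z: "z \<in> I"
    then have zS: "z \<in> S\<^sup>1" using O'(2) by blast
    have "h z \<in> J" using z by (simp add: J_def)
    then have hm: "\<bar>h z - m\<bar> < \<delta>" unfolding J_ab by (auto simp: m_def \<delta>_def abs_less_iff field_simps)
    have "cis (- \<mu>) * z = cis (- \<mu>) * q (h z)" by (simp add: qh[OF zS])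
    also have "\<dots> = cis (h z - m)" by (simp add: q_def \<mu>_def cis_mult)
    finally have "Re (cis (- \<mu>) * z) = cos \<bar>h z - m\<bar>" by simp
    moreover have "cos \<delta> < cos \<bar>h z - m\<bar>" by (rule cos_monotone_0_pi) (use hm \<delta> in auto)
    ultimately show "z \<in> {z \<in> S\<^sup>1. cos \<delta> < Re (cis (- \<mu>) * z)}" using zS by simp
  next
    fix z assume z: "z \<in> {z \<in> S\<^sup>1. cos \<delta> < Re (cis (- \<mu>) * z)}"
    define u where "u = Arg (cis (- \<mu>) * z)"
    have u: "cis u = cis (- \<mu>) * z" unfolding u_def by (rule cis_Arg_circle) (use z in \<open>simp add: norm_mult\<close>)
    have "\<bar>u\<bar> < \<delta>"
    proof (rule ccontr)
      assume n: "\<not> \<bar>u\<bar> < \<delta>"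
      have "\<bar>u\<bar> \<le> pi" using Arg_bounded[of "cis (- \<mu>) * z"] by (auto simp: u_def abs_le_iff)
      then have "cos \<bar>u\<bar> \<le> cos \<delta>" using n \<delta> by (intro cos_monotone_0_pi_le) auto
      moreover have "cos u = Re (cis (- \<mu>) * z)" using u by (metis cis.sel(1))
      ultimately show False using z by simp
    qed
    then have "u + m \<in> J" unfolding J_ab by (auto simp: m_def \<delta>_def abs_less_iff field_simps)
    moreover have "q (u + m) = z"
    proof -
      have "q (u + m) = cis \<mu> * cis u" by (simp add: q_def \<mu>_def cis_mult algebra_simps)
      also have "\<dots> = z" unfolding u by (simp add: cis_mult flip: mult.assoc)
      finally show ?thesis .
    qed
    ultimately show "z \<in> I" using J_eq O'(2) z by auto
  qed
  moreover have "-1 < cos \<delta>" "cos \<delta> < 1"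
    using cos_monotone_0_pi[of \<delta> pi] cos_monotone_0_pi[of 0 \<delta>] \<delta> by auto
  ultimately show ?thesis using that by blast
qed

text \<open>Intervals form a single orbit of the Moebius group: the upper half circle is rotated to
  the right half circle, dilated to the correct length, and rotated to the correct centre.\<close>

lemma circle_interval_half_circle:
  assumes "circle_interval I" obtains \<gamma> where "\<gamma> \<in> Mob" "I = \<gamma> ` half_circle 1"
proof -
  obtain \<mu> r where r: "-1 < r" "r < 1" and I: "I = {z \<in> S\<^sup>1. r < Re (cis (- \<mu>) * z)}"
    using circle_interval_arc[OF assms] by blast
  obtain t where t: "{z \<in> S\<^sup>1. r < Re z} = dil t ` {z \<in> S\<^sup>1. 0 < Re z}" using arc_dil[OF r] by blast
  have "rotation (- (pi / 2)) ` half_circle 1 = {z \<in> S\<^sup>1. 0 < Re z}"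
    unfolding half_circle_def rotation_image by simp
  then have "I = (rotation \<mu> \<circ> dil t \<circ> rotation (- (pi / 2))) ` half_circle 1"
    unfolding I image_comp[symmetric] by (simp only: t[symmetric] rotation_image)
  then show ?thesis by (rule that[rotated]) (intro Mob_comp rotation_Mob dil_Mob)
qed

section \<open>Operators on the domain\<close>

lemma locally_convex_pullback:
  assumes x: "Vector_Spaces.linear sc sc x" and T: "locally_convex_topology sc T"
  shows "locally_convex_topology sc (pullback_topology UNIV x T)"
  unfolding locally_convex_topology_def
proof (intro conjI allI impI)
  let ?P = "pullback_topology UNIV x T"
  have add: "x (v + w) = x v + x w" and scl: "x (sc c v) = sc c (x v)" for v w c
    using x by (simp_all add: Vector_Spaces.linear_iff)
  have top: "topspace T = UNIV" and T_add: "continuous_map (prod_topology T T) T (\<lambda>(v, w). v + w)"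
    and T_sc: "continuous_map (prod_topology euclidean T) T (\<lambda>(c, v). sc c v)"
    using T unfolding locally_convex_topology_def by blast+
  show "topspace ?P = UNIV" by (simp add: topspace_pullback_topology top)
  have px: "continuous_map ?P T x" using continuous_map_pullback[OF continuous_map_id, of UNIV x T] by simp
  show "continuous_map (prod_topology ?P ?P) ?P (\<lambda>(v, w). v + w)"
  proof (rule continuous_map_pullback')
    have "continuous_map (prod_topology ?P ?P) (prod_topology T T) (\<lambda>(v, w). (x v, x w))"
      unfolding continuous_map_prod_top using px by blast
    from continuous_map_compose[OF this T_add]
    show "continuous_map (prod_topology ?P ?P) T (x \<circ> (\<lambda>(v, w). v + w))"
      by (simp add: o_def case_prod_unfold add)
  qed simp
  show "continuous_map (prod_topology euclidean ?P) ?P (\<lambda>(c, v). sc c v)"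
  proof (rule continuous_map_pullback')
    have "continuous_map (prod_topology euclidean ?P) (prod_topology euclidean T) (\<lambda>(c, v). (id c :: complex, x v))"
      unfolding continuous_map_prod_top using px continuous_map_id by blast
    from continuous_map_compose[OF this T_sc]
    show "continuous_map (prod_topology euclidean ?P) T (x \<circ> (\<lambda>(c, v). sc c v))"
      by (simp add: o_def case_prod_unfold scl)
  qed simp
  fix W assume "openin ?P W \<and> 0 \<in> W"
  then obtain W0 where W0: "openin T W0" "W = x -` W0" "0 \<in> W" by (auto simp: openin_pullback_topology)
  have "x 0 = 0" using add[of 0 0] by simp
  then have "0 \<in> W0" using W0 by auto
  then obtain V where V: "openin T V" "0 \<in> V" "V \<subseteq> W0"
    and cvx: "\<And>v w t. v \<in> V \<Longrightarrow> w \<in> V \<Longrightarrow> t \<in> {0..1} \<Longrightarrow> sc (of_real t) v + sc (of_real (1 - t)) w \<in> V"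
    using T W0(1) unfolding locally_convex_topology_def by meson
  show "\<exists>V. openin ?P V \<and> 0 \<in> V \<and> V \<subseteq> W \<and> (\<forall>v\<in>V. \<forall>w\<in>V. \<forall>t\<in>{0..1}. sc (of_real t) v + sc (of_real (1 - t)) w \<in> V)"
  proof (intro exI[of _ "x -` V"] conjI)
    show "openin ?P (x -` V)" unfolding openin_pullback_topology using V(1) by blast
    show "0 \<in> x -` V" using V(2) \<open>x 0 = 0\<close> by simp
    show "x -` V \<subseteq> W" using V(3) W0(2) by auto
    show "\<forall>v\<in>x -` V. \<forall>w\<in>x -` V. \<forall>t\<in>{0..1}. sc (of_real t) v + sc (of_real (1 - t)) w \<in> x -` V"
      using cvx by (simp add: add scl)
  qed
qed

text \<open>The pullback along x of any competing topology T is locally convex, and the hypothesis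
  says that words are continuous for it. By maximality of the strong topology it is coarser than the
  strong one, which is the continuity of x into T.\<close>

lemma cont_opsI:
  assumes x: "Vector_Spaces.linear sc sc x"
    and c: "\<And>T \<phi>s v. words_continuous F T \<Longrightarrow> set \<phi>s \<subseteq> F \<Longrightarrow>
      continuous_map (tuple_topology (length \<phi>s)) T (\<lambda>f. x (word \<phi>s f v))"
  shows "x \<in> cont_ops sc F"
  unfolding cont_ops_def
proof (intro CollectI conjI x continuous_map_into_strong_topology)
  fix T assume T: "locally_convex_topology sc T" "words_continuous F T"
  let ?P = "pullback_topology UNIV x T"
  have "words_continuous F ?P"
    unfolding words_continuous_def
  proof (intro allI impI continuous_map_pullback')
    show "continuous_map (tuple_topology (length \<phi>s)) T (x \<circ> (\<lambda>f. word \<phi>s f v))" if "set \<phi>s \<subseteq> F" for \<phi>s v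
      using c[OF T(2) that] by (simp add: o_def)
  qed simp
  from continuous_map_id_strong_topology[OF locally_convex_pullback[OF x T(1)] this]
  have "continuous_map (strong_topology sc F) T ((id \<circ> x) \<circ> id)"
    by (rule continuous_map_compose[OF _ continuous_map_pullback[OF continuous_map_id]])
  then show "continuous_map (strong_topology sc F) T x" by simp
qed

context wightman_cft
begin

text \<open>\<phi>(f) maps a word to a longer word whose first letter is frozen at f, so it suffices
  that inserting a constant entry into a tuple is continuous.\<close>

lemma field_cont_op:
  assumes \<phi>: "\<phi> \<in> F" and f: "f \<in> C\<^sup>\<infinity>" shows "\<phi> f \<in> cont_ops sc F"
proof (rule cont_opsI[OF field_linear[OF assms]])
  fix T' :: "'d topology" and \<phi>s v assume T': "words_continuous F T'" "set \<phi>s \<subseteq> F"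
  let ?k = "length \<phi>s"
  let ?g = "\<lambda>h. \<lambda>j\<in>{..<Suc ?k}. if j = 0 then f else h (j - 1)"
  have "continuous_map (tuple_topology ?k) (tuple_topology (Suc ?k)) ?g"
    unfolding continuous_map_componentwise
  proof (intro conjI ballI)
    show "?g ` topspace (tuple_topology ?k) \<subseteq> extensional {..<Suc ?k}" by auto
    fix j assume j: "j \<in> {..<Suc ?k}"
    show "continuous_map (tuple_topology ?k) smooth_topology (\<lambda>h. ?g h j)"
    proof (cases "j = 0")
      case True
      then have "(\<lambda>h. ?g h j) = (\<lambda>h. f)" by simp
      then show ?thesis using f by (simp only: continuous_map_const topspace_smooth simp_thms)
    next
      case False
      then have "j - 1 \<in> {..<?k}" "(\<lambda>h. ?g h j) = (\<lambda>h. h (j - 1))" using j by (simp_all add: less_diff_conv2 Suc_leI)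
      then show ?thesis using continuous_map_product_projection[of "j - 1" "{..<?k}" "\<lambda>_. smooth_topology"] by (simp only:)
    qed
  qed
  moreover have "continuous_map (tuple_topology (Suc ?k)) T' (\<lambda>h. word (\<phi> # \<phi>s) h v)"
  proof -
    have "set (\<phi> # \<phi>s) \<subseteq> F" using T'(2) \<phi> by simp
    then have "continuous_map (tuple_topology (length (\<phi> # \<phi>s))) T' (\<lambda>h. word (\<phi> # \<phi>s) h v)"
      using T'(1) unfolding words_continuous_def by blast
    then show ?thesis by (simp only: length_Cons)
  qed
  ultimately have "continuous_map (tuple_topology ?k) T' ((\<lambda>h. word (\<phi> # \<phi>s) h v) \<circ> ?g)"
    by (rule continuous_map_compose)
  moreover have "word (\<phi> # \<phi>s) (?g h) v = \<phi> f (word \<phi>s h v)" for h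
  proof -
    have "map (\<lambda>j. ((\<phi> # \<phi>s) ! j, ?g h j)) [0..<Suc ?k] = (\<phi>, f) # map (\<lambda>j. (\<phi>s ! j, h j)) [0..<?k]"
      unfolding map_upt_Suc by simp
    then show ?thesis unfolding word_eq_wop by (simp only: length_Cons wop.simps fst_conv snd_conv)
  qed
  ultimately show "continuous_map (tuple_topology ?k) T' (\<lambda>h. \<phi> f (word \<phi>s h v))" by (simp only: o_def)
qed

lemma cont_ops_unital: "unital_algebra sc (cont_ops sc F)"
  unfolding unital_algebra_def
proof (intro conjI ballI allI)
  show "id \<in> cont_ops sc F" by (simp add: cont_ops_def linear_id)
  fix x assume x: "x \<in> cont_ops sc F"
  then have lx: "Vector_Spaces.linear sc sc x" and cx: "continuous_map T T x" by (auto simp: cont_ops_def)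
  show "(\<lambda>v. sc c (x v)) \<in> cont_ops sc F" for c
    using strong_continuous_scale[OF cx, of c] lx
    by (auto simp: cont_ops_def Vector_Spaces.linear_iff scale_right_distrib scale_left_commute)
  fix y assume y: "y \<in> cont_ops sc F"
  then have ly: "Vector_Spaces.linear sc sc y" and cy: "continuous_map T T y" by (auto simp: cont_ops_def)
  show "(\<lambda>v. x v + y v) \<in> cont_ops sc F"
    using strong_continuous_add[OF cx cy] lx ly
    by (auto simp: cont_ops_def Vector_Spaces.linear_iff scale_right_distrib algebra_simps)
  show "x \<circ> y \<in> cont_ops sc F"
    using continuous_map_compose[OF cy cx] Vector_Spaces.linear_compose[OF ly lx] by (simp add: cont_ops_def)
qed

end

section \<open>Haag duality\<close>

context involutive_wightman_cft
begin

section \<open>The star algebra and the commutants of the local algebras\<close>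

abbreviation star where "star \<equiv> star_ops sc F form"

abbreviation local_commutant where "local_commutant I \<equiv> commutant sc F form (local_alg sc F I)"

lemma star_linear: "x \<in> star \<Longrightarrow> Vector_Spaces.linear sc sc x"
  by (simp add: star_ops_def cont_ops_def)

lemma star_adjoint: "x \<in> star \<Longrightarrow> \<exists>y\<in>star. is_adjoint form x y"
  unfolding star_ops_def using is_adjoint_sym by blast

lemma starI: "x \<in> cont_ops sc F \<Longrightarrow> y \<in> cont_ops sc F \<Longrightarrow> is_adjoint form x y \<Longrightarrow> x \<in> star"
  unfolding star_ops_def by blast

lemma star_unital: "unital_algebra sc star"
  unfolding unital_algebra_def
proof (intro conjI ballI allI)
  note c = cont_ops_unital[unfolded unital_algebra_def]
  show "id \<in> star" by (rule starI[of _ id]) (use c in \<open>auto simp: is_adjoint_def\<close>)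
  fix x assume "x \<in> star"
  then obtain x' where x: "x \<in> cont_ops sc F" "x' \<in> cont_ops sc F" "is_adjoint form x x'" unfolding star_ops_def by blast
  show "(\<lambda>v. sc a (x v)) \<in> star" for a
    by (rule starI[of _ "\<lambda>v. sc (cnj a) (x' v)"]) (use c x in \<open>auto simp: is_adjoint_def form_scale form_scale_right\<close>)
  fix y assume "y \<in> star"
  then obtain y' where y: "y \<in> cont_ops sc F" "y' \<in> cont_ops sc F" "is_adjoint form y y'" unfolding star_ops_def by blast
  show "(\<lambda>v. x v + y v) \<in> star"
    by (rule starI[of _ "\<lambda>v. x' v + y' v"]) (use c x y in \<open>auto simp: is_adjoint_def form_add form_add_right\<close>)
  show "x \<circ> y \<in> star" by (rule starI[of _ "y' \<circ> x'"]) (use c x y in \<open>auto simp: is_adjoint_def\<close>)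
qed

lemma star_comp: "x \<in> star \<Longrightarrow> y \<in> star \<Longrightarrow> x \<circ> y \<in> star"
  and star_id: "id \<in> star"
  and star_add: "x \<in> star \<Longrightarrow> y \<in> star \<Longrightarrow> (\<lambda>v. x v + y v) \<in> star"
  and star_scale: "x \<in> star \<Longrightarrow> (\<lambda>v. sc c (x v)) \<in> star"
  using star_unital unfolding unital_algebra_def by blast+

lemma field_star:
  assumes \<phi>: "\<phi> \<in> F" and f: "f \<in> C\<^sup>\<infinity>" shows "\<phi> f \<in> star"
proof -
  obtain \<psi> where "\<psi> \<in> F" "is_adjoint form (\<phi> f) (\<psi> (\<lambda>z. (-1) ^ d \<phi> * cnj (f z)))"
    using field_adjoint_field[OF \<phi>] f by blast
  moreover have "(\<lambda>z. (-1) ^ d \<phi> * cnj (f z)) \<in> C\<^sup>\<infinity>" by (intro smooth_cmult(1) smooth_cnj f)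
  ultimately show ?thesis using field_cont_op[OF \<phi> f] field_cont_op by (intro starI)
qed

lemma wop_star: "field_word F I ps \<Longrightarrow> wop ps \<in> star"
proof (induction ps)
  case Nil
  have "wop [] = (id :: 'd \<Rightarrow> 'd)" by auto
  then show ?case using star_id by (simp only:)
next
  case (Cons p ps)
  have "wop (p # ps) = fst p (snd p) \<circ> wop ps" by auto
  then show ?case using Cons by (simp only:) (rule star_comp, simp_all add: field_star)
qed

lemma U_star: "\<gamma> \<in> Mob \<Longrightarrow> U \<gamma> \<in> star"
proof (rule starI[of _ "U (inv \<gamma>)"])
  assume \<gamma>: "\<gamma> \<in> Mob"
  show "U \<gamma> \<in> cont_ops sc F" "U (inv \<gamma>) \<in> cont_ops sc F" by (intro U_cont \<gamma> Mob_inv)+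
  have "form (U \<gamma> v) u = form v (U (inv \<gamma>) u)" for v u
    using U_unitary[OF \<gamma>, of v "U (inv \<gamma>) u"] by (simp add: U_inv(1)[OF \<gamma>])
  then show "is_adjoint form (U \<gamma>) (U (inv \<gamma>))" by (simp add: is_adjoint_def)
qed

text \<open>Commuting with the generators suffices: the maps that commute with a linear x form a
  unital algebra.\<close>

lemma local_commutant_iff: "x \<in> local_commutant I \<longleftrightarrow> x \<in> star \<and> commutes_with_fields I x"
proof
  assume x: "x \<in> local_commutant I"
  have "x \<circ> \<phi> f = \<phi> f \<circ> x" if "\<phi> \<in> F" "f \<in> C\<^sup>\<infinity>" "supp f \<subseteq> I" for \<phi> f
  proof -
    have "\<phi> f \<in> local_alg sc F I" unfolding local_alg_def by (rule subsetD[OF hull_subset]) (use that in blast)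
    then show ?thesis using x unfolding commutant_def by blast
  qed
  then have "x (\<phi> f v) = \<phi> f (x v)" if "\<phi> \<in> F" "f \<in> C\<^sup>\<infinity>" "supp f \<subseteq> I" for \<phi> f v
    using that unfolding o_def by (metis (no_types))
  then show "x \<in> star \<and> commutes_with_fields I x"
    using x unfolding commutant_def commutes_with_fields_def by blast
next
  assume x: "x \<in> star \<and> commutes_with_fields I x"
  then have lx: "Vector_Spaces.linear sc sc x" using star_linear by blast
  have "local_alg sc F I \<subseteq> {y. x \<circ> y = y \<circ> x}"
    unfolding local_alg_def
  proof (rule hull_minimal)
    show "{\<phi> f | \<phi> f. \<phi> \<in> F \<and> f \<in> C\<^sup>\<infinity> \<and> supp f \<subseteq> I} \<subseteq> {y. x \<circ> y = y \<circ> x}"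
      using x by (auto simp: commutes_with_fieldsD fun_eq_iff)
    show "unital_algebra sc {y. x \<circ> y = y \<circ> x}"
      unfolding unital_algebra_def by (auto simp: fun_eq_iff lin_add[OF lx] lin_scale[OF lx])
  qed
  then show "x \<in> local_commutant I" using x unfolding commutant_def by blast
qed

lemma commutes_with_fields_adjoint:
  assumes x: "commutes_with_fields I x" "is_adjoint form x x'" shows "commutes_with_fields I x'"
  unfolding commutes_with_fields_def
proof (intro ballI impI allI)
  fix \<phi> f v assume \<phi>: "\<phi> \<in> F" and f: "f \<in> C\<^sup>\<infinity>" "supp f \<subseteq> I"
  let ?g = "\<lambda>z. (-1) ^ d \<phi> * cnj (f z)"
  obtain \<psi> where \<psi>: "\<psi> \<in> F" "is_adjoint form (\<phi> f) (\<psi> ?g)" using field_adjoint_field[OF \<phi>] f(1) by blast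
  have g: "?g \<in> C\<^sup>\<infinity>" "supp ?g \<subseteq> I"
    using smooth_cmult(1)[OF smooth_cnj[OF f(1)]] order_trans[OF supp_cmult_cnj f(2)] by auto
  have x': "form (x' v) u = form v (x u)" for v u using is_adjoint_sym[OF x(2)] by (simp add: is_adjoint_def)
  have "form (x' (\<phi> f v)) u = form (\<phi> f (x' v)) u" for u
    using \<psi>(2) by (simp add: x' is_adjoint_def commutes_with_fieldsD[OF x(1) \<psi>(1) g])
  then show "x' (\<phi> f v) = \<phi> f (x' v)" by (rule form_eqI)
qed

lemma local_commutant_unital_star: "unital_star_algebra sc F form (local_commutant I)"
  unfolding unital_star_algebra_def unital_algebra_def
proof (intro conjI ballI allI)
  show "id \<in> local_commutant I" unfolding local_commutant_iff by (simp add: star_id commutes_with_fields_def)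
  show "local_commutant I \<subseteq> star" unfolding commutant_def by blast
  fix x assume x: "x \<in> local_commutant I"
  then have xs: "x \<in> star" and xc: "commutes_with_fields I x" by (auto simp: local_commutant_iff)
  show "(\<lambda>v. sc c (x v)) \<in> local_commutant I" for c
    unfolding local_commutant_iff
    using star_scale[OF xs, of c] xc by (auto simp: commutes_with_fields_def lin_scale[OF field_linear])
  obtain x' where "x' \<in> star" "is_adjoint form x x'" using star_adjoint[OF xs] by blast
  then show "\<exists>y\<in>local_commutant I. is_adjoint form x y"
    using commutes_with_fields_adjoint[OF xc] by (auto simp: local_commutant_iff)
  fix y assume y: "y \<in> local_commutant I"
  then have ys: "y \<in> star" and yc: "commutes_with_fields I y" by (auto simp: local_commutant_iff)
  show "(\<lambda>v. x v + y v) \<in> local_commutant I"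
    unfolding local_commutant_iff
    using star_add[OF xs ys] xc yc by (auto simp: commutes_with_fields_def lin_add[OF field_linear])
  show "x \<circ> y \<in> local_commutant I"
    unfolding local_commutant_iff using star_comp[OF xs ys] xc yc by (auto simp: commutes_with_fields_def)
qed

lemma commutes_with_fields_conj:
  assumes \<gamma>: "\<gamma> \<in> Mob" and x: "commutes_with_fields I x"
  shows "commutes_with_fields (\<gamma> ` I) (U \<gamma> \<circ> x \<circ> inv (U \<gamma>))"
  unfolding commutes_with_fields_def
proof (intro ballI impI allI)
  fix \<phi> f v assume \<phi>: "\<phi> \<in> F" and f: "f \<in> C\<^sup>\<infinity>" "supp f \<subseteq> \<gamma> ` I"
  let ?g = "beta (d \<phi>) (inv \<gamma>) f"
  have g: "?g \<in> C\<^sup>\<infinity>" by (rule beta_smooth[OF Mob_inv[OF \<gamma>] f(1)])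
  have "supp ?g \<subseteq> inv \<gamma> ` \<gamma> ` I" by (rule supp_beta[OF Mob_inv[OF \<gamma>] f])
  also have "inv \<gamma> ` \<gamma> ` I = I" by (simp add: image_image Mob_inv_inv(2)[OF \<gamma>])
  finally have s: "supp ?g \<subseteq> I" .
  have \<phi>U: "\<phi> f (U \<gamma> w) = U \<gamma> (\<phi> ?g w)" for w
  proof -
    have "U (inv \<gamma>) (\<phi> f (U \<gamma> w)) = \<phi> ?g w"
      by (simp add: U_field[OF \<phi> Mob_inv[OF \<gamma>] f(1)] U_inv(2)[OF \<gamma>])
    then have "U \<gamma> (U (inv \<gamma>) (\<phi> f (U \<gamma> w))) = U \<gamma> (\<phi> ?g w)" by simp
    then show ?thesis by (simp only: U_inv(1)[OF \<gamma>])
  qed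
  show "(U \<gamma> \<circ> x \<circ> inv (U \<gamma>)) (\<phi> f v) = \<phi> f ((U \<gamma> \<circ> x \<circ> inv (U \<gamma>)) v)"
    by (simp add: inv_U[OF \<gamma>] U_field[OF \<phi> Mob_inv[OF \<gamma>] f(1)] commutes_with_fieldsD[OF x \<phi> g s] \<phi>U)
qed

lemma local_commutant_conj:
  assumes \<gamma>: "\<gamma> \<in> Mob"
  shows "(\<lambda>x. U \<gamma> \<circ> x \<circ> inv (U \<gamma>)) ` local_commutant I = local_commutant (\<gamma> ` I)"
proof -
  have sub: "(\<lambda>x. U \<gamma> \<circ> x \<circ> inv (U \<gamma>)) ` local_commutant I \<subseteq> local_commutant (\<gamma> ` I)" if \<gamma>: "\<gamma> \<in> Mob" for \<gamma> I
  proof (rule image_subsetI)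
    fix x assume "x \<in> local_commutant I"
    then have "x \<in> star" "commutes_with_fields I x" by (simp_all add: local_commutant_iff)
    then show "U \<gamma> \<circ> x \<circ> inv (U \<gamma>) \<in> local_commutant (\<gamma> ` I)"
      unfolding local_commutant_iff using commutes_with_fields_conj[OF \<gamma>]
      by (simp add: inv_U[OF \<gamma>] star_comp U_star[OF \<gamma>] U_star[OF Mob_inv[OF \<gamma>]])
  qed
  moreover have "local_commutant (\<gamma> ` I) \<subseteq> (\<lambda>x. U \<gamma> \<circ> x \<circ> inv (U \<gamma>)) ` local_commutant I"
  proof
    fix y assume y: "y \<in> local_commutant (\<gamma> ` I)"
    let ?x = "U (inv \<gamma>) \<circ> y \<circ> inv (U (inv \<gamma>))"
    have "?x \<in> local_commutant (inv \<gamma> ` \<gamma> ` I)" using sub[OF Mob_inv[OF \<gamma>]] y by blast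
    then have "?x \<in> local_commutant I" by (simp add: image_image Mob_inv_inv(2)[OF \<gamma>])
    moreover have "y = U \<gamma> \<circ> ?x \<circ> inv (U \<gamma>)"
      by (rule ext) (simp add: inv_U[OF \<gamma>] inv_U[OF Mob_inv[OF \<gamma>]] U_inv[OF \<gamma>] inv_inv_eq[OF Mob_bij[OF \<gamma>]])
    ultimately show "y \<in> (\<lambda>x. U \<gamma> \<circ> x \<circ> inv (U \<gamma>)) ` local_commutant I" by blast
  qed
  ultimately show ?thesis using \<gamma> by blast
qed

lemma complementary_commute:
  assumes \<gamma>: "\<gamma> \<in> Mob" and x: "x \<in> local_commutant (\<gamma> ` half_circle (-1))" and y: "y \<in> local_commutant (\<gamma> ` half_circle 1)"
  shows "x \<circ> y = y \<circ> x"
proof -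
  obtain x0 where x0: "x0 \<in> local_commutant (half_circle (-1))" "x = U \<gamma> \<circ> x0 \<circ> inv (U \<gamma>)"
    using x unfolding local_commutant_conj[OF \<gamma>, symmetric] by blast
  obtain y0 where y0: "y0 \<in> local_commutant (half_circle 1)" "y = U \<gamma> \<circ> y0 \<circ> inv (U \<gamma>)"
    using y unfolding local_commutant_conj[OF \<gamma>, symmetric] by blast
  obtain x' where x': "is_adjoint form x0 x'" using x0(1) star_adjoint unfolding local_commutant_iff by blast
  obtain y' where y': "is_adjoint form y0 y'" using y0(1) star_adjoint unfolding local_commutant_iff by blast
  have "x0 (y0 v) = y0 (x0 v)" for v
    by (rule half_circle_commute[OF x' _ y']) (use x0(1) y0(1) in \<open>simp_all add: local_commutant_iff\<close>)
  then show ?thesis by (simp add: x0(2) y0(2) fun_eq_iff inv_U[OF \<gamma>] U_inv[OF \<gamma>])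
qed

text \<open>By locality the fields of the complement lie in P(I)', so the bicommutant commutes with
  them; this is one inclusion. The other is the commutation of P(I')' with P(I)'.\<close>

lemma bicommutant_half_circle:
  assumes \<gamma>: "\<gamma> \<in> Mob"
  shows "bicommutant_alg sc F form (\<gamma> ` half_circle 1) = local_commutant (\<gamma> ` half_circle (-1))"
proof
  let ?I = "\<gamma> ` half_circle 1" and ?J = "\<gamma> ` half_circle (-1)"
  have disj: "?I \<inter> ?J = {}"
    using half_circle_disjoint[of 1] image_Int[OF bij_is_inj[OF Mob_bij[OF \<gamma>]], of "half_circle 1" "half_circle (-1)"] by simp
  show "local_commutant ?J \<subseteq> bicommutant_alg sc F form ?I"
    unfolding bicommutant_alg_def commutant_def[of sc F form "local_commutant ?I"]
    using complementary_commute[OF \<gamma>] local_commutant_iff by blast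
  show "bicommutant_alg sc F form ?I \<subseteq> local_commutant ?J"
  proof
    fix x assume "x \<in> bicommutant_alg sc F form ?I"
    then have x: "x \<in> star" "\<And>y. y \<in> local_commutant ?I \<Longrightarrow> x \<circ> y = y \<circ> x"
      unfolding bicommutant_alg_def commutant_def[of sc F form "local_commutant ?I"] by auto
    have "commutes_with_fields ?J x"
      unfolding commutes_with_fields_def
    proof (intro ballI impI allI)
      fix \<phi> f v assume \<phi>: "\<phi> \<in> F" and f: "f \<in> C\<^sup>\<infinity>" "supp f \<subseteq> ?J"
      have "commutes_with_fields ?I (\<phi> f)"
        unfolding commutes_with_fields_def
      proof (intro ballI impI allI)
        fix \<psi> g v assume \<psi>: "\<psi> \<in> F" and g: "g \<in> C\<^sup>\<infinity>" "supp g \<subseteq> ?I"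
        have "supp f \<inter> supp g = {}" using f(2) g(2) disj by blast
        from locality[OF \<phi> \<psi> f(1) g(1) this] show "\<phi> f (\<psi> g v) = \<psi> g (\<phi> f v)" unfolding o_def by (rule fun_cong)
      qed
      then have "x \<circ> \<phi> f = \<phi> f \<circ> x" by (intro x(2)) (simp add: local_commutant_iff field_star[OF \<phi> f(1)])
      then show "x (\<phi> f v) = \<phi> f (x v)" unfolding o_def by (rule fun_cong)
    qed
    with x(1) show "x \<in> local_commutant ?J" by (simp add: local_commutant_iff)
  qed
qed

lemma circle_interval_cases:
  assumes "circle_interval I"
  obtains \<gamma> where "\<gamma> \<in> Mob" "I = \<gamma> ` half_circle 1" "opposite I = \<gamma> ` half_circle (-1)"
    "bicommutant_alg sc F form I = local_commutant (opposite I)"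
proof -
  obtain \<gamma> where \<gamma>: "\<gamma> \<in> Mob" "I = \<gamma> ` half_circle 1" using circle_interval_half_circle[OF assms] by blast
  have "half_circle 1 \<subseteq> S\<^sup>1" by (auto simp: half_circle_def)
  then have "opposite I = \<gamma> ` half_circle (-1)" unfolding \<gamma>(2) by (simp add: opposite_Mob[OF \<gamma>(1)] opposite_half_circle)
  with \<gamma> bicommutant_half_circle[OF \<gamma>(1)] show ?thesis by (intro that) simp_all
qed

text \<open>A vector outside the closure is separated by a compatible functional that vanishes on
  the subspace Q(I)\<Omega>. That subspace contains all words in I applied to \<Omega>, so
  Reeh-Schlieder makes the functional zero.\<close>

lemma vacuum_dense:
  assumes I: "circle_interval I"
  shows "strong_topology sc F closure_of {x \<Omega> | x. x \<in> bicommutant_alg sc F form I} = UNIV"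
proof (rule ccontr)
  let ?Q = "bicommutant_alg sc F form I" let ?M = "{x \<Omega> | x. x \<in> ?Q}"
  assume "T closure_of ?M \<noteq> UNIV"
  then obtain v where v: "v \<notin> T closure_of ?M" by blast
  have Q: "?Q = local_commutant (opposite I)" using circle_interval_cases[OF I] by blast
  have alg: "id \<in> ?Q" "\<And>x y. x \<in> ?Q \<Longrightarrow> y \<in> ?Q \<Longrightarrow> (\<lambda>v. x v + y v) \<in> ?Q" "\<And>c x. x \<in> ?Q \<Longrightarrow> (\<lambda>v. sc c (x v)) \<in> ?Q"
    using local_commutant_unital_star[of "opposite I"] unfolding Q unital_star_algebra_def unital_algebra_def by blast+
  have "(\<lambda>v. sc 0 (id v)) \<in> ?Q" by (rule alg(3)[OF alg(1)])
  then have M0: "0 \<in> ?M" by force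
  have M1: "x + y \<in> ?M" if xy: "x \<in> ?M" "y \<in> ?M" for x y
  proof -
    obtain a b where ab: "a \<in> ?Q" "x = a \<Omega>" "b \<in> ?Q" "y = b \<Omega>" using xy by blast
    show ?thesis by (rule CollectI, rule exI[of _ "\<lambda>v. a v + b v"]) (use alg(2)[OF ab(1,3)] ab(2,4) in simp)
  qed
  have M2: "sc c x \<in> ?M" if xM: "x \<in> ?M" for c x
  proof -
    obtain a where a: "a \<in> ?Q" "x = a \<Omega>" using xM by blast
    show ?thesis by (rule CollectI, rule exI[of _ "\<lambda>v. sc c (a v)"]) (use alg(3)[OF a(1)] a(2) in simp)
  qed
  obtain L where L: "compatible_functional sc F L" "\<And>x. x \<in> ?M \<Longrightarrow> L x = 0" "L v \<noteq> 0"
    using strong_separation[OF M0 M1 M2 v] by blast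
  have "L v = 0"
  proof (rule reeh_schlieder[OF compatible_tame[OF L(1)]])
    show "openin (top_of_set S\<^sup>1) I" "I \<noteq> {}" using I by (auto simp: circle_interval_def)
    fix ps assume ps: "field_word F I ps"
    have "wop ps \<circ> y = y \<circ> wop ps" if "y \<in> local_commutant I" for y
      using that commutes_with_wop[OF _ ps] by (auto simp: local_commutant_iff fun_eq_iff)
    then have "wop ps \<in> ?Q" unfolding bicommutant_alg_def commutant_def[of sc F form "local_commutant I"]
      using wop_star[OF ps] by blast
    then show "L (wop ps \<Omega>) = 0" by (intro L(2)) blast
  qed
  with L(3) show False ..
qed

lemma opposite_antimono: "I \<subseteq> J \<Longrightarrow> opposite J \<subseteq> opposite I"
  unfolding opposite_def by (rule interior_of_mono) blast

lemma local_commutant_antimono: "I \<subseteq> J \<Longrightarrow> local_commutant J \<subseteq> local_commutant I"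
  unfolding subset_iff local_commutant_iff commutes_with_fields_def by blast

text \<open>With Q(I) = P(I')' the axioms become statements about commutants: isotony reverses
  inclusions twice, and locality holds because Q(I') is by definition the commutant of
  P(I')'.\<close>

theorem bicommutant_net: "moebius_net sc F form U \<Omega> (bicommutant_alg sc F form)"
  unfolding moebius_net_def
proof (intro conjI allI impI ballI)
  have Q: "bicommutant_alg sc F form I = local_commutant (opposite I)" if "circle_interval I" for I
    using circle_interval_cases[OF that] by blast
  show "unital_star_algebra sc F form (bicommutant_alg sc F form I)" if "circle_interval I" for I
    unfolding Q[OF that] by (rule local_commutant_unital_star)
  show "bicommutant_alg sc F form I \<subseteq> bicommutant_alg sc F form J"
    if "circle_interval I \<and> circle_interval J \<and> I \<subseteq> J" for I J
    using that by (simp add: Q local_commutant_antimono opposite_antimono)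
  show "(\<lambda>x. U \<gamma> \<circ> x \<circ> inv (U \<gamma>)) ` bicommutant_alg sc F form I = bicommutant_alg sc F form (\<gamma> ` I)"
    if \<gamma>: "\<gamma> \<in> Mob" and I: "circle_interval I" for \<gamma> I
  proof -
    \<comment> \<open>The interval \<gamma>(I) is the image of the half circle under \<gamma>
      \<circ> \<delta>, which identifies its bicommutant as well.\<close>
    obtain \<delta> where \<delta>: "\<delta> \<in> Mob" "I = \<delta> ` half_circle 1" "opposite I = \<delta> ` half_circle (-1)"
      "bicommutant_alg sc F form I = local_commutant (opposite I)"
      by (rule circle_interval_cases[OF I])
    have "bicommutant_alg sc F form (\<gamma> ` I) = local_commutant (\<gamma> ` opposite I)"
      using bicommutant_half_circle[OF Mob_comp[OF \<gamma> \<delta>(1)]]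
      by (simp only: \<delta>(3)) (simp only: \<delta>(2) image_comp)
    then show ?thesis by (simp add: Q[OF I] local_commutant_conj[OF \<gamma>])
  qed
  show "x \<circ> y = y \<circ> x"
    if "circle_interval I" "x \<in> bicommutant_alg sc F form I" "y \<in> bicommutant_alg sc F form (opposite I)" for I x y
  proof -
    have "x \<in> local_commutant (opposite I)" using that(2) by (simp only: Q[OF that(1)])
    moreover have "y \<in> commutant sc F form (local_commutant (opposite I))" using that(3) by (simp only: bicommutant_alg_def)
    ultimately show ?thesis unfolding commutant_def[of sc F form "local_commutant (opposite I)"] by simp
  qed
  show "U \<gamma> \<Omega> = \<Omega>" if "\<gamma> \<in> Mob" for \<gamma> by (rule vacuum_invariant[OF that])
  show "strong_topology sc F closure_of {x \<Omega> | x. x \<in> bicommutant_alg sc F form I} = UNIV" if "circle_interval I" for I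
    by (rule vacuum_dense[OF that])
qed

end

theorem theorem5p18:
  fixes sc :: "complex \<Rightarrow> 'd \<Rightarrow> 'd::ab_group_add"
    and F :: "'d distr set"
    and d :: "'d distr \<Rightarrow> nat"
    and U :: "(complex \<Rightarrow> complex) \<Rightarrow> 'd \<Rightarrow> 'd"
    and \<Omega> :: 'd
    and form :: "'d \<Rightarrow> 'd \<Rightarrow> complex"
    and \<theta> :: "'d \<Rightarrow> 'd"
  assumes "involutive_wightman_cft sc F d U \<Omega> form \<theta>"
  shows "moebius_net sc F form U \<Omega> (bicommutant_alg sc F form) \<and>
    (\<forall>I. circle_interval I \<longrightarrow>
       commutant sc F form (bicommutant_alg sc F form I) =
       bicommutant_alg sc F form (opposite I)) \<and>
    (\<forall>I. circle_interval I \<longrightarrow>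
       bicommutant_alg sc F form I = commutant sc F form (local_alg sc F (opposite I)))"
proof -
  interpret involutive_wightman_cft sc F d U \<Omega> form \<theta> by (rule assms)
  have Q: "bicommutant_alg sc F form I = commutant sc F form (local_alg sc F (opposite I))" if "circle_interval I" for I
    using circle_interval_cases[OF that] by blast
  \<comment> \<open>Both sides are the bicommutant of P(I'): the left by the equality just obtained,
    the right by definition.\<close>
  moreover have "commutant sc F form (bicommutant_alg sc F form I) = bicommutant_alg sc F form (opposite I)"
    if "circle_interval I" for I
    unfolding Q[OF that] bicommutant_alg_def[of sc F form "opposite I"] ..
  ultimately show ?thesis using bicommutant_net by blast
qed

end
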